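(* Let $s\in(0,1)$, $N>2s$, $2^*=\frac{2N}{N-2s}$, $p\ge 2^*-1$ and $q>(p-1)\frac{N}{2s}-1$ (in particular $q>p$), and let $\Omega\subset\mathbb{R}^N$ be a bounded domain with smooth boundary. If $u$ is any nonnegative weak solution of $$(-\Delta)^s u=u^p-u^q\ \text{ in }\mathbb{R}^N,\qquad u\in\dot H^s(\mathbb{R}^N)\cap L^{q+1}(\mathbb{R}^N),$$ or of $$(-\Delta)^s u=u^p-u^q\ \text{ in }\Omega,\qquad u=0\ \text{ in }\mathbb{R}^N\setminus\Omega,\qquad u\in X_0\cap L^{q+1}(\Omega),$$ then $u$ is a classical solution of the respective problem.
   Context: $c_{N,s}=\frac{2^{2s}s\,\Gamma(\frac N2+s)}{\pi^{N/2}\Gamma(1-s)}$. Set $\|u\|^2_{\dot H^s(\mathbb{R}^N)}=\frac{c_{N,s}}{2}\int_{\mathbb{R}^N}\int_{\mathbb{R}^N}\frac{|u(x)-u(y)|^2}{|x-y|^{N+2s}}\,dx\,dy$; $\dot H^s(\mathbb{R}^N)$ is the completion of $C_0^\infty(\mathbb{R}^N)$ with respect to $\|u\|_{\dot H^s(\mathbb{R}^N)}+|u|_{L^{2^*}(\mathbb{R}^N)}$. $X_0=\{v\in H^s(\mathbb{R}^N): v=0 \text{ in }\mathbb{R}^N\setminus\Omega\}$, where $H^s(\mathbb{R}^N)$ is the usual fractional Sobolev space. A nonnegative $u\in\dot H^s(\mathbb{R}^N)\cap L^{q+1}(\mathbb{R}^N)$ is a weak solution of the problem in $\mathbb{R}^N$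 if for every $\varphi\in\dot H^s(\mathbb{R}^N)$ $$\frac{c_{N,s}}{2}\int_{\mathbb{R}^N}\int_{\mathbb{R}^N}\frac{(u(x)-u(y))(\varphi(x)-\varphi(y))}{|x-y|^{N+2s}}\,dx\,dy=\int_{\mathbb{R}^N}u^p\varphi\,dx-\int_{\mathbb{R}^N}u^q\varphi\,dx ;$$ a nonnegative $u\in X_0\cap L^{q+1}(\Omega)$ is a weak solution of the problem in $\Omega$ if the same identity holds for every $\varphi\in X_0$. A classical solution of $(-\Delta)^su=f(u)$ in $D$ (here $D=\mathbb{R}^N$ or $D=\Omega$) is a function $u\in C(\mathbb{R}^N)$ such that for every $x\in D$ the fractional Laplacian of $u$ at $x$ can be written as $$-(-\Delta)^su(x)=\frac{c_{N,s}}{2}\int_{\mathbb{R}^N}\frac{u(x+y)-2u(x)+u(x-y)}{|y|^{N+2s}}\,dy$$ and the equation holds pointwise at every $x\in D$. As usual, $u$ is identified with its continuous representative. *)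

theory Defs
  imports "HOL-Analysis.Analysis"
begin

text \<open>Throughout, the space $R^N$ is a Euclidean space \<^typ>\<open>'a\<close> with $N = DIM('a)$; functions are real-valued and
  Lebesgue measurable, and elements of function spaces are representatives of a.e. classes.
  Powers $u^p$ with real exponent are \<open>powr\<close>; they are only used for (a.e.) nonnegative \<open>u\<close>.\<close>

definition c_Ns :: "nat \<Rightarrow> real \<Rightarrow> real" where
  "c_Ns N s = 2 powr (2 * s) * s * Gamma (real N / 2 + s) / (pi powr (real N / 2) * Gamma (1 - s))"

definition two_star :: "nat \<Rightarrow> real \<Rightarrow> real" where
  "two_star N s = 2 * real N / (real N - 2 * s)"

subsection \<open>Smooth functions and smooth bounded domains\<close>

primrec C_k :: "nat \<Rightarrow> ('a::euclidean_space \<Rightarrow> real) \<Rightarrow> bool" where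
  "C_k 0 f \<longleftrightarrow> continuous_on UNIV f"
| "C_k (Suc k) f \<longleftrightarrow> (\<forall>x. f differentiable (at x)) \<and>
     (\<forall>b\<in>Basis. C_k k (\<lambda>x. frechet_derivative f (at x) b))"

definition C_infinity :: "('a::euclidean_space \<Rightarrow> real) \<Rightarrow> bool" where
  "C_infinity f \<longleftrightarrow> (\<forall>k. C_k k f)"

definition C0_infinity :: "('a::euclidean_space \<Rightarrow> real) set" where
  "C0_infinity = {f. C_infinity f \<and> compact (closure {x. f x \<noteq> 0})}"

text \<open>Near each boundary point, the domain lies on one side of the graph of a smooth function \<open>g\<close> of
  the other coordinates, after relabelling (\<open>b\<close>) and reorienting (\<open>\<sigma>\<close>) the axes. The function \<open>g\<close> of
  $N - 1$ variables is encoded as a function on the whole space that does not depend on the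
  coordinate along \<open>b\<close>; if $N = 1$ it is a constant.\<close>

definition smooth_boundary :: "'a::euclidean_space set \<Rightarrow> bool" where
  "smooth_boundary \<Omega> \<longleftrightarrow> (\<forall>x\<in>frontier \<Omega>. \<exists>r>0. \<exists>b\<in>Basis. \<exists>\<sigma>\<in>{-1, 1}. \<exists>g.
     C_infinity g \<and> (\<forall>y t. g (y + t *\<^sub>R b) = g y) \<and>
     \<Omega> \<inter> ball x r = {y \<in> ball x r. \<sigma> * (y \<bullet> b) > g y})"

definition smooth_bounded_domain :: "'a::euclidean_space set \<Rightarrow> bool" where
  "smooth_bounded_domain \<Omega> \<longleftrightarrow>
     open \<Omega> \<and> connected \<Omega> \<and> \<Omega> \<noteq> {} \<and> bounded \<Omega> \<and> smooth_boundary \<Omega>"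

subsection \<open>Function spaces\<close>

definition Lp_on :: "'a::euclidean_space set \<Rightarrow> real \<Rightarrow> ('a \<Rightarrow> real) set" where
  "Lp_on D r = {u \<in> borel_measurable lebesgue. set_integrable lebesgue D (\<lambda>x. \<bar>u x\<bar> powr r)}"

definition Lp_norm :: "real \<Rightarrow> ('a::euclidean_space \<Rightarrow> real) \<Rightarrow> real" where
  "Lp_norm r u = (LINT x|lebesgue. \<bar>u x\<bar> powr r) powr (1 / r)"

definition energy_integrand ::
    "real \<Rightarrow> ('a::euclidean_space \<Rightarrow> real) \<Rightarrow> ('a \<Rightarrow> real) \<Rightarrow> 'a \<times> 'a \<Rightarrow> real" where
  "energy_integrand s u v = (\<lambda>(x, y).
     (u x - u y) * (v x - v y) / norm (x - y) powr (real DIM('a) + 2 * s))"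

definition energy_form ::
    "real \<Rightarrow> ('a::euclidean_space \<Rightarrow> real) \<Rightarrow> ('a \<Rightarrow> real) \<Rightarrow> real" where
  "energy_form s u v =
     c_Ns DIM('a) s / 2 * (LINT z|(lebesgue \<Otimes>\<^sub>M lebesgue). energy_integrand s u v z)"

definition finite_energy :: "real \<Rightarrow> ('a::euclidean_space \<Rightarrow> real) \<Rightarrow> bool" where
  "finite_energy s u \<longleftrightarrow> integrable (lebesgue \<Otimes>\<^sub>M lebesgue) (energy_integrand s u u)"

definition Hdot_norm :: "real \<Rightarrow> ('a::euclidean_space \<Rightarrow> real) \<Rightarrow> real" where
  "Hdot_norm s u = sqrt (energy_form s u u)"

text \<open>The completion of $C_0^\infty$ is realised as a space of functions: since the norm controls the
  norm of the Banach space $L^{2^*}$ and the energy is lower semicontinuous, every Cauchy sequence of test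
  functions converges, in the full norm, to a unique element of $L^{2^*}$ of finite energy.\<close>

definition Hdot :: "real \<Rightarrow> ('a::euclidean_space \<Rightarrow> real) set" where
  "Hdot s = {u \<in> Lp_on UNIV (two_star DIM('a) s). finite_energy s u \<and>
     (\<exists>\<phi>. (\<forall>n. \<phi> n \<in> C0_infinity) \<and>
       (\<lambda>n. Hdot_norm s (\<lambda>x. u x - \<phi> n x) + Lp_norm (two_star DIM('a) s) (\<lambda>x. u x - \<phi> n x))
         \<longlonglongrightarrow> 0)}"

definition Hs :: "real \<Rightarrow> ('a::euclidean_space \<Rightarrow> real) set" where
  "Hs s = {u \<in> Lp_on UNIV 2. finite_energy s u}"

definition X0 :: "real \<Rightarrow> 'a::euclidean_space set \<Rightarrow> ('a \<Rightarrow> real) set" where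
  "X0 s \<Omega> = {v \<in> Hs s. AE x in lebesgue. x \<notin> \<Omega> \<longrightarrow> v x = 0}"

subsection \<open>Weak and classical solutions\<close>

text \<open>A Bochner integral that diverges has value 0 by convention. The integrability conditions exclude
  this: the weak identity is asserted as an identity between convergent integrals. (The energy
  integral converges by Cauchy-Schwarz.)\<close>

definition weak_identity ::
    "real \<Rightarrow> real \<Rightarrow> real \<Rightarrow> ('a::euclidean_space \<Rightarrow> real) \<Rightarrow> ('a \<Rightarrow> real) \<Rightarrow> bool" where
  "weak_identity s p q u \<phi> \<longleftrightarrow>
     integrable lebesgue (\<lambda>x. u x powr p * \<phi> x) \<and>
     integrable lebesgue (\<lambda>x. u x powr q * \<phi> x) \<and>
     energy_form s u \<phi> = (LINT x|lebesgue. u x powr p * \<phi> x) - (LINT x|lebesgue. u x powr q * \<phi> x)"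

definition weak_solution_space ::
    "real \<Rightarrow> real \<Rightarrow> real \<Rightarrow> ('a::euclidean_space \<Rightarrow> real) \<Rightarrow> bool" where
  "weak_solution_space s p q u \<longleftrightarrow>
     u \<in> Hdot s \<inter> Lp_on UNIV (q + 1) \<and> (AE x in lebesgue. 0 \<le> u x) \<and>
     (\<forall>\<phi>\<in>Hdot s. weak_identity s p q u \<phi>)"

definition weak_solution_domain ::
    "real \<Rightarrow> real \<Rightarrow> real \<Rightarrow> 'a::euclidean_space set \<Rightarrow> ('a \<Rightarrow> real) \<Rightarrow> bool" where
  "weak_solution_domain s p q \<Omega> u \<longleftrightarrow>
     u \<in> X0 s \<Omega> \<inter> Lp_on \<Omega> (q + 1) \<and> (AE x in lebesgue. 0 \<le> u x) \<and>
     (\<forall>\<phi>\<in>X0 s \<Omega>. weak_identity s p q u \<phi>)"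

definition second_difference_quotient ::
    "real \<Rightarrow> ('a::euclidean_space \<Rightarrow> real) \<Rightarrow> 'a \<Rightarrow> 'a \<Rightarrow> real" where
  "second_difference_quotient s u x y =
     (u (x + y) - 2 * u x + u (x - y)) / norm y powr (real DIM('a) + 2 * s)"

definition frac_laplacian :: "real \<Rightarrow> ('a::euclidean_space \<Rightarrow> real) \<Rightarrow> 'a \<Rightarrow> real" where
  "frac_laplacian s u x =
     - (c_Ns DIM('a) s / 2 * (LINT y|lebesgue. second_difference_quotient s u x y))"

text \<open>The integrability condition says that the integral defining the fractional Laplacian converges.\<close>

definition classical_solution ::
    "real \<Rightarrow> 'a::euclidean_space set \<Rightarrow> (real \<Rightarrow> real) \<Rightarrow> ('a \<Rightarrow> real) \<Rightarrow> bool" where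
  "classical_solution s D f u \<longleftrightarrow> continuous_on UNIV u \<and>
     (\<forall>x\<in>D. integrable lebesgue (second_difference_quotient s u x) \<and>
            frac_laplacian s u x = f (u x))"

end

theory Submission
  imports Defs
begin

text \<open>Testing the weak equation with a smooth truncation of \<open>u\<close> above the level 1 gives $u \<le> 1$, because
  $t^p - t^q < 0$ for $t > 1$; so the right-hand side is bounded. The Riesz kernel $|x|^{2s-N}$ is, up to a
  constant, a fundamental solution of the fractional Laplacian: both it and $|x|^{-N-2s}$ are superpositions of
  Gaussians, and convolving Gaussians reduces the claim to a Frullani integral. Cutting the Riesz kernel off near
  the origin yields a parametrix with compact support; testing with its convolutions with bump functions shows that
  \<open>u\<close> is locally a function with quadratically small second differences plus the truncated Riesz potential of
  the right-hand side. Therefore \<open>u\<close> is locally Hoelder continuous, hence so is the right-hand side, hence the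
  second differences of \<open>u\<close> are $O(|h|^{\<gamma>})$ with $\<gamma> > 2s$: the singular integral converges and is continuous,
  and the equation holds pointwise. In a domain, continuity at a boundary point follows by comparison with
  barriers: the exterior ball condition and the nonlocality of the energy form force the upper limit \<open>M\<close> of \<open>u\<close>
  at the point to be 0.\<close>

text \<open>No Fourier transform enters: for the fundamental solution only the existence of a
  positive constant is proved, and the Frullani integral supplies it. The weak equation knows
  \<open>u\<close> only up to null sets and through test functions, so regularity has to come by
  duality: smoothness of the parametrix is carried over to \<open>u\<close> by Fubini and the
  fundamental lemma of the calculus of variations. One pass is not enough. For a merely bounded
  right-hand side the potential gains an exponent below 2s, too little for the singular integral. A
  Hoelder exponent of the right-hand side, however small, pushes the gain beyond 2s, because the
  second difference of the kernel has mean zero and can be paired with g(z + w) - g(z). At the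
  boundary no explicit supersolution is used. At scale r the interaction with the exterior ball and
  the fractional Laplacian of a bump of width r are both of order r^(-2s), while all other terms
  stay bounded as r tends to 0; a bump of small height therefore loses against the
  interaction.\<close>

abbreviation borel_fun :: "('a::topological_space \<Rightarrow> 'b::topological_space) \<Rightarrow> bool" where
  "borel_fun f \<equiv> f \<in> borel_measurable borel"

abbreviation L1 :: "('a::euclidean_space \<Rightarrow> real) \<Rightarrow> bool" where
  "L1 f \<equiv> integrable lborel f"

abbreviation lborel2 :: "('a::euclidean_space \<times> 'b::euclidean_space) measure" where
  "lborel2 \<equiv> lborel \<Otimes>\<^sub>M lborel"

lemma le_mult_right_mono: "x \<le> a * t \<Longrightarrow> a \<le> b \<Longrightarrow> 0 \<le> t \<Longrightarrow> x \<le> b * t" for x a b t :: real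
  by (rule order_trans[OF _ mult_right_mono])

lemmas integrable_plus = Bochner_Integration.integrable_add
  and integrable_minus = Bochner_Integration.integrable_diff
  and integral_plus = Bochner_Integration.integral_add
  and integral_minus = Bochner_Integration.integral_diff
  and lint_nonneg = Bochner_Integration.integral_nonneg
  and lint_cong = Bochner_Integration.integral_cong

section \<open>Lebesgue integrals and powers of the norm\<close>

lemma nn_integral_lborel_shift:
  fixes c :: "'a::euclidean_space"
  assumes [measurable]: "borel_fun f"
  shows "(\<integral>\<^sup>+x. f (x + c) \<partial>lborel) = (\<integral>\<^sup>+x. f x \<partial>lborel)"
proof -
  have "(\<integral>\<^sup>+x. f x \<partial>lborel) = (\<integral>\<^sup>+x. f x \<partial>distr lborel borel ((+) c))"
    by (simp add: lborel_distr_plus)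
  also have "\<dots> = (\<integral>\<^sup>+x. f (c + x) \<partial>lborel)"
    by (rule nn_integral_distr) auto
  finally show ?thesis by (simp add: add.commute)
qed

lemma distr_lborel_uminus: "distr lborel borel uminus = (lborel :: 'a::euclidean_space measure)"
  using lborel_affine[of "-1" "0::'a"] by (simp add: density_1)

lemma integrable_lborel_shift:
  assumes "L1 f"
  shows "L1 (\<lambda>x. f (x + c))"
proof -
  have [measurable]: "borel_fun f"
    using borel_measurable_integrable[OF assms] by simp
  have "integrable (distr lborel borel ((+) c)) f"
    using assms by (simp add: lborel_distr_plus)
  then show ?thesis
    by (subst (asm) integrable_distr_eq) (auto simp: add.commute)
qed

lemma integral_lborel_shift:
  fixes f :: "'a::euclidean_space \<Rightarrow> real"
  assumes [measurable]: "borel_fun f"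
  shows "(LBINT x. f (x + c)) = (LBINT x. f x)"
proof -
  have "(LBINT x. f x) = (LINT x|distr lborel borel ((+) c). f x)"
    by (simp add: lborel_distr_plus)
  also have "\<dots> = (LBINT x. f (c + x))"
    by (rule integral_distr) auto
  finally show ?thesis by (simp add: add.commute)
qed

lemma integrable_lborel_uminus:
  assumes "L1 f"
  shows "L1 (\<lambda>x. f (- x))"
proof -
  have [measurable]: "borel_fun f"
    using borel_measurable_integrable[OF assms] by simp
  have "integrable (distr lborel borel uminus) f"
    using assms by (simp add: distr_lborel_uminus)
  then show ?thesis
    by (subst (asm) integrable_distr_eq) auto
qed

lemma integral_lborel_uminus:
  fixes f :: "'a::euclidean_space \<Rightarrow> real"
  assumes [measurable]: "borel_fun f"
  shows "(LBINT x. f (- x)) = (LBINT x. f x)"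
proof -
  have "(LBINT x. f x) = (LINT x|distr lborel borel uminus. f x)"
    by (simp add: distr_lborel_uminus)
  also have "\<dots> = (LBINT x. f (- x))"
    by (rule integral_distr) auto
  finally show ?thesis by simp
qed

lemma integrable_lborel_reflect:
  assumes "L1 f"
  shows "L1 (\<lambda>x. f (c - x))"
  using integrable_lborel_uminus[OF integrable_lborel_shift[OF assms, of c]] by simp

lemma integral_lborel_reflect:
  fixes f :: "'a::euclidean_space \<Rightarrow> real"
  assumes [measurable]: "borel_fun f"
  shows "(LBINT x. f (c - x)) = (LBINT x. f x)"
  using integral_lborel_uminus[of "\<lambda>x. f (x + c)"] integral_lborel_shift[of f c] by simp

lemma integrable_dominated:
  fixes f g :: "'a \<Rightarrow> real"
  assumes "integrable M f" "g \<in> borel_measurable M" "\<And>x. \<bar>g x\<bar> \<le> f x"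
  shows "integrable M g"
  by (rule Bochner_Integration.integrable_bound[OF assms(1,2)]) (auto intro!: AE_I2 order_trans[OF assms(3) abs_ge_self])

lemma integrable_dominated_nonneg:
  fixes f g :: "'a \<Rightarrow> real"
  assumes "integrable M f" "\<And>x. 0 \<le> g x" "g \<in> borel_measurable M" "\<And>x. g x \<le> f x"
  shows "integrable M g"
  using assms(2,4) by (intro integrable_dominated[OF assms(1,3)]) simp

lemma integrable_dominated_pair:
  fixes f g :: "'a \<Rightarrow> 'b \<Rightarrow> real"
  assumes "integrable M (\<lambda>(x, y). f x y)" "(\<lambda>(x, y). g x y) \<in> borel_measurable M" "\<And>x y. \<bar>g x y\<bar> \<le> f x y"
  shows "integrable M (\<lambda>(x, y). g x y)"
  using assms(3) by (intro integrable_dominated[OF assms(1,2)]) auto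

lemma integrable_pairI:
  fixes F :: "'a::euclidean_space \<Rightarrow> 'b::euclidean_space \<Rightarrow> real"
  assumes [measurable]: "(\<lambda>(x, y). F x y) \<in> borel_measurable (borel \<Otimes>\<^sub>M borel)"
    and "(\<integral>\<^sup>+x. (\<integral>\<^sup>+y. ennreal \<bar>F x y\<bar> \<partial>lborel) \<partial>lborel) < \<infinity>"
  shows "integrable lborel2 (\<lambda>(x, y). F x y)"
proof (rule integrableI_bounded)
  have "(\<integral>\<^sup>+z. ennreal (norm (case z of (x, y) \<Rightarrow> F x y)) \<partial>lborel2) =
     (\<integral>\<^sup>+x. (\<integral>\<^sup>+y. ennreal \<bar>F x y\<bar> \<partial>lborel) \<partial>lborel)"
    by (subst lborel.nn_integral_fst[symmetric]) (auto simp: split_beta')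
  with assms(2) show "(\<integral>\<^sup>+z. ennreal (norm (case z of (x, y) \<Rightarrow> F x y)) \<partial>lborel2) < \<infinity>"
    by simp
qed simp

lemma integrable_pairD:
  fixes F :: "'a::euclidean_space \<Rightarrow> 'b::euclidean_space \<Rightarrow> real"
  assumes F: "integrable lborel2 (\<lambda>(x, y). F x y)"
  shows "(\<integral>\<^sup>+x. (\<integral>\<^sup>+y. ennreal \<bar>F x y\<bar> \<partial>lborel) \<partial>lborel) < \<infinity>"
proof -
  have [measurable]: "(\<lambda>(x, y). F x y) \<in> borel_measurable (borel \<Otimes>\<^sub>M borel)"
    using borel_measurable_integrable[OF F] by simp
  have "(\<integral>\<^sup>+z. ennreal (norm (case z of (x, y) \<Rightarrow> F x y)) \<partial>lborel2) =
     (\<integral>\<^sup>+x. (\<integral>\<^sup>+y. ennreal \<bar>F x y\<bar> \<partial>lborel) \<partial>lborel)"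
    by (subst lborel.nn_integral_fst[symmetric]) (auto simp: split_beta')
  with F show ?thesis
    by (auto simp: integrable_iff_bounded)
qed

lemma LINT_swap:
  fixes F :: "'a::euclidean_space \<Rightarrow> 'b::euclidean_space \<Rightarrow> real"
  assumes "integrable lborel2 (\<lambda>(x, y). F x y)"
  shows "(LBINT x. LBINT y. F x y) = (LBINT y. LBINT x. F x y)"
  using lborel_pair.Fubini_integral[OF assms] by simp

section \<open>Integrability of powers of the norm by dyadic decomposition\<close>

lemma powr_of_power2: "((2::real) ^ n) powr c = 2 powr (n * c)"
  by (simp add: powr_realpow[symmetric] powr_powr)

lemma power_of_powr2: "((2::real) powr c) ^ n = 2 powr (n * c)"
  by (simp add: powr_power mult.commute)

lemma ball_in_borel [measurable]: "ball (c::'a::euclidean_space) r \<in> sets borel"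
  by simp

lemma cball_in_borel [measurable]: "cball (c::'a::euclidean_space) r \<in> sets borel"
  by simp

text \<open>A substitute for polar coordinates: a radial power is compared with a step function on
  concentric balls whose radii form a geometric progression, so that its integral is controlled by a
  geometric series.\<close>

lemma dyadic_nn_integral_finite:
  fixes f :: "'a::euclidean_space \<Rightarrow> ennreal"
  assumes f: "\<And>w. f w \<le> (\<Sum>n. ennreal (c n) * indicator (ball 0 (r n)) w)"
    and nn: "\<And>n. 0 \<le> c n" "\<And>n. 0 \<le> r n"
    and sm: "summable (\<lambda>n. c n * r n ^ DIM('a))"
  shows "(\<integral>\<^sup>+w. f w \<partial>lborel) < \<infinity>"
proof -
  have "(\<integral>\<^sup>+w. f w \<partial>lborel) \<le> (\<integral>\<^sup>+w. (\<Sum>n. ennreal (c n) * indicator (ball 0 (r n)) (w::'a)) \<partial>lborel)"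
    by (rule nn_integral_mono) (rule f)
  also have "\<dots> = (\<Sum>n. \<integral>\<^sup>+w. ennreal (c n) * indicator (ball 0 (r n)) (w::'a) \<partial>lborel)"
    by (rule nn_integral_suminf) (auto intro!: borel_measurable_times_ennreal borel_measurable_indicator)
  also have "\<dots> = (\<Sum>n. ennreal (unit_ball_vol (DIM('a)) * (c n * r n ^ DIM('a))))"
    using nn by (intro suminf_cong)
      (simp add: nn_integral_cmult_indicator emeasure_ball ennreal_mult'[symmetric] mult_ac)
  also have "\<dots> < \<infinity>"
    using nn sm by (simp add: suminf_ennreal2 summable_mult)
  finally show ?thesis .
qed

lemma ennreal_le_suminf_term:
  fixes g :: "nat \<Rightarrow> ennreal"
  assumes "x \<le> g n" shows "x \<le> (\<Sum>n. g n)"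
  by (meson assms ennreal_suminf_lessD leD le_less_linear order.trans)

lemma integrable_norm_powr_ball:
  fixes a R :: real
  assumes a: "a < DIM('a::euclidean_space)" and R: "0 < R"
  shows "L1 (\<lambda>w::'a. norm w powr (- a) * indicator (ball 0 R) w)"
proof -
  \<comment> \<open>For a nonnegative exponent the power decreases with the norm, so on each shell
    it is largest at the inner radius. For negative \<open>a\<close> the integrand is bounded on the
    ball; that case follows at the end.\<close>
  have *: "(\<integral>\<^sup>+w. ennreal (norm w powr (- b) * indicator (ball 0 R) (w::'a)) \<partial>lborel) < \<infinity>"
    if b: "0 \<le> b" "b < DIM('a)" for b :: real
  proof (rule dyadic_nn_integral_finite)
    fix w :: 'a
    show "ennreal (norm w powr (- b) * indicator (ball 0 R) w) \<le>
      (\<Sum>n. ennreal ((R / 2 ^ Suc n) powr (- b)) * indicator (ball 0 (R / 2 ^ n)) w)"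
    proof (cases "w = 0 \<or> norm w \<ge> R")
      case True
      then have "norm w powr (- b) * indicator (ball 0 R) w = 0" by auto
      then show ?thesis by (simp only: ennreal_0 zero_le)
    next
      case False
      then have w: "w \<noteq> 0" "norm w < R" by auto
      have "\<exists>n. R / 2 ^ n \<le> norm w"
      proof -
        obtain n where "(1/2) ^ n < norm w / R"
          using real_arch_pow_inv[of "norm w / R" "1/2"] w R by auto
        then show ?thesis using R by (auto simp: field_simps power_divide intro!: exI[of _ n])
      qed
      \<comment> \<open>The first radius that does not exceed |w|. Index 0 is excluded by |w| < R,
        and the preceding radius still exceeds |w|, which puts w into the shell between the
        two.\<close>
      define n where "n = (LEAST n. R / 2 ^ n \<le> norm w)"
      have n1: "R / 2 ^ n \<le> norm w"
        unfolding n_def by (rule LeastI_ex) fact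
      then have "n \<noteq> 0" using w by (intro notI) simp
      then obtain m where m: "n = Suc m" by (cases n) auto
      have n2: "norm w < R / 2 ^ m"
        using not_less_Least[of m "\<lambda>n. R / 2 ^ n \<le> norm w"] m unfolding n_def[symmetric] by auto
      show ?thesis
      proof (rule ennreal_le_suminf_term[of _ _ m])
        have "norm w powr (- b) \<le> (R / 2 ^ Suc m) powr (- b)"
          using n1 m R b w by (intro powr_mono2') auto
        then show "ennreal (norm w powr (- b) * indicator (ball 0 R) w) \<le>
            ennreal ((R / 2 ^ Suc m) powr (- b)) * indicator (ball 0 (R / 2 ^ m)) w"
          using w n2 by (auto simp: indicator_def intro!: ennreal_leI)
      qed
    qed
  next
    have "(\<lambda>n. (R / 2 ^ Suc n) powr (- b) * (R / 2 ^ n) ^ DIM('a)) =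
      (\<lambda>n. ((R/2) powr (-b) * R ^ DIM('a)) * (2 powr (b - DIM('a))) ^ n)"
    proof
      fix n
      have 1: "(R / 2 ^ Suc n) powr (- b) = (R/2) powr (-b) * 2 powr (n * b)"
      proof -
        have "(R / 2 ^ Suc n) powr (- b) = ((R / 2) / 2 ^ n) powr (- b)" by simp
        also have "\<dots> = (R / 2) powr (- b) / (2 ^ n) powr (- b)"
          by (rule powr_divide)
        also have "\<dots> = (R / 2) powr (- b) * 2 powr (n * b)"
          unfolding powr_of_power2 by (simp add: powr_minus_divide)
        finally show ?thesis .
      qed
      have 2: "(R / 2 ^ n) ^ DIM('a) = R ^ DIM('a) * 2 powr (- (n * real DIM('a)))"
      proof -
        have "((2::real) ^ n) ^ DIM('a) = 2 powr (n * real DIM('a))"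
          by (simp add: powr_realpow[symmetric] powr_powr)
        then show ?thesis by (simp only: power_divide powr_minus_divide mult_1_right times_divide_eq_right)
      qed
      have 3: "(2 powr (b - DIM('a))) ^ n = 2 powr (n * b) * 2 powr (- (n * real DIM('a)))"
        unfolding power_of_powr2 powr_add[symmetric] by (simp add: algebra_simps)
      show "(R / 2 ^ Suc n) powr (- b) * (R / 2 ^ n) ^ DIM('a) =
        ((R/2) powr (-b) * R ^ DIM('a)) * (2 powr (b - DIM('a))) ^ n"
        unfolding 1 2 3 by simp
    qed
    \<comment> \<open>Ratio of the geometric series: each halving of the radius multiplies the power
      by 2^b and the volume by 2^(-N).\<close>
    moreover have "2 powr (b - DIM('a)) < (1::real)"
      using b by (simp add: powr_less_one)
    ultimately show "summable (\<lambda>n. (R / 2 ^ Suc n) powr (- b) * (R / 2 ^ n) ^ DIM('a))"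
      by (auto intro!: summable_mult summable_geometric)
  qed (use R in auto)
  have "(\<integral>\<^sup>+w. ennreal (norm w powr (- a) * indicator (ball 0 R) (w::'a)) \<partial>lborel) < \<infinity>"
  proof (cases "0 \<le> a")
    case False
    have "(\<integral>\<^sup>+w. ennreal (norm w powr (- a) * indicator (ball 0 R) (w::'a)) \<partial>lborel) \<le>
      (\<integral>\<^sup>+w. ennreal (R powr (- a)) * indicator (ball 0 R) (w::'a) \<partial>lborel)"
      using False by (intro nn_integral_mono) (auto simp: indicator_def intro!: ennreal_leI powr_mono2)
    also have "\<dots> < \<infinity>"
      using R by (subst nn_integral_cmult_indicator) (auto simp: emeasure_ball ennreal_mult_less_top)
    finally show ?thesis .
  qed (use * a in auto)
  then show ?thesis
    by (intro integrableI_bounded) auto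
qed

text \<open>The same shells, now doubling outwards; the ratio 2^(N-b) is below 1 because the power
  decays faster than the volume grows.\<close>

lemma integrable_norm_powr_outside:
  fixes b R :: real
  assumes b: "b > DIM('a::euclidean_space)" and R: "0 < R"
  shows "L1 (\<lambda>w::'a. norm w powr (- b) * indicator (- ball 0 R) w)"
proof -
  have b0: "b > 0" using b by simp
  have "(\<integral>\<^sup>+w. ennreal (norm w powr (- b) * indicator (- ball 0 R) (w::'a)) \<partial>lborel) < \<infinity>"
  proof (rule dyadic_nn_integral_finite)
    fix w :: 'a
    show "ennreal (norm w powr (- b) * indicator (- ball 0 R) w) \<le>
      (\<Sum>n. ennreal ((R * 2 ^ n) powr (- b)) * indicator (ball 0 (R * 2 ^ Suc n)) w)"
    proof (cases "norm w < R")
      case True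
      then have "norm w powr (- b) * indicator (- ball 0 R) w = 0" by auto
      then show ?thesis by (simp only: ennreal_0 zero_le)
    next
      case False
      then have w: "R \<le> norm w" by auto
      have "\<exists>n. norm w < R * 2 ^ n"
      proof -
        obtain n where "norm w / R < 2 ^ n"
          using real_arch_pow[of 2 "norm w / R"] by auto
        then show ?thesis using R by (auto simp: field_simps intro!: exI[of _ n])
      qed
      define n where "n = (LEAST n. norm w < R * 2 ^ n)"
      have n1: "norm w < R * 2 ^ n"
        unfolding n_def by (rule LeastI_ex) fact
      then have "n \<noteq> 0" using w by (intro notI) simp
      then obtain m where m: "n = Suc m" by (cases n) auto
      have n2: "R * 2 ^ m \<le> norm w"
        using not_less_Least[of m "\<lambda>n. norm w < R * 2 ^ n"] m unfolding n_def[symmetric] by auto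
      show ?thesis
      proof (rule ennreal_le_suminf_term[of _ _ m])
        have "norm w powr (- b) \<le> (R * 2 ^ m) powr (- b)"
          using n2 R b0 by (intro powr_mono2') auto
        then show "ennreal (norm w powr (- b) * indicator (- ball 0 R) w) \<le>
            ennreal ((R * 2 ^ m) powr (- b)) * indicator (ball 0 (R * 2 ^ Suc m)) w"
          using w n1 m by (auto simp: indicator_def intro!: ennreal_leI)
      qed
    qed
  next
    have "(\<lambda>n. (R * 2 ^ n) powr (- b) * (R * 2 ^ Suc n) ^ DIM('a)) =
      (\<lambda>n. (R powr (-b) * (2 * R) ^ DIM('a)) * (2 powr (DIM('a) - b)) ^ n)"
    proof
      fix n
      have 1: "(R * 2 ^ n) powr (- b) = R powr (-b) * 2 powr (- n * b)"
        using R by (simp add: powr_mult powr_of_power2)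
      have 2: "(R * 2 ^ Suc n) ^ DIM('a) = (2 * R) ^ DIM('a) * 2 powr (n * real DIM('a))"
      proof -
        have "((2::real) ^ n) ^ DIM('a) = 2 powr (n * real DIM('a))"
          by (simp add: powr_realpow[symmetric] powr_powr)
        then show ?thesis by (simp add: power_mult_distrib)
      qed
      have 3: "(2 powr (DIM('a) - b)) ^ n = 2 powr (- n * b) * 2 powr (n * real DIM('a))"
        unfolding power_of_powr2 powr_add[symmetric] by (simp add: algebra_simps)
      show "(R * 2 ^ n) powr (- b) * (R * 2 ^ Suc n) ^ DIM('a) =
        (R powr (-b) * (2 * R) ^ DIM('a)) * (2 powr (DIM('a) - b)) ^ n"
        unfolding 1 2 3 by simp
    qed
    moreover have "2 powr (DIM('a) - b) < (1::real)"
      using b by (simp add: powr_less_one)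
    ultimately show "summable (\<lambda>n. (R * 2 ^ n) powr (- b) * (R * 2 ^ Suc n) ^ DIM('a))"
      by (auto intro!: summable_mult summable_geometric)
  qed (use R in auto)
  then show ?thesis
    by (intro integrableI_bounded) auto
qed

section \<open>Second differences and the fractional kernel\<close>

text \<open>The increment precedes the point, so that \<open>sd f h\<close> is again a function: it
  can be convolved, differentiated and fed to \<open>sd\<close> or \<open>Lop\<close>.\<close>

definition sd :: "('a::real_vector \<Rightarrow> real) \<Rightarrow> 'a \<Rightarrow> 'a \<Rightarrow> real" where
  "sd f h x = f (x + h) + f (x - h) - 2 * f x"

lemma sd_0 [simp]: "sd f 0 x = 0"
  by (simp add: sd_def)

lemma borel_measurable_sd [measurable]:
  fixes f :: "'a::euclidean_space \<Rightarrow> real"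
  assumes [measurable]: "borel_fun f" "g \<in> M \<rightarrow>\<^sub>M borel" "h \<in> M \<rightarrow>\<^sub>M borel"
  shows "(\<lambda>z. sd f (g z) (h z)) \<in> borel_measurable M"
  unfolding sd_def by measurable

lemma abs_sd_le:
  assumes "\<And>x. \<bar>f x\<bar> \<le> B" shows "\<bar>sd f h x\<bar> \<le> 4 * B"
  using assms[of "x + h"] assms[of "x - h"] assms[of x] unfolding sd_def by linarith

lemma first_difference_bound:
  fixes g :: "real \<Rightarrow> real"
  assumes g: "\<And>t. t \<in> {0..1} \<Longrightarrow> (g has_real_derivative g' t) (at t)"
    and B: "\<And>t. t \<in> {0..1} \<Longrightarrow> \<bar>g' t\<bar> \<le> B"
  shows "\<bar>g 1 - g 0\<bar> \<le> B"
proof -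
  obtain z where "z > 0" "z < 1" "g 1 - g 0 = (1 - 0) * g' z"
    using MVT2[of 0 1 g g'] g by auto
  then show ?thesis using B[of z] by simp
qed

text \<open>The symmetric sum \<open>G t = g t + g (- t)\<close> has derivative g'(t) - g'(-t),
  which the mean value theorem bounds by 2 t B. The first-difference bound for \<open>G\<close> then
  yields the constant 2.\<close>

lemma second_difference_bound:
  fixes g :: "real \<Rightarrow> real"
  assumes g: "\<And>t. t \<in> {-1..1} \<Longrightarrow> (g has_real_derivative g' t) (at t)"
    and g': "\<And>t. t \<in> {-1..1} \<Longrightarrow> (g' has_real_derivative g'' t) (at t)"
    and B: "\<And>t. t \<in> {-1..1} \<Longrightarrow> \<bar>g'' t\<bar> \<le> B"
  shows "\<bar>g 1 + g (-1) - 2 * g 0\<bar> \<le> 2 * B"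
proof -
  define G where "G t = g t + g (- t)" for t
  have dG: "(G has_real_derivative g' t - g' (- t)) (at t)" if "t \<in> {0..1}" for t
  proof -
    have "((\<lambda>t. g (- t)) has_real_derivative g' (- t) * (-1)) (at t)"
      by (rule DERIV_chain2[OF g]) (use that in \<open>auto intro!: derivative_eq_intros\<close>)
    then show ?thesis
      unfolding G_def using g[of t] that by (auto intro!: derivative_eq_intros)
  qed
  have "\<bar>g' t - g' (- t)\<bar> \<le> 2 * B" if "t \<in> {0..1}" for t
  proof (cases "t = 0")
    case True
    then show ?thesis using B[of 0] by auto
  next
    case False
    then have "- t < t" using that by auto
    then obtain z where z: "z > - t" "z < t" "g' t - g' (- t) = (t - (- t)) * g'' z"
    proof -
      have "\<exists>z>- t. z < t \<and> g' t - g' (- t) = (t - (- t)) * g'' z"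
        by (rule MVT2[OF \<open>- t < t\<close>], rule g') (use \<open>t \<in> {0..1}\<close> in auto)
      then show ?thesis using that by blast
    qed
    have "\<bar>g' t - g' (- t)\<bar> = 2 * t * \<bar>g'' z\<bar>"
      using z(3) that by (simp add: abs_mult)
    also have "\<dots> \<le> 2 * 1 * B"
      using B[of z] that z by (intro mult_mono) auto
    finally show ?thesis by simp
  qed
  from first_difference_bound[OF dG this] show ?thesis
    by (simp add: G_def algebra_simps)
qed

lemma norm_powr_eq: "norm (x::'a::real_inner) powr c = (x \<bullet> x) powr (c / 2)"
  by (cases "x = 0") (simp_all add: norm_eq_sqrt_inner powr_half_sqrt[symmetric] powr_powr)

lemma norm_powr_line_deriv:
  fixes w h :: "'a::real_inner"
  assumes nz: "w + t *\<^sub>R h \<noteq> 0"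
  shows "((\<lambda>t. norm (w + t *\<^sub>R h) powr c) has_real_derivative
          c * norm (w + t *\<^sub>R h) powr (c - 2) * (h \<bullet> (w + t *\<^sub>R h))) (at t)"
proof -
  have q: "((\<lambda>t. (w + t *\<^sub>R h) \<bullet> (w + t *\<^sub>R h)) has_real_derivative 2 * (h \<bullet> (w + t *\<^sub>R h))) (at t)"
  proof -
    have "(\<lambda>t. (w + t *\<^sub>R h) \<bullet> (w + t *\<^sub>R h)) = (\<lambda>t. w \<bullet> w + 2 * t * (w \<bullet> h) + t\<^sup>2 * (h \<bullet> h))"
      by (simp add: inner_add_left inner_add_right inner_commute power2_eq_square algebra_simps)
    moreover have "((\<lambda>t. w \<bullet> w + 2 * t * (w \<bullet> h) + t\<^sup>2 * (h \<bullet> h)) has_real_derivative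
        2 * (w \<bullet> h) + 2 * t * (h \<bullet> h)) (at t)"
      by (auto intro!: derivative_eq_intros)
    ultimately show ?thesis
      by (simp only:) (simp add: inner_add_right inner_commute algebra_simps)
  qed
  have pos: "(w + t *\<^sub>R h) \<bullet> (w + t *\<^sub>R h) > 0" using nz by simp
  have "((\<lambda>t. ((w + t *\<^sub>R h) \<bullet> (w + t *\<^sub>R h)) powr (c / 2)) has_real_derivative
     (c / 2) * ((w + t *\<^sub>R h) \<bullet> (w + t *\<^sub>R h)) powr (c / 2 - 1) * (2 * (h \<bullet> (w + t *\<^sub>R h)))) (at t)"
    using DERIV_fun_powr[OF q pos, of "c/2"] by simp
  moreover have "((w + t *\<^sub>R h) \<bullet> (w + t *\<^sub>R h)) powr (c / 2 - 1) = norm (w + t *\<^sub>R h) powr (c - 2)"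
    by (simp add: norm_powr_eq diff_divide_distrib)
  ultimately show ?thesis
    by (simp add: norm_powr_eq mult.assoc)
qed

lemma norm_line_ge:
  fixes w h :: "'a::real_inner"
  assumes "norm h \<le> norm w / 2" "\<bar>t\<bar> \<le> 1"
  shows "norm w / 2 \<le> norm (w + t *\<^sub>R h)"
proof -
  have "norm (t *\<^sub>R h) \<le> 1 * norm h"
    using mult_right_mono[OF assms(2) norm_ge_zero[of h]] by simp
  moreover have "norm w - norm (t *\<^sub>R h) \<le> norm (w + t *\<^sub>R h)"
    by (metis add.commute norm_diff_ineq)
  ultimately show ?thesis using assms by linarith
qed

text \<open>Since |h| is at most half the distance to the singularity, the whole segment from w to w
  + h has norm at least |w|/2. There the derivative is at most a |h| times the power -a-1 of the
  norm, and replacing that norm by |w|/2 costs the factor 2^(a+1).\<close>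

lemma norm_powr_first_difference:
  fixes w h :: "'a::real_inner"
  assumes a: "0 < a" and h: "norm h \<le> norm w / 2" and w: "w \<noteq> 0"
  shows "\<bar>norm (w + h) powr (- a) - norm w powr (- a)\<bar> \<le>
    a * 2 powr (a + 1) * norm h * norm w powr (- a - 1)"
proof -
  let ?q = "\<lambda>t. norm (w + t *\<^sub>R h)"
  have q: "norm w / 2 \<le> ?q t" if "t \<in> {0..1}" for t
    using norm_line_ge[OF h, of t] that by auto
  have qp: "?q t > 0" if "t \<in> {0..1}" for t
    using q[OF that] w by (smt (verit) zero_less_divide_iff zero_less_norm_iff)
  have "\<bar>norm (w + 1 *\<^sub>R h) powr (- a) - norm (w + 0 *\<^sub>R h) powr (- a)\<bar> \<le>
    a * 2 powr (a + 1) * norm h * norm w powr (- a - 1)"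
  proof (rule first_difference_bound)
    fix t :: real assume t: "t \<in> {0..1}"
    show "((\<lambda>t. norm (w + t *\<^sub>R h) powr (- a)) has_real_derivative
      (- a) * ?q t powr (- a - 2) * (h \<bullet> (w + t *\<^sub>R h))) (at t)"
      by (rule norm_powr_line_deriv) (use qp[OF t] in auto)
    have "\<bar>(- a) * ?q t powr (- a - 2) * (h \<bullet> (w + t *\<^sub>R h))\<bar> = a * ?q t powr (- a - 2) * \<bar>h \<bullet> (w + t *\<^sub>R h)\<bar>"
      using a by (simp add: abs_mult)
    also have "\<dots> \<le> a * ?q t powr (- a - 2) * (norm h * ?q t)"
      using a by (intro mult_left_mono Cauchy_Schwarz_ineq2) auto
    also have "\<dots> = a * norm h * ?q t powr (- a - 1)"
    proof -
      have "?q t powr (- a - 1) = ?q t powr (- a - 2) * ?q t"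
      proof -
        have e: "- a - 1 = (- a - 2) + 1" by simp
        show ?thesis unfolding e powr_add using qp[OF t] by simp
      qed
      then show ?thesis by simp
    qed
    also have "\<dots> \<le> a * norm h * (norm w / 2) powr (- a - 1)"
      using a q[OF t] w by (intro mult_left_mono powr_mono2') auto
    also have "(norm w / 2) powr (- a - 1) = 2 powr (a + 1) * norm w powr (- a - 1)"
    proof -
      have e: "- a - 1 = - (a + 1)" by simp
      show ?thesis unfolding e by (simp only: powr_divide powr_minus) (simp add: field_simps)
    qed
    finally show "\<bar>(- a) * ?q t powr (- a - 2) * (h \<bullet> (w + t *\<^sub>R h))\<bar> \<le> a * 2 powr (a + 1) * norm h * norm w powr (- a - 1)"
      by (simp add: mult_ac)
  qed
  then show ?thesis by simp
qed

text \<open>Same idea one order higher. The second derivative along the segment has two terms with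
  coefficients a (a+2) and a, which add up to a (a+3); 2^(a+2) comes from |w|/2 and the leading 2
  from \<open>second_difference_bound\<close>.\<close>

lemma norm_powr_sd:
  fixes w h :: "'a::real_inner"
  assumes a: "0 < a" and h: "norm h \<le> norm w / 2" and w: "w \<noteq> 0"
  shows "\<bar>sd (\<lambda>x. norm x powr (- a)) h w\<bar> \<le>
    2 * (a * (a + 3) * 2 powr (a + 2)) * (norm h)\<^sup>2 * norm w powr (- a - 2)"
proof -
  let ?q = "\<lambda>t. norm (w + t *\<^sub>R h)"
  let ?i = "\<lambda>t. h \<bullet> (w + t *\<^sub>R h)"
  have q: "norm w / 2 \<le> ?q t" if "t \<in> {-1..1}" for t
    using norm_line_ge[OF h, of t] that by auto
  have qp: "?q t > 0" if "t \<in> {-1..1}" for t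
    using q[OF that] w by (smt (verit) zero_less_divide_iff zero_less_norm_iff)
  define g'' where "g'' t = - a * ((- a - 2) * ?q t powr (- a - 4) * ?i t * ?i t + ?q t powr (- a - 2) * (h \<bullet> h))" for t
  have "\<bar>norm (w + 1 *\<^sub>R h) powr (- a) + norm (w + (-1) *\<^sub>R h) powr (- a) - 2 * norm (w + 0 *\<^sub>R h) powr (- a)\<bar> \<le>
    2 * (a * (a + 3) * 2 powr (a + 2) * (norm h)\<^sup>2 * norm w powr (- a - 2))"
  proof (rule second_difference_bound)
    fix t :: real assume t: "t \<in> {-1..1}"
    have nz: "w + t *\<^sub>R h \<noteq> 0" using qp[OF t] by auto
    show "((\<lambda>t. norm (w + t *\<^sub>R h) powr (- a)) has_real_derivative
      (- a) * ?q t powr (- a - 2) * ?i t) (at t)"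
      by (rule norm_powr_line_deriv[OF nz])
    have i: "(?i has_real_derivative h \<bullet> h) (at t)"
      by (auto intro!: derivative_eq_intros simp: inner_add_right)
    have "((\<lambda>t. - a * (?q t powr (- a - 2) * ?i t)) has_real_derivative g'' t) (at t)"
      unfolding g''_def
      using DERIV_cmult[OF DERIV_mult[OF norm_powr_line_deriv[OF nz, of "- a - 2"] i], of "- a"]
      by (simp add: algebra_simps)
    then show "((\<lambda>t. (- a) * ?q t powr (- a - 2) * ?i t) has_real_derivative g'' t) (at t)"
      by (simp add: mult.assoc)
    have e1: "?q t powr (- a - 2) = ?q t powr (- a - 4) * ?q t * ?q t"
    proof -
      have e: "- a - 2 = (- a - 4) + 2" by simp
      show ?thesis unfolding e powr_add using qp[OF t] by (simp add: power2_eq_square)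
    qed
    have ii: "?i t * ?i t \<le> (norm h)\<^sup>2 * (?q t * ?q t)"
      using Cauchy_Schwarz_ineq[of h "w + t *\<^sub>R h"] by (simp add: power2_eq_square power2_norm_eq_inner dot_square_norm)
    have "\<bar>g'' t\<bar> \<le> a * (\<bar>(- a - 2) * ?q t powr (- a - 4) * ?i t * ?i t\<bar> + \<bar>?q t powr (- a - 2) * (h \<bullet> h)\<bar>)"
      unfolding g''_def abs_mult[of "-a"] abs_minus_cancel abs_of_pos[OF a] using a
      by (intro mult_left_mono abs_triangle_ineq) auto
    also have "\<dots> = a * ((a + 2) * ?q t powr (- a - 4) * (?i t * ?i t) + ?q t powr (- a - 2) * (norm h)\<^sup>2)"
    proof -
      have "\<bar>(- a - 2) * ?q t powr (- a - 4) * ?i t * ?i t\<bar> = \<bar>- a - 2\<bar> * \<bar>?q t powr (- a - 4)\<bar> * \<bar>?i t * ?i t\<bar>"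
        by (simp add: abs_mult)
      also have "\<dots> = (a + 2) * ?q t powr (- a - 4) * (?i t * ?i t)"
        using a by simp
      finally show ?thesis by (simp add: abs_mult power2_norm_eq_inner)
    qed
    also have "\<dots> \<le> a * ((a + 2) * ?q t powr (- a - 4) * ((norm h)\<^sup>2 * (?q t * ?q t)) + ?q t powr (- a - 2) * (norm h)\<^sup>2)"
      using a ii by (intro mult_left_mono add_right_mono) auto
    also have "\<dots> = a * (a + 3) * (norm h)\<^sup>2 * ?q t powr (- a - 2)"
      by (simp add: e1 algebra_simps)
    also have "\<dots> \<le> a * (a + 3) * (norm h)\<^sup>2 * (norm w / 2) powr (- a - 2)"
      using a q[OF t] w by (intro mult_left_mono powr_mono2') auto
    also have "(norm w / 2) powr (- a - 2) = 2 powr (a + 2) * norm w powr (- a - 2)"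
    proof -
      have e: "- a - 2 = - (a + 2)" by simp
      show ?thesis unfolding e by (simp only: powr_divide powr_minus) (simp add: field_simps)
    qed
    finally show "\<bar>g'' t\<bar> \<le> a * (a + 3) * 2 powr (a + 2) * (norm h)\<^sup>2 * norm w powr (- a - 2)"
      by (simp add: mult_ac)
  qed
  then show ?thesis by (simp add: sd_def mult_ac)
qed

section \<open>The kernel of the fractional Laplacian\<close>

locale fractional_order =
  fixes s :: real and space :: "'a::euclidean_space itself"
  assumes s_pos: "0 < s" and s_less_1: "s < 1" and dim_gt: "2 * s < real DIM('a)"
begin

text \<open>By the convention 0 powr c = 0 the kernel is 0 at the origin, so the diagonal needs no
  separate treatment in the energy.\<close>

definition ker :: "'a \<Rightarrow> real" where
  "ker h = norm h powr (- (real DIM('a) + 2 * s))"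

lemma ker_nonneg [simp]: "0 \<le> ker h"
  by (simp add: ker_def)

lemma ker_uminus [simp]: "ker (- h) = ker h"
  by (simp add: ker_def)

lemma ker_commute: "ker (x - y) = ker (y - x)"
  by (simp add: ker_def norm_minus_commute)

lemma ker_0 [simp]: "ker 0 = 0"
  by (simp add: ker_def)

lemma borel_measurable_ker [measurable]: "borel_fun ker"
  unfolding ker_def by measurable

lemma integrable_ker_outside:
  assumes "0 < R" shows "L1 (\<lambda>h. ker h * indicator (- ball 0 R) h)"
  unfolding ker_def by (rule integrable_norm_powr_outside) (use assms s_pos in auto)

text \<open>Near 0 the product is the power -(N + 2s - \<gamma>) of the norm, integrable exactly
  because \<gamma> > 2s; at infinity the kernel decays fast enough by itself. All singular integrals
  below are dominated by this function.\<close>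

lemma integrable_ker_min:
  assumes g: "2 * s < \<gamma>"
  shows "L1 (\<lambda>h. ker h * min 1 (norm h powr \<gamma>))"
proof (rule integrable_dominated_nonneg)
  show "L1 (\<lambda>h. norm h powr (- (DIM('a) + 2 * s - \<gamma>)) * indicator (ball 0 1) h
    + ker h * indicator (- ball 0 1) h)"
    using g by (intro integrable_plus integrable_norm_powr_ball integrable_ker_outside) auto
  show "ker h * min 1 (norm h powr \<gamma>) \<le> norm h powr (- (DIM('a) + 2 * s - \<gamma>)) * indicator (ball 0 1) h
    + ker h * indicator (- ball 0 1) h" for h
  proof (cases "norm h < 1")
    case True
    have "ker h * min 1 (norm h powr \<gamma>) \<le> ker h * norm h powr \<gamma>"
      by (intro mult_left_mono) auto
    also have "\<dots> = norm h powr (- (DIM('a) + 2 * s - \<gamma>))"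
      unfolding ker_def powr_add[symmetric] by (simp add: algebra_simps)
    finally show ?thesis using True by simp
  next
    case False
    then show ?thesis by (simp add: mult_left_le)
  qed
qed (simp, measurable)

lemma integrable_ker_min2: "L1 (\<lambda>h. ker h * min 1 ((norm h)\<^sup>2))"
  using integrable_ker_min[of 2] s_less_1 by simp

text \<open>The fractional Laplacian without its factor \<open>c_Ns DIM('a) s / 2\<close>. The same
  factor is left out of \<open>form\<close> and compensated in \<open>source\<close>.\<close>

definition Lop :: "('a \<Rightarrow> real) \<Rightarrow> 'a \<Rightarrow> real" where
  "Lop f x = - (LBINT h. sd f h x * ker h)"

end

section \<open>Calculus of smooth functions\<close>

text \<open>The argument order makes \<open>pd b\<close> an operator on functions, so that higher
  derivatives are iterates such as \<open>pd b (pd c f)\<close>.\<close>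

definition pd :: "'a::euclidean_space \<Rightarrow> ('a \<Rightarrow> real) \<Rightarrow> 'a \<Rightarrow> real" where
  "pd b f x = frechet_derivative f (at x) b"

lemma C_k_Suc_iff: "C_k (Suc k) f \<longleftrightarrow> (\<forall>x. f differentiable (at x)) \<and> (\<forall>b\<in>Basis. C_k k (pd b f))"
  by (simp add: pd_def[abs_def])

declare C_k.simps(2) [simp del]

lemma pd_eqI: "(f has_derivative D) (at x) \<Longrightarrow> pd b f x = D b"
  unfolding pd_def by (metis frechet_derivative_at)

lemma C_k_SucI:
  assumes "\<And>x. (f has_derivative D x) (at x)" "\<And>b. b \<in> Basis \<Longrightarrow> C_k k (\<lambda>x. D x b)"
  shows "C_k (Suc k) f"
proof -
  have "pd b f = (\<lambda>x. D x b)" for b using pd_eqI[OF assms(1)] by auto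
  then show ?thesis using assms unfolding C_k_Suc_iff by (auto simp: differentiable_def)
qed

lemma C_k_imp_continuous: "C_k k f \<Longrightarrow> continuous_on UNIV f"
proof (cases k)
  case (Suc m)
  assume "C_k k f"
  then show ?thesis
    unfolding Suc C_k_Suc_iff
    by (auto intro!: continuous_at_imp_continuous_on differentiable_imp_continuous_within)
qed simp

lemma C_k_Suc_imp: "C_k (Suc k) f \<Longrightarrow> C_k k f"
proof (induction k arbitrary: f)
  case 0
  then show ?case using C_k_imp_continuous by simp
next
  case (Suc k)
  then show ?case by (subst C_k_Suc_iff) (auto simp: C_k_Suc_iff[of "Suc k"])
qed

lemma C_k_Suc_has_derivative:
  assumes "C_k (Suc k) f"
  shows "(f has_derivative frechet_derivative f (at x)) (at x)"
  using assms unfolding C_k_Suc_iff by (simp add: frechet_derivative_works[symmetric])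

lemma C_k_const [simp]: "C_k k (\<lambda>x. c)"
proof (induction k arbitrary: c)
  case (Suc k)
  show ?case by (rule C_k_SucI[where D="\<lambda>x h. 0"]) (auto intro: Suc)
qed simp

lemma C_k_add: "C_k k f \<Longrightarrow> C_k k g \<Longrightarrow> C_k k (\<lambda>x. f x + g x)"
proof (induction k arbitrary: f g)
  case (Suc k)
  show ?case
  proof (rule C_k_SucI)
    show "((\<lambda>x. f x + g x) has_derivative (\<lambda>h. frechet_derivative f (at x) h + frechet_derivative g (at x) h)) (at x)" for x
      by (intro has_derivative_add C_k_Suc_has_derivative[OF Suc.prems(1)] C_k_Suc_has_derivative[OF Suc.prems(2)])
    show "C_k k (\<lambda>x. frechet_derivative f (at x) b + frechet_derivative g (at x) b)" if "b \<in> Basis" for b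
      using Suc.prems that by (intro Suc.IH) (auto simp: C_k.simps(2))
  qed
qed (auto intro: continuous_intros)

lemma C_k_mult: "C_k k f \<Longrightarrow> C_k k g \<Longrightarrow> C_k k (\<lambda>x. f x * g x)"
proof (induction k arbitrary: f g)
  case (Suc k)
  show ?case
  proof (rule C_k_SucI)
    show "((\<lambda>x. f x * g x) has_derivative (\<lambda>h. f x * frechet_derivative g (at x) h + frechet_derivative f (at x) h * g x)) (at x)" for x
      by (intro has_derivative_mult C_k_Suc_has_derivative[OF Suc.prems(1)] C_k_Suc_has_derivative[OF Suc.prems(2)])
    show "C_k k (\<lambda>x. f x * frechet_derivative g (at x) b + frechet_derivative f (at x) b * g x)" if "b \<in> Basis" for b
      using Suc.prems that C_k_Suc_imp[OF Suc.prems(1)] C_k_Suc_imp[OF Suc.prems(2)]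
      by (intro C_k_add Suc.IH) (auto simp: C_k.simps(2))
  qed
qed (auto intro: continuous_intros)

lemma C_k_inner: "C_k k (\<lambda>x. x \<bullet> a)"
proof (cases k)
  case (Suc m)
  show ?thesis unfolding Suc
    by (rule C_k_SucI[where D="\<lambda>x h. h \<bullet> a"]) (auto intro!: derivative_eq_intros)
qed (auto intro: continuous_intros)

lemma real_derivative_eq_pd:
  assumes "(G has_real_derivative d) (at t)" shows "pd 1 G t = d"
  using pd_eqI[of G "(*) d" t 1] assms by (simp add: has_field_derivative_def)

lemma C_k_Suc_real_DERIV:
  fixes G :: "real \<Rightarrow> real"
  assumes "C_k (Suc k) G"
  shows "(G has_real_derivative pd 1 G t) (at t)"
proof -
  have "(G has_derivative frechet_derivative G (at t)) (at t)"
    by (rule C_k_Suc_has_derivative[OF assms])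
  then obtain d where "(G has_real_derivative d) (at t)"
    using has_real_derivative by blast
  then show ?thesis using real_derivative_eq_pd by metis
qed

lemma C_k_Suc_realI:
  fixes G :: "real \<Rightarrow> real"
  assumes "\<And>t. (G has_real_derivative G' t) (at t)" "C_k k G'"
  shows "C_k (Suc k) G"
  by (rule C_k_SucI[where D="\<lambda>x h. G' x * h"]) (use assms in \<open>auto simp: has_field_derivative_def\<close>)

text \<open>The outer function has one real variable, so the chain rule produces a single product.
  Both factors have one order of smoothness less, and the induction keeps \<open>G\<close> and
  \<open>f\<close> arbitrary to absorb this.\<close>

lemma C_k_compose:
  fixes G :: "real \<Rightarrow> real"
  shows "C_k k G \<Longrightarrow> C_k k f \<Longrightarrow> C_k k (\<lambda>x. G (f x))"
proof (induction k arbitrary: f G)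
  case 0
  then show ?case
    using continuous_on_compose2[of UNIV G UNIV f] by simp
next
  case (Suc k)
  show ?case
  proof (rule C_k_SucI)
    show "((\<lambda>x. G (f x)) has_derivative (\<lambda>h. pd 1 G (f x) * frechet_derivative f (at x) h)) (at x)" for x
      by (rule has_derivative_compose[OF C_k_Suc_has_derivative[OF Suc.prems(2)]
          C_k_Suc_real_DERIV[OF Suc.prems(1), unfolded has_field_derivative_def]])
    show "C_k k (\<lambda>x. pd 1 G (f x) * frechet_derivative f (at x) b)" if "b \<in> Basis" for b
    proof (rule C_k_mult)
      show "C_k k (\<lambda>x. pd 1 G (f x))"
        using Suc.prems C_k_Suc_imp[OF Suc.prems(2)] by (rule_tac Suc.IH) (auto simp: C_k_Suc_iff)
      show "C_k k (\<lambda>x. frechet_derivative f (at x) b)"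
        using Suc.prems(2) that by (auto simp: C_k.simps(2))
    qed
  qed
qed

lemma C_k_compose_affine: "C_k k f \<Longrightarrow> C_k k (\<lambda>x. f (r *\<^sub>R x + c))"
proof (induction k arbitrary: f)
  case 0
  then show ?case
    by (auto intro!: continuous_on_compose2[of UNIV f UNIV "\<lambda>x. r *\<^sub>R x + c"] continuous_intros)
next
  case (Suc k)
  show ?case
  proof (rule C_k_SucI)
    fix x
    have lin: "linear (frechet_derivative f (at (r *\<^sub>R x + c)))"
      by (metis C_k_Suc_has_derivative[OF Suc.prems] has_derivative_linear)
    have "((\<lambda>x. f (r *\<^sub>R x + c)) has_derivative (\<lambda>h. frechet_derivative f (at (r *\<^sub>R x + c)) (r *\<^sub>R h))) (at x)"
      by (rule has_derivative_compose[where f="\<lambda>x. r *\<^sub>R x + c" and f'="\<lambda>x. r *\<^sub>R x"])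
        (auto intro!: derivative_eq_intros C_k_Suc_has_derivative[OF Suc.prems])
    then show "((\<lambda>x. f (r *\<^sub>R x + c)) has_derivative (\<lambda>h. r * frechet_derivative f (at (r *\<^sub>R x + c)) h)) (at x)"
      by (simp add: linear_cmul[OF lin])
    show "C_k k (\<lambda>x. r * frechet_derivative f (at (r *\<^sub>R x + c)) b)" if "b \<in> Basis" for b
      using Suc.IH[of "\<lambda>x. frechet_derivative f (at x) b"] Suc.prems that
      by (intro C_k_mult) (auto simp: C_k.simps(2))
  qed
qed

lemma C_infinity_const [simp]: "C_infinity (\<lambda>x. d)"
  and C_infinity_inner: "C_infinity (\<lambda>x. x \<bullet> a)"
  and C_infinity_add: "C_infinity f \<Longrightarrow> C_infinity g \<Longrightarrow> C_infinity (\<lambda>x. f x + g x)"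
  and C_infinity_mult: "C_infinity f \<Longrightarrow> C_infinity g \<Longrightarrow> C_infinity (\<lambda>x. f x * g x)"
  and C_infinity_compose: "C_infinity G \<Longrightarrow> C_infinity f \<Longrightarrow> C_infinity (\<lambda>x. G (f x))"
  and C_infinity_shift: "C_infinity f \<Longrightarrow> C_infinity (\<lambda>x. f (x + c))"
  and C_infinity_scale: "C_infinity f \<Longrightarrow> C_infinity (\<lambda>x. f (r *\<^sub>R x))"
  by (auto simp: C_infinity_def C_k_inner C_k_add C_k_mult C_k_compose C_k_compose_affine[of _ _ 1, simplified] C_k_compose_affine[of _ _ _ 0, simplified])

lemma C_infinity_uminus: "C_infinity f \<Longrightarrow> C_infinity (\<lambda>x. - f x)"
  using C_infinity_mult[of "\<lambda>_. -1" f] by simp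

lemma C_infinity_diff: "C_infinity f \<Longrightarrow> C_infinity g \<Longrightarrow> C_infinity (\<lambda>x. f x - g x)"
  using C_infinity_add[OF _ C_infinity_uminus, of f g] by simp

lemma C_infinity_sum: "(\<And>i. i \<in> A \<Longrightarrow> C_infinity (f i)) \<Longrightarrow> C_infinity (\<lambda>x. \<Sum>i\<in>A. f i x)"
  by (induction A rule: infinite_finite_induct) (auto intro!: C_infinity_add)

lemma C_infinity_prod: "(\<And>i. i \<in> A \<Longrightarrow> C_infinity (f i)) \<Longrightarrow> C_infinity (\<lambda>x. \<Prod>i\<in>A. f i x)"
  by (induction A rule: infinite_finite_induct) (auto intro!: C_infinity_mult)

lemma C_infinity_norm_square: "C_infinity (\<lambda>x::'a::euclidean_space. (norm x)\<^sup>2)"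
proof -
  have "(\<lambda>x::'a. (norm x)\<^sup>2) = (\<lambda>x. \<Sum>b\<in>Basis. (x \<bullet> b) * (x \<bullet> b))"
    by (subst power2_norm_eq_inner, subst euclidean_inner) (rule refl)
  then show ?thesis by (simp add: C_infinity_sum C_infinity_mult C_infinity_inner)
qed

lemma C_infinity_pd: "C_infinity f \<Longrightarrow> b \<in> Basis \<Longrightarrow> C_infinity (pd b f)"
  unfolding C_infinity_def by (metis C_k_Suc_iff)

lemma C_infinity_continuous: "C_infinity f \<Longrightarrow> continuous_on A f"
  unfolding C_infinity_def by (metis C_k_imp_continuous continuous_on_subset subset_UNIV)

lemma C_infinity_measurable: "C_infinity f \<Longrightarrow> f \<in> borel_measurable borel"
  using C_infinity_continuous borel_measurable_continuous_onI by blast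

lemma C_infinity_has_derivative: "C_infinity f \<Longrightarrow> (f has_derivative frechet_derivative f (at x)) (at x)"
  unfolding C_infinity_def by (metis C_k_Suc_has_derivative)

lemma frechet_derivative_eq_sum_pd:
  assumes "C_infinity f"
  shows "frechet_derivative f (at x) h = (\<Sum>b\<in>Basis. (h \<bullet> b) * pd b f x)"
proof -
  have lin: "linear (frechet_derivative f (at x))"
    using C_infinity_has_derivative[OF assms] has_derivative_linear by blast
  have "frechet_derivative f (at x) h = frechet_derivative f (at x) (\<Sum>b\<in>Basis. (h \<bullet> b) *\<^sub>R b)"
    by (simp add: euclidean_representation)
  then show ?thesis
    by (simp add: linear_sum[OF lin] linear_cmul[OF lin] pd_def)
qed

section \<open>Taylor bounds along segments\<close>

lemma C_infinity_line_deriv: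
  assumes "C_infinity f"
  shows "((\<lambda>t. f (x + t *\<^sub>R h)) has_real_derivative (\<Sum>b\<in>Basis. (h \<bullet> b) * pd b f (x + t *\<^sub>R h))) (at t)"
proof -
  have lin: "linear (frechet_derivative f (at (x + t *\<^sub>R h)))"
    using C_infinity_has_derivative[OF assms] has_derivative_linear by blast
  have "((\<lambda>t. f (x + t *\<^sub>R h)) has_derivative (\<lambda>r. frechet_derivative f (at (x + t *\<^sub>R h)) (r *\<^sub>R h))) (at t)"
    by (rule has_derivative_compose[OF _ C_infinity_has_derivative[OF assms], of "\<lambda>t. x + t *\<^sub>R h"])
       (auto intro!: derivative_eq_intros)
  moreover have "(\<lambda>r. frechet_derivative f (at (x + t *\<^sub>R h)) (r *\<^sub>R h)) =
      (*) (\<Sum>b\<in>Basis. (h \<bullet> b) * pd b f (x + t *\<^sub>R h))"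
    by (rule ext) (simp add: linear_cmul[OF lin] frechet_derivative_eq_sum_pd[OF assms, symmetric])
  ultimately show ?thesis
    unfolding has_field_derivative_def by simp
qed

lemma sum_abs_inner_le:
  assumes "\<And>b. b \<in> Basis \<Longrightarrow> \<bar>c b\<bar> \<le> B"
  shows "\<bar>\<Sum>b\<in>Basis. ((h::'a::euclidean_space) \<bullet> b) * c b\<bar> \<le> real DIM('a) * (B * norm h)"
proof -
  have "\<bar>\<Sum>b\<in>Basis. (h \<bullet> b) * c b\<bar> \<le> (\<Sum>b\<in>Basis. \<bar>(h \<bullet> b) * c b\<bar>)"
    by (rule sum_abs)
  also have "\<dots> \<le> (\<Sum>b\<in>(Basis::'a set). B * norm h)"
  proof (rule sum_mono)
    fix b :: 'a assume b: "b \<in> Basis"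
    have "\<bar>(h \<bullet> b) * c b\<bar> = \<bar>c b\<bar> * \<bar>h \<bullet> b\<bar>" by (simp add: abs_mult)
    also have "\<dots> \<le> B * norm h"
      using assms[OF b] Basis_le_norm[OF b, of h] by (intro mult_mono) auto
    finally show "\<bar>(h \<bullet> b) * c b\<bar> \<le> B * norm h" .
  qed
  finally show ?thesis by simp
qed

lemma C_infinity_first_difference:
  fixes f :: "'a::euclidean_space \<Rightarrow> real"
  assumes f: "C_infinity f"
    and B: "\<And>b t. b \<in> Basis \<Longrightarrow> t \<in> {0..1} \<Longrightarrow> \<bar>pd b f (x + t *\<^sub>R h)\<bar> \<le> B"
  shows "\<bar>f (x + h) - f x\<bar> \<le> real DIM('a) * (B * norm h)"
  using first_difference_bound[OF C_infinity_line_deriv[OF f, of x h]]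
    sum_abs_inner_le[of "\<lambda>b. pd b f (x + t *\<^sub>R h)" B h for t] B by simp

lemma C_infinity_second_difference:
  fixes f :: "'a::euclidean_space \<Rightarrow> real"
  assumes f: "C_infinity f"
    and B: "\<And>b c t. b \<in> Basis \<Longrightarrow> c \<in> Basis \<Longrightarrow> t \<in> {-1..1} \<Longrightarrow> \<bar>pd b (pd c f) (x + t *\<^sub>R h)\<bar> \<le> B"
  shows "\<bar>sd f h x\<bar> \<le> 2 * ((real DIM('a))\<^sup>2 * B * (norm h)\<^sup>2)"
proof -
  have "\<bar>f (x + 1 *\<^sub>R h) + f (x + (-1) *\<^sub>R h) - 2 * f (x + 0 *\<^sub>R h)\<bar> \<le> 2 * ((real DIM('a))\<^sup>2 * B * (norm h)\<^sup>2)"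
  proof (rule second_difference_bound)
    fix t :: real assume t: "t \<in> {-1..1}"
    show "((\<lambda>t. f (x + t *\<^sub>R h)) has_real_derivative (\<Sum>b\<in>Basis. (h \<bullet> b) * pd b f (x + t *\<^sub>R h))) (at t)"
      by (rule C_infinity_line_deriv[OF f])
    show "((\<lambda>t. \<Sum>b\<in>Basis. (h \<bullet> b) * pd b f (x + t *\<^sub>R h)) has_real_derivative
        (\<Sum>b\<in>Basis. (h \<bullet> b) * (\<Sum>c\<in>Basis. (h \<bullet> c) * pd c (pd b f) (x + t *\<^sub>R h)))) (at t)"
      by (intro DERIV_sum DERIV_cmult C_infinity_line_deriv C_infinity_pd f)
    have "\<bar>\<Sum>b\<in>Basis. (h \<bullet> b) * (\<Sum>c\<in>Basis. (h \<bullet> c) * pd c (pd b f) (x + t *\<^sub>R h))\<bar> \<le>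
      real DIM('a) * ((real DIM('a) * (B * norm h)) * norm h)"
      using B t by (intro sum_abs_inner_le) auto
    then show "\<bar>\<Sum>b\<in>Basis. (h \<bullet> b) * (\<Sum>c\<in>Basis. (h \<bullet> c) * pd c (pd b f) (x + t *\<^sub>R h))\<bar> \<le>
      (real DIM('a))\<^sup>2 * B * (norm h)\<^sup>2"
      by (simp add: power2_eq_square mult_ac)
  qed
  then show ?thesis by (simp add: sd_def)
qed

text \<open>The first-difference bound is applied to f(x + t h) minus its linear part in t; the
  derivative of that is a difference of gradients, again controlled by a first difference.\<close>

lemma C_infinity_taylor1:
  fixes f :: "'a::euclidean_space \<Rightarrow> real"
  assumes f: "C_infinity f"
    and B: "\<And>b c z. b \<in> Basis \<Longrightarrow> c \<in> Basis \<Longrightarrow> \<bar>pd b (pd c f) z\<bar> \<le> B"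
  shows "\<bar>f (x + h) - f x - frechet_derivative f (at x) h\<bar> \<le> (real DIM('a))\<^sup>2 * B * (norm h)\<^sup>2"
proof -
  have "\<bar>(f (x + 1 *\<^sub>R h) - 1 * frechet_derivative f (at x) h) - (f (x + 0 *\<^sub>R h) - 0 * frechet_derivative f (at x) h)\<bar>
    \<le> (real DIM('a))\<^sup>2 * B * (norm h)\<^sup>2"
  proof (rule first_difference_bound)
    fix t :: real assume t: "t \<in> {0..1}"
    show "((\<lambda>t. f (x + t *\<^sub>R h) - t * frechet_derivative f (at x) h) has_real_derivative
      (\<Sum>b\<in>Basis. (h \<bullet> b) * pd b f (x + t *\<^sub>R h)) - frechet_derivative f (at x) h) (at t)"
      by (auto intro!: derivative_eq_intros C_infinity_line_deriv[OF f])
    have B0: "0 \<le> B"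
      using B[of "SOME b. b \<in> Basis" "SOME b. b \<in> Basis" 0] abs_ge_zero order_trans
      by (metis (full_types) SOME_Basis)
    have *: "\<bar>pd b f (x + t *\<^sub>R h) - pd b f x\<bar> \<le> real DIM('a) * (B * norm h)" if b: "b \<in> Basis" for b
    proof -
      have "\<bar>pd b f (x + t *\<^sub>R h) - pd b f x\<bar> \<le> real DIM('a) * (B * norm (t *\<^sub>R h))"
        using B b by (intro C_infinity_first_difference C_infinity_pd f) auto
      also have "\<dots> \<le> real DIM('a) * (B * (1 * norm h))"
        using t B0 by (intro mult_left_mono) (auto intro: mult_right_mono simp: mult_left_le_one_le)
      finally show ?thesis by simp
    qed
    have "(\<Sum>b\<in>Basis. (h \<bullet> b) * pd b f (x + t *\<^sub>R h)) - frechet_derivative f (at x) h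
      = (\<Sum>b\<in>Basis. (h \<bullet> b) * (pd b f (x + t *\<^sub>R h) - pd b f x))"
      by (simp add: frechet_derivative_eq_sum_pd[OF f] sum_subtractf right_diff_distrib)
    also have "\<bar>\<dots>\<bar> \<le> real DIM('a) * ((real DIM('a) * (B * norm h)) * norm h)"
      by (rule sum_abs_inner_le) (rule *)
    finally show "\<bar>(\<Sum>b\<in>Basis. (h \<bullet> b) * pd b f (x + t *\<^sub>R h)) - frechet_derivative f (at x) h\<bar>
      \<le> (real DIM('a))\<^sup>2 * B * (norm h)\<^sup>2"
      by (simp add: power2_eq_square mult_ac)
  qed
  then show ?thesis by simp
qed

lemma C_infinity_bounded_on_cball:
  assumes "C_infinity f"
  obtains B where "0 < B" "\<And>x. x \<in> cball c R \<Longrightarrow> \<bar>f x\<bar> \<le> B"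
proof -
  have "bounded (f ` cball c R)"
    by (intro compact_imp_bounded compact_continuous_image C_infinity_continuous assms compact_cball)
  then show ?thesis
    unfolding bounded_pos using that by auto
qed

lemma bounded_family_sup:
  assumes "finite A" "\<And>a. a \<in> A \<Longrightarrow> \<exists>B::real. \<forall>x\<in>S. \<bar>f a x\<bar> \<le> B"
  shows "\<exists>B>0. \<forall>a\<in>A. \<forall>x\<in>S. \<bar>f a x\<bar> \<le> B"
  using assms
proof (induction A rule: finite_induct)
  case empty
  then show ?case by (auto intro: exI[of _ 1])
next
  case (insert a A)
  then obtain B B' where "B > 0" "\<forall>a\<in>A. \<forall>x\<in>S. \<bar>f a x\<bar> \<le> B" "\<forall>x\<in>S. \<bar>f a x\<bar> \<le> B'"
    by (metis insertCI)
  then show ?case by (intro exI[of _ "max B B'"]) fastforce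
qed

text \<open>Compactness bounds f and its derivatives on the ball of radius R. The condition |x| +
  |h| \<le> R keeps the segment x + t h, |t| \<le> 1, inside that ball, as the mean value arguments
  require.\<close>

lemma C_infinity_local_bounds:
  fixes f :: "'a::euclidean_space \<Rightarrow> real"
  assumes f: "C_infinity f"
  obtains C where "0 < C" "\<And>x. norm x \<le> R \<Longrightarrow> \<bar>f x\<bar> \<le> C"
    "\<And>x h. norm x + norm h \<le> R \<Longrightarrow> \<bar>f (x + h) - f x\<bar> \<le> C * norm h"
    "\<And>x h. norm x + norm h \<le> R \<Longrightarrow> \<bar>sd f h x\<bar> \<le> C * (norm h)\<^sup>2"
proof -
  obtain B0 where B0: "0 < B0" "\<And>x. x \<in> cball 0 R \<Longrightarrow> \<bar>f x\<bar> \<le> B0"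
    using C_infinity_bounded_on_cball[OF f] by blast
  obtain B1 where B1: "0 < B1" "\<And>b x. b \<in> Basis \<Longrightarrow> x \<in> cball 0 R \<Longrightarrow> \<bar>pd b f x\<bar> \<le> B1"
  proof -
    have "\<exists>B>0. \<forall>b\<in>Basis. \<forall>x\<in>cball 0 R. \<bar>pd b f x\<bar> \<le> B"
    proof (rule bounded_family_sup)
      fix b :: 'a assume "b \<in> Basis"
      then show "\<exists>B. \<forall>x\<in>cball 0 R. \<bar>pd b f x\<bar> \<le> B"
        using C_infinity_bounded_on_cball[OF C_infinity_pd[OF f]] by metis
    qed simp
    then show ?thesis using that by blast
  qed
  obtain B2 where B2: "0 < B2" "\<And>b c x. b \<in> Basis \<Longrightarrow> c \<in> Basis \<Longrightarrow> x \<in> cball 0 R \<Longrightarrow> \<bar>pd b (pd c f) x\<bar> \<le> B2"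
  proof -
    have "\<exists>B>0. \<forall>a\<in>Basis \<times> Basis. \<forall>x\<in>cball 0 R. \<bar>(case a of (b, c) \<Rightarrow> pd b (pd c f)) x\<bar> \<le> B"
    proof (rule bounded_family_sup)
      fix a :: "'a \<times> 'a" assume "a \<in> Basis \<times> Basis"
      then obtain b c where a: "a = (b, c)" "b \<in> Basis" "c \<in> Basis" by auto
      obtain B where "\<And>x. x \<in> cball 0 R \<Longrightarrow> \<bar>pd b (pd c f) x\<bar> \<le> B"
        using C_infinity_bounded_on_cball[OF C_infinity_pd[OF C_infinity_pd[OF f a(3)] a(2)]] by blast
      then show "\<exists>B. \<forall>x\<in>cball 0 R. \<bar>(case a of (b, c) \<Rightarrow> pd b (pd c f)) x\<bar> \<le> B"
        by (intro exI[of _ B]) (auto simp: a)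
    qed simp
    then obtain B where "B > 0" "\<forall>a\<in>Basis \<times> Basis. \<forall>x\<in>cball 0 R. \<bar>(case a of (b, c) \<Rightarrow> pd b (pd c f)) x\<bar> \<le> B"
      by blast
    then show ?thesis by (intro that[of B]) auto
  qed
  let ?C = "max B0 (max (real DIM('a) * B1) (2 * ((real DIM('a))\<^sup>2 * B2)))"
  have seg: "x + t *\<^sub>R h \<in> cball 0 R" if "norm x + norm h \<le> R" "\<bar>t\<bar> \<le> 1" for x h :: 'a and t
  proof -
    have "norm (x + t *\<^sub>R h) \<le> norm x + \<bar>t\<bar> * norm h"
      by (metis norm_scaleR norm_triangle_ineq)
    also have "\<dots> \<le> norm x + 1 * norm h"
      using that(2) by (intro add_left_mono mult_right_mono) auto
    finally show ?thesis using that by simp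
  qed
  show ?thesis
  proof (rule that[of ?C])
    show "0 < ?C" using B0 by auto
    show "\<bar>f x\<bar> \<le> ?C" if "norm x \<le> R" for x
      using B0(2)[of x] that by simp
    show "\<bar>f (x + h) - f x\<bar> \<le> ?C * norm h" if "norm x + norm h \<le> R" for x h
    proof -
      have "\<bar>f (x + h) - f x\<bar> \<le> real DIM('a) * (B1 * norm h)"
        using seg[OF that] B1 by (intro C_infinity_first_difference f) auto
      also have "\<dots> = real DIM('a) * B1 * norm h" by simp
      finally show ?thesis by (rule le_mult_right_mono) auto
    qed
    show "\<bar>sd f h x\<bar> \<le> ?C * (norm h)\<^sup>2" if "norm x + norm h \<le> R" for x h
    proof -
      have "\<bar>sd f h x\<bar> \<le> 2 * ((real DIM('a))\<^sup>2 * B2 * (norm h)\<^sup>2)"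
        using seg[OF that] B2 by (intro C_infinity_second_difference f) auto
      also have "\<dots> = 2 * ((real DIM('a))\<^sup>2 * B2) * (norm h)\<^sup>2" by simp
      finally show ?thesis by (rule le_mult_right_mono) auto
    qed
  qed
qed

section \<open>Test functions\<close>

text \<open>The classical flat function exp(-1/t), multiplied by powers of 1/t to obtain a family
  closed under differentiation: the derivative of \<open>flat n\<close> is a combination of
  \<open>flat (n + 2)\<close> and \<open>flat (n + 1)\<close>. Smoothness then follows by
  induction.\<close>

definition flat :: "nat \<Rightarrow> real \<Rightarrow> real" where
  "flat n t = (if 0 < t then exp (- (1 / t)) * (1 / t) ^ n else 0)"

lemma power_le_fact_exp:
  assumes "0 \<le> x" shows "x ^ n \<le> fact n * exp (x::real)"
proof -
  have s: "(\<lambda>n. x ^ n /\<^sub>R fact n) sums exp x" by (rule exp_converges)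
  have "x ^ n /\<^sub>R fact n = (\<Sum>i\<in>{n}. x ^ i /\<^sub>R fact i)" by simp
  also have "\<dots> \<le> (\<Sum>i. x ^ i /\<^sub>R fact i)"
    using s assms by (intro sum_le_suminf) (auto simp: sums_iff)
  also have "\<dots> = exp x" using s by (simp add: sums_iff)
  finally show ?thesis by (simp add: field_simps)
qed

text \<open>The term of order n + 2 of the exponential series at 1/t. The quadratic bound makes the
  difference quotient at 0 tend to 0.\<close>

lemma flat_bound: "0 \<le> flat n t" "flat n t \<le> fact (n + 2) * t\<^sup>2"
proof -
  show "0 \<le> flat n t" by (simp add: flat_def)
  show "flat n t \<le> fact (n + 2) * t\<^sup>2"
  proof (cases "0 < t")
    case True
    have "(1 / t) ^ (n + 2) \<le> fact (n + 2) * exp (1 / t)"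
      using True by (intro power_le_fact_exp) auto
    then have "(1 / t) ^ (n + 2) * (t\<^sup>2 * exp (- (1 / t))) \<le> fact (n + 2) * exp (1 / t) * (t\<^sup>2 * exp (- (1 / t)))"
      by (rule mult_right_mono) auto
    moreover have "(1 / t) ^ (n + 2) * (t\<^sup>2 * exp (- (1 / t))) = flat n t"
      using True by (simp add: flat_def power_add power2_eq_square)
    moreover have "fact (n + 2) * exp (1 / t) * (t\<^sup>2 * exp (- (1 / t))) = fact (n + 2) * t\<^sup>2"
    proof -
      have "exp (1 / t) * exp (- (1 / t)) = 1" by (simp add: mult_exp_exp)
      then have "exp (1 / t) * (t\<^sup>2 * exp (- (1 / t))) = t\<^sup>2"
        by (simp add: mult.left_commute)
      then show ?thesis by (simp only: mult.assoc)
    qed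
    ultimately show ?thesis by (simp only:)
  qed (simp add: flat_def)
qed

lemma flat_DERIV: "(flat n has_real_derivative (flat (n + 2) t - n * flat (n + 1) t)) (at t)"
proof -
  consider "t > 0" | "t < 0" | "t = 0" by linarith
  then show ?thesis
  proof cases
    case 1
    have "((\<lambda>t. exp (- (1 / t)) * (1 / t) ^ n) has_real_derivative (flat (n + 2) t - n * flat (n + 1) t)) (at t)"
    proof -
      have 1: "((\<lambda>t. exp (- (1 / t))) has_real_derivative exp (- (1 / t)) * (1 / t)\<^sup>2) (at t)"
        using 1 by (auto intro!: derivative_eq_intros simp: power2_eq_square)
      have 2: "((\<lambda>t. (1 / t) ^ n) has_real_derivative - (n * (1 / t) ^ (n + 1))) (at t)"
      proof (cases n)
        case (Suc m)
        have "((\<lambda>t. 1 / t) has_real_derivative - ((1 / t)\<^sup>2)) (at t)"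
          using \<open>0 < t\<close> by (auto intro!: derivative_eq_intros simp: power2_eq_square)
        from DERIV_power[OF this, of n] show ?thesis
          unfolding Suc by (simp add: power2_eq_square algebra_simps)
      qed simp
      show ?thesis
        by (rule DERIV_cong[OF DERIV_mult[OF 1 2]])
          (use \<open>0 < t\<close> in \<open>simp add: flat_def power_add power2_eq_square algebra_simps\<close>)
    qed
    then show ?thesis
      by (rule has_field_derivative_transform_within_open[of _ _ _ "{0<..}"]) (use 1 in \<open>auto simp: flat_def\<close>)
  next
    case 2
    have "((\<lambda>t. 0) has_real_derivative 0) (at t)" by simp
    then have "(flat n has_real_derivative 0) (at t)"
      by (rule has_field_derivative_transform_within_open[of _ _ _ "{..<0}"]) (use 2 in \<open>auto simp: flat_def\<close>)
    then show ?thesis using 2 by (simp add: flat_def)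
  next
    case 3
    have "(flat n has_real_derivative 0) (at 0)"
      unfolding DERIV_def
    proof (rule Lim_null_comparison)
      show "\<forall>\<^sub>F h in at 0. norm ((flat n (0 + h) - flat n 0) / h) \<le> fact (n + 2) * \<bar>h\<bar>"
      proof (rule always_eventually, rule allI)
        fix h :: real
        have "\<bar>flat n h\<bar> \<le> fact (n + 2) * \<bar>h\<bar> * \<bar>h\<bar>"
          using flat_bound[of n h] by (simp add: power2_eq_square mult.assoc)
        then show "norm ((flat n (0 + h) - flat n 0) / h) \<le> fact (n + 2) * \<bar>h\<bar>"
          by (cases "h = 0") (simp_all add: flat_def[of n 0] divide_le_eq)
      qed
      show "((\<lambda>h::real. fact (n + 2) * \<bar>h\<bar>) \<longlongrightarrow> 0) (at 0)"
      proof -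
        have "((\<lambda>h::real. fact (n + 2) * \<bar>h\<bar>) \<longlongrightarrow> fact (n + 2) * \<bar>0\<bar>) (at 0)"
          by (intro tendsto_intros)
        then show ?thesis by (simp only: abs_zero mult_zero_right)
      qed
    qed
    then show ?thesis using 3 by (simp add: flat_def)
  qed
qed

lemma C_infinity_flat: "C_infinity (flat n)"
proof -
  have "C_k k (flat n)" for k
  proof (induction k arbitrary: n)
    case 0
    then show ?case
      using flat_DERIV by (auto intro!: continuous_at_imp_continuous_on DERIV_isCont)
  next
    case (Suc k)
    have "C_k k (\<lambda>t. flat (n + 2) t + (- real n) * flat (n + 1) t)"
      by (intro C_k_add C_k_mult C_k_const Suc)
    then show ?case
      by (intro C_k_Suc_realI[OF flat_DERIV]) simp
  qed
  then show ?thesis by (simp add: C_infinity_def)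
qed

lemma C_infinity_ident_real: "C_infinity (\<lambda>t::real. t)"
  using C_infinity_inner[of "1::real"] by simp

lemma C_infinity_realI:
  fixes G :: "real \<Rightarrow> real"
  assumes "\<And>t. (G has_real_derivative G' t) (at t)" "C_infinity G'"
  shows "C_infinity G"
  unfolding C_infinity_def
proof
  fix k
  show "C_k k G"
    using C_k_Suc_imp[OF C_k_Suc_realI[OF assms(1)]] assms(2) unfolding C_infinity_def by blast
qed

lemma ex_antiderivative:
  fixes g :: "real \<Rightarrow> real"
  assumes "continuous_on UNIV g"
  obtains G where "\<And>t. (G has_real_derivative g t) (at t)"
proof -
  have "\<exists>F. \<forall>x::real. - \<infinity> < ereal x \<longrightarrow> ereal x < \<infinity> \<longrightarrow> (F has_vector_derivative g x) (at x)"
    by (rule einterval_antiderivative)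
       (use assms in \<open>auto simp: continuous_on_eq_continuous_at\<close>)
  then show ?thesis
    using that by (auto simp: has_real_derivative_iff_has_vector_derivative)
qed

lemma ex_smooth_step:
  "\<exists>\<theta>. C_infinity \<theta> \<and> (\<forall>t. 0 \<le> \<theta> t \<and> \<theta> t \<le> 1) \<and> (\<forall>t\<le>0. \<theta> t = 0) \<and> (\<forall>t\<ge>1. \<theta> t = 1) \<and>
     (\<forall>t>0. 0 < \<theta> (t::real))"
proof -
  \<comment> \<open>Smooth, nonnegative and positive exactly on (0, 1); the step is its
    antiderivative normalised to rise from 0 to 1.\<close>
  let ?b = "\<lambda>t. flat 0 t * flat 0 (1 - t)"
  have smb: "C_infinity ?b"
    by (intro C_infinity_mult C_infinity_flat C_infinity_compose[of "flat 0" "\<lambda>t. 1 - t"]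
        C_infinity_diff C_infinity_const C_infinity_ident_real)
  obtain B where B: "\<And>t. (B has_real_derivative ?b t) (at t)"
    using ex_antiderivative[OF C_infinity_continuous[OF smb]] by blast
  have mono: "B x \<le> B y" if "x \<le> y" for x y
    by (rule DERIV_nonneg_imp_nondecreasing[OF that]) (use B flat_bound in \<open>auto intro!: exI mult_nonneg_nonneg\<close>)
  have const: "B x = B y" if "\<And>t. x \<le> t \<Longrightarrow> t \<le> y \<Longrightarrow> ?b t = 0" "x \<le> y" for x y
  proof (cases "x < y")
    case True
    have "\<exists>z>x. z < y \<and> B y - B x = (y - x) * ?b z"
      by (rule MVT2[OF True]) (rule B)
    then obtain z where "x < z" "z < y" "B y - B x = (y - x) * ?b z" by blast
    then show ?thesis using that(1)[of z] by simp
  qed (use that in auto)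
  \<comment> \<open>The mean value point must fall into (0, 1), where the bump is positive; hence
    the detour over min t (1/2).\<close>
  have strict: "B 0 < B t" if "0 < t" for t
  proof -
    have "B 0 < B (min t (1/2))"
    proof -
      have "\<exists>z>0. z < min t (1/2) \<and> B (min t (1/2)) - B 0 = (min t (1/2) - 0) * ?b z"
        by (rule MVT2) (use that B in auto)
      then obtain z where z: "0 < z" "z < min t (1/2)" "B (min t (1/2)) - B 0 = (min t (1/2) - 0) * ?b z"
        by blast
      have "0 < ?b z" using z(1,2) by (simp add: flat_def)
      then have "0 < B (min t (1/2)) - B 0" unfolding z(3) using that by simp
      then show ?thesis by simp
    qed
    also have "\<dots> \<le> B t" by (rule mono) simp
    finally show ?thesis .
  qed
  define \<theta> where "\<theta> t = (B t - B 0) / (B 1 - B 0)" for t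
  have p: "B 1 - B 0 > 0" using strict[of 1] by simp
  have 0: "\<theta> t = 0" if "t \<le> 0" for t
    using const[of t 0] that unfolding \<theta>_def by (auto simp: flat_def)
  have 1: "\<theta> t = 1" if "t \<ge> 1" for t
    using const[of 1 t] that p unfolding \<theta>_def by (auto simp: flat_def)
  have m: "\<theta> x \<le> \<theta> y" if "x \<le> y" for x y
    using mono[OF that] p unfolding \<theta>_def by (auto intro: divide_right_mono)
  have sm: "C_infinity \<theta>"
  proof (rule C_infinity_realI)
    show "(\<theta> has_real_derivative ((1 / (B 1 - B 0)) * ?b t)) (at t)" for t
      unfolding \<theta>_def
      by (rule DERIV_cong[OF DERIV_cdivide[OF DERIV_diff[OF B[of t] DERIV_const[of "B 0"]], of "B 1 - B 0"]]) simp
    show "C_infinity (\<lambda>t. (1 / (B 1 - B 0)) * ?b t)"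
      by (intro C_infinity_mult[OF _ smb] C_infinity_const)
  qed
  have bd: "0 \<le> \<theta> t" "\<theta> t \<le> 1" for t
    using m[of t 0] m[of 0 t] m[of t 1] m[of 1 t] 0[of t] 0[of 0] 1[of t] 1[of 1]
    by (smt (verit))+
  have pos: "0 < \<theta> t" if "0 < t" for t
    using strict[OF that] p unfolding \<theta>_def by simp
  show ?thesis using sm bd 0 1 pos by blast
qed

definition smooth_step :: "real \<Rightarrow> real" where
  "smooth_step = (SOME \<theta>. C_infinity \<theta> \<and> (\<forall>t. 0 \<le> \<theta> t \<and> \<theta> t \<le> 1) \<and> (\<forall>t\<le>0. \<theta> t = 0) \<and> (\<forall>t\<ge>1. \<theta> t = 1) \<and>
     (\<forall>t>0. 0 < \<theta> (t::real)))"

lemma C_infinity_smooth_step: "C_infinity smooth_step"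
  and smooth_step_nonneg: "0 \<le> smooth_step t"
  and smooth_step_le_1: "smooth_step t \<le> 1"
  and smooth_step_0: "t \<le> 0 \<Longrightarrow> smooth_step t = 0"
  and smooth_step_1: "1 \<le> t \<Longrightarrow> smooth_step t = 1"
  and smooth_step_pos: "0 < t \<Longrightarrow> 0 < smooth_step t"
  using someI_ex[OF ex_smooth_step] unfolding smooth_step_def[symmetric] by auto

text \<open>A smooth stand-in for the positive part of t - 1, obtained by integrating a shifted
  step. Smoothness keeps compositions with test functions smooth, slopes in [0, 1] give monotonicity
  and energy contraction, and positivity above 1 detects the set where the solution exceeds
  1.\<close>

lemma ex_smooth_truncation:
  obtains G where "C_infinity G" "\<And>t. t \<le> 1 \<Longrightarrow> G t = 0" "\<And>t. 1 < t \<Longrightarrow> 0 < G t"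
    "\<And>x y::real. x \<le> y \<Longrightarrow> G x \<le> G y" "\<And>x y. \<bar>G x - G y\<bar> \<le> \<bar>x - y\<bar>"
proof -
  let ?g = "\<lambda>t. smooth_step (t + - 1)"
  have sm: "C_infinity ?g" by (intro C_infinity_shift C_infinity_smooth_step)
  obtain B where B: "\<And>t. (B has_real_derivative ?g t) (at t)"
    using ex_antiderivative[OF C_infinity_continuous[OF sm]] by blast
  have mvt: "\<exists>z>x. z < y \<and> B y - B x = (y - x) * ?g z" if "x < y" for x y
    by (rule MVT2[OF that]) (rule B)
  define G where "G t = B t - B 1" for t
  have mono: "G x \<le> G y" if "x \<le> y" for x y
  proof (cases "x = y")
    case False
    then obtain z where "B y - B x = (y - x) * ?g z" using mvt[of x y] \<open>x \<le> y\<close> by force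
    then have "0 \<le> B y - B x" using \<open>x \<le> y\<close> smooth_step_nonneg by simp
    then show ?thesis by (simp add: G_def)
  qed simp
  show ?thesis
  proof (rule that)
    show "C_infinity G"
    proof (rule C_infinity_realI[OF _ sm])
      show "(G has_real_derivative ?g t) (at t)" for t
        unfolding G_def using DERIV_diff[OF B[of t] DERIV_const[of "B 1"]] by simp
    qed
    show "G t = 0" if "t \<le> 1" for t
    proof (cases "t = 1")
      case False
      then obtain z where "z < 1" "B 1 - B t = (1 - t) * ?g z" using mvt[of t 1] \<open>t \<le> 1\<close> by force
      then show ?thesis using smooth_step_0[of "z + - 1"] by (simp add: G_def)
    qed (simp add: G_def)
    show "0 < G t" if "1 < t" for t
    proof -
      obtain z where "1 < z" "B t - B 1 = (t - 1) * ?g z" using mvt[of 1 t] \<open>1 < t\<close> by force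
      then show ?thesis using smooth_step_pos[of "z + - 1"] that by (simp add: G_def)
    qed
    show "G x \<le> G y" if "x \<le> y" for x y by (rule mono[OF that])
    have lt: "\<bar>G x - G y\<bar> \<le> \<bar>x - y\<bar>" if "x < y" for x y
    proof -
      obtain z where z: "B y - B x = (y - x) * ?g z" using mvt[OF \<open>x < y\<close>] by blast
      have "\<bar>B y - B x\<bar> \<le> (y - x) * 1"
        unfolding z abs_mult using \<open>x < y\<close> smooth_step_nonneg[of "z + - 1"] smooth_step_le_1[of "z + - 1"]
        by (intro mult_mono) auto
      then show ?thesis using that by (simp add: G_def abs_minus_commute)
    qed
    show "\<bar>G x - G y\<bar> \<le> \<bar>x - y\<bar>" for x y
    proof (cases x y rule: linorder_cases)
      case greater
      then show ?thesis using lt[of y x] by (subst (1 2) abs_minus_commute)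
    qed (use lt in auto)
  qed
qed

section \<open>Compactly supported smooth functions\<close>

lemma pd_zero_of_locally_zero:
  assumes "open U" "x \<in> U" "\<And>y. y \<in> U \<Longrightarrow> f y = 0"
  shows "pd b f x = 0"
proof -
  have "((\<lambda>x. 0) has_derivative (\<lambda>h. 0)) (at x)" by simp
  then have "(f has_derivative (\<lambda>h. 0)) (at x)"
    by (rule has_derivative_transform_within_open[OF _ assms(1,2)]) (use assms(3) in auto)
  then show ?thesis by (rule pd_eqI)
qed

lemma C0_infinityI:
  assumes "C_infinity f" "\<And>x. R < norm x \<Longrightarrow> f x = 0"
  shows "f \<in> C0_infinity"
proof -
  have "closure {x. f x \<noteq> 0} \<subseteq> cball 0 R"
    using assms(2) by (intro closure_minimal) (auto simp: not_less[symmetric])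
  then have "compact (closure {x. f x \<noteq> 0})"
    by (metis bounded_cball bounded_subset closed_closure compact_eq_bounded_closed)
  then show ?thesis using assms by (simp add: C0_infinity_def)
qed

lemma C0_infinity_imp_C_infinity: "f \<in> C0_infinity \<Longrightarrow> C_infinity f"
  by (simp add: C0_infinity_def)

lemma C0_infinity_support:
  assumes "f \<in> C0_infinity"
  obtains R where "0 < R" "\<And>x. R < norm x \<Longrightarrow> f x = 0"
proof -
  have "bounded (closure {x. f x \<noteq> 0})"
    using assms by (auto simp: C0_infinity_def compact_imp_bounded)
  then obtain R where "0 < R" "\<And>x. x \<in> closure {x. f x \<noteq> 0} \<Longrightarrow> norm x \<le> R"
    unfolding bounded_pos by blast
  then show ?thesis using that[of R] closure_subset[of "{x. f x \<noteq> 0}"] by force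
qed

lemma C0_infinity_pd:
  assumes "f \<in> C0_infinity" "b \<in> Basis"
  shows "pd b f \<in> C0_infinity"
proof -
  obtain R where R: "0 < R" "\<And>x. R < norm x \<Longrightarrow> f x = 0"
    using C0_infinity_support[OF assms(1)] by blast
  show ?thesis
  proof (rule C0_infinityI)
    show "C_infinity (pd b f)"
      using assms by (intro C_infinity_pd C0_infinity_imp_C_infinity)
    show "pd b f x = 0" if "R < norm x" for x
      by (rule pd_zero_of_locally_zero[of "- cball 0 R"]) (use R that in auto)
  qed
qed

lemma C0_infinity_measurable [measurable_dest]: "f \<in> C0_infinity \<Longrightarrow> f \<in> borel_measurable borel"
  by (intro C_infinity_measurable C0_infinity_imp_C_infinity)

lemma C0_infinity_bounded:
  assumes "f \<in> C0_infinity"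
  obtains B where "0 < B" "\<And>x. \<bar>f x\<bar> \<le> B"
proof -
  obtain R where R: "0 < R" "\<And>x. R < norm x \<Longrightarrow> f x = 0"
    using C0_infinity_support[OF assms(1)] by blast
  obtain B where B: "0 < B" "\<And>x. x \<in> cball 0 R \<Longrightarrow> \<bar>f x\<bar> \<le> B"
    using C_infinity_bounded_on_cball[OF C0_infinity_imp_C_infinity[OF assms]] by blast
  have "\<bar>f x\<bar> \<le> B" for x
    using R(2)[of x] B(1) B(2)[of x] by (cases "R < norm x") auto
  then show ?thesis using that B by blast
qed

lemma C0_infinity_integrable:
  fixes f :: "'a::euclidean_space \<Rightarrow> real"
  assumes "f \<in> C0_infinity"
  shows "L1 f"
proof -
  obtain R where R: "0 < R" "\<And>x. R < norm x \<Longrightarrow> f x = 0"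
    using C0_infinity_support[OF assms(1)] by blast
  obtain B where B: "0 < B" "\<And>x. \<bar>f x\<bar> \<le> B" using C0_infinity_bounded[OF assms] by blast
  have [measurable]: "borel_fun f" using assms by (rule C0_infinity_measurable)
  show ?thesis
  proof (rule integrable_dominated)
    show "L1 (\<lambda>x. B * indicator (cball 0 R) (x::'a))"
      using R(1) by (intro integrable_mult_right integrable_real_indicator) (auto simp: emeasure_cball)
    show "\<bar>f x\<bar> \<le> B * indicator (cball 0 R) x" for x
      using R B by (auto simp: indicator_def not_less[symmetric])
  qed simp
qed

text \<open>Local bounds hold near the support, and far away everything vanishes. The form min 1
  |h|^2 is the one that is integrable against the fractional kernel.\<close>

lemma C0_infinity_bounds:
  fixes f :: "'a::euclidean_space \<Rightarrow> real"
  assumes "f \<in> C0_infinity"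
  obtains C where "0 < C" "\<And>x. \<bar>f x\<bar> \<le> C" "\<And>x h. \<bar>f (x + h) - f x\<bar> \<le> C * norm h"
    "\<And>x h. \<bar>sd f h x\<bar> \<le> C * min 1 ((norm h)\<^sup>2)"
proof -
  obtain R where R: "0 < R" "\<And>x. R < norm x \<Longrightarrow> f x = 0"
    using C0_infinity_support[OF assms(1)] by blast
  obtain B where B: "0 < B" "\<And>x. \<bar>f x\<bar> \<le> B" using C0_infinity_bounded[OF assms] by blast
  obtain C where C: "0 < C"
    "\<And>x h. norm x + norm h \<le> R + 2 \<Longrightarrow> \<bar>f (x + h) - f x\<bar> \<le> C * norm h"
    "\<And>x h. norm x + norm h \<le> R + 2 \<Longrightarrow> \<bar>sd f h x\<bar> \<le> C * (norm h)\<^sup>2"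
    by (rule C_infinity_local_bounds[OF C0_infinity_imp_C_infinity[OF assms], of "R + 2"]) (rule that; assumption)
  \<comment> \<open>If |h| \<le> 1 but |x| + |h| > R + 2, then |x| > R + 1, and x + h is still
    outside the support.\<close>
  have far: "f (x + h) = 0" if "norm h \<le> 1" "\<not> norm x + norm h \<le> R + 2" for x h :: 'a
    using that norm_diff_ineq[of x h] by (intro R(2)) linarith
  show ?thesis
  proof (rule that[of "max C (4 * B)"])
    show "0 < max C (4 * B)" using B by simp
    show "\<bar>f x\<bar> \<le> max C (4 * B)" for x using B(1) B(2)[of x] by linarith
    show "\<bar>f (x + h) - f x\<bar> \<le> max C (4 * B) * norm h" for x h
    proof (cases "norm h \<le> 1")
      case True
      show ?thesis
      proof (cases "norm x + norm h \<le> R + 2")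
        case T: True
        then have "\<bar>f (x + h) - f x\<bar> \<le> C * norm h" by (rule C)
        then show ?thesis by (rule le_mult_right_mono) auto
      next
        case False
        then show ?thesis using far[OF True False] R(2)[of x] True B by simp
      qed
    next
      case False
      have "\<bar>f (x + h) - f x\<bar> \<le> 4 * B * 1" using B(1) B(2)[of x] B(2)[of "x + h"] by linarith
      also have "\<dots> \<le> max C (4 * B) * norm h" using False B C by (intro mult_mono) auto
      finally show ?thesis .
    qed
    show "\<bar>sd f h x\<bar> \<le> max C (4 * B) * min 1 ((norm h)\<^sup>2)" for x h
    proof (cases "norm h \<le> 1")
      case True
      then have m: "min 1 ((norm h)\<^sup>2) = (norm h)\<^sup>2"
        by (simp add: min_absorb2 power_le_one)
      show ?thesis
      proof (cases "norm x + norm h \<le> R + 2")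
        case T: True
        then have "\<bar>sd f h x\<bar> \<le> C * (norm h)\<^sup>2" by (rule C)
        also have "\<dots> \<le> max C (4 * B) * (norm h)\<^sup>2" by (intro mult_right_mono) auto
        finally show ?thesis unfolding m .
      next
        case False
        then show ?thesis using far[OF True False] far[of "- h" x] R(2)[of x] True B
          by (simp add: sd_def)
      qed
    next
      case False
      then have m: "min 1 ((norm h)\<^sup>2) = 1"
        by (simp add: min_absorb1)
      show ?thesis using abs_sd_le[of f B h x] B unfolding m by simp
    qed
  qed
qed

text \<open>Because \<theta> vanishes below e > 0, the singularity of the power at 0 is never seen.
  The derivative is a sum of two functions of the same shape, with \<theta>' and exponent a, and
  with a \<theta> and exponent a - 1, so the induction must keep both \<theta> and the exponent
  arbitrary.\<close>

lemma C_infinity_mult_powr: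
  assumes e: "0 < e" and \<theta>: "C_infinity \<theta>" "\<And>t. t < e \<Longrightarrow> \<theta> t = 0"
  shows "C_infinity (\<lambda>t::real. \<theta> t * t powr a)"
proof -
  have D: "((\<lambda>t. \<theta> t * t powr a) has_real_derivative pd 1 \<theta> t * t powr a + (a * \<theta> t) * t powr (a - 1)) (at t)"
    if sm: "C_infinity \<theta>" and z: "\<And>t. t < e \<Longrightarrow> \<theta> t = 0" for \<theta> t a
  proof (cases "t > 0")
    case True
    have 1: "(\<theta> has_real_derivative pd 1 \<theta> t) (at t)"
      using C_k_Suc_real_DERIV sm unfolding C_infinity_def by blast
    have 2: "((\<lambda>t. t powr a) has_real_derivative a * t powr (a - 1)) (at t)"
      using True by (rule has_real_derivative_powr)
    show ?thesis
      by (rule DERIV_cong[OF DERIV_mult[OF 1 2]]) simp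
  next
    case False
    have "((\<lambda>t. 0) has_real_derivative 0) (at t)" by simp
    then have "((\<lambda>t. \<theta> t * t powr a) has_real_derivative 0) (at t)"
      by (rule has_field_derivative_transform_within_open[of _ _ _ "{..<e}"]) (use z False e in auto)
    moreover have "pd 1 \<theta> t = 0"
      by (rule pd_zero_of_locally_zero[of "{..<e}"]) (use z False e in auto)
    ultimately show ?thesis using z[of t] False e by simp
  qed
  have "C_k k (\<lambda>t. \<theta> t * t powr a)" if "C_infinity \<theta>" "\<And>t. t < e \<Longrightarrow> \<theta> t = 0" for k \<theta> a
    using that
  proof (induction k arbitrary: \<theta> a)
    case 0
    then show ?case
      using D[OF 0] by (auto intro!: continuous_at_imp_continuous_on DERIV_isCont)
  next
    case (Suc k)
    show ?case
    proof (rule C_k_Suc_realI[OF D[OF Suc.prems]])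
      have "C_k k (\<lambda>t. pd 1 \<theta> t * t powr a)"
      proof (rule Suc.IH)
        show "C_infinity (pd 1 \<theta>)" by (rule C_infinity_pd[OF Suc.prems(1)]) simp
        show "pd 1 \<theta> t = 0" if "t < e" for t
          by (rule pd_zero_of_locally_zero[of "{..<e}"]) (use Suc.prems that in auto)
      qed
      moreover have "C_k k (\<lambda>t. (a * \<theta> t) * t powr (a - 1))"
        by (rule Suc.IH) (use Suc.prems in \<open>auto intro!: C_infinity_mult\<close>)
      ultimately show "C_k k (\<lambda>t. pd 1 \<theta> t * t powr a + (a * \<theta> t) * t powr (a - 1))"
        by (rule C_k_add)
    qed
  qed
  then show ?thesis using \<theta> by (simp add: C_infinity_def)
qed

section \<open>Smoothness of convolutions\<close>

definition conv :: "('a::euclidean_space \<Rightarrow> real) \<Rightarrow> ('a \<Rightarrow> real) \<Rightarrow> 'a \<Rightarrow> real" where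
  "conv K f x = (LBINT z. K z * f (x - z))"

lemma conv_integrable:
  assumes K: "L1 K" and f: "borel_fun f" "\<And>x. \<bar>f x\<bar> \<le> B"
  shows "L1 (\<lambda>z. K z * f (x - z))"
proof (rule integrable_dominated)
  have [measurable]: "borel_fun K" using borel_measurable_integrable[OF K] by simp
  note [measurable] = f(1)
  show "L1 (\<lambda>z. B * \<bar>K z\<bar>)" using K by simp
  have "0 \<le> B" using f(2)[of 0] by simp
  then show "\<bar>K z * f (x - z)\<bar> \<le> B * \<bar>K z\<bar>" for z
    using mult_right_mono[OF f(2) abs_ge_zero] by (simp add: abs_mult mult.commute)
  show "(\<lambda>z. K z * f (x - z)) \<in> borel_measurable lborel" by measurable
qed

text \<open>\<open>K\<close> is merely integrable, so the derivative has to fall on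
  \<open>f\<close>. The Taylor remainder of \<open>f\<close> is quadratic uniformly in the base
  point and integrates against |K| to a quadratic remainder.\<close>

lemma conv_has_derivative:
  fixes K :: "'a::euclidean_space \<Rightarrow> real"
  assumes K: "L1 K" and f: "f \<in> C0_infinity"
  shows "(conv K f has_derivative (\<lambda>h. \<Sum>b\<in>Basis. (h \<bullet> b) * conv K (pd b f) x)) (at x)"
proof -
  have [measurable]: "borel_fun K" using borel_measurable_integrable[OF K] by simp
  have fsm: "C_infinity f" by (rule C0_infinity_imp_C_infinity[OF f])
  have int: "L1 (\<lambda>z. K z * g (y - z))" if "g \<in> C0_infinity" for g y
    using conv_integrable[OF K C0_infinity_measurable[OF that]] C0_infinity_bounded[OF that] by metis
  have "\<exists>B>0. \<forall>a\<in>Basis \<times> Basis. \<forall>x\<in>UNIV. \<bar>(case a of (b, c) \<Rightarrow> pd b (pd c f)) x\<bar> \<le> B"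
  proof (rule bounded_family_sup)
    fix a :: "'a \<times> 'a" assume "a \<in> Basis \<times> Basis"
    then obtain b c where a: "a = (b, c)" "b \<in> Basis" "c \<in> Basis" by auto
    obtain B where "\<And>x. \<bar>pd b (pd c f) x\<bar> \<le> B"
      using C0_infinity_bounded[OF C0_infinity_pd[OF C0_infinity_pd[OF f a(3)] a(2)]] by blast
    then show "\<exists>B. \<forall>x\<in>UNIV. \<bar>(case a of (b, c) \<Rightarrow> pd b (pd c f)) x\<bar> \<le> B"
      by (intro exI[of _ B]) (auto simp: a)
  qed simp
  then obtain B where B: "B > 0" "\<And>b c x. b \<in> Basis \<Longrightarrow> c \<in> Basis \<Longrightarrow> \<bar>pd b (pd c f) x\<bar> \<le> B"
    by fastforce
  define C where "C = (real DIM('a))\<^sup>2 * B"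
  have C: "0 \<le> C" "\<bar>f (y + h) - f y - (\<Sum>b\<in>Basis. (h \<bullet> b) * pd b f y)\<bar> \<le> C * (norm h)\<^sup>2" for y h
    using B C_infinity_taylor1[OF fsm B(2), of y h]
    by (auto simp: C_def frechet_derivative_eq_sum_pd[OF fsm])
  define M where "M = (LBINT z. \<bar>K z\<bar>)"
  have rem: "\<bar>conv K f (x + h) - conv K f x - (\<Sum>b\<in>Basis. (h \<bullet> b) * conv K (pd b f) x)\<bar> \<le> M * (C * (norm h)\<^sup>2)" for h
  proof -
    have eq: "K z * f ((x + h) - z) - K z * f (x - z) - (\<Sum>b\<in>Basis. (h \<bullet> b) * (K z * pd b f (x - z))) =
      K z * (f (x - z + h) - f (x - z) - (\<Sum>b\<in>Basis. (h \<bullet> b) * pd b f (x - z)))" for z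
    proof -
      have 1: "(x + h) - z = x - z + h" by simp
      have "(\<Sum>b\<in>Basis. (h \<bullet> b) * (K z * pd b f (x - z))) = K z * (\<Sum>b\<in>Basis. (h \<bullet> b) * pd b f (x - z))"
        by (simp add: sum_distrib_left mult.left_commute)
      then show ?thesis unfolding 1 by (simp add: right_diff_distrib)
    qed
    have i1: "L1 (\<lambda>z. K z * (f (x - z + h) - f (x - z) - (\<Sum>b\<in>Basis. (h \<bullet> b) * pd b f (x - z))))"
    proof -
      have "L1 (\<lambda>z. K z * f ((x + h) - z) - K z * f (x - z) - (\<Sum>b\<in>Basis. (h \<bullet> b) * (K z * pd b f (x - z))))"
        by (intro integrable_minus Bochner_Integration.integrable_sum integrable_mult_right int f C0_infinity_pd)
      then show ?thesis by (simp only: eq)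
    qed
    have "conv K f (x + h) - conv K f x - (\<Sum>b\<in>Basis. (h \<bullet> b) * conv K (pd b f) x) =
      (LBINT z. K z * f ((x + h) - z) - K z * f (x - z) - (\<Sum>b\<in>Basis. (h \<bullet> b) * (K z * pd b f (x - z))))"
    proof -
      have "(LBINT z. (\<Sum>b\<in>Basis. (h \<bullet> b) * (K z * pd b f (x - z)))) = (\<Sum>b\<in>Basis. (h \<bullet> b) * conv K (pd b f) x)"
        unfolding conv_def
        by (subst Bochner_Integration.integral_sum) (auto intro!: integrable_mult_right int f C0_infinity_pd)
      moreover have "L1 (\<lambda>z. \<Sum>b\<in>Basis. (h \<bullet> b) * (K z * pd b f (x - z)))"
        by (intro Bochner_Integration.integrable_sum integrable_mult_right int f C0_infinity_pd)
      ultimately show ?thesis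
        using int[OF f] by (simp add: conv_def)
    qed
    also have "\<dots> = (LBINT z. K z * (f (x - z + h) - f (x - z) - (\<Sum>b\<in>Basis. (h \<bullet> b) * pd b f (x - z))))"
      by (simp only: eq)
    finally have "\<bar>conv K f (x + h) - conv K f x - (\<Sum>b\<in>Basis. (h \<bullet> b) * conv K (pd b f) x)\<bar> =
      \<bar>LBINT z. K z * (f (x - z + h) - f (x - z) - (\<Sum>b\<in>Basis. (h \<bullet> b) * pd b f (x - z)))\<bar>"
      by (rule arg_cong)
    also have "\<dots> \<le> (LBINT z. \<bar>K z\<bar> * (C * (norm h)\<^sup>2))"
    proof (rule integral_abs_bound_integral[OF i1])
      show "L1 (\<lambda>z. \<bar>K z\<bar> * (C * (norm h)\<^sup>2))"
        by (rule integrable_mult_left[OF integrable_abs[OF K]])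
      show "\<bar>K z * (f (x - z + h) - f (x - z) - (\<Sum>b\<in>Basis. (h \<bullet> b) * pd b f (x - z)))\<bar> \<le> \<bar>K z\<bar> * (C * (norm h)\<^sup>2)" for z
        unfolding abs_mult by (rule mult_left_mono[OF C(2) abs_ge_zero])
    qed
    also have "\<dots> = M * (C * (norm h)\<^sup>2)" by (simp add: M_def)
    finally show ?thesis .
  qed
  have "((\<lambda>y. M * C * norm (y - x)) \<longlongrightarrow> M * C * norm (x - x)) (at x)"
    by (intro tendsto_intros)
  then have lim: "((\<lambda>y. M * C * norm (y - x)) \<longlongrightarrow> 0) (at x)" by simp
  show ?thesis
  proof (rule has_derivativeI_sandwich[of 1])
    show "bounded_linear (\<lambda>h. \<Sum>b\<in>Basis. (h \<bullet> b) * conv K (pd b f) x)"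
      by (intro bounded_linear_sum bounded_linear_mult_const bounded_linear_inner_left)
    show "norm (conv K f y - conv K f x - (\<Sum>b\<in>Basis. ((y - x) \<bullet> b) * conv K (pd b f) x)) / norm (y - x) \<le> M * C * norm (y - x)"
      if "y \<noteq> x" for y
    proof -
      have p: "norm (y - x) > 0" using that by simp
      have "norm (conv K f y - conv K f x - (\<Sum>b\<in>Basis. ((y - x) \<bullet> b) * conv K (pd b f) x)) \<le> M * (C * (norm (y - x))\<^sup>2)"
        using rem[of "y - x"] by simp
      then show ?thesis
        using p by (simp add: divide_le_eq power2_eq_square mult.assoc)
    qed
  qed (use lim in auto)
qed

lemma C_infinity_conv:
  fixes K :: "'a::euclidean_space \<Rightarrow> real"
  assumes K: "L1 K" and f: "f \<in> C0_infinity"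
  shows "C_infinity (conv K f)"
proof -
  have "C_k k (conv K f)" if "f \<in> C0_infinity" for k f
    using that
  proof (induction k arbitrary: f)
    case 0
    then show ?case
      by (auto intro!: continuous_at_imp_continuous_on has_derivative_continuous[OF conv_has_derivative[OF K]])
  next
    case (Suc k)
    show ?case
    proof (rule C_k_SucI[OF conv_has_derivative[OF K Suc.prems]])
      fix b :: 'a assume b: "b \<in> Basis"
      have "(\<Sum>c\<in>Basis. (b \<bullet> c) * conv K (pd c f) x) = conv K (pd b f) x" for x
      proof -
        have "(\<Sum>c\<in>Basis. (b \<bullet> c) * conv K (pd c f) x) = (\<Sum>c\<in>Basis. if c = b then conv K (pd c f) x else 0)"
          using b by (intro sum.cong) (auto simp: inner_Basis)
        then show ?thesis using b by simp
      qed
      then show "C_k k (\<lambda>x. \<Sum>c\<in>Basis. (b \<bullet> c) * conv K (pd c f) x)"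
        using Suc.IH[OF C0_infinity_pd[OF Suc.prems b]] by simp
    qed
  qed
  then show ?thesis using f by (simp add: C_infinity_def)
qed

section \<open>Gaussian kernels\<close>

lemma lborel_scale:
  fixes f :: "'a::euclidean_space \<Rightarrow> real"
  assumes c: "c \<noteq> 0" and f: "L1 f"
  shows "L1 (\<lambda>x. f (c *\<^sub>R x))"
    and "(LBINT x. f (c *\<^sub>R x)) = (LBINT x. f x) / \<bar>c\<bar> ^ DIM('a)"
proof -
  have [measurable]: "borel_fun f" using borel_measurable_integrable[OF f] by simp
  have "integrable (density (distr lborel borel (\<lambda>x. 0 + c *\<^sub>R x)) (\<lambda>_. ennreal (\<bar>c\<bar> ^ DIM('a)))) f"
    using f lborel_affine[OF c, of "0::'a"] by simp
  then show i: "L1 (\<lambda>x. f (c *\<^sub>R x))"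
    using c by (simp add: integrable_density integrable_distr_eq)
  have "(LBINT x. f x) = (LINT x|density (distr lborel borel (\<lambda>x. 0 + c *\<^sub>R x)) (\<lambda>_. ennreal (\<bar>c\<bar> ^ DIM('a))). f x)"
    using lborel_affine[OF c, of "0::'a"] by simp
  also have "\<dots> = \<bar>c\<bar> ^ DIM('a) * (LBINT x. f (c *\<^sub>R x))"
    by (simp add: integral_density integral_distr)
  finally show "(LBINT x. f (c *\<^sub>R x)) = (LBINT x. f x) / \<bar>c\<bar> ^ DIM('a)"
    using c by simp
qed

lemma lborel_real_scale_pos:
  fixes f :: "real \<Rightarrow> real"
  assumes c: "c > 0" and f: "L1 f"
  shows "L1 (\<lambda>x. f (c * x))"
    and "(LBINT x. f (c * x)) = (LBINT x. f x) / c"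
  using lborel_scale[of c f] assms by auto

text \<open>This is Gamma(b), written in the variable 1/t.\<close>

definition exp_kernel_integral :: "real \<Rightarrow> real" where
  "exp_kernel_integral b = (LBINT t. indicator {0<..} t * (t powr (- 1 - b) * exp (- (1 / t))))"

lemma exp_kernel_integrable:
  assumes b: "0 < b"
  shows "L1 (\<lambda>t::real. indicator {0<..} t * (t powr (- 1 - b) * exp (- (1 / t))))"
proof (rule integrable_dominated_nonneg)
  \<comment> \<open>Near 0 the exponential beats every power: (1/t)^(1+b) \<le> (1/t)^n \<le> n!
    exp(1/t).\<close>
  define n where "n = nat \<lceil>1 + b\<rceil>"
  have n: "1 + b \<le> real n" unfolding n_def by linarith
  show "L1 (\<lambda>t::real. fact n * indicator (ball 0 1) t + norm t powr (- (1 + b)) * indicator (- ball 0 1) t)"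
    using b by (intro integrable_plus integrable_mult_right integrable_real_indicator
        integrable_norm_powr_outside) (auto simp: emeasure_ball)
  show "indicator {0<..} t * (t powr (- 1 - b) * exp (- (1 / t))) \<le>
      fact n * indicator (ball 0 1) t + norm t powr (- (1 + b)) * indicator (- ball 0 1) t" for t :: real
  proof (cases "0 < t")
    case True
    show ?thesis
    proof (cases "t < 1")
      case t1: True
      have "t powr (- 1 - b) = (1 / t) powr (1 + b)"
      proof -
        have e: "- 1 - b = - (1 + b)" by simp
        show ?thesis unfolding e by (simp only: powr_minus_divide powr_divide powr_one_eq_one)
      qed
      also have "\<dots> \<le> (1 / t) powr (real n)"
        using True t1 n by (intro powr_mono) auto
      also have "\<dots> = (1 / t) ^ n" using True by (simp add: powr_realpow)
      also have "\<dots> \<le> fact n * exp (1 / t)"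
        using True by (intro power_le_fact_exp) auto
      finally have le: "t powr (- 1 - b) \<le> fact n * exp (1 / t)" .
      have "t powr (- 1 - b) * exp (- (1 / t)) \<le> fact n * exp (1 / t) * exp (- (1 / t))"
        by (rule mult_right_mono[OF le]) simp
      also have "\<dots> = fact n" by (simp add: mult.assoc mult_exp_exp)
      finally show ?thesis using True t1 by (simp add: indicator_def)
    next
      case False
      have "t powr (- 1 - b) * exp (- (1 / t)) \<le> t powr (- 1 - b) * 1"
        using True by (intro mult_left_mono) auto
      then show ?thesis using True False by (simp add: indicator_def)
    qed
  qed simp
qed (simp, measurable)

lemma exp_kernel_integral_pos:
  assumes b: "0 < b"
  shows "0 < exp_kernel_integral b"
proof -
  have "0 < (LBINT t. (2 powr (- 1 - b) * exp (- 1)) * indicator {1..2} (t::real))"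
    by simp
  also have "\<dots> \<le> exp_kernel_integral b"
    unfolding exp_kernel_integral_def
  proof (rule integral_mono[OF _ exp_kernel_integrable[OF b]])
    show "L1 (\<lambda>t. (2 powr (- 1 - b) * exp (- 1)) * indicator {1..2} (t::real))" by simp
    show "(2 powr (- 1 - b) * exp (- 1)) * indicator {1..2} t \<le> indicator {0<..} t * (t powr (- 1 - b) * exp (- (1 / t)))" for t :: real
    proof (cases "t \<in> {1..2}")
      case True
      have "2 powr (- 1 - b) * exp (- 1) \<le> t powr (- 1 - b) * exp (- (1 / t))"
        using True b by (intro mult_mono powr_mono2') auto
      then show ?thesis using True by simp
    qed simp
  qed
  finally show ?thesis .
qed

lemma exp_kernel_scaled:
  assumes b: "0 < b" and r: "0 < r"
  shows "L1 (\<lambda>t::real. indicator {0<..} t * (t powr (- 1 - b) * exp (- (r / t))))"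
    and "(LBINT t. indicator {0<..} t * (t powr (- 1 - b) * exp (- (r / t)))) = r powr (- b) * exp_kernel_integral b"
proof -
  let ?f = "\<lambda>t::real. indicator {0<..} t * (t powr (- 1 - b) * exp (- (1 / t)))"
  have eq: "indicator {0<..} t * (t powr (- 1 - b) * exp (- (r / t))) = r powr (- 1 - b) * ?f ((1 / r) * t)" for t :: real
  proof (cases "0 < t")
    case True
    then have "((1 / r) * t) powr (- 1 - b) = t powr (- 1 - b) / r powr (- 1 - b)"
      using r by (simp add: powr_divide)
    then show ?thesis using True r by (simp add: indicator_def)
  next
    case False
    then show ?thesis using r by (simp add: indicator_def zero_less_divide_iff)
  qed
  show "L1 (\<lambda>t::real. indicator {0<..} t * (t powr (- 1 - b) * exp (- (r / t))))"
    unfolding eq using r by (intro integrable_mult_right lborel_real_scale_pos exp_kernel_integrable b) auto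
  have "(LBINT t. indicator {0<..} t * (t powr (- 1 - b) * exp (- (r / t)))) =
      r powr (- 1 - b) * (LBINT t. ?f ((1 / r) * t))"
    unfolding eq by simp
  also have "\<dots> = r powr (- 1 - b) * (exp_kernel_integral b / (1 / r))"
    unfolding exp_kernel_integral_def
    using r by (subst lborel_real_scale_pos(2)[OF _ exp_kernel_integrable[OF b]]) auto
  also have "\<dots> = r powr (- b) * exp_kernel_integral b"
  proof -
    have e: "- b = (- 1 - b) + 1" by simp
    have "r powr (- b) = r powr (- 1 - b) * r" by (subst e, subst powr_add) (use r in simp)
    then show ?thesis by simp
  qed
  finally show "(LBINT t. indicator {0<..} t * (t powr (- 1 - b) * exp (- (r / t)))) = r powr (- b) * exp_kernel_integral b" .
qed

text \<open>The heat kernel at time t/4 multiplied by pi^(N/2). Its mass is therefore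
  \<open>gauss_mass\<close> instead of 1 at every time, and the semigroup law carries that
  factor.\<close>

definition heat :: "real \<Rightarrow> 'a::euclidean_space \<Rightarrow> real" where
  "heat t x = t powr (- (real DIM('a) / 2)) * exp (- ((norm x)\<^sup>2 / t))"

lemma heat_nonneg [simp]: "0 \<le> heat t x"
  by (simp add: heat_def)

lemma heat_uminus [simp]: "heat t (- x) = heat t x"
  by (simp add: heat_def)

lemma heat_le: "0 < t \<Longrightarrow> heat t (x::'a::euclidean_space) \<le> t powr (- (real DIM('a) / 2))"
  by (simp add: heat_def mult_left_le)

lemma borel_measurable_heat [measurable]:
  assumes [measurable]: "f \<in> M \<rightarrow>\<^sub>M borel" "g \<in> M \<rightarrow>\<^sub>M borel"
  shows "(\<lambda>z. heat (f z) (g z)) \<in> borel_measurable M"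
  unfolding heat_def by measurable

text \<open>One formula for both kernels: c = -s produces |x|^(-N-2s) and c = s produces |x|^(2s-N).
  The condition on c ensures convergence at t = infinity; at 0 the Gaussian decides because x is not
  0.\<close>

lemma heat_time_integral:
  fixes x :: "'a::euclidean_space"
  assumes x: "x \<noteq> 0" and c: "0 < real DIM('a) / 2 - c"
  shows "L1 (\<lambda>t. indicator {0<..} t * (t powr (c - 1) * heat t x))"
    and "(LBINT t. indicator {0<..} t * (t powr (c - 1) * heat t x)) =
      exp_kernel_integral (real DIM('a) / 2 - c) * norm x powr (2 * c - real DIM('a))"
proof -
  have eq: "indicator {0<..} t * (t powr (c - 1) * heat t x) =
    indicator {0<..} t * (t powr (- 1 - (real DIM('a) / 2 - c)) * exp (- ((norm x)\<^sup>2 / t)))" for t :: real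
    unfolding heat_def mult.assoc[symmetric] powr_add[symmetric]
    by (simp add: mult.assoc powr_add[symmetric] algebra_simps)
  have p: "0 < (norm x)\<^sup>2" using x by simp
  show "L1 (\<lambda>t. indicator {0<..} t * (t powr (c - 1) * heat t x))"
    unfolding eq by (rule exp_kernel_scaled(1)[OF c p])
  have "((norm x)\<^sup>2) powr (- (real DIM('a) / 2 - c)) = norm x powr (2 * c - real DIM('a))"
  proof -
    have "((norm x)\<^sup>2) powr (- (real DIM('a) / 2 - c)) = (norm x powr 2) powr (- (real DIM('a) / 2 - c))"
      using x by simp
    also have "\<dots> = norm x powr (2 * c - real DIM('a))"
      unfolding powr_powr by (simp add: algebra_simps)
    finally show ?thesis .
  qed
  then show "(LBINT t. indicator {0<..} t * (t powr (c - 1) * heat t x)) =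
      exp_kernel_integral (real DIM('a) / 2 - c) * norm x powr (2 * c - real DIM('a))"
    unfolding eq exp_kernel_scaled(2)[OF c p] by simp
qed

definition gauss_mass :: "'a::euclidean_space itself \<Rightarrow> real" where
  "gauss_mass _ = (LBINT x. exp (- ((norm (x::'a))\<^sup>2)))"

lemma integrable_gauss: "L1 (\<lambda>x::'a::euclidean_space. exp (- ((norm x)\<^sup>2)))"
proof (rule integrable_dominated_nonneg)
  let ?n = "DIM('a) + 1"
  show "L1 (\<lambda>x::'a. 1 * indicator (ball 0 1) x + fact ?n * (norm x powr (- (real ?n)) * indicator (- ball 0 1) x))"
    by (intro integrable_plus integrable_mult_right integrable_real_indicator
        integrable_norm_powr_outside) (auto simp: emeasure_ball)
  show "exp (- ((norm x)\<^sup>2)) \<le> 1 * indicator (ball 0 1) x + fact ?n * (norm x powr (- (real ?n)) * indicator (- ball 0 1) x)" for x :: 'a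
  proof (cases "norm x < 1")
    case True
    then show ?thesis by simp
  next
    case False
    then have "norm x \<le> (norm x)\<^sup>2" by (simp add: power2_eq_square mult_le_cancel_left1)
    then have "exp (- ((norm x)\<^sup>2)) \<le> exp (- norm x)" by simp
    also have "\<dots> \<le> fact ?n * norm x powr (- (real ?n))"
    proof -
      have "norm x ^ ?n \<le> fact ?n * exp (norm x)" by (rule power_le_fact_exp) simp
      moreover have "norm x powr (- (real ?n)) = inverse (norm x ^ ?n)"
      proof -
        have "0 < norm x" using False by linarith
        then have "norm x powr real ?n = norm x ^ ?n" by (rule powr_realpow)
        then show ?thesis by (simp only: powr_minus)
      qed
      moreover have "0 < norm x ^ ?n" using False by (intro zero_less_power) linarith
      ultimately show ?thesis
        by (simp add: exp_minus field_simps del: power_Suc fact_Suc)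
    qed
    finally show ?thesis using False by simp
  qed
qed (simp, measurable)

lemma gauss_mass_pos: "0 < gauss_mass TYPE('a::euclidean_space)"
proof -
  have "(LBINT x. exp (- 1) * indicat_real (ball 0 1) (x::'a)) = exp (- 1) * measure lborel (ball (0::'a) 1)"
    by (subst integral_mult_right_zero) simp
  moreover have "0 < measure lborel (ball (0::'a) 1)" by (simp add: content_ball)
  ultimately have "0 < (LBINT x. exp (- 1) * indicat_real (ball 0 1) (x::'a))"
    by (simp only: zero_less_mult_iff exp_gt_zero simp_thms)
  also have "\<dots> \<le> gauss_mass TYPE('a)"
    unfolding gauss_mass_def
  proof (rule integral_mono[OF _ integrable_gauss])
    show "L1 (\<lambda>x. exp (- 1) * indicat_real (ball 0 1) (x::'a))"
      by (intro integrable_mult_right integrable_real_indicator) (auto simp: emeasure_ball)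
    show "exp (- 1) * indicat_real (ball 0 1) x \<le> exp (- ((norm x)\<^sup>2))" for x :: 'a
      by (auto simp: indicator_def power_le_one)
  qed
  finally show ?thesis .
qed

lemma heat_eq_gauss:
  fixes x :: "'a::euclidean_space"
  assumes "0 < t"
  shows "heat t x = t powr (- (real DIM('a) / 2)) * exp (- ((norm ((1 / sqrt t) *\<^sub>R x))\<^sup>2))"
  using assms by (simp add: heat_def power_divide power_mult_distrib)

lemma sqrt_power_dim: "0 < t \<Longrightarrow> sqrt t ^ n = t powr (real n / 2)"
  by (simp add: powr_half_sqrt[symmetric] powr_powr[symmetric] powr_realpow[symmetric] powr_powr)

lemma heat_mass:
  assumes t: "0 < t"
  shows "L1 (heat t :: 'a::euclidean_space \<Rightarrow> real)"
    and "(LBINT x. heat t (x::'a)) = gauss_mass TYPE('a)"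
proof -
  have c: "1 / sqrt t \<noteq> 0" using t by simp
  show "L1 (heat t :: 'a \<Rightarrow> real)"
    unfolding heat_eq_gauss[OF t, abs_def]
    by (intro integrable_mult_right lborel_scale(1)[OF c integrable_gauss])
  have "(LBINT x. heat t (x::'a)) = t powr (- (real DIM('a) / 2)) * (gauss_mass TYPE('a) / \<bar>1 / sqrt t\<bar> ^ DIM('a))"
    unfolding heat_eq_gauss[OF t, abs_def] gauss_mass_def
    by (simp only: integral_mult_right_zero lborel_scale(2)[OF c integrable_gauss])
  also have "\<dots> = gauss_mass TYPE('a)"
    using t by (simp add: power_divide sqrt_power_dim powr_minus)
  finally show "(LBINT x. heat t (x::'a)) = gauss_mass TYPE('a)" .
qed

lemma heat_semigroup:
  fixes x :: "'a::euclidean_space"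
  assumes t: "0 < t" and r: "0 < r"
  shows "L1 (\<lambda>y. heat r y * heat t (x - y))"
    and "(LBINT y. heat r y * heat t (x - y)) = gauss_mass TYPE('a) * heat (t + r) x"
proof -
  \<comment> \<open>Completing the square in y: |y|^2/r + |x-y|^2/t is minimal at \<open>y0\<close>,
    its quadratic coefficient is 1/r + 1/t = c^2, and the minimum is |x|^2/(t + r).\<close>
  define c where "c = sqrt ((t + r) / (t * r))"
  define y0 where "y0 = (r / (t + r)) *\<^sub>R x"
  have c: "c > 0" using t r by (simp add: c_def)
  have c2: "c\<^sup>2 = (t + r) / (t * r)" using t r by (simp add: c_def)
  let ?g = "\<lambda>y::'a. exp (- ((norm y)\<^sup>2))"
  let ?K = "r powr (- (real DIM('a) / 2)) * t powr (- (real DIM('a) / 2)) * exp (- ((norm x)\<^sup>2 / (t + r)))"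
  have quad: "(norm y)\<^sup>2 / r + (norm (x - y))\<^sup>2 / t = (norm x)\<^sup>2 / (t + r) + (norm (c *\<^sub>R (y - y0)))\<^sup>2" for y
  proof -
    have k: "(norm (y - k *\<^sub>R x))\<^sup>2 = (y \<bullet> y) - 2 * k * (x \<bullet> y) + k\<^sup>2 * (x \<bullet> x)" for k
      unfolding power2_norm_eq_inner
      by (simp add: inner_diff_left inner_diff_right inner_commute power2_eq_square algebra_simps)
    have "(norm (c *\<^sub>R (y - y0)))\<^sup>2 = c\<^sup>2 * ((y \<bullet> y) - 2 * (r / (t + r)) * (x \<bullet> y) + (r / (t + r))\<^sup>2 * (x \<bullet> x))"
      unfolding norm_scaleR power_mult_distrib power2_abs y0_def k ..
    moreover have "(norm (x - y))\<^sup>2 = x \<bullet> x - 2 * (x \<bullet> y) + y \<bullet> y"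
      by (simp add: power2_norm_eq_inner inner_diff_left inner_diff_right inner_commute algebra_simps)
    moreover have "(y \<bullet> y) / r + (x \<bullet> x - 2 * (x \<bullet> y) + y \<bullet> y) / t =
      (x \<bullet> x) / (t + r) + (t + r) / (t * r) * ((y \<bullet> y) - 2 * (r / (t + r)) * (x \<bullet> y) + (r / (t + r))\<^sup>2 * (x \<bullet> x))"
    proof -
      have tr: "t + r \<noteq> 0" using t r by simp
      have 1: "(t + r) / (t * r) * (r / (t + r)) = 1 / t" using t r tr by simp
      have 2: "(t + r) / (t * r) * (r / (t + r))\<^sup>2 = r / (t * (t + r))"
        using t r tr by (simp add: power2_eq_square)
      have 3: "1 / t = 1 / (t + r) + r / (t * (t + r))" using t r tr by (simp add: divide_simps)
      have gen: "m * (A - 2 * k * B + k\<^sup>2 * C) = m * A - 2 * (m * k) * B + (m * k\<^sup>2) * C" for m k A B C :: real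
        by (simp add: algebra_simps)
      have 4: "(t + r) / (t * r) = 1 / r + 1 / t" using t r by (simp add: divide_simps)
      have "(x \<bullet> x) / (t + r) + (t + r) / (t * r) * ((y \<bullet> y) - 2 * (r / (t + r)) * (x \<bullet> y) + (r / (t + r))\<^sup>2 * (x \<bullet> x))
        = (x \<bullet> x) / (t + r) + ((t + r) / (t * r)) * (y \<bullet> y) - 2 * ((t + r) / (t * r) * (r / (t + r))) * (x \<bullet> y)
          + ((t + r) / (t * r) * (r / (t + r))\<^sup>2) * (x \<bullet> x)"
        unfolding gen by simp
      also have "\<dots> = (x \<bullet> x) * (1 / (t + r) + r / (t * (t + r))) + (1 / r + 1 / t) * (y \<bullet> y) - 2 * (1 / t) * (x \<bullet> y)"
        unfolding 1 2 unfolding 4 by (simp add: algebra_simps)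
      also have "\<dots> = (y \<bullet> y) / r + (x \<bullet> x - 2 * (x \<bullet> y) + y \<bullet> y) / t"
        unfolding 3[symmetric] by (simp add: add_divide_distrib diff_divide_distrib algebra_simps)
      finally show ?thesis by simp
    qed
    ultimately show ?thesis by (simp add: power2_norm_eq_inner[of y] power2_norm_eq_inner[of x] c2)
  qed
  have eq: "heat r y * heat t (x - y) = ?K * ?g (c *\<^sub>R (y + - y0))" for y
  proof -
    have "exp (- ((norm y)\<^sup>2 / r)) * exp (- ((norm (x - y))\<^sup>2 / t)) = exp (- ((norm x)\<^sup>2 / (t + r))) * ?g (c *\<^sub>R (y - y0))"
      unfolding mult_exp_exp using quad[of y] by (intro arg_cong[where f=exp]) linarith
    then show ?thesis by (simp add: heat_def mult_ac)
  qed
  have c0: "c \<noteq> 0" using c by simp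
  have i: "L1 (\<lambda>y::'a. ?g (c *\<^sub>R y))"
    by (rule lborel_scale(1)[OF c0 integrable_gauss])
  show "L1 (\<lambda>y. heat r y * heat t (x - y))"
    unfolding eq by (intro integrable_mult_right integrable_lborel_shift[OF i])
  have "(LBINT y. heat r y * heat t (x - y)) = ?K * (LBINT y. ?g (c *\<^sub>R (y + - y0)))"
    unfolding eq by simp
  also have "(LBINT y. ?g (c *\<^sub>R (y + - y0))) = (LBINT y. ?g (c *\<^sub>R y))"
    by (rule integral_lborel_shift) measurable
  also have "\<dots> = gauss_mass TYPE('a) / c ^ DIM('a)"
    using c lborel_scale(2)[OF c0 integrable_gauss] by (simp add: gauss_mass_def)
  also have "?K * (gauss_mass TYPE('a) / c ^ DIM('a)) = gauss_mass TYPE('a) * heat (t + r) x"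
  proof -
    have "c ^ DIM('a) = ((t + r) / (t * r)) powr (real DIM('a) / 2)"
      using t r by (simp add: c_def sqrt_power_dim del: real_sqrt_divide real_sqrt_mult)
    also have "\<dots> = (t + r) powr (real DIM('a) / 2) / (t powr (real DIM('a) / 2) * r powr (real DIM('a) / 2))"
      using t r by (simp add: powr_divide powr_mult)
    finally show ?thesis using t r by (simp add: heat_def powr_minus field_simps)
  qed
  finally show "(LBINT y. heat r y * heat t (x - y)) = gauss_mass TYPE('a) * heat (t + r) x" .
qed

abbreviation ipos :: "real \<Rightarrow> real" where "ipos \<equiv> indicat_real {0<..}"

lemma integrable_pair_times:
  fixes f :: "'a::euclidean_space \<Rightarrow> real" and g :: "'b::euclidean_space \<Rightarrow> real"
  assumes f: "L1 f" and g: "L1 g"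
  shows "integrable lborel2 (\<lambda>(x, y). f x * g y)"
proof (rule integrable_pairI)
  have [measurable]: "borel_fun f" "borel_fun g"
    using borel_measurable_integrable[OF f] borel_measurable_integrable[OF g] by simp_all
  show "(\<lambda>(x, y). f x * g y) \<in> borel_measurable (borel \<Otimes>\<^sub>M borel)" by measurable
  have "(\<integral>\<^sup>+x. (\<integral>\<^sup>+y. ennreal \<bar>f x * g y\<bar> \<partial>lborel) \<partial>lborel) =
    (\<integral>\<^sup>+x. ennreal \<bar>f x\<bar> \<partial>lborel) * (\<integral>\<^sup>+y. ennreal \<bar>g y\<bar> \<partial>lborel)"
    by (simp add: abs_mult ennreal_mult nn_integral_cmult nn_integral_multc)
  also have "\<dots> < \<infinity>"
    using f g by (auto simp: integrable_iff_bounded ennreal_mult_less_top)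
  finally show "(\<integral>\<^sup>+x. (\<integral>\<^sup>+y. ennreal \<bar>f x * g y\<bar> \<partial>lborel) \<partial>lborel) < \<infinity>" .
qed

text \<open>The L1 companion of \<open>C0_infinity_bounds\<close>: for |h| \<le> 1 the second
  difference is O(|h|^2) and lives in a fixed ball, for larger h translation invariance of the
  integral suffices.\<close>

lemma C0_infinity_sd_L1:
  fixes f :: "'a::euclidean_space \<Rightarrow> real"
  assumes f: "f \<in> C0_infinity"
  obtains C where "0 < C" "\<And>h. L1 (sd f h)"
    "\<And>h. (LBINT x. \<bar>sd f h x\<bar>) \<le> C * min 1 ((norm h)\<^sup>2)"
proof -
  have int: "L1 f" by (rule C0_infinity_integrable[OF f])
  have i1: "L1 (\<lambda>x. f (x + h))" for h by (rule integrable_lborel_shift[OF int])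
  have i2: "L1 (\<lambda>x. f (x - h))" for h using i1[of "- h"] by simp
  have isd: "L1 (sd f h)" for h
    unfolding sd_def[abs_def] using i1 i2 int by simp
  obtain R where R: "0 < R" "\<And>x. R < norm x \<Longrightarrow> f x = 0"
    using C0_infinity_support[OF f] by blast
  obtain C where C: "0 < C" "\<And>x h. \<bar>sd f h x\<bar> \<le> C * min 1 ((norm h)\<^sup>2)"
    by (rule C0_infinity_bounds[OF f]) (rule that; assumption)
  define V where "V = measure lborel (cball (0::'a) (R + 1))"
  define J where "J = (LBINT x. \<bar>f x\<bar>)"
  have J: "(LBINT x. \<bar>f (x + h)\<bar>) = J" for h
    unfolding J_def using f by (intro integral_lborel_shift[of "\<lambda>x. \<bar>f x\<bar>"]) (auto dest: C0_infinity_measurable)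
  have V0: "0 \<le> V" "0 \<le> J" by (auto simp: V_def J_def)
  show ?thesis
  proof (rule that[of "C * V + 4 * J + 1"])
    show "0 < C * V + 4 * J + 1" using C V0 by (smt (verit) mult_nonneg_nonneg)
    show "L1 (sd f h)" for h by (rule isd)
    show "(LBINT x. \<bar>sd f h x\<bar>) \<le> (C * V + 4 * J + 1) * min 1 ((norm h)\<^sup>2)" for h :: 'a
    proof (cases "norm h \<le> 1")
      case True
      have m: "min 1 ((norm h)\<^sup>2) = (norm h)\<^sup>2"
        using True by (simp add: min_absorb2 power_le_one)
      have "(LBINT x. \<bar>sd f h x\<bar>) \<le> (LBINT x. (C * (norm h)\<^sup>2) * indicat_real (cball 0 (R + 1)) (x::'a))"
      proof (rule integral_mono)
        show "L1 (\<lambda>x. \<bar>sd f h x\<bar>)" using isd by simp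
        show "L1 (\<lambda>x. (C * (norm h)\<^sup>2) * indicat_real (cball 0 (R + 1)) (x::'a))"
          using R by (intro integrable_mult_right integrable_real_indicator) (auto simp: emeasure_cball)
        show "\<bar>sd f h x\<bar> \<le> (C * (norm h)\<^sup>2) * indicat_real (cball 0 (R + 1)) x" for x
        proof (cases "norm x \<le> R + 1")
          case False
          have "R < norm (x + h)" "R < norm (x - h)" "R < norm x"
            using False True norm_diff_ineq[of x h] norm_triangle_ineq2[of x h] by linarith+
          then show ?thesis using R C(1) by (simp add: sd_def)
        qed (use C(2)[of h x] m in auto)
      qed
      also have "\<dots> = C * (norm h)\<^sup>2 * V"
        unfolding V_def by (subst integral_mult_right_zero) simp
      also have "\<dots> \<le> (C * V + 4 * J + 1) * (norm h)\<^sup>2"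
        using V0 by (simp add: algebra_simps)
      finally show ?thesis unfolding m .
    next
      case False
      have m: "min 1 ((norm h)\<^sup>2) = 1"
        using False by (simp add: min_absorb1)
      have "(LBINT x. \<bar>sd f h x\<bar>) \<le> (LBINT x. \<bar>f (x + h)\<bar> + \<bar>f (x + - h)\<bar> + 2 * \<bar>f x\<bar>)"
      proof (rule integral_mono)
        show "L1 (\<lambda>x. \<bar>sd f h x\<bar>)" using isd by simp
        show "L1 (\<lambda>x. \<bar>f (x + h)\<bar> + \<bar>f (x + - h)\<bar> + 2 * \<bar>f x\<bar>)"
          using i1[of h] i1[of "- h"] int by (intro integrable_plus integrable_mult_right integrable_abs)
      qed (simp add: sd_def)
      also have "\<dots> = 4 * J"
      proof -
        have "(LBINT x. \<bar>f (x + h)\<bar> + \<bar>f (x + - h)\<bar> + 2 * \<bar>f x\<bar>) = J + J + 2 * J"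
          using integrable_abs[OF i1[of h]] integrable_abs[OF i1[of "- h"]] integrable_abs[OF int] J[of h] J[of "- h"]
          by (simp add: J_def)
        then show ?thesis by simp
      qed
      also have "\<dots> \<le> C * V + 4 * J + 1" using C V0 by (simp add: mult_nonneg_nonneg)
      finally show ?thesis unfolding m by simp
    qed
  qed
qed

lemma conv_sd:
  fixes K :: "'a::euclidean_space \<Rightarrow> real"
  assumes int: "\<And>y. L1 (\<lambda>z. K z * f (y - z))"
  shows "sd (conv K f) h x = conv K (sd f h) x"
proof -
  have e: "(x + h) - z = x - z + h" "(x - h) - z = x - z - h" for z by simp_all
  have eq: "K z * (f (x - z + h) + f (x - z - h) - 2 * f (x - z)) =
      K z * f ((x + h) - z) + K z * f ((x - h) - z) - 2 * (K z * f (x - z))" for z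
    unfolding e by (simp add: algebra_simps)
  show ?thesis
    unfolding sd_def conv_def eq
    using int[of "x + h"] int[of "x - h"] int[of x] by simp
qed

lemma conv_abs_le:
  assumes K: "L1 K" and f: "borel_fun f" "\<And>x. \<bar>f x\<bar> \<le> B"
  shows "\<bar>conv K f x\<bar> \<le> B * (LBINT z. \<bar>K z\<bar>)"
proof -
  have "\<bar>conv K f x\<bar> \<le> (LBINT z. B * \<bar>K z\<bar>)"
    unfolding conv_def
  proof (rule integral_abs_bound_integral[OF conv_integrable[OF K f]])
    show "L1 (\<lambda>z. B * \<bar>K z\<bar>)" using K by simp
    show "\<bar>K z * f (x - z)\<bar> \<le> B * \<bar>K z\<bar>" for z
      using mult_right_mono[OF f(2) abs_ge_zero[of "K z"]] by (simp add: abs_mult mult.commute)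
  qed
  then show ?thesis by simp
qed

text \<open>Two complementary bounds: sup norm of f times the mass, good for small t, and L1 norm of
  f times the height t^(-N/2) of the Gaussian, good for large t.\<close>

lemma heat_conv_abs_le:
  fixes f :: "'a::euclidean_space \<Rightarrow> real"
  assumes t: "0 < t" and f: "L1 f" "\<And>x. \<bar>f x\<bar> \<le> B"
  shows "\<bar>conv (heat t) f x\<bar> \<le> (B * gauss_mass TYPE('a) + (LBINT x. \<bar>f x\<bar>)) * min 1 (t powr (- (real DIM('a) / 2)))"
proof -
  have m: "borel_fun f" using borel_measurable_integrable[OF f(1)] by simp
  have B0: "0 \<le> B" using f(2)[of 0] by simp
  have g0: "0 \<le> gauss_mass TYPE('a)" using gauss_mass_pos[where 'a='a] by simp
  have J0: "0 \<le> (LBINT x. \<bar>f x\<bar>)" by simp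
  have 1: "\<bar>conv (heat t) f x\<bar> \<le> B * gauss_mass TYPE('a)"
    using conv_abs_le[OF heat_mass(1)[OF t] m f(2), of x] heat_mass(2)[OF t, where 'a='a] by simp
  have "\<bar>conv (heat t) f x\<bar> \<le> (LBINT z. t powr (- (real DIM('a) / 2)) * \<bar>f (x - z)\<bar>)"
    unfolding conv_def
  proof (rule integral_abs_bound_integral[OF conv_integrable[OF heat_mass(1)[OF t] m f(2)]])
    show "L1 (\<lambda>z. t powr (- (real DIM('a) / 2)) * \<bar>f (x - z)\<bar>)"
      by (intro integrable_mult_right integrable_abs integrable_lborel_reflect f)
    show "\<bar>heat t z * f (x - z)\<bar> \<le> t powr (- (real DIM('a) / 2)) * \<bar>f (x - z)\<bar>" for z
      using mult_right_mono[OF heat_le[OF t, of z] abs_ge_zero[of "f (x - z)"]] by (simp add: abs_mult)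
  qed
  also have "\<dots> = t powr (- (real DIM('a) / 2)) * (LBINT z. \<bar>f z\<bar>)"
    using integral_lborel_reflect[of "\<lambda>z. \<bar>f z\<bar>" x] m by simp
  finally have 2: "\<bar>conv (heat t) f x\<bar> \<le> t powr (- (real DIM('a) / 2)) * (LBINT z. \<bar>f z\<bar>)" .
  have "t powr (- (real DIM('a) / 2)) * (LBINT z. \<bar>f z\<bar>) \<le> (B * gauss_mass TYPE('a) + (LBINT x. \<bar>f x\<bar>)) * t powr (- (real DIM('a) / 2))"
  proof -
    have "(LBINT z. \<bar>f z\<bar>) \<le> B * gauss_mass TYPE('a) + (LBINT x. \<bar>f x\<bar>)"
      using B0 g0 by simp
    from mult_left_mono[OF this, of "t powr (- (real DIM('a) / 2))"] show ?thesis by (simp add: mult.commute)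
  qed
  with 1 2 show ?thesis
    using add_increasing2[OF J0 1] by (auto simp: min_def)
qed

lemma borel_measurable_conv_heat [measurable]:
  assumes [measurable]: "borel_fun \<psi>" "f \<in> M \<rightarrow>\<^sub>M borel" "g \<in> M \<rightarrow>\<^sub>M borel"
  shows "(\<lambda>z. conv (heat (f z)) \<psi> (g z :: 'a::euclidean_space)) \<in> borel_measurable M"
  unfolding conv_def by measurable

lemma borel_measurable_conv [measurable]:
  assumes [measurable]: "borel_fun K" "borel_fun \<psi>" "g \<in> M \<rightarrow>\<^sub>M borel"
  shows "(\<lambda>z. conv K \<psi> (g z :: 'a::euclidean_space)) \<in> borel_measurable M"
  unfolding conv_def by measurable

text \<open>Second differences commute with convolution, so \<open>heat_conv_abs_le\<close> can be
  applied to \<open>sd \<psi> h\<close>. As both norms of \<open>sd \<psi> h\<close> are O(min 1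
  |h|^2), smallness in h and decay in t are obtained at once.\<close>

lemma heat_conv_bounds:
  fixes \<psi> :: "'a::euclidean_space \<Rightarrow> real"
  assumes \<psi>: "\<psi> \<in> C0_infinity"
  obtains C where "0 < C"
    "\<And>t x. 0 < t \<Longrightarrow> \<bar>conv (heat t) \<psi> x\<bar> \<le> C * min 1 (t powr (- (real DIM('a) / 2)))"
    "\<And>t x h. 0 < t \<Longrightarrow> \<bar>sd (conv (heat t) \<psi>) h x\<bar> \<le> C * (min 1 ((norm h)\<^sup>2) * min 1 (t powr (- (real DIM('a) / 2))))"
proof -
  obtain C1 where C1: "0 < C1" "\<And>x. \<bar>\<psi> x\<bar> \<le> C1" "\<And>x h. \<bar>sd \<psi> h x\<bar> \<le> C1 * min 1 ((norm h)\<^sup>2)"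
    by (rule C0_infinity_bounds[OF \<psi>]) (rule that; assumption)
  obtain C2 where C2: "0 < C2" "\<And>h. L1 (sd \<psi> h)"
    "\<And>h. (LBINT x. \<bar>sd \<psi> h x\<bar>) \<le> C2 * min 1 ((norm h)\<^sup>2)"
    by (rule C0_infinity_sd_L1[OF \<psi>]) blast
  define g where "g = gauss_mass TYPE('a)"
  have g: "0 < g" unfolding g_def by (rule gauss_mass_pos)
  define J where "J = (LBINT x. \<bar>\<psi> x\<bar>)"
  have J: "0 \<le> J" by (simp add: J_def)
  let ?C = "C1 * g + J + C2"
  have C: "0 < C1 * g" using C1 g by simp
  show ?thesis
  proof (rule that[of ?C])
    show "0 < ?C" using C J C2 by linarith
    fix t :: real and x :: 'a assume t: "0 < t"
    let ?m = "min 1 (t powr (- (real DIM('a) / 2)))"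
    have "\<bar>conv (heat t) \<psi> x\<bar> \<le> (C1 * g + J) * ?m"
      using heat_conv_abs_le[OF t C0_infinity_integrable[OF \<psi>] C1(2)] by (simp add: g_def J_def)
    also have "\<dots> \<le> ?C * ?m" using C2 by (intro mult_right_mono) auto
    finally show "\<bar>conv (heat t) \<psi> x\<bar> \<le> ?C * ?m" .
    fix h :: 'a
    let ?k = "min 1 ((norm h)\<^sup>2)"
    have "sd (conv (heat t) \<psi>) h x = conv (heat t) (sd \<psi> h) x"
      by (rule conv_sd, rule conv_integrable[OF heat_mass(1)[OF t] C0_infinity_measurable[OF \<psi>] C1(2)])
    also have "\<bar>\<dots>\<bar> \<le> (C1 * ?k * g + (LBINT x. \<bar>sd \<psi> h x\<bar>)) * ?m"
      using heat_conv_abs_le[OF t C2(2) C1(3)] by (simp add: g_def)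
    also have "\<dots> \<le> (C1 * ?k * g + C2 * ?k) * ?m"
      using C2(3) by (intro mult_right_mono add_left_mono) auto
    also have "\<dots> = (C1 * g + C2) * (?k * ?m)" by (simp add: algebra_simps)
    also have "\<dots> \<le> ?C * (?k * ?m)" using J by (intro mult_right_mono) auto
    finally show "\<bar>sd (conv (heat t) \<psi>) h x\<bar> \<le> ?C * (?k * ?m)" .
  qed
qed

lemma heat_conv_semigroup:
  fixes \<psi> :: "'a::euclidean_space \<Rightarrow> real"
  assumes \<psi>: "\<psi> \<in> C0_infinity" and t: "0 < t" and r: "0 < r"
  shows "conv (heat r) (conv (heat t) \<psi>) x = gauss_mass TYPE('a) * conv (heat (t + r)) \<psi> x"
proof -
  note [measurable] = C0_infinity_measurable[OF \<psi>]
  obtain B where B: "0 < B" "\<And>x. \<bar>\<psi> x\<bar> \<le> B" using C0_infinity_bounded[OF \<psi>] by blast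
  have inner: "conv (heat t) \<psi> (x - y) = (LBINT w. heat t (w - y) * \<psi> (x - w))" for y
  proof -
    have "(LBINT w. heat t (w - y) * \<psi> (x - w)) = (LBINT w. heat t ((w + y) - y) * \<psi> (x - (w + y)))"
      by (subst integral_lborel_shift[of "\<lambda>w. heat t (w - y) * \<psi> (x - w)" y]) auto
    then show ?thesis by (simp add: conv_def algebra_simps)
  qed
  have pair: "integrable lborel2 (\<lambda>(y, w). heat r y * (heat t (w - y) * \<psi> (x - w)))"
  proof (rule integrable_pairI)
    show "(\<lambda>(y, w). heat r y * (heat t (w - y) * \<psi> (x - w))) \<in> borel_measurable (borel \<Otimes>\<^sub>M borel)"
      by measurable
    have fin: "(\<integral>\<^sup>+y. ennreal (heat u (y::'a)) \<partial>lborel) < \<infinity>" if "0 < u" for u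
      using heat_mass(1)[OF that, where 'a='a] by (simp add: integrable_iff_bounded)
    have "(\<integral>\<^sup>+y. (\<integral>\<^sup>+w. ennreal \<bar>heat r y * (heat t (w - y) * \<psi> (x - w))\<bar> \<partial>lborel) \<partial>lborel) \<le>
      (\<integral>\<^sup>+y. (\<integral>\<^sup>+w. ennreal B * (ennreal (heat r y) * ennreal (heat t (w - (y::'a)))) \<partial>lborel) \<partial>lborel)"
    proof (intro nn_integral_mono)
      fix y w :: 'a
      have "\<bar>heat r y * (heat t (w - y) * \<psi> (x - w))\<bar> = (heat r y * heat t (w - y)) * \<bar>\<psi> (x - w)\<bar>"
        by (simp add: abs_mult)
      also have "\<dots> \<le> (heat r y * heat t (w - y)) * B"
        using B by (intro mult_left_mono) auto
      finally show "ennreal \<bar>heat r y * (heat t (w - y) * \<psi> (x - w))\<bar> \<le> ennreal B * (ennreal (heat r y) * ennreal (heat t (w - y)))"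
        using B(1) by (simp add: ennreal_mult[symmetric] mult.commute ennreal_leI)
    qed
    also have "\<dots> = (\<integral>\<^sup>+y. ennreal B * (ennreal (heat r y) * (\<integral>\<^sup>+w. ennreal (heat t (w + - (y::'a))) \<partial>lborel)) \<partial>lborel)"
      by (simp add: nn_integral_cmult)
    also have "\<dots> = ennreal B * ((\<integral>\<^sup>+y. ennreal (heat r (y::'a)) \<partial>lborel) * (\<integral>\<^sup>+w. ennreal (heat t (w::'a)) \<partial>lborel))"
      by (subst nn_integral_lborel_shift) (auto simp: nn_integral_cmult nn_integral_multc)
    also have "\<dots> < \<infinity>" using fin[OF t] fin[OF r] by (simp add: ennreal_mult_less_top)
    finally show "(\<integral>\<^sup>+y. (\<integral>\<^sup>+w. ennreal \<bar>heat r y * (heat t (w - y) * \<psi> (x - w))\<bar> \<partial>lborel) \<partial>lborel) < \<infinity>" .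
  qed
  have "conv (heat r) (conv (heat t) \<psi>) x = (LBINT y. LBINT w. heat r y * (heat t (w - y) * \<psi> (x - w)))"
    unfolding conv_def[of "heat r"] inner by simp
  also have "\<dots> = (LBINT w. LBINT y. heat r y * (heat t (w - y) * \<psi> (x - w)))"
    by (rule LINT_swap[OF pair])
  also have "\<dots> = (LBINT w. (LBINT y. heat r y * heat t (w - y)) * \<psi> (x - w))"
    by (simp add: mult.assoc[symmetric])
  also have "\<dots> = gauss_mass TYPE('a) * conv (heat (t + r)) \<psi> x"
    unfolding heat_semigroup(2)[OF t r] by (simp add: conv_def mult.assoc)
  finally show ?thesis .
qed

text \<open>The values at x + h and x - h each average to the Gaussian convolution at time t + r by
  the semigroup law, while the middle value only picks up the mass. A weighted second difference in
  space has become an increment in time.\<close>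

lemma heat_sd_integral:
  fixes \<psi> :: "'a::euclidean_space \<Rightarrow> real"
  assumes \<psi>: "\<psi> \<in> C0_infinity" and t: "0 < t" and r: "0 < r"
  shows "L1 (\<lambda>h. heat r h * sd (conv (heat t) \<psi>) h x)"
    and "(LBINT h. heat r h * sd (conv (heat t) \<psi>) h x) =
    2 * gauss_mass TYPE('a) * (conv (heat (t + r)) \<psi> x - conv (heat t) \<psi> x)"
proof -
  note [measurable] = C0_infinity_measurable[OF \<psi>]
  let ?P = "conv (heat t) \<psi>"
  obtain C where C: "\<And>x. \<bar>?P x\<bar> \<le> C"
  proof -
    obtain C where C: "0 < C" "\<And>x. \<bar>?P x\<bar> \<le> C * min 1 (t powr (- (real DIM('a) / 2)))"
      using heat_conv_bounds[OF \<psi>] t by metis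
    have "\<bar>?P x\<bar> \<le> C * 1" for x
      using C by (rule_tac order_trans[OF C(2)], intro mult_left_mono) auto
    then show ?thesis by (rule that)
  qed
  have i1: "L1 (\<lambda>h. heat r h * ?P (x - h))"
    by (rule conv_integrable[OF heat_mass(1)[OF r] _ C]) measurable
  have i2: "L1 (\<lambda>h. heat r h * ?P (x + h))"
    using integrable_lborel_uminus[OF i1] by simp
  have i3: "L1 (\<lambda>h. heat r (h::'a) * ?P x)"
    using heat_mass(1)[OF r, where 'a='a] by simp
  have eq: "heat r h * sd ?P h x = heat r h * ?P (x + h) + heat r h * ?P (x - h) - 2 * (heat r h * ?P x)" for h
    by (simp add: sd_def algebra_simps)
  show "L1 (\<lambda>h. heat r h * sd ?P h x)"
    unfolding eq using i1 i2 i3 by simp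
  have e1: "(LBINT h. heat r h * ?P (x - h)) = gauss_mass TYPE('a) * conv (heat (t + r)) \<psi> x"
    using heat_conv_semigroup[OF \<psi> t r] by (simp add: conv_def)
  have e2: "(LBINT h. heat r h * ?P (x + h)) = gauss_mass TYPE('a) * conv (heat (t + r)) \<psi> x"
    using integral_lborel_uminus[of "\<lambda>h. heat r h * ?P (x - h)"] e1 by simp
  have e3: "(LBINT h. heat r (h::'a) * ?P x) = gauss_mass TYPE('a) * ?P x"
    using heat_mass(2)[OF r, where 'a='a] by simp
  have "(LBINT h. heat r h * sd ?P h x) =
    (LBINT h. heat r h * ?P (x + h)) + (LBINT h. heat r h * ?P (x - h)) - 2 * (LBINT h. heat r (h::'a) * ?P x)"
    unfolding eq
    by (subst integral_minus, use i1 i2 i3 in simp, use i3 in simp,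
        subst integral_plus[OF i2 i1], subst integral_mult_right_zero, rule refl)
  then show "(LBINT h. heat r h * sd ?P h x) =
    2 * gauss_mass TYPE('a) * (conv (heat (t + r)) \<psi> x - conv (heat t) \<psi> x)"
    unfolding e1 e2 e3 by (simp add: algebra_simps)
qed

text \<open>Rescaling the Gaussian to unit time turns the variation in \<open>t\<close> into one in \<open>sqrt t\<close>.\<close>

lemma heat_conv_time_modulus:
  fixes \<psi> :: "'a::euclidean_space \<Rightarrow> real"
  assumes \<psi>: "\<psi> \<in> C0_infinity"
  obtains C where "\<And>t r. 0 < t \<Longrightarrow> 0 < r \<Longrightarrow> \<bar>conv (heat t) \<psi> x - conv (heat r) \<psi> x\<bar> \<le> C * \<bar>sqrt t - sqrt r\<bar>"
    "\<And>t. 0 < t \<Longrightarrow> \<bar>conv (heat t) \<psi> x - gauss_mass TYPE('a) * \<psi> x\<bar> \<le> C * sqrt t"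
proof -
  note [measurable] = C0_infinity_measurable[OF \<psi>]
  obtain C where C: "0 < C" "\<And>x. \<bar>\<psi> x\<bar> \<le> C" "\<And>x h. \<bar>\<psi> (x + h) - \<psi> x\<bar> \<le> C * norm h"
    by (rule C0_infinity_bounds[OF \<psi>]) (rule that; assumption)
  let ?g = "\<lambda>y::'a. exp (- ((norm y)\<^sup>2))"
  define H where "H a = (LBINT y. ?g y * \<psi> (x - a *\<^sub>R y))" for a
  have int: "L1 (\<lambda>y. ?g y * \<psi> (x - a *\<^sub>R y))" for a
  proof (rule integrable_dominated)
    show "L1 (\<lambda>y. C * ?g y)" by (intro integrable_mult_right integrable_gauss)
    show "\<bar>?g y * \<psi> (x - a *\<^sub>R y)\<bar> \<le> C * ?g y" for y
      using mult_right_mono[OF C(2) exp_ge_zero] C(1) by (simp add: abs_mult mult.commute)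
  qed measurable
  \<comment> \<open>The factor |y| costs half of the Gaussian decay: |y| \<le> 1 + |y|^2/2 \<le>
    exp(|y|^2/2).\<close>
  have ig: "L1 (\<lambda>y. norm y * ?g y)"
  proof (rule integrable_dominated_nonneg)
    show "L1 (\<lambda>y::'a. ?g ((1 / sqrt 2) *\<^sub>R y))"
      by (rule lborel_scale(1)[OF _ integrable_gauss]) simp
    show "norm y * ?g y \<le> ?g ((1 / sqrt 2) *\<^sub>R y)" for y :: 'a
    proof -
      have "norm y \<le> 1 + (norm y)\<^sup>2 / 2"
        using sum_squares_bound[of "norm y" 1] by (simp add: power2_eq_square)
      also have "\<dots> \<le> exp ((norm y)\<^sup>2 / 2)" by (rule exp_ge_add_one_self)
      finally have "norm y * ?g y \<le> exp ((norm y)\<^sup>2 / 2) * ?g y" by (rule mult_right_mono) simp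
      also have "\<dots> = ?g ((1 / sqrt 2) *\<^sub>R y)"
        by (simp add: mult_exp_exp power_mult_distrib power_divide)
      finally show ?thesis .
    qed
  qed (simp, measurable)
  define M where "M = (LBINT y. norm y * ?g y)"
  have mod: "\<bar>H a - H b\<bar> \<le> (C * M) * \<bar>a - b\<bar>" for a b
  proof -
    have e: "H a - H b = (LBINT y. ?g y * \<psi> (x - a *\<^sub>R y) - ?g y * \<psi> (x - b *\<^sub>R y))"
      unfolding H_def by (rule integral_minus[symmetric, OF int int])
    have "\<bar>H a - H b\<bar> \<le> (LBINT y. (C * \<bar>a - b\<bar>) * (norm y * ?g y))"
      unfolding e
    proof (rule integral_abs_bound_integral[OF integrable_minus[OF int int]])
      show "L1 (\<lambda>y. (C * \<bar>a - b\<bar>) * (norm y * ?g y))"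
        by (intro integrable_mult_right ig)
      fix y :: 'a
      have e: "(x - b *\<^sub>R y) + (b - a) *\<^sub>R y = x - a *\<^sub>R y" by (simp add: scaleR_diff_left)
      have "\<bar>\<psi> (x - a *\<^sub>R y) - \<psi> (x - b *\<^sub>R y)\<bar> \<le> C * norm ((b - a) *\<^sub>R y)"
        using C(3)[of "x - b *\<^sub>R y" "(b - a) *\<^sub>R y"] unfolding e .
      then have "?g y * \<bar>\<psi> (x - a *\<^sub>R y) - \<psi> (x - b *\<^sub>R y)\<bar> \<le> ?g y * (C * norm ((b - a) *\<^sub>R y))"
        by (rule mult_left_mono) simp
      then show "\<bar>?g y * \<psi> (x - a *\<^sub>R y) - ?g y * \<psi> (x - b *\<^sub>R y)\<bar> \<le> (C * \<bar>a - b\<bar>) * (norm y * ?g y)"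
      proof -
        assume le: "?g y * \<bar>\<psi> (x - a *\<^sub>R y) - \<psi> (x - b *\<^sub>R y)\<bar> \<le> ?g y * (C * norm ((b - a) *\<^sub>R y))"
        have "\<bar>?g y * \<psi> (x - a *\<^sub>R y) - ?g y * \<psi> (x - b *\<^sub>R y)\<bar> = ?g y * \<bar>\<psi> (x - a *\<^sub>R y) - \<psi> (x - b *\<^sub>R y)\<bar>"
          by (simp only: right_diff_distrib[symmetric] abs_mult abs_exp_cancel)
        also have "\<dots> \<le> ?g y * (C * (\<bar>a - b\<bar> * norm y))"
          using le by (simp only: norm_scaleR abs_minus_commute)
        finally show ?thesis by (simp only: mult_ac)
      qed
    qed
    also have "\<dots> = (C * M) * \<bar>a - b\<bar>" unfolding M_def by simp
    finally show ?thesis .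
  qed
  have P: "conv (heat t) \<psi> x = H (sqrt t)" if t: "0 < t" for t
  proof -
    have st: "1 / sqrt t \<noteq> 0" using t by simp
    have eq: "heat t z * \<psi> (x - z) = t powr (- (real DIM('a) / 2)) *
        (\<lambda>y. ?g y * \<psi> (x - sqrt t *\<^sub>R y)) ((1 / sqrt t) *\<^sub>R z)" for z
      using t by (simp add: heat_eq_gauss[OF t])
    have "conv (heat t) \<psi> x = t powr (- (real DIM('a) / 2)) * (H (sqrt t) / \<bar>1 / sqrt t\<bar> ^ DIM('a))"
      unfolding conv_def eq H_def
      by (simp only: integral_mult_right_zero lborel_scale(2)[OF st int])
    also have "\<dots> = H (sqrt t)" using t by (simp add: power_divide sqrt_power_dim powr_minus)
    finally show ?thesis .
  qed
  have H0: "H 0 = gauss_mass TYPE('a) * \<psi> x" unfolding H_def gauss_mass_def by simp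
  show ?thesis
  proof (rule that[of "C * M"])
    show "\<bar>conv (heat t) \<psi> x - conv (heat r) \<psi> x\<bar> \<le> (C * M) * \<bar>sqrt t - sqrt r\<bar>" if "0 < t" "0 < r" for t r
      using mod P that by simp
    show "\<bar>conv (heat t) \<psi> x - gauss_mass TYPE('a) * \<psi> x\<bar> \<le> (C * M) * sqrt t" if "0 < t" for t
      using mod[of "sqrt t" 0] P[OF that] H0 that by simp
  qed
qed

section \<open>The Riesz kernel as a fundamental solution\<close>

text \<open>Truncating to [a, b] allows the two halves to be separated. After the substitution t ->
  c t they cancel except near the two ends, and the ends see only the limits of H at 0 and at
  infinity. The remaining integral of 1/r over [1, c) is ln c.\<close>

lemma frullani:
  fixes H :: "real \<Rightarrow> real"
  assumes meas [measurable]: "borel_fun H"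
    and bd: "\<And>t. 0 < t \<Longrightarrow> \<bar>H t\<bar> \<le> B"
    and lim0: "(H \<longlongrightarrow> H0) (at_right 0)"
    and liminf: "(H \<longlongrightarrow> 0) at_top"
    and c: "1 < c"
    and int: "L1 (\<lambda>t. ipos t * ((H t - H (c * t)) / t))"
  shows "(LBINT t. ipos t * ((H t - H (c * t)) / t)) = H0 * (LBINT r. indicat_real {1..<c} r / r)"
proof -
  define w where "w t = ipos t * ((H t - H (c * t)) / t)" for t
  have [measurable]: "borel_fun w" unfolding w_def[abs_def] by measurable
  have B0: "0 \<le> B" using bd[of 1] by simp
  have fint: "L1 (\<lambda>t. indicat_real S t * (H t / t))"
    if "S \<subseteq> {a..b}" "0 < a" "S \<in> sets borel" for S a b
  proof (rule integrable_dominated)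
    note [measurable] = that(3)
    show "L1 (\<lambda>t. (B / a) * indicat_real {a..b} t)"
      by (intro integrable_mult_right integrable_real_indicator) (auto simp: emeasure_lborel_Icc_eq)
    show "\<bar>indicat_real S t * (H t / t)\<bar> \<le> (B / a) * indicat_real {a..b} t" for t
    proof (cases "t \<in> S")
      case True
      then have t: "t \<in> {a..b}" using that by auto
      have "\<bar>H t\<bar> / t \<le> B / a" using t that bd[of t] by (intro frac_le) auto
      then show ?thesis using True t that by (simp add: abs_divide)
    next
      case False
      then show ?thesis using B0 that by simp
    qed
    show "(\<lambda>t. indicat_real S t * (H t / t)) \<in> borel_measurable lborel" by measurable
  qed
  \<comment> \<open>Away from 0 and infinity both halves are integrable. The second becomes an
    integral over [c a, c b]; the common part drops out, and the edges next to a and b are rescaled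
    to the interval from 1 to c.\<close>
  have key: "(LBINT t. w t * indicat_real {a..b} t) =
      (LBINT r. indicat_real {1..<c} r * (H (a * r) / r)) - (LBINT r. indicat_real {1<..c} r * (H (b * r) / r))"
    if a: "0 < a" and ab: "a \<le> b" for a b
  proof -
    have ca: "c > 0" "a \<le> c * a" "b \<le> c * b" "0 < b" using c a ab by (auto simp: mult_le_cancel_right1)
    let ?f = "\<lambda>S t. indicat_real S t * (H t / t)"
    have i1: "L1 (?f {a..b})" by (rule fint[of _ a b]) (use a in auto)
    have i2: "L1 (?f {c*a..c*b})"
      by (rule fint[of _ a "c*b"]) (use a ca in auto)
    have i3: "L1 (?f {a..<c*a})" by (rule fint[of _ a "c*a"]) (use a in auto)
    have i4: "L1 (?f {b<..c*b})" by (rule fint[of _ a "c*b"]) (use a ab in auto)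
    have i2': "L1 (\<lambda>t. c * ?f {c*a..c*b} (c * t))" "(LBINT t. c * ?f {c*a..c*b} (c * t)) = (LBINT t. ?f {c*a..c*b} t)"
    proof -
      show "L1 (\<lambda>t. c * ?f {c*a..c*b} (c * t))"
        by (rule integrable_mult_right[OF lborel_real_scale_pos(1)[OF ca(1) i2]])
      have "(LBINT t. c * ?f {c*a..c*b} (c * t)) = c * ((LBINT t. ?f {c*a..c*b} t) / c)"
        by (simp only: integral_mult_right_zero lborel_real_scale_pos(2)[OF ca(1) i2])
      then show "(LBINT t. c * ?f {c*a..c*b} (c * t)) = (LBINT t. ?f {c*a..c*b} t)"
        using ca(1) by simp
    qed
    have "w t * indicat_real {a..b} t = ?f {a..b} t - c * ?f {c*a..c*b} (c * t)" for t
      using a ca by (auto simp: w_def indicator_def diff_divide_distrib)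
    then have "(LBINT t. w t * indicat_real {a..b} t) = (LBINT t. ?f {a..b} t - c * ?f {c*a..c*b} (c * t))"
      by (simp only:)
    also have "\<dots> = (LBINT t. ?f {a..b} t) - (LBINT t. ?f {c*a..c*b} t)"
      by (subst integral_minus[OF i1 i2'(1)]) (simp only: i2'(2))
    also have "\<dots> = (LBINT t. ?f {a..b} t - ?f {c*a..c*b} t)"
      by (rule integral_minus[symmetric, OF i1 i2])
    also have "\<dots> = (LBINT t. ?f {a..<c*a} t - ?f {b<..c*b} t)"
    proof (rule lint_cong[OF refl])
      fix t
      \<comment> \<open>Half-open edges make this an identity at every point, even when [a, c a] and
        [b, c b] overlap.\<close>
      have "indicat_real {a..b} t - indicat_real {c*a..c*b} t = indicat_real {a..<c*a} t - indicat_real {b<..c*b} t"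
      proof -
        have "c * a \<le> c * b" using ca(1) ab by simp
        then show ?thesis
          using ca(2,3) ab unfolding indicator_def of_bool_def
          by (simp only: atLeastAtMost_iff atLeastLessThan_iff greaterThanAtMost_iff split: if_split) linarith
      qed
      then have "(indicat_real {a..b} t - indicat_real {c*a..c*b} t) * (H t / t) = (indicat_real {a..<c*a} t - indicat_real {b<..c*b} t) * (H t / t)"
        by simp
      then show "?f {a..b} t - ?f {c*a..c*b} t = ?f {a..<c*a} t - ?f {b<..c*b} t"
        by (simp only: left_diff_distrib)
    qed
    also have "\<dots> = (LBINT t. ?f {a..<c*a} t) - (LBINT t. ?f {b<..c*b} t)"
      by (rule integral_minus[OF i3 i4])
    also have "(LBINT t. ?f {a..<c*a} t) = (LBINT r. a * ?f {a..<c*a} (a * r))"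
      using a by (simp only: integral_mult_right_zero lborel_real_scale_pos(2)[OF a i3]) simp
    also have "\<dots> = (LBINT r. indicat_real {1..<c} r * (H (a * r) / r))"
    proof (rule lint_cong[OF refl])
      show "a * ?f {a..<c*a} (a * r) = indicat_real {1..<c} r * (H (a * r) / r)" for r
      proof -
        have "a * r < c * a \<longleftrightarrow> r < c" using a by (simp add: mult.commute)
        moreover have "a \<le> a * r \<longleftrightarrow> 1 \<le> r" using a by simp
        ultimately show ?thesis using a by (auto simp: indicator_def)
      qed
    qed
    also have "(LBINT t. ?f {b<..c*b} t) = (LBINT r. b * ?f {b<..c*b} (b * r))"
      using ca(4) by (simp only: integral_mult_right_zero lborel_real_scale_pos(2)[OF ca(4) i4]) simp
    also have "\<dots> = (LBINT r. indicat_real {1<..c} r * (H (b * r) / r))"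
    proof (rule lint_cong[OF refl])
      show "b * ?f {b<..c*b} (b * r) = indicat_real {1<..c} r * (H (b * r) / r)" for r
      proof -
        have "b * r \<le> c * b \<longleftrightarrow> r \<le> c" using ca by (simp add: mult.commute)
        moreover have "b < b * r \<longleftrightarrow> 1 < r" using ca by simp
        ultimately show ?thesis using ca by (auto simp: indicator_def)
      qed
    qed
    finally show ?thesis .
  qed
  \<comment> \<open>Exhausts the half-line by [1/(n+1), n+1]. The left edge converges to the value
    H0 at 0 and the right edge to 0, both dominated by B on [1, c].\<close>
  let ?a = "\<lambda>n. 1 / real (Suc n)" and ?b = "\<lambda>n. real (Suc n)"
  have L1: "(\<lambda>n. LBINT t. w t * indicat_real {?a n..?b n} t) \<longlonglongrightarrow> (LBINT t. w t)"
  proof (rule integral_dominated_convergence[where w="\<lambda>t. \<bar>w t\<bar>"])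
    show "L1 (\<lambda>t. \<bar>w t\<bar>)" using integrable_abs[OF int] by (simp only: w_def)
    show "AE t in lborel. (\<lambda>n. w t * indicat_real {?a n..?b n} t) \<longlonglongrightarrow> w t"
    proof (rule AE_I2)
      fix t :: real
      show "(\<lambda>n. w t * indicat_real {?a n..?b n} t) \<longlonglongrightarrow> w t"
      proof (cases "0 < t")
        case True
        have "\<forall>\<^sub>F n in sequentially. ?a n < t"
        proof -
          have "(\<lambda>n. ?a n) \<longlonglongrightarrow> 0" using LIMSEQ_inverse_real_of_nat by (simp add: inverse_eq_divide)
          then show ?thesis using True by (rule order_tendstoD)
        qed
        moreover have "\<forall>\<^sub>F n in sequentially. t < ?b n"
        proof -
          obtain m where "t < real m" using reals_Archimedean2 by blast
          then show ?thesis by (intro eventually_sequentiallyI[of m]) simp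
        qed
        ultimately have "\<forall>\<^sub>F n in sequentially. w t * indicat_real {?a n..?b n} t = w t"
          by eventually_elim (simp add: indicator_def)
        then show ?thesis by (rule tendsto_eventually)
      qed (simp add: w_def)
    qed
  qed (auto simp: indicator_def intro!: AE_I2)
  have L2: "(\<lambda>n. LBINT r. indicat_real {1..<c} r * (H (?a n * r) / r)) \<longlonglongrightarrow> (LBINT r. indicat_real {1..<c} r * (H0 / r))"
  proof (rule integral_dominated_convergence[where w="\<lambda>r. B * indicat_real {1..c} r"])
    show "AE r in lborel. (\<lambda>n. indicat_real {1..<c} r * (H (?a n * r) / r)) \<longlonglongrightarrow> indicat_real {1..<c} r * (H0 / r)"
    proof (rule AE_I2)
      fix r :: real
      show "(\<lambda>n. indicat_real {1..<c} r * (H (?a n * r) / r)) \<longlonglongrightarrow> indicat_real {1..<c} r * (H0 / r)"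
      proof (cases "r \<in> {1..<c}")
        case True
        have "filterlim (\<lambda>n. ?a n * r) (at_right 0) sequentially"
        proof (rule tendsto_imp_filterlim_at_right)
          have "(\<lambda>n. ?a n * r) \<longlonglongrightarrow> 0 * r"
            using LIMSEQ_inverse_real_of_nat by (intro tendsto_mult tendsto_const) (simp add: inverse_eq_divide)
          then show "(\<lambda>n. ?a n * r) \<longlonglongrightarrow> 0" by simp
          show "\<forall>\<^sub>F n in sequentially. 0 < ?a n * r" using True by (intro always_eventually) auto
        qed
        from filterlim_compose[OF lim0 this] show ?thesis
          using True by (intro tendsto_mult tendsto_divide tendsto_const) auto
      qed simp
    qed
    show "AE r in lborel. norm (indicat_real {1..<c} r * (H (?a n * r) / r)) \<le> B * indicat_real {1..c} r" for n
    proof (rule AE_I2)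
      fix r :: real
      show "norm (indicat_real {1..<c} r * (H (?a n * r) / r)) \<le> B * indicat_real {1..c} r"
      proof (cases "r \<in> {1..<c}")
        case True
        have "\<bar>H (?a n * r)\<bar> / r \<le> B / 1" using True bd[of "?a n * r"] by (intro frac_le) auto
        then show ?thesis using True by (simp add: abs_divide)
      qed (use B0 in simp)
    qed
  qed (measurable, auto intro!: integrable_mult_right integrable_real_indicator simp: emeasure_lborel_Icc_eq)
  have L3: "(\<lambda>n. LBINT r. indicat_real {1<..c} r * (H (?b n * r) / r)) \<longlonglongrightarrow> (LINT r|(lborel::real measure). (0::real))"
  proof (rule integral_dominated_convergence[where w="\<lambda>r. B * indicat_real {1..c} r"])
    show "AE r in lborel. (\<lambda>n. indicat_real {1<..c} r * (H (?b n * r) / r)) \<longlonglongrightarrow> 0"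
    proof (rule AE_I2)
      fix r :: real
      show "(\<lambda>n. indicat_real {1<..c} r * (H (?b n * r) / r)) \<longlonglongrightarrow> 0"
      proof (cases "r \<in> {1<..c}")
        case True
        have "filterlim (\<lambda>n. ?b n * r) at_top sequentially"
          using True by (intro filterlim_at_top_mult_tendsto_pos[OF tendsto_const] filterlim_compose[OF filterlim_real_sequentially filterlim_Suc]) auto
        from filterlim_compose[OF liminf this] have "(\<lambda>n. indicat_real {1<..c} r * (H (?b n * r) / r)) \<longlonglongrightarrow> indicat_real {1<..c} r * (0 / r)"
          using True by (intro tendsto_mult tendsto_divide tendsto_const) auto
        then show ?thesis by simp
      qed simp
    qed
    show "AE r in lborel. norm (indicat_real {1<..c} r * (H (?b n * r) / r)) \<le> B * indicat_real {1..c} r" for n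
    proof (rule AE_I2)
      fix r :: real
      show "norm (indicat_real {1<..c} r * (H (?b n * r) / r)) \<le> B * indicat_real {1..c} r"
      proof (cases "r \<in> {1<..c}")
        case True
        have "\<bar>H (?b n * r)\<bar> / r \<le> B / 1" using True bd[of "?b n * r"] by (intro frac_le) auto
        then show ?thesis using True by (simp add: abs_divide)
      qed (use B0 in simp)
    qed
  qed (measurable, auto intro!: integrable_mult_right integrable_real_indicator simp: emeasure_lborel_Icc_eq)
  have "?a n \<le> ?b n" for n
    by (rule order_trans[of _ 1]) (auto simp: divide_le_eq)
  then have "(\<lambda>n. LBINT t. w t * indicat_real {?a n..?b n} t) \<longlonglongrightarrow> (LBINT r. indicat_real {1..<c} r * (H0 / r)) - (LINT r|(lborel::real measure). (0::real))"
    using tendsto_diff[OF L2 L3] by (subst key) auto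
  from LIMSEQ_unique[OF L1 this]
  have "(LBINT t. w t) = (LBINT r. indicat_real {1..<c} r * (H0 / r))" by simp
  also have "\<dots> = (LBINT r. H0 * (indicat_real {1..<c} r / r))"
    by (simp add: mult.commute)
  also have "\<dots> = H0 * (LBINT r. indicat_real {1..<c} r / r)"
    by (simp only: integral_mult_right_zero)
  finally show ?thesis by (simp only: w_def)
qed

section \<open>Riesz and fractional kernel as superpositions of Gaussians\<close>

context fractional_order
begin

definition riesz :: "'a \<Rightarrow> real" where
  "riesz z = norm z powr (2 * s - real DIM('a))"

lemma borel_measurable_riesz [measurable]: "borel_fun riesz"
  unfolding riesz_def by measurable

lemma riesz_nonneg [simp]: "0 \<le> riesz z" by (simp add: riesz_def)

lemma integrable_riesz_ball: "0 < R \<Longrightarrow> L1 (\<lambda>z. riesz z * indicator (ball 0 R) z)"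
  unfolding riesz_def using integrable_norm_powr_ball[of "real DIM('a) - 2 * s" R, where 'a='a] s_pos by simp

lemma AE_neq_0: "AE z in (lborel :: 'a measure). z \<noteq> 0"
  by (rule AE_I[of _ _ "{0}"]) auto

lemma ker_eq_heat:
  assumes "h \<noteq> 0"
  shows "L1 (\<lambda>r. ipos r * (r powr (- s - 1) * heat r h))"
    and "(LBINT r. ipos r * (r powr (- s - 1) * heat r h)) = exp_kernel_integral (real DIM('a) / 2 + s) * ker h"
proof -
  have e: "2 * - s - real DIM('a) = - (real DIM('a) + 2 * s)" "real DIM('a) / 2 - - s = real DIM('a) / 2 + s" by simp_all
  have c: "0 < real DIM('a) / 2 - - s" using s_pos by (simp add: add_pos_pos)
  show "L1 (\<lambda>r. ipos r * (r powr (- s - 1) * heat r h))"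
    by (rule heat_time_integral(1)[OF assms c])
  show "(LBINT r. ipos r * (r powr (- s - 1) * heat r h)) = exp_kernel_integral (real DIM('a) / 2 + s) * ker h"
    unfolding heat_time_integral(2)[OF assms c] e ker_def ..
qed

lemma riesz_eq_heat:
  assumes "z \<noteq> 0"
  shows "L1 (\<lambda>t. ipos t * (t powr (s - 1) * heat t z))"
    and "(LBINT t. ipos t * (t powr (s - 1) * heat t z)) = exp_kernel_integral (real DIM('a) / 2 - s) * riesz z"
  using heat_time_integral[OF assms, of s] dim_gt by (auto simp: riesz_def)

text \<open>At 0 the exponent s - 1 exceeds -1 because s > 0; at infinity s - 1 - N/2 is below -1
  because 2s < N.\<close>

lemma integrable_time_weight:
  "L1 (\<lambda>t. ipos t * (t powr (s - 1) * min 1 (t powr (- (real DIM('a) / 2)))))"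
proof (rule integrable_dominated_nonneg)
  show "L1 (\<lambda>t::real. norm t powr (- (1 - s)) * indicator (ball 0 1) t + norm t powr (- (1 - s + real DIM('a) / 2)) * indicator (- ball 0 1) t)"
    using s_pos dim_gt
    by (intro integrable_plus integrable_norm_powr_ball integrable_norm_powr_outside) auto
  show "ipos t * (t powr (s - 1) * min 1 (t powr (- (real DIM('a) / 2)))) \<le>
    norm t powr (- (1 - s)) * indicator (ball 0 1) t + norm t powr (- (1 - s + real DIM('a) / 2)) * indicator (- ball 0 1) t" for t :: real
  proof (cases "0 < t")
    case True
    show ?thesis
    proof (cases "t < 1")
      case t1: True
      have "t powr (s - 1) * min 1 (t powr (- (real DIM('a) / 2))) \<le> t powr (s - 1) * 1"
        by (intro mult_left_mono) auto
      then show ?thesis using True t1 by (simp add: indicator_def)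
    next
      case False
      have "t powr (s - 1) * min 1 (t powr (- (real DIM('a) / 2))) \<le> t powr (s - 1) * t powr (- (real DIM('a) / 2))"
        by (intro mult_left_mono) auto
      also have "\<dots> = t powr (- (1 - s + real DIM('a) / 2))"
        unfolding powr_add[symmetric] by (simp add: algebra_simps)
      finally show ?thesis using True False by (simp add: indicator_def)
    qed
  qed simp
qed (simp, measurable)

end

text \<open>The hypotheses are required only almost everywhere because the Gaussian superpositions
  diverge at the origin.\<close>

lemma integrable_pair_Fubini:
  fixes F :: "'a::euclidean_space \<Rightarrow> 'b::euclidean_space \<Rightarrow> real"
  assumes [measurable]: "(\<lambda>(x, y). F x y) \<in> borel_measurable (borel \<Otimes>\<^sub>M borel)"
    and i: "AE x in lborel. L1 (F x)"
    and b: "AE x in lborel. (LBINT y. \<bar>F x y\<bar>) \<le> g x" and g: "L1 g"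
  shows "integrable lborel2 (\<lambda>(x, y). F x y)"
proof (rule lborel_pair.Fubini_integrable)
  show "(\<lambda>(x, y). F x y) \<in> borel_measurable lborel2" by measurable
  show "AE x in lborel. L1 (\<lambda>y. case (x, y) of (x, y) \<Rightarrow> F x y)" using i by simp
  have "L1 (\<lambda>x. LBINT y. \<bar>F x y\<bar>)"
  proof (rule Bochner_Integration.integrable_bound[OF g])
    show "(\<lambda>x. LBINT y. \<bar>F x y\<bar>) \<in> borel_measurable lborel" by measurable
    show "AE x in lborel. norm (LBINT y. \<bar>F x y\<bar>) \<le> norm (g x)"
      using b by eventually_elim (auto intro: order_trans)
  qed
  then show "L1 (\<lambda>x. LBINT y. norm (case (x, y) of (x, y) \<Rightarrow> F x y))" by simp
qed

context fractional_order
begin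

text \<open>Subordination: the fractional kernel is an integral of Gaussians with weight r^(-s-1),
  so after Fubini \<open>heat_sd_integral\<close> converts the fractional Laplacian of a Gaussian
  average into a weighted increment in time. The bound in t prepares the later integration against
  t^(s-1).\<close>

lemma heat_Lop:
  assumes \<psi>: "\<psi> \<in> C0_infinity"
  obtains C where "0 < C"
    "\<And>t. 0 < t \<Longrightarrow> L1 (\<lambda>r. ipos r * (r powr (- s - 1) * (conv (heat (t + r)) \<psi> x - conv (heat t) \<psi> x)))"
    "\<And>t. 0 < t \<Longrightarrow> (LBINT r. \<bar>ipos r * (r powr (- s - 1) * (conv (heat (t + r)) \<psi> x - conv (heat t) \<psi> x))\<bar>) \<le>
       C * min 1 (t powr (- (real DIM('a) / 2)))"
    "\<And>t. 0 < t \<Longrightarrow> exp_kernel_integral (real DIM('a) / 2 + s) * (LBINT h. sd (conv (heat t) \<psi>) h x * ker h) =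
       2 * gauss_mass TYPE('a) * (LBINT r. ipos r * (r powr (- s - 1) * (conv (heat (t + r)) \<psi> x - conv (heat t) \<psi> x)))"
proof -
  note [measurable] = C0_infinity_measurable[OF \<psi>]
  obtain C where C: "0 < C" "\<And>t x h. 0 < t \<Longrightarrow> \<bar>sd (conv (heat t) \<psi>) h x\<bar> \<le> C * (min 1 ((norm h)\<^sup>2) * min 1 (t powr (- (real DIM('a) / 2))))"
    by (rule heat_conv_bounds[OF \<psi>]) (rule that; assumption)
  define E where "E = exp_kernel_integral (real DIM('a) / 2 + s)"
  have E: "0 < E" unfolding E_def using s_pos by (intro exp_kernel_integral_pos) (simp add: add_pos_pos)
  define g where "g = gauss_mass TYPE('a)"
  have g: "0 < g" unfolding g_def by (rule gauss_mass_pos)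
  define K where "K = (LBINT h. ker h * min 1 ((norm h)\<^sup>2))"
  have K0: "0 \<le> K" unfolding K_def by (intro lint_nonneg) simp
  {
    fix t :: real assume t: "0 < t"
    let ?m = "min 1 (t powr (- (real DIM('a) / 2)))"
    let ?P = "conv (heat t) \<psi>"
    let ?F = "\<lambda>h r. sd ?P h x * (ipos r * (r powr (- s - 1) * heat r h))"
    let ?D = "\<lambda>r. ipos r * (r powr (- s - 1) * (conv (heat (t + r)) \<psi> x - ?P x))"
    have absF: "(LBINT r. \<bar>?F h r\<bar>) = \<bar>sd ?P h x\<bar> * (E * ker h)" for h
    proof (cases "h = 0")
      case False
      have "(LBINT r. \<bar>?F h r\<bar>) = \<bar>sd ?P h x\<bar> * (LBINT r. ipos r * (r powr (- s - 1) * heat r h))"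
        by (simp add: abs_mult)
      then show ?thesis by (simp only: ker_eq_heat(2)[OF False] E_def)
    qed simp
    have intF: "(LBINT r. ?F h r) = sd ?P h x * (E * ker h)" for h
    proof (cases "h = 0")
      case False
      then show ?thesis by (simp only: integral_mult_right_zero ker_eq_heat(2)[OF False] E_def)
    qed simp
    have bF: "\<bar>sd ?P h x\<bar> * (E * ker h) \<le> (C * ?m * E) * (ker h * min 1 ((norm h)\<^sup>2))" for h
      using mult_right_mono[OF C(2)[OF t, of h x], of "E * ker h"] E by (simp add: mult_ac)
    have ig: "L1 (\<lambda>h. (C * ?m * E) * (ker h * min 1 ((norm h)\<^sup>2)))"
      by (intro integrable_mult_right integrable_ker_min2)
    have pair: "integrable lborel2 (\<lambda>(h, r). ?F h r)"
    proof (rule integrable_pair_Fubini[OF _ _ _ ig])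
      show "(\<lambda>(h, r). ?F h r) \<in> borel_measurable (borel \<Otimes>\<^sub>M borel)" by measurable
      show "AE h in lborel. L1 (?F h)"
        using AE_neq_0 by eventually_elim (intro integrable_mult_right ker_eq_heat(1))
      show "AE h in lborel. (LBINT r. \<bar>?F h r\<bar>) \<le> (C * ?m * E) * (ker h * min 1 ((norm h)\<^sup>2))"
        unfolding absF using bF by simp
    qed
    \<comment> \<open>For fixed r the space integral is exactly the Gaussian average of second
      differences; for r \<le> 0 the indicator makes both sides 0.\<close>
    have inn: "(LBINT h. ?F h r) = 2 * g * ?D r" for r
    proof (cases "0 < r")
      case True
      have "(LBINT h. ?F h r) = (ipos r * r powr (- s - 1)) * (LBINT h. heat r h * sd ?P h x)"
        by (subst integral_mult_right_zero[symmetric]) (simp add: mult_ac)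
      then show ?thesis unfolding heat_sd_integral(2)[OF \<psi> t True] by (simp add: g_def)
    qed simp
    have "L1 (\<lambda>r. LBINT h. ?F h r)"
      by (rule lborel_pair.integrable_snd[OF pair])
    then have "L1 (\<lambda>r. (1 / (2 * g)) * (2 * g * ?D r))"
      unfolding inn by (rule integrable_mult_right)
    then have 1: "L1 ?D" using g by simp
    have "E * (LBINT h. sd ?P h x * ker h) = (LBINT h. LBINT r. ?F h r)"
      unfolding intF by (simp add: mult.left_commute[of _ E])
    also have "\<dots> = 2 * g * (LBINT r. ?D r)"
      unfolding LINT_swap[OF pair] inn by simp
    finally have 2: "E * (LBINT h. sd ?P h x * ker h) = 2 * g * (LBINT r. ?D r)" .
    have pair': "integrable lborel2 (\<lambda>(h, r). \<bar>?F h r\<bar>)"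
      using integrable_abs[OF pair] by (simp add: split_beta')
    have "(LBINT r. \<bar>2 * g * ?D r\<bar>) \<le> (LBINT r. LBINT h. \<bar>?F h r\<bar>)"
    proof (rule integral_mono)
      show "L1 (\<lambda>r. \<bar>2 * g * ?D r\<bar>)" by (intro integrable_abs integrable_mult_right 1)
      show "L1 (\<lambda>r. LBINT h. \<bar>?F h r\<bar>)" by (rule lborel_pair.integrable_snd[OF pair'])
      show "\<bar>2 * g * ?D r\<bar> \<le> (LBINT h. \<bar>?F h r\<bar>)" for r
        unfolding inn[symmetric] by (rule integral_abs_bound)
    qed
    also have "\<dots> = (LBINT h. LBINT r. \<bar>?F h r\<bar>)" by (rule LINT_swap[OF pair', symmetric])
    also have "\<dots> \<le> (LBINT h. (C * ?m * E) * (ker h * min 1 ((norm h)\<^sup>2)))"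
      using lborel_pair.integrable_fst[OF pair'] by (intro integral_mono ig) (auto simp: absF bF)
    also have "\<dots> = C * ?m * E * K" by (simp add: K_def)
    finally have "(LBINT r. \<bar>2 * g * ?D r\<bar>) \<le> C * ?m * E * K" .
    moreover have "(LBINT r. \<bar>2 * g * ?D r\<bar>) = 2 * g * (LBINT r. \<bar>?D r\<bar>)"
      using g by (simp add: abs_mult)
    ultimately have "(LBINT r. \<bar>?D r\<bar>) \<le> (C * E * K / (2 * g)) * ?m"
      using g by (simp add: field_simps)
    also have "\<dots> \<le> (C * E * K / (2 * g) + 1) * ?m" by (intro mult_right_mono) auto
    finally have 3: "(LBINT r. \<bar>?D r\<bar>) \<le> (C * E * K / (2 * g) + 1) * ?m" .
    note 1 2 3
  } note * = this
  show ?thesis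
  proof (rule that[of "C * E * K / (2 * g) + 1"])
    show "0 < C * E * K / (2 * g) + 1" using C E K0 g by (simp add: add_nonneg_pos)
  qed (use * in \<open>auto simp: E_def g_def\<close>)
qed

text \<open>The Riesz kernel is not integrable at infinity, but the compact support of \<psi>
  restricts the integral to a ball.\<close>

lemma riesz_conv_integrable:
  assumes \<psi>: "\<psi> \<in> C0_infinity"
  shows "L1 (\<lambda>z. riesz z * \<psi> (x - z))"
proof -
  note [measurable] = C0_infinity_measurable[OF \<psi>]
  obtain B where B: "0 < B" "\<And>x. \<bar>\<psi> x\<bar> \<le> B" using C0_infinity_bounded[OF \<psi>] by blast
  obtain R where R: "0 < R" "\<And>x. R < norm x \<Longrightarrow> \<psi> x = 0" using C0_infinity_support[OF \<psi>] by blast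
  define r where "r = norm x + R + 1"
  have r: "0 < r" using R by (simp add: r_def add_nonneg_pos add_pos_pos)
  show ?thesis
  proof (rule integrable_dominated)
    show "L1 (\<lambda>z. B * (riesz z * indicator (ball 0 r) z))"
      by (intro integrable_mult_right integrable_riesz_ball r)
    show "\<bar>riesz z * \<psi> (x - z)\<bar> \<le> B * (riesz z * indicator (ball 0 r) z)" for z
    proof (cases "norm z < r")
      case True
      have "\<bar>riesz z * \<psi> (x - z)\<bar> = riesz z * \<bar>\<psi> (x - z)\<bar>" by (simp add: abs_mult)
      also have "\<dots> \<le> riesz z * B" using B by (intro mult_left_mono) auto
      finally show ?thesis using True by (simp add: mult.commute)
    next
      case False
      then have "R < norm (x - z)" using norm_triangle_ineq2[of z x] by (simp add: r_def norm_minus_commute)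
      then show ?thesis using R B by simp
    qed
  qed measurable
qed

lemma riesz_conv_eq_heat:
  assumes \<psi>: "\<psi> \<in> C0_infinity"
  shows "L1 (\<lambda>t. ipos t * (t powr (s - 1) * conv (heat t) \<psi> x))"
    and "exp_kernel_integral (real DIM('a) / 2 - s) * conv riesz \<psi> x =
      (LBINT t. ipos t * (t powr (s - 1) * conv (heat t) \<psi> x))"
proof -
  note [measurable] = C0_infinity_measurable[OF \<psi>]
  define E where "E = exp_kernel_integral (real DIM('a) / 2 - s)"
  have E: "0 < E" unfolding E_def using dim_gt by (intro exp_kernel_integral_pos) simp
  let ?F = "\<lambda>z t. \<psi> (x - z) * (ipos t * (t powr (s - 1) * heat t z))"
  have ig: "L1 (\<lambda>z. E * \<bar>riesz z * \<psi> (x - z)\<bar>)"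
    by (intro integrable_mult_right integrable_abs riesz_conv_integrable \<psi>)
  have pair: "integrable lborel2 (\<lambda>(z, t). ?F z t)"
  proof (rule integrable_pair_Fubini[OF _ _ _ ig])
    show "(\<lambda>(z, t). ?F z t) \<in> borel_measurable (borel \<Otimes>\<^sub>M borel)" by measurable
    show "AE z in lborel. L1 (?F z)"
      using AE_neq_0 by eventually_elim (intro integrable_mult_right riesz_eq_heat(1))
    show "AE z in lborel. (LBINT t. \<bar>?F z t\<bar>) \<le> E * \<bar>riesz z * \<psi> (x - z)\<bar>"
      using AE_neq_0
    proof eventually_elim
      case (elim z)
      have "(LBINT t. \<bar>?F z t\<bar>) = \<bar>\<psi> (x - z)\<bar> * (LBINT t. ipos t * (t powr (s - 1) * heat t z))"
        by (simp add: abs_mult)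
      also have "\<dots> = \<bar>\<psi> (x - z)\<bar> * (E * riesz z)" by (simp only: riesz_eq_heat(2)[OF elim] E_def)
      finally show ?case by (simp add: abs_mult mult_ac)
    qed
  qed
  have inn: "(LBINT z. ?F z t) = ipos t * (t powr (s - 1) * conv (heat t) \<psi> x)" for t
    unfolding conv_def integral_mult_right_zero[symmetric] by (simp add: mult_ac)
  show "L1 (\<lambda>t. ipos t * (t powr (s - 1) * conv (heat t) \<psi> x))"
    using lborel_pair.integrable_snd[OF pair] unfolding inn .
  have "E * conv riesz \<psi> x = (LBINT z. E * (riesz z * \<psi> (x - z)))"
    by (simp add: conv_def)
  also have "\<dots> = (LBINT z. LBINT t. ?F z t)"
  proof (rule integral_cong_AE)
    show "AE z in lborel. E * (riesz z * \<psi> (x - z)) = (LBINT t. ?F z t)"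
      using AE_neq_0
    proof eventually_elim
      case (elim z)
      show ?case unfolding integral_mult_right_zero riesz_eq_heat(2)[OF elim] E_def by (simp add: mult_ac)
    qed
  qed measurable
  also have "\<dots> = (LBINT t. ipos t * (t powr (s - 1) * conv (heat t) \<psi> x))"
    unfolding LINT_swap[OF pair] inn ..
  finally show "exp_kernel_integral (real DIM('a) / 2 - s) * conv riesz \<psi> x =
      (LBINT t. ipos t * (t powr (s - 1) * conv (heat t) \<psi> x))" unfolding E_def .
qed

end

lemma borel_measurable_sd_conv_heat [measurable]:
  assumes [measurable]: "borel_fun \<psi>" "f \<in> M \<rightarrow>\<^sub>M borel" "g \<in> M \<rightarrow>\<^sub>M borel" "h \<in> M \<rightarrow>\<^sub>M borel"
  shows "(\<lambda>z. sd (conv (heat (f z)) \<psi>) (g z) (h z :: 'a::euclidean_space)) \<in> borel_measurable M"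
  unfolding sd_def by measurable

context fractional_order
begin

lemma riesz_conv_sd_eq_heat:
  assumes \<psi>: "\<psi> \<in> C0_infinity"
  shows "L1 (\<lambda>t. ipos t * (t powr (s - 1) * sd (conv (heat t) \<psi>) h x))"
    and "exp_kernel_integral (real DIM('a) / 2 - s) * sd (conv riesz \<psi>) h x =
      (LBINT t. ipos t * (t powr (s - 1) * sd (conv (heat t) \<psi>) h x))"
proof -
  let ?G = "\<lambda>y t. ipos t * (t powr (s - 1) * conv (heat t) \<psi> y)"
  note i = riesz_conv_eq_heat(1)[OF \<psi>]
  have eq: "ipos t * (t powr (s - 1) * sd (conv (heat t) \<psi>) h x) = ?G (x + h) t + ?G (x - h) t - 2 * ?G x t" for t
    by (simp add: sd_def algebra_simps)
  show "L1 (\<lambda>t. ipos t * (t powr (s - 1) * sd (conv (heat t) \<psi>) h x))"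
    unfolding eq by (intro integrable_minus integrable_plus integrable_mult_right i)
  have "(LBINT t. ?G (x + h) t + ?G (x - h) t - 2 * ?G x t) =
    (LBINT t. ?G (x + h) t) + (LBINT t. ?G (x - h) t) - 2 * (LBINT t. ?G x t)"
    by (subst integral_minus[OF integrable_plus[OF i i] integrable_mult_right[OF i]],
        subst integral_plus[OF i i], subst integral_mult_right_zero, rule refl)
  then show "exp_kernel_integral (real DIM('a) / 2 - s) * sd (conv riesz \<psi>) h x =
      (LBINT t. ipos t * (t powr (s - 1) * sd (conv (heat t) \<psi>) h x))"
    unfolding eq riesz_conv_eq_heat(2)[OF \<psi>, symmetric] by (simp add: sd_def algebra_simps)
qed

text \<open>\<open>D l\<close> is ln(1 + l). Superposing Gaussians twice expresses the left-hand
  side as a double integral over t and r of t^(s-1) r^(-s-1) times the increment of P from t to t +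
  r. In the variable l = r/t the t-integral is a Frullani integral: it sees \<psi> only through the
  value of P at time 0, a multiple of \<psi> x.\<close>

lemma riesz_conv_Lop_eq:
  assumes \<psi>: "\<psi> \<in> C0_infinity"
  defines "D \<equiv> \<lambda>l. (LBINT r. indicat_real {1..<1 + l} r / r)"
  shows "L1 (\<lambda>l. ipos l * (l powr (- s - 1) * (\<psi> x * D l)))"
    and "exp_kernel_integral (real DIM('a) / 2 - s) * exp_kernel_integral (real DIM('a) / 2 + s) * Lop (conv riesz \<psi>) x =
      2 * (gauss_mass TYPE('a))\<^sup>2 * (LBINT l. ipos l * (l powr (- s - 1) * (\<psi> x * D l)))"
proof -
  note [measurable] = C0_infinity_measurable[OF \<psi>]
  define E where "E = exp_kernel_integral (real DIM('a) / 2 - s)"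
  define E' where "E' = exp_kernel_integral (real DIM('a) / 2 + s)"
  define g where "g = gauss_mass TYPE('a)"
  have g: "0 < g" unfolding g_def by (rule gauss_mass_pos)
  let ?m = "\<lambda>t. min 1 (t powr (- (real DIM('a) / 2)))"
  let ?W = "\<lambda>t. ipos t * (t powr (s - 1) * ?m t)"
  define P where "P t = conv (heat t) \<psi> x" for t
  have [measurable]: "borel_fun P" unfolding P_def[abs_def] by measurable
  obtain C where C: "0 < C" "\<And>t x. 0 < t \<Longrightarrow> \<bar>conv (heat t) \<psi> x\<bar> \<le> C * ?m t"
    "\<And>t x h. 0 < t \<Longrightarrow> \<bar>sd (conv (heat t) \<psi>) h x\<bar> \<le> C * (min 1 ((norm h)\<^sup>2) * ?m t)"
    by (rule heat_conv_bounds[OF \<psi>]) (rule that; assumption)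
  obtain C' where C': "0 < C'"
    "\<And>t. 0 < t \<Longrightarrow> L1 (\<lambda>r. ipos r * (r powr (- s - 1) * (P (t + r) - P t)))"
    "\<And>t. 0 < t \<Longrightarrow> (LBINT r. \<bar>ipos r * (r powr (- s - 1) * (P (t + r) - P t))\<bar>) \<le> C' * ?m t"
    "\<And>t. 0 < t \<Longrightarrow> E' * (LBINT h. sd (conv (heat t) \<psi>) h x * ker h) =
       2 * g * (LBINT r. ipos r * (r powr (- s - 1) * (P (t + r) - P t)))"
    by (rule heat_Lop[OF \<psi>, of x, folded E'_def g_def P_def]) (rule that; assumption)
  let ?G = "\<lambda>h t. ker h * (ipos t * (t powr (s - 1) * sd (conv (heat t) \<psi>) h x))"
  \<comment> \<open>The bound on the second difference splits into a factor in h, integrable by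
    \<open>integrable_ker_min2\<close>, and the factor \<open>?W t\<close>, integrable by
    \<open>integrable_time_weight\<close>.\<close>
  have pair1: "integrable lborel2 (\<lambda>(h, t). ?G h t)"
  proof (rule integrable_dominated_pair)
    show "integrable lborel2 (\<lambda>(h, t). (C * (ker h * min 1 ((norm h)\<^sup>2))) * ?W t)"
      by (intro integrable_pair_times integrable_mult_right integrable_ker_min2 integrable_time_weight)
    show "\<bar>?G h t\<bar> \<le> (C * (ker h * min 1 ((norm h)\<^sup>2))) * ?W t" for h t
    proof (cases "0 < t")
      case True
      have "(ker h * t powr (s - 1)) * \<bar>sd (conv (heat t) \<psi>) h x\<bar> \<le> (ker h * t powr (s - 1)) * (C * (min 1 ((norm h)\<^sup>2) * ?m t))"
        by (intro mult_left_mono C(3)[OF True]) simp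
      then show ?thesis using True by (simp add: abs_mult mult_ac)
    qed simp
  qed measurable
  let ?R = "\<lambda>t r. ipos r * (r powr (- s - 1) * (P (t + r) - P t))"
  have "E * E' * (LBINT h. sd (conv riesz \<psi>) h x * ker h) = E' * (LBINT h. LBINT t. ?G h t)"
  proof -
    have "E * (LBINT h. sd (conv riesz \<psi>) h x * ker h) = (LBINT h. ker h * (E * sd (conv riesz \<psi>) h x))"
      by (subst integral_mult_right_zero[symmetric]) (simp add: mult_ac)
    also have "\<dots> = (LBINT h. LBINT t. ?G h t)"
      unfolding E_def riesz_conv_sd_eq_heat(2)[OF \<psi>] by (simp only: integral_mult_right_zero)
    finally show ?thesis by (simp only: mult.assoc mult.left_commute[of E])
  qed
  also have "\<dots> = (LBINT t. E' * (LBINT h. ?G h t))"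
    unfolding LINT_swap[OF pair1] by (simp only: integral_mult_right_zero)
  also have "\<dots> = (LBINT t. 2 * g * (ipos t * (t powr (s - 1) * (LBINT r. ?R t r))))"
  proof (rule lint_cong[OF refl])
    fix t
    show "E' * (LBINT h. ?G h t) = 2 * g * (ipos t * (t powr (s - 1) * (LBINT r. ?R t r)))"
    proof (cases "0 < t")
      case True
      have "(LBINT h. ?G h t) = (ipos t * t powr (s - 1)) * (LBINT h. sd (conv (heat t) \<psi>) h x * ker h)"
        by (subst integral_mult_right_zero[symmetric]) (simp add: mult_ac)
      then have "E' * (LBINT h. ?G h t) = (ipos t * t powr (s - 1)) * (E' * (LBINT h. sd (conv (heat t) \<psi>) h x * ker h))"
        by (simp only: mult_ac)
      then show ?thesis unfolding C'(4)[OF True] by (simp only: mult_ac)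
    qed simp
  qed
  also have "\<dots> = 2 * g * (LBINT t. ipos t * (t powr (s - 1) * (LBINT r. ?R t r)))"
    by (simp only: integral_mult_right_zero)
  finally have main1: "E * E' * (LBINT h. sd (conv riesz \<psi>) h x * ker h) =
    2 * g * (LBINT t. ipos t * (t powr (s - 1) * (LBINT r. ?R t r)))" .

  \<comment> \<open>Integrand after the substitution r = t l. The powers of t collapse to 1/t, as
    t^(s-1), the Jacobian t and t^(-s-1) multiply to t^(-1).\<close>
  let ?Q = "\<lambda>t l. (ipos l * l powr (- s - 1)) * (ipos t * ((P ((1 + l) * t) - P t) / t))"
  have RQ: "t powr (s - 1) * (t * ?R t (t * l)) = ?Q t l" if t: "0 < t" for t l
  proof (cases "0 < l")
    case True
    have e: "t powr (s - 1) * (t * t powr (- s - 1)) = 1 / t"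
    proof -
      have "t powr (s - 1) * t powr (- s - 1) = t powr (- 2)" by (simp add: powr_add[symmetric])
      also have "\<dots> = 1 / t\<^sup>2" using t by (simp add: powr_minus_divide)
      finally have "t powr (s - 1) * (t * t powr (- s - 1)) = t * (1 / t\<^sup>2)" by (simp only: mult.left_commute)
      then show ?thesis using t by (simp add: power2_eq_square)
    qed
    have "t powr (s - 1) * (t * ?R t (t * l)) = (t powr (s - 1) * (t * t powr (- s - 1))) * (l powr (- s - 1) * (P (t + t * l) - P t))"
      using t True by (simp add: powr_mult zero_less_mult_iff mult_ac)
    also have "\<dots> = (1 / t) * (l powr (- s - 1) * (P (t + t * l) - P t))" unfolding e ..
    finally have "t powr (s - 1) * (t * ?R t (t * l)) = (1 / t) * (l powr (- s - 1) * (P (t + t * l) - P t))" .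
    moreover have "t + t * l = (1 + l) * t" by (simp add: algebra_simps)
    ultimately have "t powr (s - 1) * (t * ?R t (t * l)) = (1 / t) * (l powr (- s - 1) * (P ((1 + l) * t) - P t))"
      by (simp only:)
    also have "\<dots> = ?Q t l" using t True by simp
    finally show ?thesis .
  next
    case False
    then show ?thesis using t by (simp add: zero_less_mult_iff)
  qed
  have Rint: "ipos t * (t powr (s - 1) * (LBINT r. ?R t r)) = (LBINT l. ?Q t l)" for t
  proof (cases "0 < t")
    case True
    have "(LBINT r. ?R t r) = t * (LBINT l. ?R t (t * l))"
      using lborel_real_scale_pos(2)[OF True C'(2)[OF True]] True by simp
    then have "ipos t * (t powr (s - 1) * (LBINT r. ?R t r)) = (LBINT l. t powr (s - 1) * (t * ?R t (t * l)))"
      using True by (simp only: integral_mult_right_zero) simp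
    then show ?thesis unfolding RQ[OF True] .
  qed simp
  \<comment> \<open>The absolute l-integral is the rescaled absolute r-integral, for which
    \<open>C'(3)\<close> gives a bound that remains integrable against t^(s-1).\<close>
  have pair2: "integrable lborel2 (\<lambda>(t, l). ?Q t l)"
  proof (rule integrable_pair_Fubini)
    show "(\<lambda>(t, l). ?Q t l) \<in> borel_measurable (borel \<Otimes>\<^sub>M borel)" by measurable
    show "AE t in lborel. L1 (?Q t)"
    proof (rule AE_I2)
      fix t
      show "L1 (?Q t)"
      proof (cases "0 < t")
        case True
        have "L1 (\<lambda>l. t powr (s - 1) * (t * ?R t (t * l)))"
          by (intro integrable_mult_right lborel_real_scale_pos(1)[OF True C'(2)[OF True]])
        then show ?thesis unfolding RQ[OF True] .
      qed simp
    qed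
    show "AE t in lborel. (LBINT l. \<bar>?Q t l\<bar>) \<le> C' * ?W t"
    proof (rule AE_I2)
      fix t
      show "(LBINT l. \<bar>?Q t l\<bar>) \<le> C' * ?W t"
      proof (cases "0 < t")
        case True
        have "(LBINT l. \<bar>?Q t l\<bar>) = (LBINT l. t powr (s - 1) * (t * \<bar>?R t (t * l)\<bar>))"
          unfolding RQ[OF True, symmetric] using True by (simp add: abs_mult)
        also have "\<dots> = t powr (s - 1) * (t * (LBINT l. \<bar>?R t (t * l)\<bar>))"
          by (simp only: integral_mult_right_zero)
        also have "\<dots> = t powr (s - 1) * (LBINT r. \<bar>?R t r\<bar>)"
          using lborel_real_scale_pos(2)[OF True integrable_abs[OF C'(2)[OF True]]] True by simp
        also have "\<dots> \<le> t powr (s - 1) * (C' * ?m t)"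
          by (intro mult_left_mono C'(3)[OF True]) simp
        finally show ?thesis using True by (simp add: mult_ac)
      qed simp
    qed
    show "L1 (\<lambda>t. C' * ?W t)" by (intro integrable_mult_right integrable_time_weight)
  qed
  obtain Cm where Cm: "\<And>t r. 0 < t \<Longrightarrow> 0 < r \<Longrightarrow> \<bar>P t - P r\<bar> \<le> Cm * \<bar>sqrt t - sqrt r\<bar>"
    "\<And>t. 0 < t \<Longrightarrow> \<bar>P t - g * \<psi> x\<bar> \<le> Cm * sqrt t"
    by (rule heat_conv_time_modulus[OF \<psi>, of x, folded P_def g_def]) (rule that; assumption)
  \<comment> \<open>Gaussian averages concentrate at x as t tends to 0; their limit is the mass
    times \<psi> x.\<close>
  have lim0: "(P \<longlongrightarrow> g * \<psi> x) (at_right 0)"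
  proof (rule LIM_zero_cancel, rule Lim_null_comparison)
    show "\<forall>\<^sub>F t in at_right 0. norm (P t - g * \<psi> x) \<le> Cm * sqrt t"
      using eventually_at_right_less[of "0::real"] by eventually_elim (use Cm in auto)
    have "((\<lambda>t. Cm * sqrt t) \<longlongrightarrow> Cm * sqrt 0) (at_right 0)" by (intro tendsto_intros)
    then show "((\<lambda>t. Cm * sqrt t) \<longlongrightarrow> 0) (at_right 0)" by simp
  qed
  have liminf: "(P \<longlongrightarrow> 0) at_top"
  proof (rule Lim_null_comparison)
    show "\<forall>\<^sub>F t in at_top. norm (P t) \<le> C * t powr (- (real DIM('a) / 2))"
      using eventually_gt_at_top[of 0]
    proof eventually_elim
      case (elim t)
      have "\<bar>P t\<bar> \<le> C * ?m t" unfolding P_def by (rule C(2)[OF elim])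
      also have "\<dots> \<le> C * t powr (- (real DIM('a) / 2))" using C(1) by (intro mult_left_mono) auto
      finally show ?case by simp
    qed
    have "((\<lambda>t. C * t powr (- (real DIM('a) / 2))) \<longlongrightarrow> C * 0) at_top"
      by (intro tendsto_mult tendsto_const tendsto_neg_powr filterlim_ident) simp
    then show "((\<lambda>t. C * t powr (- (real DIM('a) / 2))) \<longlongrightarrow> 0) at_top" by simp
  qed
  have bdP: "\<bar>P t\<bar> \<le> C" if "0 < t" for t
  proof -
    have "\<bar>P t\<bar> \<le> C * ?m t" unfolding P_def by (rule C(2)[OF that])
    also have "\<dots> \<le> C * 1" using C(1) by (intro mult_left_mono) auto
    finally show ?thesis by simp
  qed
  \<comment> \<open>Fubini grants integrability of the Frullani integrand for almost every l only.
    The minus sign arises because \<open>frullani\<close> takes the increment in the opposite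
    order.\<close>
  have inner: "AE l in lborel. (LBINT t. ?Q t l) = - (g * (ipos l * (l powr (- s - 1) * (\<psi> x * D l))))"
    using lborel_pair.AE_integrable_snd[OF pair2]
  proof eventually_elim
    case (elim l)
    show ?case
    proof (cases "0 < l")
      case True
      then have nz: "ipos l * l powr (- s - 1) \<noteq> 0" by simp
      have "L1 (\<lambda>t. inverse (- (ipos l * l powr (- s - 1))) * ?Q t l)"
        by (rule integrable_mult_right[OF elim])
      moreover have "inverse (- (ipos l * l powr (- s - 1))) * ?Q t l = ipos t * ((P t - P ((1 + l) * t)) / t)" for t
      proof -
        have 1: "inverse (- a) * (a * b) = - b" if "a \<noteq> 0" for a b :: real using that by (simp add: field_simps)
        have "- (ipos t * ((X - Y) / t)) = ipos t * ((Y - X) / t)" for X Y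
          by (simp add: diff_divide_distrib right_diff_distrib)
        then show ?thesis unfolding 1[OF nz] .
      qed
      ultimately have i: "L1 (\<lambda>t. ipos t * ((P t - P ((1 + l) * t)) / t))" by (simp only:)
      have "(LBINT t. ipos t * ((P t - P ((1 + l) * t)) / t)) = (g * \<psi> x) * D l"
        unfolding D_def by (rule frullani[OF _ bdP lim0 liminf _ i]) (use True in auto)
      moreover have "(LBINT t. ?Q t l) = - ((ipos l * l powr (- s - 1)) * (LBINT t. ipos t * ((P t - P ((1 + l) * t)) / t)))"
      proof -
        have "?Q t l = - (ipos l * l powr (- s - 1)) * (ipos t * ((P t - P ((1 + l) * t)) / t))" for t
          by (simp add: diff_divide_distrib algebra_simps)
        then have "(LBINT t. ?Q t l) = (LBINT t. - (ipos l * l powr (- s - 1)) * (ipos t * ((P t - P ((1 + l) * t)) / t)))"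
          by (simp only:)
        then show ?thesis by (simp only: integral_mult_right_zero minus_mult_left)
      qed
      ultimately show ?thesis by (simp add: mult_ac)
    qed simp
  qed
  have Dm: "(\<lambda>l. ipos l * (l powr (- s - 1) * (\<psi> x * D l))) \<in> borel_measurable lborel"
  proof -
    have "D = (\<lambda>l. LBINT r. (if 1 \<le> r \<and> r < 1 + l then 1 / r else 0))"
      unfolding D_def by (intro ext lint_cong) auto
    then have [measurable]: "borel_fun D" by (simp only:) measurable
    show ?thesis by measurable
  qed
  \<comment> \<open>Convergence of the l-integral is a by-product of Fubini; no estimate of the
    logarithm is required.\<close>
  have "L1 (\<lambda>l. LBINT t. ?Q t l)" by (rule lborel_pair.integrable_snd[OF pair2])
  then have "L1 (\<lambda>l. - (g * (ipos l * (l powr (- s - 1) * (\<psi> x * D l)))))"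
    by (rule integrable_cong_AE_imp) (use Dm inner in auto)
  then have "L1 (\<lambda>l. (- inverse g) * - (g * (ipos l * (l powr (- s - 1) * (\<psi> x * D l)))))"
    by (rule integrable_mult_right)
  then show iD: "L1 (\<lambda>l. ipos l * (l powr (- s - 1) * (\<psi> x * D l)))"
    using g by (simp add: field_simps)
  have "(LBINT t. ipos t * (t powr (s - 1) * (LBINT r. ?R t r))) = (LBINT t. LBINT l. ?Q t l)"
    unfolding Rint ..
  also have "\<dots> = (LBINT l. LBINT t. ?Q t l)" by (rule LINT_swap[OF pair2])
  also have "\<dots> = (LBINT l. - (g * (ipos l * (l powr (- s - 1) * (\<psi> x * D l)))))"
  proof (rule integral_cong_AE)
    show "(\<lambda>l. LBINT t. ?Q t l) \<in> borel_measurable lborel" by measurable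
  qed (use Dm inner in auto)
  also have "\<dots> = - (g * (LBINT l. ipos l * (l powr (- s - 1) * (\<psi> x * D l))))"
    by (simp only: Bochner_Integration.integral_minus integral_mult_right_zero)
  finally show "exp_kernel_integral (real DIM('a) / 2 - s) * exp_kernel_integral (real DIM('a) / 2 + s) * Lop (conv riesz \<psi>) x =
      2 * (gauss_mass TYPE('a))\<^sup>2 * (LBINT l. ipos l * (l powr (- s - 1) * (\<psi> x * D l)))"
    using main1 unfolding Lop_def E_def E'_def g_def by (simp add: power2_eq_square algebra_simps)
qed

text \<open>The right-hand side of \<open>riesz_conv_Lop_eq\<close> is \<psi> x times an integral
  that depends neither on \<psi> nor on x. The integrand is positive for l > 0, so this integral,
  and with it the constant, is positive.\<close>

theorem riesz_fundamental_solution: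
  obtains C where "0 < C" "\<And>\<psi> x. \<psi> \<in> C0_infinity \<Longrightarrow> Lop (conv riesz \<psi>) x = C * \<psi> x"
proof -
  define D where "D l = (LBINT r. indicat_real {1..<1 + l} r / r)" for l :: real
  let ?f = "\<lambda>l. ipos l * (l powr (- s - 1) * D l)"
  let ?E = "exp_kernel_integral (real DIM('a) / 2 - s) * exp_kernel_integral (real DIM('a) / 2 + s)"
  have E: "0 < ?E" using s_pos dim_gt by (intro mult_pos_pos exp_kernel_integral_pos) (auto simp: add_pos_pos)
  have g: "0 < gauss_mass TYPE('a)" by (rule gauss_mass_pos)
  have Dpos: "0 < D l" if l: "0 < l" for l
  proof -
    have "0 < (LBINT r. (1 / (1 + l)) * indicat_real {1..<1 + l} r)" using l by (subst integral_mult_right_zero) simp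
    also have "\<dots> \<le> D l"
      unfolding D_def
    proof (rule integral_mono)
      show "L1 (\<lambda>r. (1 / (1 + l)) * indicat_real {1..<1 + l} r)"
        using l by (intro integrable_mult_right integrable_real_indicator) auto
      show "L1 (\<lambda>r. indicat_real {1..<1 + l} r / r)"
      proof (rule integrable_dominated)
        show "L1 (indicat_real {1..<1 + l})" using l by (intro integrable_real_indicator) auto
        show "\<bar>indicat_real {1..<1 + l} r / r\<bar> \<le> indicat_real {1..<1 + l} r" for r
          by (auto simp: indicator_def divide_le_eq)
      qed measurable
      show "(1 / (1 + l)) * indicat_real {1..<1 + l} r \<le> indicat_real {1..<1 + l} r / r" for r
        using l by (auto simp: indicator_def intro!: divide_left_mono)
    qed
    finally show ?thesis .
  qed
  note L = riesz_conv_Lop_eq[folded D_def]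
  show ?thesis
  proof (cases "L1 ?f")
    case True
    define K where "K = (LBINT l. ?f l)"
    have f0: "0 \<le> ?f l" for l using Dpos[of l] by (cases "0 < l") auto
    have "K \<noteq> 0"
    proof
      assume "K = 0"
      then have "AE l in lborel. ?f l = 0"
        using integral_nonneg_eq_0_iff_AE[OF True] f0 unfolding K_def by simp
      then have "AE l in lborel. l \<le> (0::real)"
      proof eventually_elim
        case (elim l)
        then show ?case using Dpos[of l] by (cases "0 < l") auto
      qed
      then have "AE l in lborel. l \<notin> {0<..<1::real}" by eventually_elim auto
      then have "emeasure lborel {0<..<1::real} = 0"
        by (subst (asm) AE_iff_measurable[of "{0<..<1}"]) auto
      then show False by simp
    qed
    moreover have "0 \<le> K" unfolding K_def by (intro lint_nonneg f0)
    ultimately have K: "0 < K" by simp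
    have "Lop (conv riesz \<psi>) x = (2 * (gauss_mass TYPE('a))\<^sup>2 * K / ?E) * \<psi> x" if "\<psi> \<in> C0_infinity" for \<psi> x
    proof -
      have "(LBINT l. ipos l * (l powr (- s - 1) * (\<psi> x * D l))) = \<psi> x * K"
        unfolding K_def by (subst integral_mult_right_zero[symmetric]) (simp add: mult_ac)
      with L(2)[OF that, of x] have "?E * Lop (conv riesz \<psi>) x = 2 * (gauss_mass TYPE('a))\<^sup>2 * (\<psi> x * K)" by (simp only:)
      moreover have "L = (2 * G * K / e) * p" if "0 < e" "e * L = 2 * G * (p * K)" for e L G p :: real
        using that by (simp add: field_simps)
      ultimately show ?thesis using E by blast
    qed
    moreover have "0 < 2 * (gauss_mass TYPE('a))\<^sup>2 * K / ?E"
      using K g E by (intro divide_pos_pos[OF _ E] mult_pos_pos) auto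
    ultimately show ?thesis by (rule that[rotated])
  next
    \<comment> \<open>If l^(-s-1) ln(1 + l) were not integrable, \<open>L(1)\<close> would force
      every test function to vanish, and then any constant would do. This spares a direct
      integrability estimate.\<close>
    case False
    have 0: "\<psi> x = 0" if "\<psi> \<in> C0_infinity" for \<psi> and x :: 'a
    proof (rule ccontr)
      assume nz: "\<psi> x \<noteq> 0"
      have "L1 (\<lambda>l. inverse (\<psi> x) * (ipos l * (l powr (- s - 1) * (\<psi> x * D l))))"
        by (rule integrable_mult_right[OF L(1)[OF that]])
      moreover have "inverse (\<psi> x) * (ipos l * (l powr (- s - 1) * (\<psi> x * D l))) = ?f l" for l
        using nz by (simp add: field_simps)
      ultimately show False using False by simp
    qed
    have "Lop (conv riesz \<psi>) x = 1 * \<psi> x" if "\<psi> \<in> C0_infinity" for \<psi> x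
      using L(2)[OF that, of x] 0[OF that, of x] E by (auto simp: zero_less_mult_iff)
    then show ?thesis using that[of 1] by simp
  qed
qed

end

section \<open>The energy form\<close>

lemma AE_zero_if_box_integrals_zero:
  fixes W :: "'a::euclidean_space \<Rightarrow> real"
  assumes W: "L1 W"
    and 0: "\<And>a b. (LBINT x. W x * indicat_real (box a b) x) = 0"
  shows "AE x in lborel. W x = 0"
proof -
  have [measurable]: "borel_fun W" using borel_measurable_integrable[OF W] by simp
  \<comment> \<open>The positive and the negative part of W as densities. They give equal finite
    mass to every box; boxes are stable under intersection and generate the Borel sets, so the two
    measures coincide, and with them the densities almost everywhere.\<close>
  let ?M = "density lborel (\<lambda>x. ennreal (W x))" and ?N = "density lborel (\<lambda>x. ennreal (- W x))"
  let ?E = "range (\<lambda>(a, b). box a b :: 'a set)"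
  have em: "emeasure (density lborel (\<lambda>x. ennreal (f x))) (box a b) = ennreal (LBINT x. max 0 (f x) * indicat_real (box a b) x)"
    if f: "L1 f" for f a b
  proof -
    have [measurable]: "borel_fun f" using borel_measurable_integrable[OF f] by simp
    have i: "L1 (\<lambda>x. max 0 (f x) * indicat_real (box a b) x)"
      using f by (intro integrable_real_mult_indicator) auto
    have "emeasure (density lborel (\<lambda>x. ennreal (f x))) (box a b) = (\<integral>\<^sup>+x. ennreal (f x) * indicator (box a b) x \<partial>lborel)"
      by (rule emeasure_density) auto
    also have "\<dots> = (\<integral>\<^sup>+x. ennreal (max 0 (f x) * indicat_real (box a b) x) \<partial>lborel)"
      by (intro nn_integral_cong) (auto simp: indicator_def max_def ennreal_neg)
    also have "\<dots> = ennreal (LBINT x. max 0 (f x) * indicat_real (box a b) x)"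
      by (intro nn_integral_eq_integral i) auto
    finally show ?thesis .
  qed
  have eq: "emeasure ?M (box a b) = emeasure ?N (box a b)" for a b
  proof -
    have i1: "L1 (\<lambda>x. max 0 (W x) * indicat_real (box a b) x)"
      using W by (intro integrable_real_mult_indicator) auto
    have i2: "L1 (\<lambda>x. max 0 (- W x) * indicat_real (box a b) x)"
      using W by (intro integrable_real_mult_indicator) auto
    have "W x * indicat_real (box a b) x = max 0 (W x) * indicat_real (box a b) x - max 0 (- W x) * indicat_real (box a b) x" for x
      by (auto simp: max_def indicator_def)
    then have "(LBINT x. max 0 (W x) * indicat_real (box a b) x) - (LBINT x. max 0 (- W x) * indicat_real (box a b) x) = 0"
      using 0[of a b] integral_minus[OF i1 i2] by simp
    then show ?thesis using em[OF W, of a b] em[of "\<lambda>x. - W x" a b] W by simp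
  qed
  have "?M = ?N"
  proof (rule measure_eqI_generator_eq[where E="?E" and \<Omega>=UNIV and A="\<lambda>n. box (- (real n *\<^sub>R One)) (real n *\<^sub>R One)"])
    show "Int_stable ?E" by (auto simp: Int_stable_def box_Int_box)
    show "sets ?M = sigma_sets UNIV ?E" "sets ?N = sigma_sets UNIV ?E" by (simp_all add: borel_eq_box)
    show "(\<Union>n. box (- (real n *\<^sub>R One)) (real n *\<^sub>R One)) = (UNIV :: 'a set)" by (rule UN_box_eq_UNIV)
    show "emeasure ?M (box (- (real n *\<^sub>R One)) (real n *\<^sub>R One)) \<noteq> \<infinity>" for n
      using em[OF W] by simp
  qed (use eq in auto)
  then have "AE x in lborel. ennreal (W x) = ennreal (- W x)"
    by (intro sigma_finite_measure.density_unique[OF sigma_finite_lborel]) auto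
  then show ?thesis
  proof eventually_elim
    case (elim x)
    show ?case
    proof (cases "0 \<le> W x")
      case True
      then have "ennreal (W x) = 0" using elim by (simp add: ennreal_neg)
      then show ?thesis using True by (simp add: ennreal_eq_0_iff)
    next
      case False
      then have "ennreal (- W x) = 0" using elim by (simp add: ennreal_neg)
      then show ?thesis using False by (simp add: ennreal_eq_0_iff)
    qed
  qed
qed

lemma smooth_step_tendsto_1: "0 < t \<Longrightarrow> (\<lambda>n. smooth_step (real n * t)) \<longlonglongrightarrow> 1"
proof (rule tendsto_eventually)
  assume t: "0 < t"
  obtain m where m: "1 / t < real m" using reals_Archimedean2 by blast
  have "smooth_step (real n * t) = 1" if "m \<le> n" for n
  proof (rule smooth_step_1)
    have "1 / t \<le> real n" using m that by linarith
    then show "1 \<le> real n * t" using t by (simp add: divide_le_eq)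
  qed
  then show "\<forall>\<^sub>F n in sequentially. smooth_step (real n * t) = 1"
    by (intro eventually_sequentiallyI[of m])
qed

lemma fundamental_lemma_CoV:
  fixes w :: "'a::euclidean_space \<Rightarrow> real"
  assumes [measurable]: "borel_fun w"
    and int: "L1 (\<lambda>x. w x * indicat_real (ball c r) x)"
    and H: "\<And>\<psi>. \<psi> \<in> C0_infinity \<Longrightarrow> (\<And>x. x \<notin> ball c r \<Longrightarrow> \<psi> x = 0) \<Longrightarrow> (LBINT x. w x * \<psi> x) = 0"
  shows "AE x in lborel. x \<in> ball c r \<longrightarrow> w x = 0"
proof (cases "0 < r")
  case True
  let ?W = "\<lambda>x. w x * indicat_real (ball c r) x"
  have "(LBINT x. ?W x * indicat_real (box a b) x) = 0" for a b :: 'a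
  proof -
    \<comment> \<open>Smooth approximation from inside of the indicator of box and ball:
      \<open>smooth_step (real n * t)\<close> tends to 1 for t > 0 and is 0 otherwise. The ball
      enters through r^2 - |x-c|^2, which is smooth also at the centre.\<close>
    define \<psi> where "\<psi> n x = smooth_step (real n * (r\<^sup>2 - (norm (x - c))\<^sup>2)) *
      (\<Prod>i\<in>Basis. smooth_step (real n * (x \<bullet> i - a \<bullet> i)) * smooth_step (real n * (b \<bullet> i - x \<bullet> i)))" for n and x :: 'a
    have sm: "C_infinity (\<psi> n)" for n
    proof -
      have 1: "C_infinity (\<lambda>x::'a. smooth_step (real n * (r\<^sup>2 - (norm (x + - c))\<^sup>2)))"
        by (intro C_infinity_compose[OF C_infinity_smooth_step] C_infinity_mult C_infinity_const C_infinity_diff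
            C_infinity_shift[OF C_infinity_norm_square, of "- c"])
      have 2: "C_infinity (\<lambda>x::'a. \<Prod>i\<in>Basis. smooth_step (real n * (x \<bullet> i - a \<bullet> i)) * smooth_step (real n * (b \<bullet> i - x \<bullet> i)))"
        by (intro C_infinity_prod C_infinity_mult[OF C_infinity_compose C_infinity_compose] C_infinity_smooth_step
            C_infinity_mult[OF C_infinity_const] C_infinity_diff C_infinity_inner C_infinity_const)
      show ?thesis using C_infinity_mult[OF 1 2] unfolding \<psi>_def[abs_def] by simp
    qed
    have out: "\<psi> n x = 0" if "x \<notin> ball c r" for n x
    proof -
      have "r\<^sup>2 \<le> (norm (x - c))\<^sup>2" using that True by (intro power_mono) (auto simp: dist_norm norm_minus_commute)
      then have "real n * (r\<^sup>2 - (norm (x - c))\<^sup>2) \<le> 0" by (simp add: mult_nonneg_nonpos)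
      then show ?thesis by (simp add: \<psi>_def smooth_step_0)
    qed
    have C0: "\<psi> n \<in> C0_infinity" for n
    proof (rule C0_infinityI[OF sm])
      fix x :: 'a assume "norm c + r < norm x"
      then show "\<psi> n x = 0" using norm_triangle_ineq2[of x c] by (intro out) (simp add: dist_norm norm_minus_commute)
    qed
    have bd: "0 \<le> \<psi> n x" "\<psi> n x \<le> 1" for n x
    proof -
      have p: "0 \<le> (\<Prod>i\<in>Basis. smooth_step (real n * (x \<bullet> i - a \<bullet> i)) * smooth_step (real n * (b \<bullet> i - x \<bullet> i)))"
        by (intro prod_nonneg mult_nonneg_nonneg smooth_step_nonneg ballI)
      then show "0 \<le> \<psi> n x" unfolding \<psi>_def by (intro mult_nonneg_nonneg smooth_step_nonneg)
      have "(\<Prod>i\<in>Basis. smooth_step (real n * (x \<bullet> i - a \<bullet> i)) * smooth_step (real n * (b \<bullet> i - x \<bullet> i))) \<le> 1"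
        by (intro prod_le_1 conjI mult_nonneg_nonneg smooth_step_nonneg mult_le_one smooth_step_le_1)
      then show "\<psi> n x \<le> 1" unfolding \<psi>_def by (intro mult_le_one smooth_step_le_1 p)
    qed
    have lim: "(\<lambda>n. \<psi> n x) \<longlonglongrightarrow> indicat_real (ball c r) x * indicat_real (box a b) x" for x
    proof (cases "x \<in> ball c r \<and> x \<in> box a b")
      case T: True
      have 1: "0 < r\<^sup>2 - (norm (x - c))\<^sup>2"
        using T True by (simp add: dist_norm norm_minus_commute power_strict_mono)
      have "(\<lambda>n. \<psi> n x) \<longlonglongrightarrow> 1 * (\<Prod>i\<in>(Basis::'a set). 1 * 1)"
        unfolding \<psi>_def using T 1
        by (intro tendsto_mult tendsto_prod smooth_step_tendsto_1) (auto simp: box_def)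
      then show ?thesis using T by simp
    next
      case False
      have "\<psi> n x = 0" for n
      proof (cases "x \<in> ball c r")
        case True
        then have "x \<notin> box a b" using False by simp
        then obtain i where i: "i \<in> Basis" "x \<bullet> i - a \<bullet> i \<le> 0 \<or> b \<bullet> i - x \<bullet> i \<le> 0" by (force simp: box_def)
        then have "smooth_step (real n * (x \<bullet> i - a \<bullet> i)) * smooth_step (real n * (b \<bullet> i - x \<bullet> i)) = 0"
          by (auto simp: smooth_step_0 mult_nonneg_nonpos)
        then have "(\<Prod>i\<in>Basis. smooth_step (real n * (x \<bullet> i - a \<bullet> i)) * smooth_step (real n * (b \<bullet> i - x \<bullet> i))) = 0"
          using i(1) by (intro prod_zero) auto
        then show ?thesis by (simp add: \<psi>_def)
      qed (rule out)
      then show ?thesis using False by auto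
    qed
    have [measurable]: "borel_fun (\<psi> n)" for n by (rule C_infinity_measurable[OF sm])
    have "(\<lambda>n. LBINT x. w x * \<psi> n x) \<longlonglongrightarrow> (LBINT x. ?W x * indicat_real (box a b) x)"
    proof (rule integral_dominated_convergence[OF _ _ integrable_abs[OF int]])
      show "AE x in lborel. (\<lambda>n. w x * \<psi> n x) \<longlonglongrightarrow> ?W x * indicat_real (box a b) x"
      proof (rule AE_I2)
        fix x :: 'a show "(\<lambda>n. w x * \<psi> n x) \<longlonglongrightarrow> ?W x * indicat_real (box a b) x"
          unfolding mult.assoc by (intro tendsto_mult tendsto_const lim)
      qed
      show "AE x in lborel. norm (w x * \<psi> n x) \<le> \<bar>?W x\<bar>" for n
      proof (rule AE_I2)
        fix x :: 'a show "norm (w x * \<psi> n x) \<le> \<bar>?W x\<bar>"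
          using bd[of n x] out[of x n] by (cases "x \<in> ball c r") (auto simp: abs_mult mult_left_le)
      qed
    qed measurable
    moreover have "(LBINT x. w x * \<psi> n x) = 0" for n by (rule H[OF C0 out])
    ultimately show ?thesis by (simp add: LIMSEQ_const_iff)
  qed
  from AE_zero_if_box_integrals_zero[OF int this]
  show ?thesis by eventually_elim auto
next
  case False
  then have "ball c r = {}" by (intro ball_empty) simp
  then show ?thesis by (simp only: empty_iff) simp
qed

section \<open>The energy form on Borel functions\<close>

context fractional_order
begin

definition energy_density :: "('a \<Rightarrow> real) \<Rightarrow> ('a \<Rightarrow> real) \<Rightarrow> 'a \<Rightarrow> 'a \<Rightarrow> real" where
  "energy_density u v x y = (u x - u y) * (v x - v y) * ker (x - y)"

lemma borel_measurable_energy_density [measurable]: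
  assumes [measurable]: "borel_fun u" "borel_fun v"
  shows "(\<lambda>(x, y). energy_density u v x y) \<in> borel_measurable (borel \<Otimes>\<^sub>M borel)"
  unfolding energy_density_def by measurable

definition form_integrable :: "('a \<Rightarrow> real) \<Rightarrow> ('a \<Rightarrow> real) \<Rightarrow> bool" where
  "form_integrable u v \<longleftrightarrow> integrable lborel2 (\<lambda>(x, y). energy_density u v x y)"

text \<open>The energy form without its constant and over the Borel product measure;
  \<open>energy_form_eq_form\<close> is the bridge to \<open>energy_form\<close>.\<close>

definition form :: "('a \<Rightarrow> real) \<Rightarrow> ('a \<Rightarrow> real) \<Rightarrow> real" where
  "form u v = (LINT z|lborel2. (case z of (x, y) \<Rightarrow> energy_density u v x y))"

lemma form_commute: "form u v = form v u"
  and form_integrable_commute: "form_integrable u v \<longleftrightarrow> form_integrable v u"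
  by (auto simp: form_def form_integrable_def energy_density_def mult.commute)

text \<open>For fixed \<open>h\<close> this is a summation by parts: translation invariance moves both
  differences onto \<open>a\<close>.\<close>

lemma form_by_parts:
  fixes a b :: "'a \<Rightarrow> real"
  assumes [measurable]: "borel_fun a" "borel_fun b"
    and fi: "form_integrable a b"
    and ab: "\<And>h. L1 (\<lambda>x. a (x + h) * b x)"
    and pair: "integrable lborel2 (\<lambda>(h, x). b x * (sd a h x * ker h))"
  shows "form a b = (LBINT x. b x * Lop a x)"
    and "L1 (\<lambda>x. b x * Lop a x)"
proof -
  let ?F = "energy_density a b"
  have F: "integrable lborel2 (\<lambda>(x, y). ?F x y)"
    using fi unfolding form_integrable_def .
  have Fm: "(\<lambda>(x, y). ?F x y) \<in> borel_measurable (borel \<Otimes>\<^sub>M borel)" by measurable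
  have Fm1: "borel_fun (?F x)" for x unfolding energy_density_def[abs_def] by measurable
  \<comment> \<open>Coordinates (x, h) with y = x + h. For fixed x this is a translation, so
    absolute convergence is preserved and the order of integration may be changed.\<close>
  have pair': "integrable lborel2 (\<lambda>(x, h). ?F x (h + x))"
  proof (rule integrable_pairI)
    show "(\<lambda>(x, h). ?F x (h + x)) \<in> borel_measurable (borel \<Otimes>\<^sub>M borel)"
      unfolding energy_density_def by measurable
    have "(\<integral>\<^sup>+h. ennreal \<bar>?F x (h + x)\<bar> \<partial>lborel) = (\<integral>\<^sup>+y. ennreal \<bar>?F x y\<bar> \<partial>lborel)" for x
      using Fm1[of x] by (intro nn_integral_lborel_shift[of "\<lambda>y. ennreal \<bar>?F x y\<bar>"]) measurable
    then show "(\<integral>\<^sup>+x. (\<integral>\<^sup>+h. ennreal \<bar>?F x (h + x)\<bar> \<partial>lborel) \<partial>lborel) < \<infinity>"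
      using integrable_pairD[OF F] by simp
  qed
  have inner: "(LBINT x. ?F x (h + x)) = - (LBINT x. b x * (sd a h x * ker h))" for h
  proof -
    have i1: "L1 (\<lambda>x. a x * b x)" using ab[of 0] by simp
    have i2: "L1 (\<lambda>x. a (x + h) * b x)" by (rule ab)
    have i2': "L1 (\<lambda>x. a (x - h) * b x)" using ab[of "- h"] by simp
    have s1: "L1 (\<lambda>x. a (x + h) * b (x + h))" "(LBINT x. a (x + h) * b (x + h)) = (LBINT x. a x * b x)"
      using integrable_lborel_shift[OF i1, of h] integral_lborel_shift[of "\<lambda>x. a x * b x" h] by auto
    have s2: "L1 (\<lambda>x. a x * b (x + h))" "(LBINT x. a x * b (x + h)) = (LBINT x. a (x - h) * b x)"
      using integrable_lborel_shift[OF i2', of h] integral_lborel_shift[of "\<lambda>x. a (x - h) * b x" h] by auto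
    have "(LBINT x. ?F x (h + x)) = (LBINT x. ker h * (a x * b x + a (x + h) * b (x + h) - a (x + h) * b x - a x * b (x + h)))"
    proof (rule lint_cong[OF refl])
      fix x
      have "ker (x - (h + x)) = ker h" using ker_uminus[of h] by simp
      then show "?F x (h + x) = ker h * (a x * b x + a (x + h) * b (x + h) - a (x + h) * b x - a x * b (x + h))"
        by (simp add: energy_density_def add.commute algebra_simps)
    qed
    also have "\<dots> = ker h * ((LBINT x. a x * b x) + (LBINT x. a x * b x) - (LBINT x. a (x + h) * b x) - (LBINT x. a (x - h) * b x))"
      using i1 i2 s1 s2 by simp
    also have "\<dots> = - ((LBINT x. a (x + h) * b x + a (x - h) * b x - 2 * (a x * b x)) * ker h)"
    proof -
      have "(LBINT x. a (x + h) * b x + a (x - h) * b x - 2 * (a x * b x)) =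
        (LBINT x. a (x + h) * b x) + (LBINT x. a (x - h) * b x) - 2 * (LBINT x. a x * b x)"
        using i1 i2 i2' by simp
      then show ?thesis by (simp only:) (simp add: algebra_simps)
    qed
    also have "(LBINT x. a (x + h) * b x + a (x - h) * b x - 2 * (a x * b x)) * ker h = (LBINT x. (a (x + h) * b x + a (x - h) * b x - 2 * (a x * b x)) * ker h)"
      by simp
    also have "\<dots> = (LBINT x. b x * (sd a h x * ker h))"
      by (intro lint_cong) (simp_all add: sd_def algebra_simps)
    finally show ?thesis .
  qed
  have "form a b = (LBINT x. LBINT y. ?F x y)"
    unfolding form_def using lborel_pair.integral_fst[OF F] by simp
  also have "\<dots> = (LBINT x. LBINT h. ?F x (h + x))"
    using Fm1 by (intro lint_cong refl integral_lborel_shift[symmetric])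
  also have "\<dots> = (LBINT h. LBINT x. ?F x (h + x))" by (rule LINT_swap[OF pair'])
  also have "\<dots> = - (LBINT h. LBINT x. b x * (sd a h x * ker h))"
    unfolding inner by simp
  also have "\<dots> = - (LBINT x. LBINT h. b x * (sd a h x * ker h))"
    unfolding LINT_swap[OF pair] ..
  also have "\<dots> = (LBINT x. b x * Lop a x)" by (simp add: Lop_def)
  finally show "form a b = (LBINT x. b x * Lop a x)" .
  have "L1 (\<lambda>x. LBINT h. b x * (sd a h x * ker h))"
    by (rule lborel_pair.integrable_snd[OF pair])
  then have "L1 (\<lambda>x. - (LBINT h. b x * (sd a h x * ker h)))" by simp
  then show "L1 (\<lambda>x. b x * Lop a x)" by (simp add: Lop_def)
qed

text \<open>Here \<open>u\<close> is only bounded, so all differences are moved to the test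
  function. Absolute convergence rests on the L1 bound for \<open>sd \<phi> h\<close>, quadratic for
  small h and uniform for large h.\<close>

lemma form_C0_infinity:
  assumes \<phi>: "\<phi> \<in> C0_infinity" and [measurable]: "borel_fun u" and B: "\<And>x. \<bar>u x\<bar> \<le> B"
    and fi: "form_integrable u \<phi>"
  shows "form u \<phi> = (LBINT x. u x * Lop \<phi> x)"
    and "L1 (\<lambda>x. u x * Lop \<phi> x)"
proof -
  have m [measurable]: "borel_fun \<phi>" by (rule C0_infinity_measurable[OF \<phi>])
  have B0: "0 \<le> B" using B[of 0] by simp
  obtain C where C: "0 < C" "\<And>h. L1 (sd \<phi> h)"
    "\<And>h. (LBINT x. \<bar>sd \<phi> h x\<bar>) \<le> C * min 1 ((norm h)\<^sup>2)"
    by (rule C0_infinity_sd_L1[OF \<phi>]) (rule that; assumption)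
  have mu: "L1 (\<lambda>x. f x * u x)" if "L1 f" for f
  proof (rule integrable_dominated)
    show "L1 (\<lambda>x. B * \<bar>f x\<bar>)" using that by simp
    have [measurable]: "borel_fun f" using borel_measurable_integrable[OF that] by simp
    show "(\<lambda>x. f x * u x) \<in> borel_measurable lborel" by measurable
    show "\<bar>f x * u x\<bar> \<le> B * \<bar>f x\<bar>" for x
      using B0 mult_right_mono[OF B abs_ge_zero] by (simp add: abs_mult mult.commute)
  qed
  have pair: "integrable lborel2 (\<lambda>(h, x). u x * (sd \<phi> h x * ker h))"
  proof (rule integrable_pair_Fubini)
    show "(\<lambda>(h, x). u x * (sd \<phi> h x * ker h)) \<in> borel_measurable (borel \<Otimes>\<^sub>M borel)" by measurable
    have i: "L1 (\<lambda>x. u x * (sd \<phi> h x * ker h))" for h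
      using mu[OF integrable_mult_left[OF C(2)[of h], of "ker h"]] by (simp add: mult_ac)
    show "AE h in lborel. L1 (\<lambda>x. u x * (sd \<phi> h x * ker h))" by (intro AE_I2 i)
    show "AE h in lborel. (LBINT x. \<bar>u x * (sd \<phi> h x * ker h)\<bar>) \<le> (B * C) * (ker h * min 1 ((norm h)\<^sup>2))"
    proof (rule AE_I2)
      fix h
      have "(LBINT x. \<bar>u x * (sd \<phi> h x * ker h)\<bar>) \<le> (LBINT x. (B * ker h) * \<bar>sd \<phi> h x\<bar>)"
      proof (rule integral_mono)
        show "L1 (\<lambda>x. \<bar>u x * (sd \<phi> h x * ker h)\<bar>)" by (rule integrable_abs[OF i])
        show "L1 (\<lambda>x. (B * ker h) * \<bar>sd \<phi> h x\<bar>)" by (intro integrable_mult_right integrable_abs C)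
        show "\<bar>u x * (sd \<phi> h x * ker h)\<bar> \<le> (B * ker h) * \<bar>sd \<phi> h x\<bar>" for x
          using mult_right_mono[OF B, of "\<bar>sd \<phi> h x\<bar> * ker h" x] by (simp add: abs_mult mult_ac)
      qed
      also have "\<dots> = (B * ker h) * (LBINT x. \<bar>sd \<phi> h x\<bar>)" by (simp only: integral_mult_right_zero)
      also have "\<dots> \<le> (B * ker h) * (C * min 1 ((norm h)\<^sup>2))" using B0 by (intro mult_left_mono C(3)) simp
      finally show "(LBINT x. \<bar>u x * (sd \<phi> h x * ker h)\<bar>) \<le> (B * C) * (ker h * min 1 ((norm h)\<^sup>2))"
        by (simp add: mult_ac)
    qed
    show "L1 (\<lambda>h. (B * C) * (ker h * min 1 ((norm h)\<^sup>2)))"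
      by (intro integrable_mult_right integrable_ker_min2)
  qed
  have ab: "L1 (\<lambda>x. \<phi> (x + h) * u x)" for h
    by (intro mu integrable_lborel_shift C0_infinity_integrable \<phi>)
  note * = form_by_parts[OF m assms(2) _ ab pair]
  show "form u \<phi> = (LBINT x. u x * Lop \<phi> x)" "L1 (\<lambda>x. u x * Lop \<phi> x)"
    using * fi form_integrable_commute form_commute by auto
qed

end

section \<open>The parametrix\<close>

lemma pd_shift:
  assumes "C_infinity f"
  shows "pd b (\<lambda>x. f (x + c)) x = pd b f (x + c)"
proof -
  have "((\<lambda>x. f (x + c)) has_derivative (\<lambda>h. frechet_derivative f (at (x + c)) h)) (at x)"
    by (rule has_derivative_compose[where f="\<lambda>x. x + c" and f'="\<lambda>x. x"])
      (auto intro!: derivative_eq_intros C_infinity_has_derivative[OF assms])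
  from pd_eqI[OF this] show ?thesis by (simp add: pd_def)
qed

lemma pd_shift_minus: "C_infinity f \<Longrightarrow> pd b (\<lambda>x. f (x - c)) x = pd b f (x - c)"
  and C_infinity_shift_minus: "C_infinity f \<Longrightarrow> C_infinity (\<lambda>x. f (x - c))"
  using pd_shift[of f b "- c"] C_infinity_shift[of f "- c"] by simp_all

lemma pd_add: "C_infinity f \<Longrightarrow> C_infinity g \<Longrightarrow> pd b (\<lambda>x. f x + g x) x = pd b f x + pd b g x"
  using pd_eqI[OF has_derivative_add[OF C_infinity_has_derivative C_infinity_has_derivative]] by (simp add: pd_def)

lemma pd_diff: "C_infinity f \<Longrightarrow> C_infinity g \<Longrightarrow> pd b (\<lambda>x. f x - g x) x = pd b f x - pd b g x"
  using pd_eqI[OF has_derivative_diff[OF C_infinity_has_derivative C_infinity_has_derivative]] by (simp add: pd_def)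

lemma pd_cmult: "C_infinity f \<Longrightarrow> pd b (\<lambda>x. c * f x) x = c * pd b f x"
  using pd_eqI[OF has_derivative_mult_right[OF C_infinity_has_derivative]] by (simp add: pd_def)

lemma C_infinity_first_diff: "C_infinity f \<Longrightarrow> C_infinity (\<lambda>x. f (x + y) - f x)"
  by (rule C_infinity_diff[OF C_infinity_shift])

lemma C_infinity_sd: "C_infinity f \<Longrightarrow> C_infinity (sd f y)"
  unfolding sd_def[abs_def] diff_conv_add_uminus[of _ y]
  by (rule C_infinity_diff[OF C_infinity_add[OF C_infinity_shift C_infinity_shift] C_infinity_mult[OF C_infinity_const]])

lemma pd_pd_first_diff:
  assumes "C_infinity f" "b \<in> Basis" "c \<in> Basis"
  shows "pd b (pd c (\<lambda>x. f (x + y) - f x)) x = pd b (pd c f) (x + y) - pd b (pd c f) x"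
proof -
  have "pd c (\<lambda>x. f (x + y) - f x) = (\<lambda>x. pd c f (x + y) - pd c f x)"
    using assms by (simp add: fun_eq_iff pd_diff pd_shift C_infinity_shift)
  then show ?thesis
    using assms by (simp add: pd_diff pd_shift C_infinity_shift C_infinity_pd)
qed

lemma pd_pd_sd:
  assumes f: "C_infinity f" and "b \<in> Basis" "c \<in> Basis"
  shows "pd b (pd c (sd f y)) x = sd (pd b (pd c f)) y x"
proof -
  have 1: "pd i (sd g y) = sd (pd i g) y" if g: "C_infinity g" for g i
    unfolding sd_def[abs_def]
    using g by (simp add: fun_eq_iff pd_diff pd_add pd_cmult pd_shift pd_shift_minus C_infinity_shift C_infinity_shift_minus C_infinity_add C_infinity_mult)
  show ?thesis using assms by (simp add: 1 C_infinity_pd)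
qed

section \<open>The fractional Laplacian of bounded smooth functions\<close>

context fractional_order
begin

definition ker_mass :: real where
  "ker_mass = (LBINT h. ker h * min 1 ((norm h)\<^sup>2))"

lemma ker_mass_nonneg: "0 \<le> ker_mass"
  unfolding ker_mass_def by (intro lint_nonneg) simp

lemma Lop_integrable:
  assumes [measurable]: "borel_fun f" and M: "\<And>h. \<bar>sd f h w\<bar> \<le> M * min 1 ((norm h)\<^sup>2)"
  shows "L1 (\<lambda>h. sd f h w * ker h)"
proof (rule integrable_dominated)
  show "L1 (\<lambda>h. M * (ker h * min 1 ((norm h)\<^sup>2)))" by (intro integrable_mult_right integrable_ker_min2)
  show "\<bar>sd f h w * ker h\<bar> \<le> M * (ker h * min 1 ((norm h)\<^sup>2))" for h
    using mult_right_mono[OF M[of h], of "ker h"] by (simp add: abs_mult mult_ac)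
qed measurable

lemma Lop_bound:
  assumes [measurable]: "borel_fun f" and M: "\<And>h. \<bar>sd f h w\<bar> \<le> M * min 1 ((norm h)\<^sup>2)"
  shows "\<bar>Lop f w\<bar> \<le> M * ker_mass"
proof -
  have "\<bar>Lop f w\<bar> \<le> (LBINT h. M * (ker h * min 1 ((norm h)\<^sup>2)))"
    unfolding Lop_def abs_minus_cancel
  proof (rule integral_abs_bound_integral[OF Lop_integrable[OF assms]])
    show "L1 (\<lambda>h. M * (ker h * min 1 ((norm h)\<^sup>2)))" by (intro integrable_mult_right integrable_ker_min2)
    show "\<bar>sd f h w * ker h\<bar> \<le> M * (ker h * min 1 ((norm h)\<^sup>2))" for h
      using mult_right_mono[OF M[of h], of "ker h"] by (simp add: abs_mult mult_ac)
  qed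
  then show ?thesis by (simp add: ker_mass_def)
qed

text \<open>Increments with |h| \<le> 1 use the second derivatives, which are therefore needed only
  on the ball of radius R + 1; longer increments use the bound 4 \<tau> on values. The two ranges
  account for 2 N^2 and 4 in the constant.\<close>

lemma Lop_local_bound:
  assumes f: "C_infinity f" and t: "\<And>x. \<bar>f x\<bar> \<le> \<tau>" "\<And>b c z. b \<in> Basis \<Longrightarrow> c \<in> Basis \<Longrightarrow> norm z \<le> R + 1 \<Longrightarrow> \<bar>pd b (pd c f) z\<bar> \<le> \<tau>"
    and w: "norm w \<le> R"
  shows "\<bar>Lop f w\<bar> \<le> ((2 * (real DIM('a))\<^sup>2 + 4) * \<tau>) * ker_mass"
proof (rule Lop_bound[OF C_infinity_measurable[OF f]])
  fix h :: 'a
  have t0: "0 \<le> \<tau>" using t(1)[of 0] by simp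
  show "\<bar>sd f h w\<bar> \<le> ((2 * (real DIM('a))\<^sup>2 + 4) * \<tau>) * min 1 ((norm h)\<^sup>2)"
  proof (cases "norm h \<le> 1")
    case True
    then have m: "min 1 ((norm h)\<^sup>2) = (norm h)\<^sup>2" by (simp add: min_absorb2 power_le_one)
    have "\<bar>sd f h w\<bar> \<le> 2 * ((real DIM('a))\<^sup>2 * \<tau> * (norm h)\<^sup>2)"
    proof (rule C_infinity_second_difference[OF f])
      fix b c :: 'a and r :: real assume bc: "b \<in> Basis" "c \<in> Basis" and r: "r \<in> {-1..1}"
      have "norm (w + r *\<^sub>R h) \<le> norm w + \<bar>r\<bar> * norm h" by (metis norm_scaleR norm_triangle_ineq)
      also have "\<dots> \<le> R + 1 * 1" using r True w by (intro add_mono mult_mono) auto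
      finally show "\<bar>pd b (pd c f) (w + r *\<^sub>R h)\<bar> \<le> \<tau>" by (intro t(2) bc) simp
    qed
    also have "\<dots> \<le> ((2 * (real DIM('a))\<^sup>2 + 4) * \<tau>) * (norm h)\<^sup>2"
      using t0 by (simp add: algebra_simps)
    finally show ?thesis unfolding m .
  next
    case False
    then have m: "min 1 ((norm h)\<^sup>2) = 1" by (simp add: min_absorb1)
    have "\<bar>sd f h w\<bar> \<le> 4 * \<tau>" by (rule abs_sd_le[OF t(1)])
    also have "\<dots> \<le> (2 * (real DIM('a))\<^sup>2 + 4) * \<tau>" using t0 by (intro mult_right_mono) auto
    finally show ?thesis unfolding m by simp
  qed
qed

lemma Lop_first_diff:
  assumes [measurable]: "borel_fun f" and M: "\<And>h w. \<bar>sd f h w\<bar> \<le> M * min 1 ((norm h)\<^sup>2)"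
  shows "Lop (\<lambda>x. f (x + y) - f x) w = Lop f (w + y) - Lop f w"
proof -
  have e: "sd (\<lambda>x. f (x + y) - f x) h w * ker h = sd f h (w + y) * ker h - sd f h w * ker h" for h
    by (simp add: sd_def algebra_simps)
  show ?thesis unfolding Lop_def e
    by (subst integral_minus) (auto intro!: Lop_integrable[OF _ M])
qed

text \<open>Translation invariance: differences of \<open>Lop f\<close> are \<open>Lop\<close> of
  differences of \<open>f\<close>. This reduces regularity of \<open>Lop f\<close> to size
  estimates.\<close>

lemma Lop_sd:
  assumes [measurable]: "borel_fun f" and M: "\<And>h w. \<bar>sd f h w\<bar> \<le> M * min 1 ((norm h)\<^sup>2)"
  shows "Lop (sd f y) w = sd (Lop f) y w"
proof -
  have i: "L1 (\<lambda>h. sd f h v * ker h)" for v by (rule Lop_integrable[OF assms(1) M])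
  have e: "sd (sd f y) h w * ker h = sd f h (w + y) * ker h + sd f h (w - y) * ker h - 2 * (sd f h w * ker h)" for h
    by (simp add: sd_def algebra_simps)
  have "(LBINT h. sd (sd f y) h w * ker h) =
     (LBINT h. sd f h (w + y) * ker h) + (LBINT h. sd f h (w - y) * ker h) - 2 * (LBINT h. sd f h w * ker h)"
    unfolding e using i by simp
  then show ?thesis unfolding Lop_def sd_def[of "\<lambda>x. - (LBINT h. sd f h x * ker h)"] by simp
qed

text \<open>Equal to 0 for |x|^2 \<le> \<rho>^2/2 and to 1 for |x| \<ge> \<rho>; written in |x|^2
  for smoothness at the origin.\<close>

definition cutoff :: "real \<Rightarrow> 'a \<Rightarrow> real" where
  "cutoff \<rho> x = smooth_step (2 * (norm x)\<^sup>2 / \<rho>\<^sup>2 - 1)"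

definition riesz_far :: "real \<Rightarrow> 'a \<Rightarrow> real" where
  "riesz_far \<rho> x = cutoff \<rho> x * riesz x"

text \<open>The parametrix: it keeps the singularity but has compact support, so its convolution
  with a bump is again a test function.\<close>

definition riesz_near :: "real \<Rightarrow> 'a \<Rightarrow> real" where
  "riesz_near \<rho> x = (1 - cutoff \<rho> x) * riesz x"

lemma riesz_split: "riesz x = riesz_near \<rho> x + riesz_far \<rho> x"
  by (simp add: riesz_near_def riesz_far_def algebra_simps)

lemma riesz_eq_square: "riesz x = ((norm x)\<^sup>2) powr (s - real DIM('a) / 2)"
  unfolding riesz_def norm_powr_eq power2_norm_eq_inner by (simp add: diff_divide_distrib)

lemma C_infinity_riesz_far:
  assumes "0 < \<rho>" shows "C_infinity (riesz_far \<rho>)"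
proof -
  have "C_infinity (\<lambda>t. smooth_step ((2 / \<rho>\<^sup>2) * t - 1) * t powr (s - real DIM('a) / 2))"
  proof (rule C_infinity_mult_powr[of "\<rho>\<^sup>2 / 2"])
    show "C_infinity (\<lambda>t. smooth_step ((2 / \<rho>\<^sup>2) * t - 1))"
      by (intro C_infinity_compose[OF C_infinity_smooth_step] C_infinity_diff C_infinity_mult C_infinity_const C_infinity_ident_real)
    show "smooth_step ((2 / \<rho>\<^sup>2) * t - 1) = 0" if "t < \<rho>\<^sup>2 / 2" for t
      using that assms by (intro smooth_step_0) (simp add: field_simps)
  qed (use assms in simp)
  from C_infinity_compose[OF this C_infinity_norm_square] show ?thesis
    unfolding riesz_far_def[abs_def] cutoff_def riesz_eq_square by simp
qed

lemma borel_measurable_riesz_far [measurable]: "0 < \<rho> \<Longrightarrow> riesz_far \<rho> \<in> borel_measurable borel"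
  by (intro C_infinity_measurable C_infinity_riesz_far)

lemma cutoff_eq_1: "0 < \<rho> \<Longrightarrow> \<rho> \<le> norm x \<Longrightarrow> cutoff \<rho> x = 1"
  unfolding cutoff_def by (intro smooth_step_1) (simp add: field_simps power_mono)

lemma riesz_near_eq_0: "0 < \<rho> \<Longrightarrow> \<rho> \<le> norm x \<Longrightarrow> riesz_near \<rho> x = 0"
  by (simp add: riesz_near_def cutoff_eq_1)

lemma riesz_near_nonneg: "0 \<le> riesz_near \<rho> x"
  by (simp add: riesz_near_def cutoff_def smooth_step_le_1)

lemma riesz_near_le: "riesz_near \<rho> x \<le> riesz x"
  using mult_right_mono[of "1 - cutoff \<rho> x" 1 "riesz x"] by (simp add: riesz_near_def cutoff_def smooth_step_nonneg)

lemma borel_measurable_riesz_near [measurable]: "borel_fun (riesz_near \<rho>)"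
proof -
  have [measurable]: "borel_fun smooth_step" by (rule C_infinity_measurable[OF C_infinity_smooth_step])
  show ?thesis unfolding riesz_near_def cutoff_def by measurable
qed

lemma integrable_riesz_near:
  assumes "0 < \<rho>" shows "L1 (riesz_near \<rho>)"
proof (rule integrable_dominated[OF integrable_riesz_ball[OF assms]])
  show "\<bar>riesz_near \<rho> x\<bar> \<le> riesz x * indicator (ball 0 \<rho>) x" for x
    using riesz_near_eq_0[OF assms] riesz_near_nonneg riesz_near_le
    by (auto simp: indicator_def not_less)
qed simp

text \<open>On a compact set smoothness suffices. Outside, \<open>riesz_far\<close> is a pure power
  whose differences carry further negative powers of |x| \<ge> 1 and stay bounded; increments longer
  than 1 are estimated through the values.\<close>

lemma riesz_far_global_bounds:
  assumes \<rho>: "0 < \<rho>"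
  obtains C where "0 < C" "\<And>x. \<bar>riesz_far \<rho> x\<bar> \<le> C" "\<And>x y. \<bar>riesz_far \<rho> (x + y) - riesz_far \<rho> x\<bar> \<le> C * norm y"
    "\<And>x y. \<bar>sd (riesz_far \<rho>) y x\<bar> \<le> C * min 1 ((norm y)\<^sup>2)" "\<And>x y. \<bar>sd (riesz_far \<rho>) y x\<bar> \<le> C * (norm y)\<^sup>2"
proof -
  let ?S = "riesz_far \<rho>"
  define a where "a = real DIM('a) - 2 * s"
  have a: "0 < a" using dim_gt by (simp add: a_def)
  have ra: "riesz x = norm x powr (- a)" for x by (simp add: riesz_def a_def)
  \<comment> \<open>The value of the Riesz kernel at |x|^2 = \<rho>^2/2, below which the cutoff
    vanishes.\<close>
  define B where "B = (\<rho>\<^sup>2 / 2) powr (s - real DIM('a) / 2)"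
  have B: "\<bar>?S x\<bar> \<le> B" for x
  proof (cases "(norm x)\<^sup>2 \<le> \<rho>\<^sup>2 / 2")
    case True
    then have "cutoff \<rho> x = 0" unfolding cutoff_def using \<rho> by (intro smooth_step_0) (simp add: field_simps)
    then show ?thesis by (simp add: riesz_far_def B_def)
  next
    case False
    have "\<bar>?S x\<bar> \<le> 1 * riesz x"
      unfolding riesz_far_def abs_mult by (intro mult_mono) (auto simp: cutoff_def smooth_step_nonneg smooth_step_le_1)
    also have "\<dots> \<le> B" unfolding B_def riesz_eq_square using False \<rho> dim_gt
      by (simp only: mult_1) (intro powr_mono2', auto)
    finally show ?thesis .
  qed
  have B0: "0 < B" using \<rho> by (simp add: B_def)
  \<comment> \<open>For |x| > R and |y| \<le> 1 this yields |y| \<le> |x|/2, |x| \<ge> 1, and x + y,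
    x - y in the region where the cutoff is 1.\<close>
  define R where "R = 2 * (\<rho> + 1)"
  obtain C1 where C1: "0 < C1" "\<And>x h. norm x + norm h \<le> R + 1 \<Longrightarrow> \<bar>?S (x + h) - ?S x\<bar> \<le> C1 * norm h"
    "\<And>x h. norm x + norm h \<le> R + 1 \<Longrightarrow> \<bar>sd ?S h x\<bar> \<le> C1 * (norm h)\<^sup>2"
    by (rule C_infinity_local_bounds[OF C_infinity_riesz_far[OF \<rho>], of "R + 1"]) (rule that; assumption)
  define c1 where "c1 = a * 2 powr (a + 1)"
  define c2 where "c2 = 2 * (a * (a + 3) * 2 powr (a + 2))"
  have c: "0 < c1" "0 < c2" using a by (auto simp: c1_def c2_def)
  have far: "\<bar>?S (x + y) - ?S x\<bar> \<le> c1 * norm y" "\<bar>sd ?S y x\<bar> \<le> c2 * (norm y)\<^sup>2"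
    if x: "R < norm x" and y: "norm y \<le> 1" for x y
  proof -
    have y2: "norm y \<le> norm x / 2" and x0: "x \<noteq> 0" and x1: "1 \<le> norm x" using x y \<rho> by (auto simp: R_def)
    have Sr: "?S z = norm z powr (- a)" if "\<rho> \<le> norm z" for z using that \<rho> by (simp add: riesz_far_def cutoff_eq_1 ra)
    have n1: "\<rho> \<le> norm (x + y)" using norm_diff_ineq[of x y] x y \<rho> by (simp add: R_def)
    have n2: "\<rho> \<le> norm (x - y)" using norm_triangle_ineq2[of x y] x y \<rho> by (simp add: R_def)
    have n3: "\<rho> \<le> norm x" using x \<rho> by (simp add: R_def)
    have p: "norm x powr (- a - 1) \<le> 1" "norm x powr (- a - 2) \<le> 1"
      using powr_mono[of "- a - 1" 0 "norm x"] powr_mono[of "- a - 2" 0 "norm x"] x0 x1 a by auto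
    have "\<bar>?S (x + y) - ?S x\<bar> \<le> c1 * norm y * norm x powr (- a - 1)"
      using norm_powr_first_difference[OF a y2 x0] by (simp add: Sr n1 n3 c1_def)
    also have "\<dots> \<le> c1 * norm y * 1" using c p by (intro mult_left_mono) auto
    finally show "\<bar>?S (x + y) - ?S x\<bar> \<le> c1 * norm y" by simp
    have "\<bar>sd ?S y x\<bar> \<le> c2 * (norm y)\<^sup>2 * norm x powr (- a - 2)"
      using norm_powr_sd[OF a y2 x0] by (simp add: sd_def Sr n1 n2 n3 c2_def)
    also have "\<dots> \<le> c2 * (norm y)\<^sup>2 * 1" using c p by (intro mult_left_mono) auto
    finally show "\<bar>sd ?S y x\<bar> \<le> c2 * (norm y)\<^sup>2" by simp
  qed
  let ?C = "C1 + c1 + c2 + 4 * B"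
  have sq: "\<bar>sd ?S y x\<bar> \<le> ?C * min 1 ((norm y)\<^sup>2)" for x y
  proof (cases "norm y \<le> 1")
    case True
    then have m: "min 1 ((norm y)\<^sup>2) = (norm y)\<^sup>2" by (simp add: min_absorb2 power_le_one)
    have "\<bar>sd ?S y x\<bar> \<le> ?C * (norm y)\<^sup>2"
    proof (cases "norm x \<le> R")
      case T: True
      show ?thesis by (rule le_mult_right_mono[OF C1(3)]) (use T True c B0 in auto)
    next
      case False
      show ?thesis by (rule le_mult_right_mono[OF far(2)]) (use False True C1 c B0 in auto)
    qed
    then show ?thesis unfolding m .
  next
    case False
    then have m: "min 1 ((norm y)\<^sup>2) = 1" by (simp add: min_absorb1)
    have "\<bar>sd ?S y x\<bar> \<le> 4 * B" by (rule abs_sd_le[OF B])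
    then show ?thesis unfolding m using C1 c by simp
  qed
  show ?thesis
  proof (rule that[of ?C])
    show C0: "0 < ?C" using C1 c B0 by simp
    show "\<bar>?S x\<bar> \<le> ?C" for x using B[of x] B0 C1 c by linarith
    show "\<bar>sd ?S y x\<bar> \<le> ?C * min 1 ((norm y)\<^sup>2)" for x y by (rule sq)
    have "?C * min 1 ((norm y)\<^sup>2) \<le> ?C * (norm y)\<^sup>2" for y :: 'a
      using C0 by (intro mult_left_mono) auto
    then show "\<bar>sd ?S y x\<bar> \<le> ?C * (norm y)\<^sup>2" for x y using sq[of y x] order_trans by blast
    show "\<bar>?S (x + y) - ?S x\<bar> \<le> ?C * norm y" for x y
    proof (cases "norm y \<le> 1")
      case True
      show ?thesis
      proof (cases "norm x \<le> R")
        case T: True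
        show ?thesis by (rule le_mult_right_mono[OF C1(2)]) (use T True c B0 in auto)
      next
        case False
        show ?thesis by (rule le_mult_right_mono[OF far(1)]) (use False True C1 c B0 in auto)
      qed
    next
      case False
      have "\<bar>?S (x + y) - ?S x\<bar> \<le> (2 * B) * 1" using B[of x] B[of "x + y"] by linarith
      also have "\<dots> \<le> ?C * norm y" using False B0 C1 c by (intro mult_mono) auto
      finally show ?thesis .
    qed
  qed
qed

text \<open>A differenced \<open>riesz_far\<close> is again smooth, with values and local second
  derivatives of size |y| or |y|^2. So \<open>Lop_local_bound\<close> applies with \<tau> of that
  size, and commutation with differences gives the claim.\<close>

lemma Lop_riesz_far_bounds:
  assumes \<rho>: "0 < \<rho>"
  obtains C where "0 < C" "\<And>w. norm w \<le> R \<Longrightarrow> \<bar>Lop (riesz_far \<rho>) w\<bar> \<le> C"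
    "\<And>w y. norm w \<le> R \<Longrightarrow> norm y \<le> 1 \<Longrightarrow> \<bar>Lop (riesz_far \<rho>) (w + y) - Lop (riesz_far \<rho>) w\<bar> \<le> C * norm y"
    "\<And>w y. norm w \<le> R \<Longrightarrow> norm y \<le> 1 \<Longrightarrow> \<bar>sd (Lop (riesz_far \<rho>)) y w\<bar> \<le> C * (norm y)\<^sup>2"
proof -
  let ?S = "riesz_far \<rho>"
  have sm: "C_infinity ?S" by (rule C_infinity_riesz_far[OF \<rho>])
  have m: "borel_fun ?S" by (rule C_infinity_measurable[OF sm])
  obtain G where G: "0 < G" "\<And>x y. \<bar>?S (x + y) - ?S x\<bar> \<le> G * norm y"
    "\<And>x y. \<bar>sd ?S y x\<bar> \<le> G * min 1 ((norm y)\<^sup>2)" "\<And>x y. \<bar>sd ?S y x\<bar> \<le> G * (norm y)\<^sup>2"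
    by (rule riesz_far_global_bounds[OF \<rho>]) (rule that; assumption)
  \<comment> \<open>\<open>Lop_local_bound\<close> looks at the ball of radius R + 1 and increments
    have length at most 1, so R + 3 leaves room. The constants of the finitely many pairs of
    directions are summed into \<open>H\<close> below.\<close>
  have "\<forall>p\<in>Basis \<times> Basis. \<exists>C>0. (\<forall>x y. norm x + norm y \<le> R + 3 \<longrightarrow>
      \<bar>pd (fst p) (pd (snd p) ?S) (x + y) - pd (fst p) (pd (snd p) ?S) x\<bar> \<le> C * norm y \<and>
      \<bar>sd (pd (fst p) (pd (snd p) ?S)) y x\<bar> \<le> C * (norm y)\<^sup>2)"
  proof
    fix p :: "'a \<times> 'a" assume "p \<in> Basis \<times> Basis"
    then have "C_infinity (pd (fst p) (pd (snd p) ?S))" using sm by (auto intro!: C_infinity_pd)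
    then show "\<exists>C>0. (\<forall>x y. norm x + norm y \<le> R + 3 \<longrightarrow>
      \<bar>pd (fst p) (pd (snd p) ?S) (x + y) - pd (fst p) (pd (snd p) ?S) x\<bar> \<le> C * norm y \<and>
      \<bar>sd (pd (fst p) (pd (snd p) ?S)) y x\<bar> \<le> C * (norm y)\<^sup>2)"
      by (rule C_infinity_local_bounds[where R="R + 3"]) blast
  qed
  then obtain Cf where Cf: "\<And>p. p \<in> Basis \<times> Basis \<Longrightarrow> 0 < Cf p"
    "\<And>p x y. p \<in> Basis \<times> Basis \<Longrightarrow> norm x + norm y \<le> R + 3 \<Longrightarrow>
      \<bar>pd (fst p) (pd (snd p) ?S) (x + y) - pd (fst p) (pd (snd p) ?S) x\<bar> \<le> Cf p * norm y \<and>
      \<bar>sd (pd (fst p) (pd (snd p) ?S)) y x\<bar> \<le> Cf p * (norm y)\<^sup>2"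
    unfolding bchoice_iff by metis
  define H where "H = G + (\<Sum>p\<in>Basis \<times> Basis. Cf p)"
  have le: "Cf p \<le> H" if "p \<in> Basis \<times> Basis" for p
  proof -
    have "Cf p \<le> (\<Sum>p\<in>Basis \<times> Basis. Cf p)" using that Cf(1) by (intro member_le_sum) (auto intro: less_imp_le)
    then show ?thesis using G by (simp add: H_def)
  qed
  have GH: "G \<le> H" "0 < H"
    using Cf(1) G(1) sum_nonneg[of "Basis \<times> Basis" Cf] by (auto simp: H_def intro: less_imp_le add_pos_nonneg)
  have d1: "\<bar>pd b (pd c ?S) (x + y) - pd b (pd c ?S) x\<bar> \<le> H * norm y"
    and d2: "\<bar>sd (pd b (pd c ?S)) y x\<bar> \<le> H * (norm y)\<^sup>2"
    if "b \<in> Basis" "c \<in> Basis" "norm x + norm y \<le> R + 3" for b c x y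
    using Cf(2)[of "(b, c)" x y] that le[of "(b, c)"] mult_right_mono[OF le[of "(b, c)"], of "norm y"]
      mult_right_mono[OF le[of "(b, c)"], of "(norm y)\<^sup>2"] by auto
  let ?D = "(2 * (real DIM('a))\<^sup>2 + 4) * ker_mass"
  have D0: "0 \<le> ?D" using ker_mass_nonneg by simp
  show ?thesis
  proof (rule that[of "?D * H + G * ker_mass + 1"])
    show "0 < ?D * H + G * ker_mass + 1" using D0 GH G(1) ker_mass_nonneg by (intro add_nonneg_pos add_nonneg_nonneg mult_nonneg_nonneg) auto
    show "\<bar>Lop ?S w\<bar> \<le> ?D * H + G * ker_mass + 1" for w
    proof -
      have "\<bar>Lop ?S w\<bar> \<le> G * ker_mass" by (rule Lop_bound[OF m G(3)])
      moreover have "0 \<le> ?D * H" using D0 GH by simp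
      ultimately show ?thesis by linarith
    qed
    have up: "?D * H * t \<le> (?D * H + G * ker_mass + 1) * t" if "0 \<le> t" for t
      using that G(1) ker_mass_nonneg by (intro mult_right_mono) auto
    fix w y :: 'a assume w: "norm w \<le> R" and y: "norm y \<le> 1"
    have "\<bar>Lop (\<lambda>x. ?S (x + y) - ?S x) w\<bar> \<le> ((2 * (real DIM('a))\<^sup>2 + 4) * (H * norm y)) * ker_mass"
    proof (rule Lop_local_bound[OF C_infinity_first_diff[OF sm] _ _ w])
      show "\<bar>?S (x + y) - ?S x\<bar> \<le> H * norm y" for x
        using G(2)[of x y] mult_right_mono[OF GH(1), of "norm y"] by simp
      show "\<bar>pd b (pd c (\<lambda>x. ?S (x + y) - ?S x)) z\<bar> \<le> H * norm y"
        if "b \<in> Basis" "c \<in> Basis" "norm z \<le> R + 1" for b c z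
        unfolding pd_pd_first_diff[OF sm that(1,2)] using that y by (intro d1) auto
    qed
    then show "\<bar>Lop ?S (w + y) - Lop ?S w\<bar> \<le> (?D * H + G * ker_mass + 1) * norm y"
      unfolding Lop_first_diff[OF m G(3)] using up[of "norm y"] by (simp add: mult_ac)
    have "\<bar>Lop (sd ?S y) w\<bar> \<le> ((2 * (real DIM('a))\<^sup>2 + 4) * (H * (norm y)\<^sup>2)) * ker_mass"
    proof (rule Lop_local_bound[OF C_infinity_sd[OF sm] _ _ w])
      show "\<bar>sd ?S y x\<bar> \<le> H * (norm y)\<^sup>2" for x
        using G(4)[of y x] mult_right_mono[OF GH(1), of "(norm y)\<^sup>2"] by simp
      show "\<bar>pd b (pd c (sd ?S y)) z\<bar> \<le> H * (norm y)\<^sup>2"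
        if "b \<in> Basis" "c \<in> Basis" "norm z \<le> R + 1" for b c z
        unfolding pd_pd_sd[OF sm that(1,2)] using that y by (intro d2) auto
    qed
    then show "\<bar>sd (Lop ?S) y w\<bar> \<le> (?D * H + G * ker_mass + 1) * (norm y)\<^sup>2"
      unfolding Lop_sd[OF m G(3)] using up[of "(norm y)\<^sup>2"] by (simp add: mult_ac)
  qed
qed

text \<open>Off the support of \<open>riesz_near \<rho>\<close> this is
  \<open>- Lop (riesz_near \<rho>) w\<close>: the middle value is 0 and the two translates
  contribute equally, whence the factor 2.\<close>

definition far_kernel :: "real \<Rightarrow> 'a \<Rightarrow> real" where
  "far_kernel \<rho> w = 2 * (LBINT y. riesz_near \<rho> y * ker (w - y))"

text \<open>The bounds are relative to \<open>ker v\<close>, so that \<open>ker (w - y)\<close> can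
  afterwards be exchanged for \<open>ker w\<close>. At v = 0 the hypothesis forces h = 0.\<close>

lemma ker_near_bounds:
  obtains C where "0 < C" "\<And>v h. norm h \<le> norm v / 2 \<Longrightarrow> \<bar>ker (v + h) - ker v\<bar> \<le> C * norm h * (ker v / norm v)"
    "\<And>v h. norm h \<le> norm v / 2 \<Longrightarrow> \<bar>sd ker h v\<bar> \<le> C * (norm h)\<^sup>2 * (ker v / (norm v)\<^sup>2)"
proof -
  define a where "a = real DIM('a) + 2 * s"
  have a: "0 < a" using s_pos by (simp add: a_def add_pos_pos)
  have ka: "ker = (\<lambda>v. norm v powr (- a))" by (auto simp: ker_def a_def)
  define c1 where "c1 = a * 2 powr (a + 1)"
  define c2 where "c2 = 2 * (a * (a + 3) * 2 powr (a + 2))"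
  have c: "0 < c1" "0 < c2" using a by (auto simp: c1_def c2_def)
  have p1: "norm v powr (- a - 1) = ker v / norm v" if "v \<noteq> 0" for v
    using that by (simp add: ka powr_diff)
  have p2: "norm v powr (- a - 2) = ker v / (norm v)\<^sup>2" if "v \<noteq> 0" for v
    using that by (simp add: ka powr_diff)
  show ?thesis
  proof (rule that[of "c1 + c2"])
    show "0 < c1 + c2" using c by simp
    fix v h :: 'a assume h: "norm h \<le> norm v / 2"
    show "\<bar>ker (v + h) - ker v\<bar> \<le> (c1 + c2) * norm h * (ker v / norm v)"
    proof (cases "v = 0")
      case False
      have "\<bar>ker (v + h) - ker v\<bar> \<le> c1 * norm h * (ker v / norm v)"
        using norm_powr_first_difference[OF a h False] unfolding p1[OF False] by (simp add: ka c1_def)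
      then show ?thesis by (rule le_mult_right_mono) (use c in \<open>auto intro!: mult_right_mono\<close>)
    qed (use h in simp)
    show "\<bar>sd ker h v\<bar> \<le> (c1 + c2) * (norm h)\<^sup>2 * (ker v / (norm v)\<^sup>2)"
    proof (cases "v = 0")
      case False
      have "\<bar>sd ker h v\<bar> \<le> c2 * (norm h)\<^sup>2 * (ker v / (norm v)\<^sup>2)"
        using norm_powr_sd[OF a h False] unfolding p2[OF False] by (simp add: ka c2_def)
      then show ?thesis by (rule le_mult_right_mono) (use c in \<open>auto intro!: mult_right_mono\<close>)
    qed (use h in simp)
  qed
qed

lemma ker_le_scaled:
  assumes "0 < c" "v \<noteq> 0" "c * norm v \<le> norm w"
  shows "ker w \<le> c powr (- (real DIM('a) + 2 * s)) * ker v"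
proof -
  have "norm w powr (- (real DIM('a) + 2 * s)) \<le> (c * norm v) powr (- (real DIM('a) + 2 * s))"
    using assms s_pos by (intro powr_mono2') auto
  then show ?thesis using assms by (simp add: ker_def powr_mult)
qed

lemma far_kernel_integrable:
  assumes \<rho>: "0 < \<rho>" and w: "3 * \<rho> / 2 \<le> norm w"
  shows "L1 (\<lambda>y. riesz_near \<rho> y * ker (w - y))"
proof (rule integrable_dominated)
  let ?B = "(\<rho> / 2) powr (- (real DIM('a) + 2 * s))"
  show "L1 (\<lambda>y. ?B * riesz_near \<rho> y)" by (intro integrable_mult_right integrable_riesz_near \<rho>)
  show "\<bar>riesz_near \<rho> y * ker (w - y)\<bar> \<le> ?B * riesz_near \<rho> y" for y
  proof (cases "norm y < \<rho>")
    case True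
    have "\<rho> / 2 \<le> norm (w - y)" using norm_triangle_ineq2[of w y] w True by linarith
    then have "ker (w - y) \<le> ?B" unfolding ker_def using \<rho> s_pos by (intro powr_mono2') auto
    from mult_left_mono[OF this riesz_near_nonneg] show ?thesis
      using riesz_near_nonneg by (simp add: abs_mult mult.commute)
  qed (use riesz_near_eq_0[OF \<rho>] in simp)
qed measurable

text \<open>For |w| \<ge> 2 \<rho> and y in the support of \<open>riesz_near\<close>, the distance
  |w - y| is at least \<rho> and at least |w|/2: no singularity is met, and
  \<open>ker (w - y)\<close> is bounded by a multiple of \<open>ker w\<close>. The factor
  \<open>ker w\<close> makes the bounds integrable at infinity.\<close>

lemma far_kernel_bounds:
  assumes \<rho>: "0 < \<rho>"
  obtains C where "0 < C" "\<And>w. 2 * \<rho> \<le> norm w \<Longrightarrow> \<bar>far_kernel \<rho> w\<bar> \<le> C * ker w"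
    "\<And>w h. 2 * \<rho> \<le> norm w \<Longrightarrow> norm h \<le> \<rho> / 2 \<Longrightarrow> \<bar>far_kernel \<rho> (w + h) - far_kernel \<rho> w\<bar> \<le> C * norm h * ker w"
    "\<And>w h. 2 * \<rho> \<le> norm w \<Longrightarrow> norm h \<le> \<rho> / 2 \<Longrightarrow> \<bar>sd (far_kernel \<rho>) h w\<bar> \<le> C * (norm h)\<^sup>2 * ker w"
proof -
  let ?K = "riesz_near \<rho>"
  define J where "J = (LBINT y. ?K y)"
  have J0: "0 \<le> J" unfolding J_def by (intro lint_nonneg riesz_near_nonneg)
  obtain c where c: "0 < c" "\<And>v h. norm h \<le> norm v / 2 \<Longrightarrow> \<bar>ker (v + h) - ker v\<bar> \<le> c * norm h * (ker v / norm v)"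
    "\<And>v h. norm h \<le> norm v / 2 \<Longrightarrow> \<bar>sd ker h v\<bar> \<le> c * (norm h)\<^sup>2 * (ker v / (norm v)\<^sup>2)"
    by (rule ker_near_bounds) (rule that; assumption)
  define d where "d = (1 / 2) powr (- (real DIM('a) + 2 * s))"
  have d: "0 < d" by (simp add: d_def)
  have geo: "\<rho> \<le> norm (w - y) \<and> ker (w - y) \<le> d * ker w" if "2 * \<rho> \<le> norm w" "norm y < \<rho>" for w y
  proof -
    have n: "1 / 2 * norm w \<le> norm (w - y)" using norm_triangle_ineq2[of w y] that by linarith
    moreover have "w \<noteq> 0" using that \<rho> by auto
    ultimately have "ker (w - y) \<le> d * ker w" unfolding d_def by (intro ker_le_scaled) auto
    then show ?thesis using n that by linarith
  qed
  have gen: "\<bar>2 * (LBINT y. ?K y * f y)\<bar> \<le> 2 * J * m"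
    if i: "L1 (\<lambda>y. ?K y * f y)" and m: "\<And>y. norm y < \<rho> \<Longrightarrow> \<bar>f y\<bar> \<le> m" for f m
  proof -
    have "\<bar>LBINT y. ?K y * f y\<bar> \<le> (LBINT y. ?K y * m)"
    proof (rule integral_abs_bound_integral[OF i])
      show "L1 (\<lambda>y. ?K y * m)" by (intro integrable_mult_left integrable_riesz_near \<rho>)
      show "\<bar>?K y * f y\<bar> \<le> ?K y * m" for y
        using m[of y] riesz_near_nonneg riesz_near_eq_0[OF \<rho>] by (cases "norm y < \<rho>") (auto simp: abs_mult intro!: mult_left_mono)
    qed
    then show ?thesis by (simp add: J_def)
  qed
  let ?C = "2 * J * d + 2 * J * c * d / \<rho> + 2 * J * c * d / \<rho>\<^sup>2 + 1"
  have nn: "0 \<le> 2 * J * d" "0 \<le> 2 * J * c * d / \<rho>" "0 \<le> 2 * J * c * d / \<rho>\<^sup>2"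
    using J0 c(1) d \<rho> by auto
  have i: "L1 (\<lambda>y. ?K y * ker (w - y))" if "3 * \<rho> / 2 \<le> norm w" for w
    by (rule far_kernel_integrable[OF \<rho> that])
  show ?thesis
  proof (rule that[of ?C])
    show "0 < ?C" using nn by linarith
    fix w :: 'a assume w: "2 * \<rho> \<le> norm w"
    have w0: "3 * \<rho> / 2 \<le> norm w" using w \<rho> by linarith
    have "\<bar>far_kernel \<rho> w\<bar> \<le> 2 * J * (d * ker w)"
      unfolding far_kernel_def using geo[OF w] by (intro gen i w0) auto
    also have "\<dots> = (2 * J * d) * ker w" by simp
    also have "\<dots> \<le> ?C * ker w" using nn by (intro mult_right_mono) auto
    finally show "\<bar>far_kernel \<rho> w\<bar> \<le> ?C * ker w" .
    fix h :: 'a assume h: "norm h \<le> \<rho> / 2"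
    have w1: "3 * \<rho> / 2 \<le> norm (w + h)" using norm_diff_ineq[of w h] w h by linarith
    have w2: "3 * \<rho> / 2 \<le> norm (w - h)" using norm_triangle_ineq2[of w h] w h by linarith
    have "far_kernel \<rho> (w + h) - far_kernel \<rho> w = 2 * (LBINT y. ?K y * ker ((w + h) - y) - ?K y * ker (w - y))"
      unfolding far_kernel_def by (subst integral_minus[OF i[OF w1] i[OF w0]]) simp
    also have "\<dots> = 2 * (LBINT y. ?K y * (ker ((w - y) + h) - ker (w - y)))"
      by (simp add: algebra_simps)
    finally have e1: "far_kernel \<rho> (w + h) - far_kernel \<rho> w = 2 * (LBINT y. ?K y * (ker ((w - y) + h) - ker (w - y)))" .
    have "\<bar>far_kernel \<rho> (w + h) - far_kernel \<rho> w\<bar> \<le> 2 * J * (c * norm h * (d * ker w / \<rho>))"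
      unfolding e1
    proof (rule gen)
      have "L1 (\<lambda>y. ?K y * ker ((w + h) - y) - ?K y * ker (w - y))"
        by (rule integrable_minus[OF i[OF w1] i[OF w0]])
      then show "L1 (\<lambda>y. ?K y * (ker ((w - y) + h) - ker (w - y)))" by (simp add: algebra_simps)
      fix y :: 'a assume y: "norm y < \<rho>"
      note g = geo[OF w y]
      have "\<bar>ker ((w - y) + h) - ker (w - y)\<bar> \<le> c * norm h * (ker (w - y) / norm (w - y))"
        using g h by (intro c(2)) linarith
      also have "\<dots> \<le> c * norm h * (d * ker w / \<rho>)"
        using g \<rho> c(1) d by (intro mult_left_mono frac_le) auto
      finally show "\<bar>ker ((w - y) + h) - ker (w - y)\<bar> \<le> c * norm h * (d * ker w / \<rho>)" .
    qed
    also have "\<dots> = (2 * J * c * d / \<rho>) * (norm h * ker w)" by simp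
    also have "\<dots> \<le> ?C * (norm h * ker w)" using nn by (intro mult_right_mono) auto
    finally show "\<bar>far_kernel \<rho> (w + h) - far_kernel \<rho> w\<bar> \<le> ?C * norm h * ker w" by (simp only: mult.assoc)
    have eq2: "?K y * ker ((w + h) - y) + ?K y * ker ((w - h) - y) - 2 * (?K y * ker (w - y)) = ?K y * sd ker h (w - y)" for y
      by (simp add: sd_def algebra_simps)
    have "sd (far_kernel \<rho>) h w = 2 * (LBINT y. ?K y * ker ((w + h) - y) + ?K y * ker ((w - h) - y) - 2 * (?K y * ker (w - y)))"
      unfolding sd_def far_kernel_def using i[OF w0] i[OF w1] i[OF w2] by simp
    then have e2: "sd (far_kernel \<rho>) h w = 2 * (LBINT y. ?K y * sd ker h (w - y))" unfolding eq2 .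
    have "\<bar>sd (far_kernel \<rho>) h w\<bar> \<le> 2 * J * (c * (norm h)\<^sup>2 * (d * ker w / \<rho>\<^sup>2))"
      unfolding e2
    proof (rule gen)
      have "L1 (\<lambda>y. ?K y * ker ((w + h) - y) + ?K y * ker ((w - h) - y) - 2 * (?K y * ker (w - y)))"
        using i[OF w0] i[OF w1] i[OF w2] by simp
      then show "L1 (\<lambda>y. ?K y * sd ker h (w - y))" unfolding eq2 .
      fix y :: 'a assume y: "norm y < \<rho>"
      note g = geo[OF w y]
      have "\<bar>sd ker h (w - y)\<bar> \<le> c * (norm h)\<^sup>2 * (ker (w - y) / (norm (w - y))\<^sup>2)"
        using g h by (intro c(3)) linarith
      also have "\<dots> \<le> c * (norm h)\<^sup>2 * (d * ker w / \<rho>\<^sup>2)"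
        using g \<rho> c(1) d by (intro mult_left_mono frac_le power_mono) auto
      finally show "\<bar>sd ker h (w - y)\<bar> \<le> c * (norm h)\<^sup>2 * (d * ker w / \<rho>\<^sup>2)" .
    qed
    also have "\<dots> = (2 * J * c * d / \<rho>\<^sup>2) * ((norm h)\<^sup>2 * ker w)" by simp
    also have "\<dots> \<le> ?C * ((norm h)\<^sup>2 * ker w)" using nn by (intro mult_right_mono) auto
    finally show "\<bar>sd (far_kernel \<rho>) h w\<bar> \<le> ?C * (norm h)\<^sup>2 * ker w" by (simp only: mult.assoc)
  qed
qed

end

lemma conv_commute:
  fixes K f :: "'a::euclidean_space \<Rightarrow> real"
  assumes [measurable]: "borel_fun K" "borel_fun f"
  shows "conv K f x = conv f K x"
  unfolding conv_def using integral_lborel_reflect[of "\<lambda>z. K z * f (x - z)" x] by (simp add: mult.commute)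

section \<open>Hoelder estimates in the mean for the Riesz kernel\<close>

context fractional_order
begin

lemma riesz_le_powr:
  assumes "norm v \<le> R" "0 \<le> e"
  shows "riesz v \<le> R powr e * norm v powr (- (real DIM('a) - 2 * s + e))"
proof -
  have "riesz v = norm v powr e * norm v powr (- (real DIM('a) - 2 * s + e))"
    unfolding riesz_def powr_add[symmetric] by (simp add: algebra_simps)
  also have "\<dots> \<le> R powr e * norm v powr (- (real DIM('a) - 2 * s + e))"
    using assms by (intro mult_right_mono powr_mono2) auto
  finally show ?thesis .
qed

text \<open>Interpolation: surplus powers of the smaller quantity are exchanged for powers of the
  larger one.\<close>

lemma powr_split_le:
  assumes "0 < r" "r \<le> (t::real)" "0 \<le> e - d"
  shows "r powr e * t powr c \<le> r powr d * t powr (c + (e - d))"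
proof -
  have "r powr e * t powr c = r powr d * (r powr (e - d) * t powr c)"
    using assms by (simp add: powr_diff)
  also have "\<dots> \<le> r powr d * (t powr (e - d) * t powr c)"
    using assms by (intro mult_left_mono mult_right_mono powr_mono2) auto
  finally show ?thesis by (simp add: powr_add mult.commute)
qed

text \<open>If |h| \<le> |w|/2, the mean value bound is interpolated down to |h|^\<beta>. Otherwise
  both points lie within 3 |h| of the origin, and the values themselves are small enough. The
  resulting power of the norm is locally integrable as long as \<beta> < 2s.\<close>

lemma riesz_first_difference:
  assumes \<beta>: "0 < \<beta>" "\<beta> \<le> 1"
  obtains C where "0 < C" "\<And>w h. \<bar>riesz (w + h) - riesz w\<bar> \<le>
    C * norm h powr \<beta> * (norm w powr (- (real DIM('a) - 2 * s + \<beta>)) + norm (w + h) powr (- (real DIM('a) - 2 * s + \<beta>)))"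
proof -
  define a where "a = real DIM('a) - 2 * s"
  have a: "0 < a" using dim_gt by (simp add: a_def)
  define c where "c = a * 2 powr (a + 1)"
  have c: "0 < c" using a by (simp add: c_def)
  show ?thesis
  proof (rule that[of "c + 3 powr \<beta>"])
    show "0 < c + 3 powr \<beta>" using c by (simp add: add_pos_pos)
    fix w h :: 'a
    let ?p = "\<lambda>v::'a. norm v powr (- (real DIM('a) - 2 * s + \<beta>))"
    show "\<bar>riesz (w + h) - riesz w\<bar> \<le> (c + 3 powr \<beta>) * norm h powr \<beta> * (?p w + ?p (w + h))"
    proof (cases "norm h \<le> norm w / 2 \<and> w \<noteq> 0")
      case True
      show ?thesis
      proof (cases "h = 0")
        case False
        have "\<bar>riesz (w + h) - riesz w\<bar> \<le> c * (norm h powr 1 * norm w powr (- a - 1))"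
          using norm_powr_first_difference[OF a, of h w] True by (simp add: riesz_def a_def c_def)
        also have "\<dots> \<le> c * (norm h powr \<beta> * norm w powr (- a - 1 + (1 - \<beta>)))"
        proof -
          have "norm h \<le> norm w" using True norm_ge_zero[of h] by linarith
          then show ?thesis using c False \<beta> by (intro mult_left_mono powr_split_le) auto
        qed
        also have "norm w powr (- a - 1 + (1 - \<beta>)) = ?p w"
          by (simp add: a_def algebra_simps)
        also have "c * (norm h powr \<beta> * ?p w) \<le> (c + 3 powr \<beta>) * (norm h powr \<beta> * (?p w + ?p (w + h)))"
          using c by (intro mult_mono mult_left_mono) auto
        finally show ?thesis by (simp only: mult.assoc)
      qed simp
    next
      case False
      then have w: "norm w \<le> 2 * norm h" by auto
      have b: "riesz v \<le> (3 * norm h) powr \<beta> * ?p v" if "norm v \<le> 3 * norm h" for v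
        using riesz_le_powr[OF that, of \<beta>] \<beta> by simp
      have "norm (w + h) \<le> 3 * norm h" using norm_triangle_ineq[of w h] w by linarith
      then have 1: "riesz (w + h) \<le> (3 * norm h) powr \<beta> * ?p (w + h)" by (rule b)
      have 2: "riesz w \<le> (3 * norm h) powr \<beta> * ?p w" using w norm_ge_zero[of h] by (intro b) linarith
      have "\<bar>riesz (w + h) - riesz w\<bar> \<le> riesz (w + h) + riesz w"
        using riesz_nonneg[of w] riesz_nonneg[of "w + h"] by linarith
      also have "\<dots> \<le> (3 * norm h) powr \<beta> * ?p (w + h) + (3 * norm h) powr \<beta> * ?p w" by (rule add_mono[OF 1 2])
      also have "\<dots> = 3 powr \<beta> * (norm h powr \<beta> * (?p w + ?p (w + h)))"
        by (simp add: powr_mult algebra_simps)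
      also have "\<dots> \<le> (c + 3 powr \<beta>) * (norm h powr \<beta> * (?p w + ?p (w + h)))"
        using c by (intro mult_right_mono) auto
      finally show ?thesis by (simp only: mult.assoc)
    qed
  qed
qed

text \<open>The weight |w|^\<alpha> stands for the Hoelder modulus of the right-hand side. It
  softens the singularity, so that the power of |h| may go up to any \<gamma> < 2s + \<alpha> with
  the remaining singularity still locally integrable.\<close>

lemma riesz_sd_weighted:
  assumes \<alpha>: "0 < \<alpha>" "\<alpha> \<le> \<gamma>" "\<gamma> \<le> 2"
  obtains C where "0 < C" "\<And>w h. \<bar>sd riesz h w\<bar> * norm w powr \<alpha> \<le>
    C * norm h powr \<gamma> * (norm w powr (- (real DIM('a) - 2 * s + (\<gamma> - \<alpha>))) +
      norm (w + h) powr (- (real DIM('a) - 2 * s + (\<gamma> - \<alpha>))) + norm (w - h) powr (- (real DIM('a) - 2 * s + (\<gamma> - \<alpha>))))"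
proof -
  define a where "a = real DIM('a) - 2 * s"
  have a: "0 < a" using dim_gt by (simp add: a_def)
  define c where "c = 2 * (a * (a + 3) * 2 powr (a + 2))"
  have c: "0 < c" using a by (simp add: c_def)
  \<comment> \<open>For |w| \<le> 2 |h| all three points lie within 3 |h| of the origin, which gives
    3^(\<gamma>-\<alpha>), and the weight is at most (2 |h|)^\<alpha>. The leading 2 is the
    coefficient of the middle value.\<close>
  define d where "d = 2 * (3 powr (\<gamma> - \<alpha>) * 2 powr \<alpha>)"
  have d: "0 < d" by (simp add: d_def)
  show ?thesis
  proof (rule that[of "c + d"])
    show "0 < c + d" using c d by simp
    fix w h :: 'a
    let ?p = "\<lambda>v::'a. norm v powr (- (real DIM('a) - 2 * s + (\<gamma> - \<alpha>)))"
    show "\<bar>sd riesz h w\<bar> * norm w powr \<alpha> \<le> (c + d) * norm h powr \<gamma> * (?p w + ?p (w + h) + ?p (w - h))"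
    proof (cases "norm h \<le> norm w / 2 \<and> w \<noteq> 0")
      case True
      show ?thesis
      proof (cases "h = 0")
        case False
        have "riesz = (\<lambda>x. norm x powr (- a))" by (auto simp: riesz_def a_def)
        then have "\<bar>sd riesz h w\<bar> \<le> c * (norm h powr 2 * norm w powr (- a - 2))"
          using norm_powr_sd[OF a, of h w] True False by (simp add: c_def)
        also have "\<dots> \<le> c * (norm h powr \<gamma> * norm w powr (- a - 2 + (2 - \<gamma>)))"
        proof -
          have "norm h \<le> norm w" using True norm_ge_zero[of h] by linarith
          then show ?thesis using c False \<alpha> by (intro mult_left_mono powr_split_le) auto
        qed
        finally have "\<bar>sd riesz h w\<bar> * norm w powr \<alpha> \<le> c * (norm h powr \<gamma> * norm w powr (- a - 2 + (2 - \<gamma>))) * norm w powr \<alpha>"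
          by (rule mult_right_mono) simp
        also have "\<dots> = c * (norm h powr \<gamma> * ?p w)"
          unfolding mult.assoc powr_add[symmetric] by (simp add: a_def algebra_simps)
        also have "\<dots> \<le> (c + d) * (norm h powr \<gamma> * (?p w + ?p (w + h) + ?p (w - h)))"
          using c d by (intro mult_mono mult_left_mono) auto
        finally show ?thesis by (simp only: mult.assoc)
      qed simp
    next
      case False
      then have w: "norm w \<le> 2 * norm h" by auto
      have b: "riesz v \<le> (3 * norm h) powr (\<gamma> - \<alpha>) * ?p v" if "norm v \<le> 3 * norm h" for v
        using riesz_le_powr[OF that, of "\<gamma> - \<alpha>"] \<alpha> by simp
      have n: "norm (w + h) \<le> 3 * norm h" "norm (w - h) \<le> 3 * norm h"
        using norm_triangle_ineq[of w h] norm_triangle_ineq4[of w h] w by linarith+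
      have 1: "riesz (w + h) \<le> (3 * norm h) powr (\<gamma> - \<alpha>) * ?p (w + h)" "riesz (w - h) \<le> (3 * norm h) powr (\<gamma> - \<alpha>) * ?p (w - h)"
        by (rule b[OF n(1)], rule b[OF n(2)])
      have 2: "riesz w \<le> (3 * norm h) powr (\<gamma> - \<alpha>) * ?p w" using w norm_ge_zero[of h] by (intro b) linarith
      let ?e = "(3 * norm h) powr (\<gamma> - \<alpha>)"
      have "\<bar>sd riesz h w\<bar> \<le> riesz (w + h) + riesz (w - h) + 2 * riesz w"
        using riesz_nonneg[of w] riesz_nonneg[of "w + h"] riesz_nonneg[of "w - h"] unfolding sd_def by linarith
      also have "\<dots> \<le> ?e * ?p (w + h) + ?e * ?p (w - h) + 2 * (?e * ?p w)" using 1 2 by linarith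
      also have "\<dots> \<le> 2 * ?e * (?p w + ?p (w + h) + ?p (w - h))" by (simp add: distrib_left)
      finally have "\<bar>sd riesz h w\<bar> * norm w powr \<alpha> \<le> (2 * ?e * (?p w + ?p (w + h) + ?p (w - h))) * (2 * norm h) powr \<alpha>"
        using w \<alpha> by (intro mult_mono powr_mono2) auto
      also have "\<dots> = d * (norm h powr \<gamma> * (?p w + ?p (w + h) + ?p (w - h)))"
      proof -
        have "norm h powr \<gamma> = norm h powr (\<gamma> - \<alpha>) * norm h powr \<alpha>" unfolding powr_add[symmetric] by simp
        then show ?thesis by (simp add: d_def powr_mult mult_ac)
      qed
      also have "\<dots> \<le> (c + d) * (norm h powr \<gamma> * (?p w + ?p (w + h) + ?p (w - h)))"
        using c by (intro mult_right_mono) auto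
      finally show ?thesis by (simp only: mult.assoc)
    qed
  qed
qed

lemma integrable_norm_powr_shift:
  assumes b: "b < real DIM('a)" and R: "0 < R"
  shows "L1 (\<lambda>w::'a. norm (w + h) powr (- b) * indicat_real (ball 0 R) (w + h))"
    and "(LBINT w. norm (w + h) powr (- b) * indicat_real (ball 0 R) (w + h)) =
      (LBINT w. norm (w::'a) powr (- b) * indicat_real (ball 0 R) w)"
  using integrable_lborel_shift[OF integrable_norm_powr_ball[OF assms], of h]
    integral_lborel_shift[of "\<lambda>w::'a. norm w powr (- b) * indicat_real (ball 0 R) w" h] by auto

lemma integrable_cball_const: "L1 (\<lambda>w::'a. c * indicat_real (ball x R) w)"
proof (cases "0 \<le> R")
  case True
  then show ?thesis by (intro integrable_mult_right integrable_real_indicator) (auto simp: emeasure_ball)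
next
  case False
  then have "ball x R = {}" by (intro ball_empty) simp
  show ?thesis unfolding \<open>ball x R = {}\<close> by simp
qed

text \<open>\<open>riesz_near\<close> is the Riesz kernel minus a Lipschitz function, and for |h|
  \<le> \<rho> the difference lives in the ball of radius 2 \<rho>; there the pointwise bound is
  integrated, which needs \<beta> < 2s.\<close>

lemma riesz_near_first_difference:
  assumes \<rho>: "0 < \<rho>" and \<beta>: "0 < \<beta>" "\<beta> \<le> 1" "\<beta> < 2 * s"
  obtains C where "0 < C" "\<And>h. norm h \<le> \<rho> \<Longrightarrow>
    (LBINT w. \<bar>riesz_near \<rho> (w + h) - riesz_near \<rho> w\<bar>) \<le> C * norm h powr \<beta>"
proof -
  define b where "b = real DIM('a) - 2 * s + \<beta>"
  have b: "b < real DIM('a)" using \<beta> by (simp add: b_def)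
  obtain C1 where C1: "0 < C1" "\<And>w h. \<bar>riesz (w + h) - riesz w\<bar> \<le>
    C1 * norm h powr \<beta> * (norm w powr (- b) + norm (w + h) powr (- b))"
    by (rule riesz_first_difference[OF \<beta>(1,2), folded b_def]) (rule that; assumption)
  obtain C2 where C2: "0 < C2" "\<And>x y. \<bar>riesz_far \<rho> (x + y) - riesz_far \<rho> x\<bar> \<le> C2 * norm y"
    by (rule riesz_far_global_bounds[OF \<rho>]) (rule that; assumption)
  have R: "0 < 3 * \<rho>" using \<rho> by simp
  let ?P = "\<lambda>w. norm w powr (- b) * indicat_real (ball 0 (3 * \<rho>)) (w::'a)"
  define J where "J = (LBINT w. ?P w)"
  define V where "V = (LBINT w. indicat_real (ball 0 (2 * \<rho>)) (w::'a))"
  have JV: "0 \<le> J" "0 \<le> V" unfolding J_def V_def by (auto intro!: lint_nonneg)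
  show ?thesis
  proof (rule that[of "C1 * (2 * J) + C2 * \<rho> powr (1 - \<beta>) * V + 1"])
    show "0 < C1 * (2 * J) + C2 * \<rho> powr (1 - \<beta>) * V + 1" using C1 C2 JV by (intro add_nonneg_pos add_nonneg_nonneg) auto
    fix h :: 'a assume h: "norm h \<le> \<rho>"
    let ?k = "norm h powr \<beta>"
    \<comment> \<open>Brings the Lipschitz contribution of the smooth part to the common order
      |h|^\<beta>.\<close>
    have h1: "norm h \<le> \<rho> powr (1 - \<beta>) * ?k"
    proof (cases "h = 0")
      case False
      have "norm h = norm h powr (1 - \<beta>) * norm h powr \<beta>" unfolding powr_add[symmetric] using False by simp
      also have "\<dots> \<le> \<rho> powr (1 - \<beta>) * ?k" using h \<beta> by (intro mult_right_mono powr_mono2) auto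
      finally show ?thesis .
    qed simp
    let ?D = "\<lambda>w. (C1 * ?k) * (?P w + ?P (w + h)) + (C2 * \<rho> powr (1 - \<beta>) * ?k) * indicat_real (ball 0 (2 * \<rho>)) w"
    have iP: "L1 ?P" by (rule integrable_norm_powr_ball[OF b R])
    have iD: "L1 ?D"
      by (intro integrable_plus integrable_mult_right[where c="C1 * ?k"] iP integrable_norm_powr_shift b R integrable_cball_const)
    have in': "L1 (\<lambda>w. riesz_near \<rho> (w + h) - riesz_near \<rho> w)"
      by (intro integrable_minus integrable_lborel_shift integrable_riesz_near \<rho>)
    have "(LBINT w. \<bar>riesz_near \<rho> (w + h) - riesz_near \<rho> w\<bar>) \<le> (LBINT w. ?D w)"
    proof (rule integral_mono[OF integrable_abs[OF in'] iD])
      fix w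
      show "\<bar>riesz_near \<rho> (w + h) - riesz_near \<rho> w\<bar> \<le> ?D w"
      proof (cases "norm w < 2 * \<rho>")
        case True
        have "norm (w + h) < 3 * \<rho>" using norm_triangle_ineq[of w h] True h by linarith
        moreover have "norm w < 3 * \<rho>" using True \<rho> by linarith
        moreover have "\<bar>riesz_near \<rho> (w + h) - riesz_near \<rho> w\<bar> \<le> \<bar>riesz (w + h) - riesz w\<bar> + \<bar>riesz_far \<rho> (w + h) - riesz_far \<rho> w\<bar>"
          using riesz_split[of "w + h" \<rho>] riesz_split[of w \<rho>] by linarith
        moreover have "C2 * norm h \<le> C2 * \<rho> powr (1 - \<beta>) * ?k" using mult_left_mono[OF h1, of C2] C2(1) by (simp add: mult.assoc)
        ultimately show ?thesis using C1(2)[of w h] C2(2)[of w h] True by (simp add: indicator_def)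
      next
        case False
        have "\<rho> \<le> norm (w + h)" "\<rho> \<le> norm w" using norm_diff_ineq[of w h] False h \<rho> by linarith+
        then show ?thesis using riesz_near_eq_0[OF \<rho>] C1 C2 by simp
      qed
    qed
    also have "\<dots> = C1 * ?k * (J + J) + C2 * \<rho> powr (1 - \<beta>) * ?k * V"
      using iP integrable_norm_powr_shift[OF b R, of h] integrable_cball_const[of 1 0 "2 * \<rho>"] by (simp add: J_def V_def)
    also have "\<dots> \<le> (C1 * (2 * J) + C2 * \<rho> powr (1 - \<beta>) * V + 1) * ?k"
      by (simp add: algebra_simps)
    finally show "(LBINT w. \<bar>riesz_near \<rho> (w + h) - riesz_near \<rho> w\<bar>) \<le> (C1 * (2 * J) + C2 * \<rho> powr (1 - \<beta>) * V + 1) * ?k" .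
  qed
qed

text \<open>As for first differences: the singular part contributes |h|^\<gamma> by
  \<open>riesz_sd_weighted\<close>, the smooth part |h|^2, which for |h| \<le> \<rho> is at most a
  constant times |h|^\<gamma>.\<close>

lemma riesz_near_sd_weighted:
  assumes \<rho>: "0 < \<rho>" and \<alpha>: "0 < \<alpha>" "\<alpha> \<le> \<gamma>" "\<gamma> \<le> 2" "\<gamma> < 2 * s + \<alpha>"
  obtains C where "0 < C" "\<And>h. norm h \<le> \<rho> \<Longrightarrow> L1 (\<lambda>w. \<bar>sd (riesz_near \<rho>) h w\<bar> * norm w powr \<alpha>)"
    "\<And>h. norm h \<le> \<rho> \<Longrightarrow> (LBINT w. \<bar>sd (riesz_near \<rho>) h w\<bar> * norm w powr \<alpha>) \<le> C * norm h powr \<gamma>"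
proof -
  define b where "b = real DIM('a) - 2 * s + (\<gamma> - \<alpha>)"
  have b: "b < real DIM('a)" using \<alpha> by (simp add: b_def)
  obtain C1 where C1: "0 < C1" "\<And>w h. \<bar>sd riesz h w\<bar> * norm w powr \<alpha> \<le>
    C1 * norm h powr \<gamma> * (norm w powr (- b) + norm (w + h) powr (- b) + norm (w - h) powr (- b))"
    by (rule riesz_sd_weighted[OF \<alpha>(1-3), folded b_def]) (rule that; assumption)
  obtain C2 where C2: "0 < C2" "\<And>x y. \<bar>sd (riesz_far \<rho>) y x\<bar> \<le> C2 * (norm y)\<^sup>2"
    by (rule riesz_far_global_bounds[OF \<rho>]) (rule that; assumption)
  have R: "0 < 3 * \<rho>" using \<rho> by simp
  let ?P = "\<lambda>w. norm w powr (- b) * indicat_real (ball 0 (3 * \<rho>)) (w::'a)"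
  define J where "J = (LBINT w. ?P w)"
  define V where "V = (LBINT w. indicat_real (ball 0 (2 * \<rho>)) (w::'a))"
  define e where "e = \<rho> powr (2 - \<gamma>) * (2 * \<rho>) powr \<alpha>"
  have JV: "0 \<le> J" "0 \<le> V" "0 \<le> e" unfolding J_def V_def e_def by (auto intro!: lint_nonneg)
  {
    fix h :: 'a assume h: "norm h \<le> \<rho>"
    let ?k = "norm h powr \<gamma>"
    have h1: "(norm h)\<^sup>2 \<le> \<rho> powr (2 - \<gamma>) * ?k"
    proof (cases "h = 0")
      case False
      have "(norm h)\<^sup>2 = norm h powr (2 - \<gamma>) * norm h powr \<gamma>" unfolding powr_add[symmetric] using False by simp
      also have "\<dots> \<le> \<rho> powr (2 - \<gamma>) * ?k" using h \<alpha> by (intro mult_right_mono powr_mono2) auto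
      finally show ?thesis .
    qed simp
    let ?D = "\<lambda>w. (C1 * ?k) * (?P w + ?P (w + h) + ?P (w + - h)) + (C2 * e * ?k) * indicat_real (ball 0 (2 * \<rho>)) w"
    have iP: "L1 ?P" by (rule integrable_norm_powr_ball[OF b R])
    have iD: "L1 ?D"
      by (intro integrable_plus integrable_mult_right[where c="C1 * ?k"] iP integrable_norm_powr_shift b R integrable_cball_const)
    have le: "\<bar>sd (riesz_near \<rho>) h w\<bar> * norm w powr \<alpha> \<le> ?D w" for w
    proof (cases "norm w < 2 * \<rho>")
      case True
      have n: "norm (w + h) < 3 * \<rho>" "norm (w - h) < 3 * \<rho>" "norm w < 3 * \<rho>"
        using norm_triangle_ineq[of w h] norm_triangle_ineq4[of w h] True h \<rho> by linarith+
      have "\<bar>sd (riesz_near \<rho>) h w\<bar> \<le> \<bar>sd riesz h w\<bar> + \<bar>sd (riesz_far \<rho>) h w\<bar>"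
        unfolding sd_def using riesz_split[of "w + h" \<rho>] riesz_split[of "w - h" \<rho>] riesz_split[of w \<rho>] by linarith
      then have "\<bar>sd (riesz_near \<rho>) h w\<bar> * norm w powr \<alpha> \<le> (\<bar>sd riesz h w\<bar> + \<bar>sd (riesz_far \<rho>) h w\<bar>) * norm w powr \<alpha>"
        by (rule mult_right_mono) simp
      also have "\<dots> = \<bar>sd riesz h w\<bar> * norm w powr \<alpha> + \<bar>sd (riesz_far \<rho>) h w\<bar> * norm w powr \<alpha>" by (simp add: distrib_right)
      also have "\<bar>sd (riesz_far \<rho>) h w\<bar> * norm w powr \<alpha> \<le> (C2 * (\<rho> powr (2 - \<gamma>) * ?k)) * (2 * \<rho>) powr \<alpha>"
        using order_trans[OF C2(2) mult_left_mono[OF h1]] C2(1) True \<alpha> by (intro mult_mono powr_mono2) auto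
      also have "\<dots> = C2 * e * ?k" by (simp add: e_def)
      finally show ?thesis using C1(2)[of h w] n True by (simp add: indicator_def)
    next
      case False
      have "\<rho> \<le> norm (w + h)" "\<rho> \<le> norm (w - h)" "\<rho> \<le> norm w"
        using norm_diff_ineq[of w h] norm_triangle_ineq2[of w h] False h \<rho> by linarith+
      then show ?thesis using riesz_near_eq_0[OF \<rho>] C1(1) C2(1) JV(3) by (simp add: sd_def)
    qed
    have i: "L1 (\<lambda>w. \<bar>sd (riesz_near \<rho>) h w\<bar> * norm w powr \<alpha>)"
      by (rule integrable_dominated_nonneg[OF iD _ _ le]) (simp, measurable)
    have "(LBINT w. \<bar>sd (riesz_near \<rho>) h w\<bar> * norm w powr \<alpha>) \<le> (LBINT w. ?D w)"
      by (rule integral_mono[OF i iD le])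
    also have "\<dots> = C1 * ?k * (J + J + J) + C2 * e * ?k * V"
      using iP integrable_norm_powr_shift[OF b R, of h] integrable_norm_powr_shift[OF b R, of "- h"] integrable_cball_const[of 1 0 "2 * \<rho>"]
      by (simp add: J_def V_def)
    also have "\<dots> \<le> (C1 * (3 * J) + C2 * e * V + 1) * ?k" by (simp add: algebra_simps)
    finally have "(LBINT w. \<bar>sd (riesz_near \<rho>) h w\<bar> * norm w powr \<alpha>) \<le> (C1 * (3 * J) + C2 * e * V + 1) * ?k" .
    note i this
  } note * = this
  show ?thesis
  proof (rule that[of "C1 * (3 * J) + C2 * e * V + 1"])
    show "0 < C1 * (3 * J) + C2 * e * V + 1" using C1 C2 JV by (intro add_nonneg_pos add_nonneg_nonneg) auto
  qed (use * in auto)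
qed


section \<open>The parametrix applied to bump functions\<close>

lemma Lop_conv:
  assumes \<psi>: "L1 \<psi>" and [measurable]: "borel_fun f" and B: "\<And>x. \<bar>f x\<bar> \<le> B"
    and M: "\<And>h w. \<bar>sd f h w\<bar> \<le> M * min 1 ((norm h)\<^sup>2)"
  shows "L1 (\<lambda>h. sd (conv \<psi> f) h x * ker h)"
    and "Lop (conv \<psi> f) x = conv \<psi> (Lop f) x"
proof -
  have [measurable]: "borel_fun \<psi>" using borel_measurable_integrable[OF \<psi>] by simp
  have e: "sd (conv \<psi> f) h x = conv \<psi> (sd f h) x" for h
    by (rule conv_sd, rule conv_integrable[OF \<psi> assms(2) B])
  have pair: "integrable lborel2 (\<lambda>(h, z). \<psi> z * (sd f h (x - z) * ker h))"
  proof (rule integrable_dominated_pair)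
    show "integrable lborel2 (\<lambda>(h, z). (M * (ker h * min 1 ((norm h)\<^sup>2))) * \<bar>\<psi> z\<bar>)"
      by (intro integrable_pair_times integrable_mult_right integrable_ker_min2 integrable_abs \<psi>)
    show "\<bar>\<psi> z * (sd f h (x - z) * ker h)\<bar> \<le> (M * (ker h * min 1 ((norm h)\<^sup>2))) * \<bar>\<psi> z\<bar>" for h z
      using mult_right_mono[OF M[of h "x - z"], of "ker h * \<bar>\<psi> z\<bar>"] by (simp add: abs_mult mult_ac)
  qed measurable
  have e2: "sd (conv \<psi> f) h x * ker h = (LBINT z. \<psi> z * (sd f h (x - z) * ker h))" for h
    unfolding e conv_def by (subst integral_mult_left_zero[symmetric]) (simp add: mult_ac)
  show "L1 (\<lambda>h. sd (conv \<psi> f) h x * ker h)"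
    unfolding e2 by (rule lborel_pair.integrable_fst[OF pair])
  have "(LBINT h. sd (conv \<psi> f) h x * ker h) = (LBINT z. LBINT h. \<psi> z * (sd f h (x - z) * ker h))"
    unfolding e2 by (rule LINT_swap[OF pair])
  then show "Lop (conv \<psi> f) x = conv \<psi> (Lop f) x"
    by (simp add: Lop_def conv_def)
qed

lemma borel_measurable_Lop [measurable]:
  assumes [measurable]: "borel_fun f" "g \<in> M \<rightarrow>\<^sub>M borel"
  shows "(\<lambda>z. Lop f (g z)) \<in> borel_measurable M"
  unfolding Lop_def by measurable

lemma borel_measurable_far_kernel [measurable]:
  assumes [measurable]: "g \<in> M \<rightarrow>\<^sub>M borel"
  shows "(\<lambda>z. far_kernel \<rho> (g z)) \<in> borel_measurable M"
  unfolding far_kernel_def by measurable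

text \<open>Supports add up: a bump in the ball of radius \<rho> becomes a test function on the ball
  of radius 2 \<rho>, which is where the representation assumes the weak equation.\<close>

lemma conv_riesz_near_C0:
  assumes \<rho>: "0 < \<rho>" and \<psi>: "\<psi> \<in> C0_infinity" and supp: "\<And>x. x \<notin> ball x0 \<rho> \<Longrightarrow> \<psi> x = 0"
  shows "conv (riesz_near \<rho>) \<psi> \<in> C0_infinity"
    and "\<And>x. x \<notin> ball x0 (2 * \<rho>) \<Longrightarrow> conv (riesz_near \<rho>) \<psi> x = 0"
proof -
  show z: "conv (riesz_near \<rho>) \<psi> x = 0" if x: "x \<notin> ball x0 (2 * \<rho>)" for x
  proof -
    have "riesz_near \<rho> z * \<psi> (x - z) = 0" for z
    proof (cases "norm z < \<rho>")
      case True
      have "x - z \<notin> ball x0 \<rho>"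
        using norm_triangle_ineq[of "x - z - x0" z] x True by (auto simp: dist_norm norm_minus_commute algebra_simps)
      then show ?thesis using supp by simp
    qed (use riesz_near_eq_0[OF \<rho>] in simp)
    then show ?thesis unfolding conv_def by (simp only:) simp
  qed
  show "conv (riesz_near \<rho>) \<psi> \<in> C0_infinity"
  proof (rule C0_infinityI[OF C_infinity_conv[OF integrable_riesz_near[OF \<rho>] \<psi>]])
    fix x :: 'a assume "norm x0 + 2 * \<rho> < norm x"
    then show "conv (riesz_near \<rho>) \<psi> x = 0"
      using norm_triangle_ineq2[of x x0] by (intro z) (auto simp: dist_norm norm_minus_commute)
  qed
qed

text \<open>Splitting the Riesz kernel splits the potential of \<psi> into the parametrix part and a
  convolution with the smooth \<open>riesz_far\<close>, for which \<open>Lop\<close> passes under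
  the integral. The formula holds at every x, but the available bounds on its error term do not
  decay in x.\<close>

lemma Lop_parametrix_near:
  assumes C: "\<And>\<psi> x. \<psi> \<in> C0_infinity \<Longrightarrow> Lop (conv riesz \<psi>) x = C * \<psi> x"
    and \<rho>: "0 < \<rho>" and \<psi>: "\<psi> \<in> C0_infinity" and supp: "\<And>x. x \<notin> ball x0 \<rho> \<Longrightarrow> \<psi> x = 0"
  shows "Lop (conv (riesz_near \<rho>) \<psi>) x = C * \<psi> x - (LBINT z. \<psi> z * Lop (riesz_far \<rho>) (x - z))"
proof -
  note [measurable] = C0_infinity_measurable[OF \<psi>]
  have [measurable]: "borel_fun (riesz_far \<rho>)" using \<rho> by measurable
  let ?\<phi> = "conv (riesz_near \<rho>) \<psi>"
  obtain G where G: "0 < G" "\<And>x. \<bar>riesz_far \<rho> x\<bar> \<le> G" "\<And>x y. \<bar>sd (riesz_far \<rho>) y x\<bar> \<le> G * min 1 ((norm y)\<^sup>2)"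
    by (rule riesz_far_global_bounds[OF \<rho>]) (rule that; assumption)
  obtain Cb where Cb: "\<And>x h. \<bar>sd ?\<phi> h x\<bar> \<le> Cb * min 1 ((norm h)\<^sup>2)"
    by (rule C0_infinity_bounds[OF conv_riesz_near_C0(1)[OF \<rho> \<psi> supp]]) (auto intro: that)
  obtain B where B: "0 < B" "\<And>x. \<bar>\<psi> x\<bar> \<le> B" using C0_infinity_bounded[OF \<psi>] by blast
  have i1: "L1 (\<lambda>z. riesz_near \<rho> z * \<psi> (y - z))" for y
    by (rule conv_integrable[OF integrable_riesz_near[OF \<rho>] _ B(2)]) measurable
  have split: "conv riesz \<psi> y = ?\<phi> y + conv \<psi> (riesz_far \<rho>) y" for y
  proof -
    have i2: "L1 (\<lambda>z. riesz_far \<rho> z * \<psi> (y - z))"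
    proof -
      have "L1 (\<lambda>z. riesz z * \<psi> (y - z) - riesz_near \<rho> z * \<psi> (y - z))"
        by (rule integrable_minus[OF riesz_conv_integrable[OF \<psi>] i1])
      then show ?thesis by (simp add: riesz_split[of _ \<rho>] algebra_simps)
    qed
    have "conv riesz \<psi> y = (LBINT z. riesz_near \<rho> z * \<psi> (y - z) + riesz_far \<rho> z * \<psi> (y - z))"
      unfolding conv_def by (simp add: riesz_split[of _ \<rho>] distrib_right)
    also have "\<dots> = ?\<phi> y + conv (riesz_far \<rho>) \<psi> y"
      unfolding conv_def by (rule integral_plus[OF i1 i2])
    finally show ?thesis using conv_commute[of "riesz_far \<rho>" \<psi> y] by simp
  qed
  note Lc = Lop_conv[OF C0_infinity_integrable[OF \<psi>] _ G(2,3), of x]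
  have j1: "L1 (\<lambda>h. sd ?\<phi> h x * ker h)" by (rule Lop_integrable[OF _ Cb]) measurable
  have j2: "L1 (\<lambda>h. sd (conv \<psi> (riesz_far \<rho>)) h x * ker h)" by (rule Lc(1)) measurable
  have "sd (conv riesz \<psi>) h x * ker h = sd ?\<phi> h x * ker h + sd (conv \<psi> (riesz_far \<rho>)) h x * ker h" for h
    unfolding sd_def split by (simp add: algebra_simps)
  then have "Lop (conv riesz \<psi>) x = Lop ?\<phi> x + Lop (conv \<psi> (riesz_far \<rho>)) x"
    unfolding Lop_def by (simp add: j1 j2)
  moreover have "Lop (conv \<psi> (riesz_far \<rho>)) x = conv \<psi> (Lop (riesz_far \<rho>)) x" by (rule Lc(2)) measurable
  ultimately show ?thesis using C[OF \<psi>, of x] by (simp add: conv_def)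
qed

text \<open>At these points the test function itself vanishes, so only the translates remain in the
  second difference. The error term turns into an integral against \<open>far_kernel\<close>, which
  does decay.\<close>

lemma Lop_parametrix_far:
  assumes \<rho>: "0 < \<rho>" and \<psi>: "\<psi> \<in> C0_infinity" and supp: "\<And>x. x \<notin> ball x0 \<rho> \<Longrightarrow> \<psi> x = 0"
    and x: "3 * \<rho> \<le> norm (x - x0)"
  shows "Lop (conv (riesz_near \<rho>) \<psi>) x = - (LBINT z. \<psi> z * far_kernel \<rho> (x - z))"
proof -
  note [measurable] = C0_infinity_measurable[OF \<psi>]
  let ?K = "riesz_near \<rho>"
  let ?\<phi> = "conv ?K \<psi>"
  define q where "q = \<rho> powr (- (real DIM('a) + 2 * s))"
  have q: "ker h \<le> q" if "\<rho> \<le> norm h" for h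
    unfolding ker_def q_def using that \<rho> s_pos by (intro powr_mono2') auto
  have i\<psi>: "L1 \<psi>" by (rule C0_infinity_integrable[OF \<psi>])
  have iK: "L1 ?K" by (rule integrable_riesz_near[OF \<rho>])
  \<comment> \<open>Triangle inequality through x0: |x - x0| \<ge> 3 \<rho> while two of the three
    legs are shorter than \<rho>. So only increments with |h| \<ge> \<rho> matter, and there the
    kernel is bounded by \<open>q\<close>.\<close>
  have far: "\<rho> \<le> norm h" if "\<psi> z \<noteq> 0" "?K (x - h - z) \<noteq> 0" for h z
  proof -
    have "norm (z - x0) < \<rho>" using supp[of z] that by (force simp: dist_norm norm_minus_commute)
    moreover have "norm (x - h - z) < \<rho>" using riesz_near_eq_0[OF \<rho>] that by force
    moreover have "norm (x - x0) \<le> norm (x - h - z) + norm (z - x0) + norm h"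
      using norm_triangle_ineq[of "(x - h - z) + (z - x0)" h] norm_triangle_ineq[of "x - h - z" "z - x0"] by simp
    ultimately show ?thesis using x by linarith
  qed
  have pair: "integrable lborel2 (\<lambda>(z, h). \<psi> z * (ker h * ?K (x - h - z)))"
  proof (rule integrable_pair_Fubini)
    show "(\<lambda>(z, h). \<psi> z * (ker h * ?K (x - h - z))) \<in> borel_measurable (borel \<Otimes>\<^sub>M borel)" by measurable
    have iKz: "L1 (\<lambda>h. ?K (x - h - z))" for z
      using integrable_lborel_reflect[OF iK, of "x - z"] by (simp add: algebra_simps)
    have le: "\<bar>\<psi> z * (ker h * ?K (x - h - z))\<bar> \<le> (\<bar>\<psi> z\<bar> * q) * ?K (x - h - z)" for z h
    proof (cases "\<psi> z \<noteq> 0 \<and> ?K (x - h - z) \<noteq> 0")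
      case True
      have "ker h * (\<bar>\<psi> z\<bar> * ?K (x - h - z)) \<le> q * (\<bar>\<psi> z\<bar> * ?K (x - h - z))"
        using q[OF far] True riesz_near_nonneg by (intro mult_right_mono) auto
      then show ?thesis using riesz_near_nonneg by (simp add: abs_mult mult_ac)
    qed auto
    have ib: "L1 (\<lambda>h. (\<bar>\<psi> z\<bar> * q) * ?K (x - h - z))" for z by (intro integrable_mult_right iKz)
    have i: "L1 (\<lambda>h. \<psi> z * (ker h * ?K (x - h - z)))" for z
      by (rule integrable_dominated[OF ib[of z] _ le]) measurable
    show "AE z in lborel. L1 (\<lambda>h. \<psi> z * (ker h * ?K (x - h - z)))" by (intro AE_I2 i)
    show "AE z in lborel. (LBINT h. \<bar>\<psi> z * (ker h * ?K (x - h - z))\<bar>) \<le> (q * (LBINT w. ?K w)) * \<bar>\<psi> z\<bar>"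
    proof (rule AE_I2)
      fix z
      have "(LBINT h. \<bar>\<psi> z * (ker h * ?K (x - h - z))\<bar>) \<le> (LBINT h. (\<bar>\<psi> z\<bar> * q) * ?K (x - h - z))"
        by (intro integral_mono integrable_abs i ib le)
      also have "\<dots> = (\<bar>\<psi> z\<bar> * q) * (LBINT h. ?K (x - h - z))" by (simp only: integral_mult_right_zero)
      also have "(LBINT h. ?K (x - h - z)) = (LBINT w. ?K w)"
        using integral_lborel_reflect[of ?K "x - z"] by (simp add: algebra_simps)
      finally show "(LBINT h. \<bar>\<psi> z * (ker h * ?K (x - h - z))\<bar>) \<le> (q * (LBINT w. ?K w)) * \<bar>\<psi> z\<bar>"
        by (simp add: mult_ac)
    qed
    show "L1 (\<lambda>z. (q * (LBINT w. ?K w)) * \<bar>\<psi> z\<bar>)" by (intro integrable_mult_right integrable_abs i\<psi>)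
  qed
  have inz: "(LBINT h. \<psi> z * (ker h * ?K (x - h - z))) = \<psi> z * far_kernel \<rho> (x - z) / 2" for z
  proof -
    have "(LBINT h. ker h * ?K (x - h - z)) = (LBINT y. ker ((x - z) - y) * ?K (x - ((x - z) - y) - z))"
      by (subst integral_lborel_reflect[of "\<lambda>h. ker h * ?K (x - h - z)" "x - z"]) auto
    also have "\<dots> = far_kernel \<rho> (x - z) / 2"
      unfolding far_kernel_def by (simp add: mult.commute algebra_simps)
    finally show ?thesis by simp
  qed
  have \<phi>: "?\<phi> (x - h) * ker h = (LBINT z. \<psi> z * (ker h * ?K (x - h - z)))" for h
    unfolding conv_commute[OF borel_measurable_riesz_near C0_infinity_measurable[OF \<psi>]] unfolding conv_def
    by (subst integral_mult_left_zero[symmetric]) (simp add: mult_ac)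
  have i1: "L1 (\<lambda>h. ?\<phi> (x - h) * ker h)" unfolding \<phi> by (rule lborel_pair.integrable_snd[OF pair])
  have i2: "L1 (\<lambda>h. ?\<phi> (x + h) * ker h)" using integrable_lborel_uminus[OF i1] by simp
  have I: "(LBINT h. ?\<phi> (x - h) * ker h) = (LBINT z. \<psi> z * far_kernel \<rho> (x - z)) / 2"
    unfolding \<phi> LINT_swap[OF pair, symmetric] inz by simp
  have I2: "(LBINT h. ?\<phi> (x + h) * ker h) = (LBINT h. ?\<phi> (x - h) * ker h)"
    using integral_lborel_uminus[of "\<lambda>h. ?\<phi> (x - h) * ker h"] by simp
  have "?\<phi> x = 0" using x \<rho> by (intro conv_riesz_near_C0(2)[OF \<rho> \<psi> supp]) (auto simp: dist_norm norm_minus_commute)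
  then have "Lop ?\<phi> x = - (LBINT h. ?\<phi> (x + h) * ker h + ?\<phi> (x - h) * ker h)"
    by (simp add: Lop_def sd_def distrib_right)
  also have "\<dots> = - (LBINT z. \<psi> z * far_kernel \<rho> (x - z))"
    by (subst integral_plus[OF i2 i1]) (simp add: I I2)
  finally show ?thesis .
qed

text \<open>A test function has to vanish off U, but its support may reach the boundary of U. The
  constant of the energy form is absorbed into g.\<close>

definition weak_on :: "'a set \<Rightarrow> ('a \<Rightarrow> real) \<Rightarrow> ('a \<Rightarrow> real) \<Rightarrow> bool" where
  "weak_on U u g \<longleftrightarrow> (\<forall>\<phi>\<in>C0_infinity. (\<forall>x. x \<notin> U \<longrightarrow> \<phi> x = 0) \<longrightarrow>
     form_integrable u \<phi> \<and> form u \<phi> = (LBINT x. g x * \<phi> x))"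

text \<open>\<open>Lop\<close> of the parametrix applied to \<psi> is a multiple of \<psi> x minus
  the integral of \<psi> z against this kernel. Close to x0 the formula with the smooth part is
  used, further out the one with decay. The switch happens in x only, so regularity in z is
  unaffected.\<close>

definition error_kernel :: "real \<Rightarrow> 'a \<Rightarrow> 'a \<Rightarrow> 'a \<Rightarrow> real" where
  "error_kernel \<rho> x0 x z = (if norm (x - x0) < 3 * \<rho> then Lop (riesz_far \<rho>) (x - z) else far_kernel \<rho> (x - z))"

text \<open>A majorant in x of the error kernel, uniform for z near x0: bounded in the middle, the
  integrable tail of \<open>ker\<close> outside.\<close>

definition error_weight :: "real \<Rightarrow> 'a \<Rightarrow> 'a \<Rightarrow> real" where
  "error_weight \<rho> x0 x = indicator (ball x0 (3 * \<rho>)) x + ker (x - x0) * indicator (- ball 0 (3 * \<rho>)) (x - x0)"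

lemma error_weight_integrable: "0 < \<rho> \<Longrightarrow> L1 (error_weight \<rho> x0)"
  unfolding error_weight_def
  using integrable_lborel_shift[OF integrable_ker_outside[of "3 * \<rho>"], of "- x0"] integrable_cball_const[of 1 x0 "3 * \<rho>"]
  by (intro integrable_plus) auto

lemma error_kernel_bounds:
  assumes \<rho>: "0 < \<rho>" "\<rho> \<le> 1"
  obtains A where "0 < A" "\<And>x0 x z. z \<in> ball x0 \<rho> \<Longrightarrow> \<bar>error_kernel \<rho> x0 x z\<bar> \<le> A * error_weight \<rho> x0 x"
    "\<And>x0 x z h. z \<in> ball x0 \<rho> \<Longrightarrow> norm h \<le> \<rho> / 2 \<Longrightarrow> \<bar>error_kernel \<rho> x0 x (z + h) - error_kernel \<rho> x0 x z\<bar> \<le> A * norm h * error_weight \<rho> x0 x"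
    "\<And>x0 x z h. z \<in> ball x0 \<rho> \<Longrightarrow> norm h \<le> \<rho> / 2 \<Longrightarrow> \<bar>sd (error_kernel \<rho> x0 x) h z\<bar> \<le> A * (norm h)\<^sup>2 * error_weight \<rho> x0 x"
proof -
  obtain C1 where C1: "0 < C1" "\<And>w. norm w \<le> 4 * \<rho> \<Longrightarrow> \<bar>Lop (riesz_far \<rho>) w\<bar> \<le> C1"
    "\<And>w y. norm w \<le> 4 * \<rho> \<Longrightarrow> norm y \<le> 1 \<Longrightarrow> \<bar>Lop (riesz_far \<rho>) (w + y) - Lop (riesz_far \<rho>) w\<bar> \<le> C1 * norm y"
    "\<And>w y. norm w \<le> 4 * \<rho> \<Longrightarrow> norm y \<le> 1 \<Longrightarrow> \<bar>sd (Lop (riesz_far \<rho>)) y w\<bar> \<le> C1 * (norm y)\<^sup>2"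
    by (rule Lop_riesz_far_bounds[OF \<rho>(1), where R="4 * \<rho>"]) (rule that; assumption)
  obtain C2 where C2: "0 < C2" "\<And>w. 2 * \<rho> \<le> norm w \<Longrightarrow> \<bar>far_kernel \<rho> w\<bar> \<le> C2 * ker w"
    "\<And>w h. 2 * \<rho> \<le> norm w \<Longrightarrow> norm h \<le> \<rho> / 2 \<Longrightarrow> \<bar>far_kernel \<rho> (w + h) - far_kernel \<rho> w\<bar> \<le> C2 * norm h * ker w"
    "\<And>w h. 2 * \<rho> \<le> norm w \<Longrightarrow> norm h \<le> \<rho> / 2 \<Longrightarrow> \<bar>sd (far_kernel \<rho>) h w\<bar> \<le> C2 * (norm h)\<^sup>2 * ker w"
    by (rule far_kernel_bounds[OF \<rho>(1)]) (rule that; assumption)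
  \<comment> \<open>For |x - x0| \<ge> 3 \<rho> and |z - x0| < \<rho> one has |x - z| \<ge> (2/3) |x
    - x0|.\<close>
  define d where "d = (2 / 3) powr (- (real DIM('a) + 2 * s))"
  have d: "0 < d" by (simp add: d_def)
  show ?thesis
  proof (rule that[of "C1 + C2 * d"])
    have nn: "C1 \<le> C1 + C2 * d" "C2 * d \<le> C1 + C2 * d" using C1(1) C2(1) d by auto
    show "0 < C1 + C2 * d" using C1(1) C2(1) d by (simp add: add_pos_pos)
    fix x0 x z :: 'a assume z: "z \<in> ball x0 \<rho>"
    then have z': "norm (z - x0) < \<rho>" by (simp add: dist_norm norm_minus_commute)
    let ?e = "error_kernel \<rho> x0 x"
    \<comment> \<open>One case distinction for all three estimates: T evaluates at z or takes a
      first or second difference there, and t is the matching power of |h|.\<close>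
    have step: "\<bar>T ?e\<bar> \<le> (C1 + C2 * d) * t * error_weight \<rho> x0 x"
      if 1: "norm (x - z) \<le> 4 * \<rho> \<Longrightarrow> norm (x - x0) < 3 * \<rho> \<Longrightarrow> \<bar>T ?e\<bar> \<le> C1 * t"
        and 2: "2 * \<rho> \<le> norm (x - z) \<Longrightarrow> \<not> norm (x - x0) < 3 * \<rho> \<Longrightarrow> \<bar>T ?e\<bar> \<le> C2 * t * ker (x - z)" and t: "0 \<le> t" for T t
    proof (cases "norm (x - x0) < 3 * \<rho>")
      case True
      have "norm (x - z) \<le> 4 * \<rho>" using norm_triangle_ineq4[of "x - x0" "z - x0"] z' True by simp
      from 1[OF this True] have "\<bar>T ?e\<bar> \<le> C1 * t" .
      also have "\<dots> \<le> (C1 + C2 * d) * t" by (intro mult_right_mono nn t)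
      finally show ?thesis using True by (simp add: error_weight_def dist_norm norm_minus_commute)
    next
      case False
      have xz: "norm (x - x0) - \<rho> \<le> norm (x - z)"
        using norm_triangle_ineq2[of "x - x0" "z - x0"] z' by simp
      then have "2 * \<rho> \<le> norm (x - z)" using False by linarith
      from 2[OF this False] have "\<bar>T ?e\<bar> \<le> C2 * t * ker (x - z)" .
      also have "\<dots> \<le> C2 * t * (d * ker (x - x0))"
        unfolding d_def using xz False \<rho> C2(1) t by (intro mult_left_mono ker_le_scaled) auto
      also have "\<dots> = C2 * d * (t * ker (x - x0))" by simp
      also have "\<dots> \<le> (C1 + C2 * d) * (t * ker (x - x0))" using t by (intro mult_right_mono nn) simp
      finally show ?thesis using False by (simp add: error_weight_def dist_norm norm_minus_commute mult_ac)
    qed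
    show "\<bar>?e z\<bar> \<le> (C1 + C2 * d) * error_weight \<rho> x0 x"
      using step[of "\<lambda>e. e z" 1] C1(2) C2(2) by (simp add: error_kernel_def)
    fix h :: 'a assume h: "norm h \<le> \<rho> / 2"
    then have h1: "norm h \<le> 1" using \<rho> by linarith
    have e1: "x - (z + h) = (x - z) + - h" by simp
    show "\<bar>?e (z + h) - ?e z\<bar> \<le> (C1 + C2 * d) * norm h * error_weight \<rho> x0 x"
    proof (rule step[of "\<lambda>e. e (z + h) - e z"])
      show "\<bar>?e (z + h) - ?e z\<bar> \<le> C1 * norm h" if "norm (x - z) \<le> 4 * \<rho>" "norm (x - x0) < 3 * \<rho>"
        using C1(3)[OF that(1), of "- h"] h1 that(2) unfolding error_kernel_def e1 by simp
      show "\<bar>?e (z + h) - ?e z\<bar> \<le> C2 * norm h * ker (x - z)" if "2 * \<rho> \<le> norm (x - z)" "\<not> norm (x - x0) < 3 * \<rho>"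
        using C2(3)[OF that(1), of "- h"] h that(2) unfolding error_kernel_def e1 by simp
    qed simp
    have e2: "x - (z - h) = (x - z) + h" by simp
    have sdL: "sd ?e h z = sd (Lop (riesz_far \<rho>)) h (x - z)" if "norm (x - x0) < 3 * \<rho>"
      using that unfolding sd_def error_kernel_def e1 e2 by simp
    have sdF: "sd ?e h z = sd (far_kernel \<rho>) h (x - z)" if "\<not> norm (x - x0) < 3 * \<rho>"
      using that unfolding sd_def error_kernel_def e1 e2 by simp
    show "\<bar>sd ?e h z\<bar> \<le> (C1 + C2 * d) * (norm h)\<^sup>2 * error_weight \<rho> x0 x"
      by (rule step[of "\<lambda>e. sd e h z"]) (use C1(4) C2(4) h h1 sdL sdF in auto)
  qed
qed

text \<open>Testing with the parametrix convolved with an arbitrary bump \<psi> and moving every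
  integral onto \<psi> gives an identity that the fundamental lemma turns into one almost
  everywhere. In \<open>M\<close> the function \<open>u\<close> is integrated against the error
  kernel, so the regularity of \<open>M\<close> is that of the error kernel in z and requires of
  \<open>u\<close> only boundedness.\<close>

lemma parametrix_representation:
  assumes C: "\<And>\<psi> x. \<psi> \<in> C0_infinity \<Longrightarrow> Lop (conv riesz \<psi>) x = C * \<psi> x"
    and \<rho>: "0 < \<rho>" "\<rho> \<le> 1"
    and [measurable]: "borel_fun u" and B: "\<And>x. \<bar>u x\<bar> \<le> B"
    and [measurable]: "borel_fun g" and B': "\<And>x. \<bar>g x\<bar> \<le> B'"
    and weak: "weak_on (ball x0 (2 * \<rho>)) u g"
  obtains M A where "0 < A"
    "AE z in lborel. z \<in> ball x0 \<rho> \<longrightarrow> C * u z = M z + (LBINT w. riesz_near \<rho> w * g (z + w))"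
    "\<And>z. z \<in> ball x0 \<rho> \<Longrightarrow> \<bar>M z\<bar> \<le> A"
    "\<And>z h. z \<in> ball x0 \<rho> \<Longrightarrow> z + h \<in> ball x0 \<rho> \<Longrightarrow> norm h \<le> \<rho> / 2 \<Longrightarrow> \<bar>M (z + h) - M z\<bar> \<le> A * norm h"
    "\<And>z h. z \<in> ball x0 \<rho> \<Longrightarrow> z + h \<in> ball x0 \<rho> \<Longrightarrow> z - h \<in> ball x0 \<rho> \<Longrightarrow> norm h \<le> \<rho> / 2 \<Longrightarrow> \<bar>sd M h z\<bar> \<le> A * (norm h)\<^sup>2"
proof -
  have [measurable]: "borel_fun (riesz_far \<rho>)" using \<rho>(1) by measurable
  have Em [measurable]: "(\<lambda>(x, z). error_kernel \<rho> x0 x z) \<in> borel_measurable (borel \<Otimes>\<^sub>M borel)"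
    unfolding error_kernel_def by measurable
  have Em1 [measurable]: "borel_fun (\<lambda>x. error_kernel \<rho> x0 x z)" for z
    unfolding error_kernel_def by measurable
  have B0: "0 \<le> B" "0 \<le> B'" using B[of 0] B'[of 0] by auto
  let ?K = "riesz_near \<rho>"
  obtain A where A: "0 < A" "\<And>x z. z \<in> ball x0 \<rho> \<Longrightarrow> \<bar>error_kernel \<rho> x0 x z\<bar> \<le> A * error_weight \<rho> x0 x"
    "\<And>x z h. z \<in> ball x0 \<rho> \<Longrightarrow> norm h \<le> \<rho> / 2 \<Longrightarrow> \<bar>error_kernel \<rho> x0 x (z + h) - error_kernel \<rho> x0 x z\<bar> \<le> A * norm h * error_weight \<rho> x0 x"
    "\<And>x z h. z \<in> ball x0 \<rho> \<Longrightarrow> norm h \<le> \<rho> / 2 \<Longrightarrow> \<bar>sd (error_kernel \<rho> x0 x) h z\<bar> \<le> A * (norm h)\<^sup>2 * error_weight \<rho> x0 x"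
    by (rule error_kernel_bounds[OF \<rho>]) (rule that; assumption)
  let ?w = "error_weight \<rho> x0"
  have iw: "L1 ?w" by (rule error_weight_integrable[OF \<rho>(1)])
  have w0: "0 \<le> ?w x" for x by (simp add: error_weight_def)
  define W where "W = (LBINT x. ?w x)"
  have W0: "0 \<le> W" unfolding W_def by (intro lint_nonneg w0)
  \<comment> \<open>Used with t = A for \<open>M\<close> itself, and with A |h| and A |h|^2 for its
    first and second differences.\<close>
  have gen: "L1 (\<lambda>x. u x * f x) \<and> \<bar>LBINT x. u x * f x\<bar> \<le> B * t * W"
    if [measurable]: "borel_fun f" and f: "\<And>x. \<bar>f x\<bar> \<le> t * ?w x" for f t
  proof
    have le: "\<bar>u x * f x\<bar> \<le> B * t * ?w x" for x
      using mult_mono[OF B[of x] f[of x]] B0 by (simp add: abs_mult mult.assoc)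
    show i: "L1 (\<lambda>x. u x * f x)"
      by (rule integrable_dominated[OF integrable_mult_right[OF iw] _ le]) measurable
    have "\<bar>LBINT x. u x * f x\<bar> \<le> (LBINT x. B * t * ?w x)"
      by (intro integral_abs_bound_integral i integrable_mult_right iw le)
    then show "\<bar>LBINT x. u x * f x\<bar> \<le> B * t * W" by (simp add: W_def)
  qed
  define M where "M z = (LBINT x. u x * error_kernel \<rho> x0 x z)" for z
  define V where "V z = (LBINT w. ?K w * g (z + w))" for z
  have [measurable]: "borel_fun M" "borel_fun V"
    unfolding M_def[abs_def] V_def[abs_def] by measurable
  have iM: "L1 (\<lambda>x. u x * error_kernel \<rho> x0 x z)" if "z \<in> ball x0 \<rho>" for z
    using gen[OF Em1 A(2)[OF that]] by blast
  have Mb: "\<bar>M z\<bar> \<le> B * A * W" if "z \<in> ball x0 \<rho>" for z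
    using gen[OF Em1 A(2)[OF that]] unfolding M_def by blast
  have iK: "L1 ?K" by (rule integrable_riesz_near[OF \<rho>(1)])
  have Vb: "\<bar>V z\<bar> \<le> B' * (LBINT w. ?K w)" for z
  proof -
    have m: "borel_fun (\<lambda>x. g (z - x))" by measurable
    \<comment> \<open>The correlation with g is a convolution with g reflected at z, since 2 z - (z
      - w) = z + w.\<close>
    have "V z = conv ?K (\<lambda>x. g (2 *\<^sub>R z - x)) z" unfolding V_def conv_def by (simp add: scaleR_2 algebra_simps)
    then show ?thesis using conv_abs_le[OF iK, of "\<lambda>x. g (2 *\<^sub>R z - x)" B' z] B' riesz_near_nonneg by simp
  qed
  have "AE z in lborel. z \<in> ball x0 \<rho> \<longrightarrow> C * u z - M z - V z = 0"
  proof (rule fundamental_lemma_CoV)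
    show "borel_fun (\<lambda>z. C * u z - M z - V z)" by measurable
    show "L1 (\<lambda>z. (C * u z - M z - V z) * indicat_real (ball x0 \<rho>) z)"
    proof (rule integrable_dominated[OF integrable_cball_const[of "\<bar>C\<bar> * B + B * A * W + B' * (LBINT w. ?K w)" x0 \<rho>]])
      fix z
      have "\<bar>C * u z - M z - V z\<bar> \<le> \<bar>C\<bar> * B + B * A * W + B' * (LBINT w. ?K w)" if "z \<in> ball x0 \<rho>"
      proof -
        have "\<bar>C * u z\<bar> \<le> \<bar>C\<bar> * B" unfolding abs_mult by (intro mult_left_mono B) simp
        then show ?thesis using Mb[OF that] Vb[of z] by linarith
      qed
      then show "\<bar>(C * u z - M z - V z) * indicat_real (ball x0 \<rho>) z\<bar> \<le>
        (\<bar>C\<bar> * B + B * A * W + B' * (LBINT w. ?K w)) * indicat_real (ball x0 \<rho>) z"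
        by (auto simp: indicator_def)
    qed measurable
    fix \<psi> :: "'a \<Rightarrow> real" assume \<psi>: "\<psi> \<in> C0_infinity" and supp: "\<And>x. x \<notin> ball x0 \<rho> \<Longrightarrow> \<psi> x = 0"
    note [measurable] = C0_infinity_measurable[OF \<psi>]
    have i\<psi>: "L1 \<psi>" by (rule C0_infinity_integrable[OF \<psi>])
    let ?\<phi> = "conv ?K \<psi>"
    note c0 = conv_riesz_near_C0[of \<rho> \<psi> x0, OF \<rho>(1) \<psi> supp]
    have w: "form_integrable u ?\<phi>" "form u ?\<phi> = (LBINT x. g x * ?\<phi> x)"
      using weak c0 unfolding weak_on_def by auto
    \<comment> \<open>Beyond 3 \<rho> the bump is 0, so the far formula fits the same expression
      with the term C \<psi> x.\<close>
    have L: "Lop ?\<phi> x = C * \<psi> x - (LBINT z. \<psi> z * error_kernel \<rho> x0 x z)" for x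
    proof (cases "norm (x - x0) < 3 * \<rho>")
      case True
      have "Lop ?\<phi> x = C * \<psi> x - (LBINT z. \<psi> z * Lop (riesz_far \<rho>) (x - z))"
        using Lop_parametrix_near[of C \<rho> \<psi> x0 x] C \<rho> \<psi> supp by simp
      then show ?thesis using True by (simp add: error_kernel_def)
    next
      case False
      then have "\<psi> x = 0" using \<rho> by (intro supp) (simp add: dist_norm norm_minus_commute)
      then show ?thesis using False Lop_parametrix_far[of \<rho> \<psi> x0 x] \<rho> \<psi> supp by (simp add: error_kernel_def)
    qed
    have pair1: "integrable lborel2 (\<lambda>(x, z). u x * (\<psi> z * error_kernel \<rho> x0 x z))"
    proof (rule integrable_dominated_pair)
      show "integrable lborel2 (\<lambda>(x, z). (B * A * ?w x) * \<bar>\<psi> z\<bar>)"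
        by (intro integrable_pair_times integrable_mult_right iw integrable_abs i\<psi>)
      show "\<bar>u x * (\<psi> z * error_kernel \<rho> x0 x z)\<bar> \<le> (B * A * ?w x) * \<bar>\<psi> z\<bar>" for x z
      proof (cases "z \<in> ball x0 \<rho>")
        case True
        have "\<bar>u x\<bar> * \<bar>error_kernel \<rho> x0 x z\<bar> \<le> B * (A * ?w x)" by (intro mult_mono B A True B0) simp
        from mult_right_mono[OF this abs_ge_zero[of "\<psi> z"]] show ?thesis by (simp add: abs_mult mult_ac)
      qed (simp add: supp)
    qed measurable
    have pair2: "integrable lborel2 (\<lambda>(x, z). \<psi> z * (g x * ?K (x - z)))"
    proof -
      have "integrable lborel2 (\<lambda>(z, x). \<psi> z * (g x * ?K (x - z)))"
      proof (rule integrable_pair_Fubini)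
        show "(\<lambda>(z, x). \<psi> z * (g x * ?K (x - z))) \<in> borel_measurable (borel \<Otimes>\<^sub>M borel)" by measurable
        have iKz: "L1 (\<lambda>x. ?K (x - z))" for z using integrable_lborel_shift[OF iK, of "- z"] by simp
        have le: "\<bar>\<psi> z * (g x * ?K (x - z))\<bar> \<le> (\<bar>\<psi> z\<bar> * B') * ?K (x - z)" for z x
        proof -
          have "\<bar>\<psi> z\<bar> * (\<bar>g x\<bar> * ?K (x - z)) \<le> \<bar>\<psi> z\<bar> * (B' * ?K (x - z))"
            by (intro mult_left_mono mult_right_mono B' riesz_near_nonneg) simp
          then show ?thesis using riesz_near_nonneg[of \<rho> "x - z"] by (simp add: abs_mult mult_ac)
        qed
        have ib: "L1 (\<lambda>x. (\<bar>\<psi> z\<bar> * B') * ?K (x - z))" for z by (intro integrable_mult_right iKz)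
        have i: "L1 (\<lambda>x. \<psi> z * (g x * ?K (x - z)))" for z
          by (rule integrable_dominated[OF ib[of z] _ le]) measurable
        show "AE z in lborel. L1 (\<lambda>x. \<psi> z * (g x * ?K (x - z)))" by (intro AE_I2 i)
        show "AE z in lborel. (LBINT x. \<bar>\<psi> z * (g x * ?K (x - z))\<bar>) \<le> (B' * (LBINT w. ?K w)) * \<bar>\<psi> z\<bar>"
        proof (rule AE_I2)
          fix z
          have "(LBINT x. \<bar>\<psi> z * (g x * ?K (x - z))\<bar>) \<le> (LBINT x. (\<bar>\<psi> z\<bar> * B') * ?K (x - z))"
            by (intro integral_mono integrable_abs i ib le)
          also have "\<dots> = (\<bar>\<psi> z\<bar> * B') * (LBINT x. ?K (x + - z))" by simp
          also have "(LBINT x. ?K (x + - z)) = (LBINT w. ?K w)" by (rule integral_lborel_shift) measurable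
          finally show "(LBINT x. \<bar>\<psi> z * (g x * ?K (x - z))\<bar>) \<le> (B' * (LBINT w. ?K w)) * \<bar>\<psi> z\<bar>"
            by (simp add: mult_ac)
        qed
        show "L1 (\<lambda>z. (B' * (LBINT w. ?K w)) * \<bar>\<psi> z\<bar>)" by (intro integrable_mult_right integrable_abs i\<psi>)
      qed
      from lborel_pair.integrable_product_swap[OF this] show ?thesis by (simp add: split_beta')
    qed
    have V: "(LBINT x. \<psi> z * (g x * ?K (x - z))) = \<psi> z * V z" for z
      using integral_lborel_shift[of "\<lambda>x. g x * ?K (x - z)" z] unfolding V_def by (simp add: mult.commute add.commute)
    have iu: "L1 (\<lambda>x. u x * \<psi> x)"
      using conv_integrable[OF i\<psi>, of "\<lambda>x. u (- x)" B 0] B by (simp add: mult.commute)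
    have "(LBINT x. g x * ?\<phi> x) = (LBINT x. LBINT z. \<psi> z * (g x * ?K (x - z)))"
    proof (rule lint_cong[OF refl])
      fix x
      have "?\<phi> x = (LBINT z. \<psi> z * ?K (x - z))"
        unfolding conv_commute[OF borel_measurable_riesz_near C0_infinity_measurable[OF \<psi>]] unfolding conv_def ..
      then show "g x * ?\<phi> x = (LBINT z. \<psi> z * (g x * ?K (x - z)))"
        by (simp add: integral_mult_right_zero[symmetric] mult.left_commute del: integral_mult_right_zero)
    qed
    also have "\<dots> = (LBINT z. \<psi> z * V z)" unfolding LINT_swap[OF pair2] V ..
    finally have e1: "form u ?\<phi> = (LBINT z. \<psi> z * V z)" using w(2) by simp
    have i2: "L1 (\<lambda>z. \<psi> z * V z)"
      using lborel_pair.integrable_snd[OF pair2] unfolding V .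
    have M: "(LBINT x. u x * (\<psi> z * error_kernel \<rho> x0 x z)) = \<psi> z * M z" for z
      unfolding M_def by (simp add: integral_mult_right_zero[symmetric] mult.left_commute del: integral_mult_right_zero)
    have i3: "L1 (\<lambda>z. \<psi> z * M z)"
      using lborel_pair.integrable_snd[OF pair1] unfolding M .
    have ui: "u x * Lop ?\<phi> x = C * (u x * \<psi> x) - (LBINT z. u x * (\<psi> z * error_kernel \<rho> x0 x z))" for x
      unfolding L by (simp add: right_diff_distrib)
    have f: "form u ?\<phi> = (LBINT x. u x * Lop ?\<phi> x)"
      by (rule form_C0_infinity(1)[OF c0(1) _ B w(1)]) measurable
    have "form u ?\<phi> = C * (LBINT x. u x * \<psi> x) - (LBINT x. LBINT z. u x * (\<psi> z * error_kernel \<rho> x0 x z))"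
      unfolding f unfolding ui
      by (subst integral_minus[OF integrable_mult_right[OF iu] lborel_pair.integrable_fst[OF pair1]]) simp
    also have "\<dots> = C * (LBINT x. u x * \<psi> x) - (LBINT z. \<psi> z * M z)"
      unfolding LINT_swap[OF pair1] M ..
    finally have e2: "C * (LBINT x. u x * \<psi> x) - (LBINT z. \<psi> z * M z) - (LBINT z. \<psi> z * V z) = 0"
      using e1 by simp
    have eq: "(C * u z - M z - V z) * \<psi> z = C * (u z * \<psi> z) - \<psi> z * M z - \<psi> z * V z" for z by (simp add: algebra_simps)
    show "(LBINT z. (C * u z - M z - V z) * \<psi> z) = 0"
      unfolding eq using e2 iu i2 i3 by simp
  qed
  then have rep: "AE z in lborel. z \<in> ball x0 \<rho> \<longrightarrow> C * u z = M z + (LBINT w. ?K w * g (z + w))"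
    unfolding V_def by eventually_elim (auto simp: algebra_simps)
  show ?thesis
  proof (rule that[of "B * A * W + 1" M, OF _ rep])
    show "0 < B * A * W + 1" using B0 A W0 by (simp add: add_nonneg_pos)
    fix z assume z: "z \<in> ball x0 \<rho>"
    show "\<bar>M z\<bar> \<le> B * A * W + 1" using Mb[OF z] by linarith
    fix h assume zh: "z + h \<in> ball x0 \<rho>" and h: "norm h \<le> \<rho> / 2"
    have "M (z + h) - M z = (LBINT x. u x * (error_kernel \<rho> x0 x (z + h) - error_kernel \<rho> x0 x z))"
      unfolding M_def right_diff_distrib by (rule integral_minus[OF iM[OF zh] iM[OF z], symmetric])
    also have "\<bar>\<dots>\<bar> \<le> B * (A * norm h) * W" using gen[OF _ A(3)[OF z h]] by simp
    also have "\<dots> \<le> (B * A * W + 1) * norm h" by (simp add: algebra_simps)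
    finally show "\<bar>M (z + h) - M z\<bar> \<le> (B * A * W + 1) * norm h" .
    assume zh': "z - h \<in> ball x0 \<rho>"
    have eq: "u x * sd (error_kernel \<rho> x0 x) h z = u x * error_kernel \<rho> x0 x (z + h) + u x * error_kernel \<rho> x0 x (z - h) - 2 * (u x * error_kernel \<rho> x0 x z)" for x
      by (simp add: sd_def algebra_simps)
    have m: "borel_fun (\<lambda>x. sd (error_kernel \<rho> x0 x) h z)" unfolding sd_def by measurable
    have "sd M h z = (LBINT x. u x * sd (error_kernel \<rho> x0 x) h z)"
      unfolding eq unfolding sd_def M_def using iM[OF z] iM[OF zh] iM[OF zh'] by simp
    also have "\<bar>\<dots>\<bar> \<le> B * (A * (norm h)\<^sup>2) * W" using gen[OF m A(4)[OF z h]] by simp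
    also have "\<dots> \<le> (B * A * W + 1) * (norm h)\<^sup>2" by (simp add: algebra_simps)
    finally show "\<bar>sd M h z\<bar> \<le> (B * A * W + 1) * (norm h)\<^sup>2" .
  qed
qed

end

section \<open>Interior regularity\<close>

lemma continuous_AE_eq_on_open:
  fixes f g :: "'a::euclidean_space \<Rightarrow> real"
  assumes U: "open U" and f: "continuous_on U f" and g: "continuous_on U g"
    and eq: "AE x in lborel. x \<in> U \<longrightarrow> f x = g x" and x: "x \<in> U"
  shows "f x = g x"
proof (rule ccontr)
  assume ne: "f x \<noteq> g x"
  have "open (U \<inter> (\<lambda>x. f x - g x) -` (- {0}))"
    by (intro continuous_open_preimage continuous_on_diff f g U) auto
  then obtain e where e: "0 < e" "ball x e \<subseteq> U \<inter> (\<lambda>x. f x - g x) -` (- {0})"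
    using x ne by (force simp: open_contains_ball)
  have "AE y in lborel. y \<notin> ball x e" using eq by eventually_elim (use e in auto)
  then have "emeasure lborel (ball x e) = 0"
    by (subst (asm) AE_iff_measurable[of "ball x e"]) auto
  then show False using e(1) unit_ball_vol_pos[of "real DIM('a)"] by (simp add: emeasure_ball)
qed

lemma AE_pair_lborel:
  assumes "AE x in lborel. P (x::'a::euclidean_space)"
  shows "AE z in lborel2. P (fst z) \<and> P (snd z)"
proof -
  obtain N where N: "N \<in> null_sets lborel" "\<And>x. x \<notin> N \<Longrightarrow> P x"
  proof -
    obtain N where "\<And>x. x \<in> space lborel - N \<Longrightarrow> P x" "N \<in> null_sets lborel"
      by (rule AE_E3[OF assms]) (rule that; assumption)
    then show ?thesis using that[of N] by simp
  qed
  have "N \<times> UNIV \<in> null_sets lborel2" "UNIV \<times> N \<in> null_sets lborel2"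
    using N(1) by (auto simp: null_sets_def lborel.emeasure_pair_measure_Times)
  from AE_not_in[OF this(1)] AE_not_in[OF this(2)] show ?thesis
    by eventually_elim (use N(2) in \<open>auto simp: mem_Times_iff\<close>)
qed

section \<open>Hoelder regularity and the pointwise equation\<close>

context fractional_order
begin

lemma weak_on_mono: "weak_on U u g \<Longrightarrow> V \<subseteq> U \<Longrightarrow> weak_on V u g"
  unfolding weak_on_def by blast

lemma form_cong:
  assumes [measurable]: "borel_fun u" "borel_fun u'" "borel_fun \<phi>"
    and u: "AE x in lborel. u x = u' x"
  shows "form_integrable u \<phi> \<longleftrightarrow> form_integrable u' \<phi>" and "form u \<phi> = form u' \<phi>"
proof -
  have "AE z in lborel2. (case z of (x, y) \<Rightarrow> energy_density u \<phi> x y) = (case z of (x, y) \<Rightarrow> energy_density u' \<phi> x y)"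
    using AE_pair_lborel[OF u] by eventually_elim (auto simp: energy_density_def split_beta')
  from integrable_cong_AE[OF _ _ this] integral_cong_AE[OF _ _ this]
  show "form_integrable u \<phi> \<longleftrightarrow> form_integrable u' \<phi>" "form u \<phi> = form u' \<phi>"
    unfolding form_integrable_def form_def by auto
qed

lemma weak_on_cong:
  assumes [measurable]: "borel_fun u" "borel_fun u'" "borel_fun g" "borel_fun g'"
    and u: "AE x in lborel. u x = u' x" and g: "AE x in lborel. x \<in> U \<longrightarrow> g x = g' x"
    and w: "weak_on U u g"
  shows "weak_on U u' g'"
  unfolding weak_on_def
proof (intro ballI impI)
  fix \<phi> :: "'a \<Rightarrow> real" assume \<phi>: "\<phi> \<in> C0_infinity" and supp: "\<forall>x. x \<notin> U \<longrightarrow> \<phi> x = 0"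
  note [measurable] = C0_infinity_measurable[OF \<phi>]
  have "AE x in lborel. g x * \<phi> x = g' x * \<phi> x" using g by eventually_elim (use supp in auto)
  then have "(LBINT x. g x * \<phi> x) = (LBINT x. g' x * \<phi> x)" by (intro integral_cong_AE) auto
  then show "form_integrable u' \<phi> \<and> form u' \<phi> = (LBINT x. g' x * \<phi> x)"
    using w \<phi> supp form_cong[OF assms(1,2) _ u, of \<phi>] unfolding weak_on_def by auto
qed

text \<open>Half of the limiting exponent min 1 (2s), which leaves slack in the strict inequalities
  needed for local integrability.\<close>

definition hoelder_exponent :: real where
  "hoelder_exponent = min 1 (2 * s) / 2"

lemma hoelder_exponent: "0 < hoelder_exponent" "hoelder_exponent \<le> 1" "hoelder_exponent < 2 * s" "hoelder_exponent \<le> s"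
  using s_pos by (auto simp: hoelder_exponent_def min_def)

definition hoelder_on :: "'a set \<Rightarrow> ('a \<Rightarrow> real) \<Rightarrow> bool" where
  "hoelder_on S f \<longleftrightarrow> (\<exists>C. \<forall>x\<in>S. \<forall>y\<in>S. \<bar>f x - f y\<bar> \<le> C * norm (x - y) powr hoelder_exponent)"

lemma hoelder_on_subset: "hoelder_on S f \<Longrightarrow> T \<subseteq> S \<Longrightarrow> hoelder_on T f"
  unfolding hoelder_on_def by blast

lemma hoelder_on_cong: "hoelder_on S f \<Longrightarrow> (\<And>x. x \<in> S \<Longrightarrow> f x = g x) \<Longrightarrow> hoelder_on S g"
  unfolding hoelder_on_def by auto

lemma hoelder_on_continuous:
  assumes "hoelder_on S f" shows "continuous_on S f"
proof -
  obtain C where C: "\<And>x y. x \<in> S \<Longrightarrow> y \<in> S \<Longrightarrow> \<bar>f x - f y\<bar> \<le> C * norm (x - y) powr hoelder_exponent"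
    using assms unfolding hoelder_on_def by blast
  show ?thesis
    unfolding continuous_on_def
  proof
    fix x assume x: "x \<in> S"
    show "(f \<longlongrightarrow> f x) (at x within S)"
    proof (rule LIM_zero_cancel, rule Lim_null_comparison)
      show "\<forall>\<^sub>F y in at x within S. norm (f y - f x) \<le> C * norm (x - y) powr hoelder_exponent"
        using x C by (auto simp: eventually_at_filter norm_minus_commute[of x])
      have "((\<lambda>y. C * norm (x - y) powr hoelder_exponent) \<longlongrightarrow> C * norm (x - x) powr hoelder_exponent) (at x within S)"
        using hoelder_exponent by (intro tendsto_intros) auto
      then show "((\<lambda>y. C * norm (x - y) powr hoelder_exponent) \<longlongrightarrow> 0) (at x within S)" by simp
    qed
  qed
qed

text \<open>Both stages of regularity concern the same w, namely (M + V) / C0. The second is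
  conditional: in the application g is a function of u and becomes Hoelder continuous only after the
  first stage has been completed.\<close>

lemma interior_representative:
  assumes \<rho>: "0 < \<rho>" "\<rho> \<le> 1"
    and u [measurable]: "borel_fun u" and B: "\<And>x. \<bar>u x\<bar> \<le> B"
    and g [measurable]: "borel_fun g" and B': "\<And>x. \<bar>g x\<bar> \<le> B'"
    and weak: "weak_on (ball x0 (2 * \<rho>)) u g"
  obtains w where "AE z in lborel. z \<in> ball x0 \<rho> \<longrightarrow> u z = w z" "hoelder_on (ball x0 (\<rho> / 4)) w"
    "hoelder_on (ball x0 (3 * \<rho>)) g \<Longrightarrow>
       \<exists>\<gamma> C. 2 * s < \<gamma> \<and> (\<forall>z h. z \<in> ball x0 (\<rho> / 8) \<longrightarrow> norm h \<le> \<rho> / 8 \<longrightarrow> \<bar>sd w h z\<bar> \<le> C * norm h powr \<gamma>)"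
proof -
  obtain C0 where C0: "0 < C0" "\<And>\<psi> x. \<psi> \<in> C0_infinity \<Longrightarrow> Lop (conv riesz \<psi>) x = C0 * \<psi> x"
    by (rule riesz_fundamental_solution) (rule that; assumption)
  let ?K = "riesz_near \<rho>"
  obtain M A where M: "0 < A"
    "AE z in lborel. z \<in> ball x0 \<rho> \<longrightarrow> C0 * u z = M z + (LBINT w. ?K w * g (z + w))"
    "\<And>z h. z \<in> ball x0 \<rho> \<Longrightarrow> z + h \<in> ball x0 \<rho> \<Longrightarrow> norm h \<le> \<rho> / 2 \<Longrightarrow> \<bar>M (z + h) - M z\<bar> \<le> A * norm h"
    "\<And>z h. z \<in> ball x0 \<rho> \<Longrightarrow> z + h \<in> ball x0 \<rho> \<Longrightarrow> z - h \<in> ball x0 \<rho> \<Longrightarrow> norm h \<le> \<rho> / 2 \<Longrightarrow> \<bar>sd M h z\<bar> \<le> A * (norm h)\<^sup>2"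
    "\<And>z. z \<in> ball x0 \<rho> \<Longrightarrow> \<bar>M z\<bar> \<le> A"
    by (rule parametrix_representation[OF C0(2) \<rho> u B g B' weak]) (assumption, (rule that; assumption))
  define V where "V z = (LBINT w. ?K w * g (z + w))" for z
  define w where "w z = (M z + V z) / C0" for z
  let ?b = hoelder_exponent
  have iK: "L1 ?K" by (rule integrable_riesz_near[OF \<rho>(1)])
  have B0: "0 \<le> B'" using B'[of 0] by simp
  have mg: "L1 (\<lambda>y. f y * g (z + y))" if "L1 f" for f z
    using conv_integrable[OF that, of "\<lambda>y. g (2 *\<^sub>R z - y)" B' z] B' by (simp add: scaleR_2 algebra_simps)
  have Vh: "V (z + h) = (LBINT y. ?K (y - h) * g (z + y))" for z h
    using integral_lborel_shift[of "\<lambda>y. ?K (y - h) * g (z + y)" h] unfolding V_def by (simp add: algebra_simps)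
  have iKh: "L1 (\<lambda>y. ?K (y - h))" for h using integrable_lborel_shift[OF iK, of "- h"] by simp
  obtain C1 where C1: "0 < C1" "\<And>h. norm h \<le> \<rho> \<Longrightarrow> (LBINT w. \<bar>?K (w + h) - ?K w\<bar>) \<le> C1 * norm h powr ?b"
    by (rule riesz_near_first_difference[OF \<rho>(1) hoelder_exponent(1-3)]) (rule that; assumption)
  have V1: "\<bar>V (z + h) - V z\<bar> \<le> B' * C1 * norm h powr ?b" if "norm h \<le> \<rho>" for z h
  proof -
    have "V (z + h) - V z = (LBINT y. (?K (y + - h) - ?K y) * g (z + y))"
      unfolding Vh left_diff_distrib using V_def mg[OF iKh[of h]] mg[OF iK] by simp
    also have "\<bar>\<dots>\<bar> \<le> (LBINT y. B' * \<bar>?K (y + - h) - ?K y\<bar>)"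
    proof (rule integral_abs_bound_integral)
      have i: "L1 (\<lambda>y. ?K (y + - h) - ?K y)" using iKh[of h] iK by simp
      show "L1 (\<lambda>y. (?K (y + - h) - ?K y) * g (z + y))" by (rule mg[OF i])
      show "L1 (\<lambda>y. B' * \<bar>?K (y + - h) - ?K y\<bar>)" by (intro integrable_mult_right integrable_abs i)
      show "\<bar>(?K (y + - h) - ?K y) * g (z + y)\<bar> \<le> B' * \<bar>?K (y + - h) - ?K y\<bar>" for y
        using mult_right_mono[OF B'[of "z + y"] abs_ge_zero[of "?K (y + - h) - ?K y"]] by (simp add: abs_mult mult.commute)
    qed
    also have "\<dots> = B' * (LBINT y. \<bar>?K (y + - h) - ?K y\<bar>)" by (simp only: integral_mult_right_zero)
    also have "\<dots> \<le> B' * (C1 * norm (- h) powr ?b)" using that by (intro mult_left_mono C1 B0) simp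
    finally show ?thesis by (simp add: mult_ac)
  qed
  have eqw: "AE z in lborel. z \<in> ball x0 \<rho> \<longrightarrow> u z = w z"
    using M(2) by eventually_elim (use C0 in \<open>auto simp: w_def V_def field_simps\<close>)
  have pw: "norm h powr d \<le> norm h powr e" if "norm h \<le> 1" "e \<le> d" for h :: 'a and d e
  proof (cases "h = 0")
    case False
    then show ?thesis using that by (intro powr_mono') auto
  qed simp
  have hol: "hoelder_on (ball x0 (\<rho> / 4)) w"
    unfolding hoelder_on_def
  proof (intro exI ballI)
    fix y z assume y: "y \<in> ball x0 (\<rho> / 4)" and z: "z \<in> ball x0 (\<rho> / 4)"
    define h where "h = y - z"
    have h: "norm h < \<rho> / 2"
      using y z norm_triangle_ineq4[of "y - x0" "z - x0"] by (simp add: h_def dist_norm norm_minus_commute)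
    have h1: "norm h \<le> 1" using h \<rho> by linarith
    have yz: "y = z + h" by (simp add: h_def)
    have inb: "z \<in> ball x0 \<rho>" "z + h \<in> ball x0 \<rho>" using y z \<rho>(1) unfolding yz[symmetric] by (auto simp: dist_norm)
    have "\<bar>M (z + h) - M z\<bar> \<le> A * norm h" using h by (intro M inb) simp
    also have "norm h = norm h powr 1" by simp
    also have "A * norm h powr 1 \<le> A * norm h powr ?b"
      using M(1) pw[OF h1 hoelder_exponent(2)] by (intro mult_left_mono) auto
    finally have m: "\<bar>M (z + h) - M z\<bar> \<le> A * norm h powr ?b" .
    have "\<bar>w y - w z\<bar> = \<bar>(M (z + h) - M z) + (V (z + h) - V z)\<bar> / C0"
      using C0(1) unfolding w_def yz by (simp add: diff_divide_distrib[symmetric] abs_divide algebra_simps)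
    also have "\<dots> \<le> (A * norm h powr ?b + B' * C1 * norm h powr ?b) / C0"
      using m V1[of h z] h \<rho> C0(1) by (intro divide_right_mono order_trans[OF abs_triangle_ineq] add_mono) auto
    finally show "\<bar>w y - w z\<bar> \<le> ((A + B' * C1) / C0) * norm (y - z) powr ?b"
      by (simp add: h_def algebra_simps add_divide_distrib)
  qed
  have sdw: "\<exists>\<gamma> C. 2 * s < \<gamma> \<and> (\<forall>z h. z \<in> ball x0 (\<rho> / 8) \<longrightarrow> norm h \<le> \<rho> / 8 \<longrightarrow> \<bar>sd w h z\<bar> \<le> C * norm h powr \<gamma>)"
    if hg: "hoelder_on (ball x0 (3 * \<rho>)) g"
  proof -
    \<comment> \<open>It must exceed 2s for the singular integral, be at most 2 because
      \<open>M\<close> has merely quadratic second differences, and stay below 2s plus the Hoelder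
      exponent for \<open>riesz_near_sd_weighted\<close>.\<close>
    define \<gamma> where "\<gamma> = min 2 (2 * s + ?b / 2)"
    have g1: "2 * s < \<gamma>" "\<gamma> \<le> 2" "\<gamma> < 2 * s + ?b" "?b \<le> \<gamma>"
      using hoelder_exponent s_less_1 s_pos by (auto simp: \<gamma>_def min_def)
    obtain G where G: "\<And>x y. x \<in> ball x0 (3 * \<rho>) \<Longrightarrow> y \<in> ball x0 (3 * \<rho>) \<Longrightarrow> \<bar>g x - g y\<bar> \<le> G * norm (x - y) powr ?b"
      using hg unfolding hoelder_on_def by blast
    obtain C2 where C2: "0 < C2" "\<And>h. norm h \<le> \<rho> \<Longrightarrow> L1 (\<lambda>w. \<bar>sd ?K h w\<bar> * norm w powr ?b)"
      "\<And>h. norm h \<le> \<rho> \<Longrightarrow> (LBINT w. \<bar>sd ?K h w\<bar> * norm w powr ?b) \<le> C2 * norm h powr \<gamma>"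
      by (rule riesz_near_sd_weighted[OF \<rho>(1) hoelder_exponent(1) g1(4,2,3)]) (rule that; assumption)
    \<comment> \<open>The second difference of the kernel has mean zero. So g(z + y) may be replaced
      by g(z + y) - g(z), whose Hoelder bound supplies the weight |y|^\<alpha>.\<close>
    have isd: "L1 (sd ?K h)" and sd0: "(LBINT y. sd ?K h y) = 0" for h
    proof -
      have i: "L1 (\<lambda>y. ?K (y + h))" by (rule integrable_lborel_shift[OF iK])
      show "L1 (sd ?K h)" unfolding sd_def[abs_def] using i iKh[of h] iK by simp
      have "(LBINT y. ?K (y + h)) = (LBINT y. ?K y)" "(LBINT y. ?K (y - h)) = (LBINT y. ?K y)"
        using integral_lborel_shift[of ?K h] integral_lborel_shift[of ?K "- h"] by auto
      then show "(LBINT y. sd ?K h y) = 0" unfolding sd_def using i iKh[of h] iK by simp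
    qed
    have V2: "\<bar>sd V h z\<bar> \<le> \<bar>G\<bar> * C2 * norm h powr \<gamma>" if z: "z \<in> ball x0 \<rho>" and h: "norm h \<le> \<rho> / 2" for z h
    proof -
      have hr: "norm h \<le> \<rho>" using h \<rho> by simp
      have "sd V h z = (LBINT y. ?K (y - h) * g (z + y)) + (LBINT y. ?K (y - - h) * g (z + y)) - 2 * (LBINT y. ?K y * g (z + y))"
        unfolding sd_def diff_conv_add_uminus[of z h] Vh by (simp add: V_def)
      also have "\<dots> = (LBINT y. ?K (y - h) * g (z + y) + ?K (y - - h) * g (z + y) - 2 * (?K y * g (z + y)))"
        using mg[OF iKh[of h]] mg[OF iKh[of "- h"]] mg[OF iK] by simp
      also have "\<dots> = (LBINT y. sd ?K h y * g (z + y))"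
        by (intro lint_cong) (simp_all add: sd_def algebra_simps)
      also have "\<dots> = (LBINT y. sd ?K h y * (g (z + y) - g z))"
        unfolding right_diff_distrib
        by (subst integral_minus[OF mg[OF isd] integrable_mult_left[OF isd]]) (simp add: sd0)
      also have "\<bar>\<dots>\<bar> \<le> (LBINT y. \<bar>G\<bar> * (\<bar>sd ?K h y\<bar> * norm y powr ?b))"
      proof (rule integral_abs_bound_integral)
        show "L1 (\<lambda>y. sd ?K h y * (g (z + y) - g z))"
          unfolding right_diff_distrib
          by (intro integrable_minus mg integrable_mult_left isd)
        show "L1 (\<lambda>y. \<bar>G\<bar> * (\<bar>sd ?K h y\<bar> * norm y powr ?b))" by (intro integrable_mult_right C2 hr)
        fix y
        show "\<bar>sd ?K h y * (g (z + y) - g z)\<bar> \<le> \<bar>G\<bar> * (\<bar>sd ?K h y\<bar> * norm y powr ?b)"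
        proof (cases "norm y < 2 * \<rho>")
          case True
          have z1: "norm (z - x0) < \<rho>" using z by (simp add: dist_norm norm_minus_commute)
          have "norm (z + y - x0) < 3 * \<rho>" using norm_triangle_ineq[of "z - x0" y] z1 True by (simp add: algebra_simps)
          then have "\<bar>g (z + y) - g z\<bar> \<le> G * norm ((z + y) - z) powr ?b"
            using z1 \<rho> by (intro G) (auto simp: dist_norm norm_minus_commute)
          also have "\<dots> \<le> \<bar>G\<bar> * norm y powr ?b" by (simp add: mult_right_mono)
          finally have "\<bar>sd ?K h y\<bar> * \<bar>g (z + y) - g z\<bar> \<le> \<bar>sd ?K h y\<bar> * (\<bar>G\<bar> * norm y powr ?b)" by (rule mult_left_mono) simp
          then show ?thesis by (simp add: abs_mult mult_ac)
        next
          case False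
          then have "\<rho> \<le> norm (y + h)" "\<rho> \<le> norm (y - h)" "\<rho> \<le> norm y"
            using norm_diff_ineq[of y h] norm_triangle_ineq2[of y h] hr \<rho> by linarith+
          then show ?thesis using riesz_near_eq_0[OF \<rho>(1)] by (simp add: sd_def)
        qed
      qed
      also have "\<dots> = \<bar>G\<bar> * (LBINT y. \<bar>sd ?K h y\<bar> * norm y powr ?b)" by (simp only: integral_mult_right_zero)
      also have "\<dots> \<le> \<bar>G\<bar> * (C2 * norm h powr \<gamma>)" by (intro mult_left_mono C2 hr) simp
      finally show ?thesis by (simp add: mult_ac)
    qed
    show ?thesis
    proof (intro exI conjI allI impI)
      show "2 * s < \<gamma>" by (rule g1)
      fix z h :: 'a assume z: "z \<in> ball x0 (\<rho> / 8)" and h: "norm h \<le> \<rho> / 8"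
      have z1: "norm (z - x0) < \<rho> / 8" using z by (simp add: dist_norm norm_minus_commute)
      have "norm (z + h - x0) < \<rho>" "norm (z - h - x0) < \<rho>"
        using norm_triangle_ineq[of "z - x0" h] norm_triangle_ineq4[of "z - x0" h] z1 h \<rho> by (simp_all add: algebra_simps)
      then have inb: "z + h \<in> ball x0 \<rho>" "z - h \<in> ball x0 \<rho>" "z \<in> ball x0 \<rho>"
        using z1 \<rho> by (auto simp: dist_norm norm_minus_commute)
      have h2: "norm h \<le> \<rho> / 2" and h1: "norm h \<le> 1" using h \<rho> by linarith+
      have "\<bar>sd M h z\<bar> \<le> A * (norm h)\<^sup>2" by (rule M(4)[OF inb(3,1,2) h2])
      also have "(norm h)\<^sup>2 = norm h powr 2" by simp
      also have "A * norm h powr 2 \<le> A * norm h powr \<gamma>"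
        using M(1) pw[OF h1 g1(2)] by (intro mult_left_mono) auto
      finally have m: "\<bar>sd M h z\<bar> \<le> A * norm h powr \<gamma>" .
      have "sd w h z = (sd M h z + sd V h z) / C0"
        unfolding sd_def w_def by (simp add: add_divide_distrib diff_divide_distrib algebra_simps)
      then have "\<bar>sd w h z\<bar> = \<bar>sd M h z + sd V h z\<bar> / C0" using C0(1) by (simp add: abs_divide)
      also have "\<dots> \<le> (A * norm h powr \<gamma> + \<bar>G\<bar> * C2 * norm h powr \<gamma>) / C0"
        using m V2[OF inb(3) h2] C0(1) by (intro divide_right_mono order_trans[OF abs_triangle_ineq] add_mono) auto
      finally show "\<bar>sd w h z\<bar> \<le> ((A + \<bar>G\<bar> * C2) / C0) * norm h powr \<gamma>"
        by (simp add: algebra_simps add_divide_distrib)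
    qed
  qed
  show ?thesis by (rule that[OF eqw hol sdw])
qed

lemma interior_continuity:
  assumes U: "open U" and u [measurable]: "borel_fun u" and B: "\<And>x. \<bar>u x\<bar> \<le> B"
    and g [measurable]: "borel_fun g" and B': "\<And>x. \<bar>g x\<bar> \<le> B'"
    and weak: "weak_on U u g"
  obtains v where "AE x in lborel. x \<in> U \<longrightarrow> v x = u x" "continuous_on U v"
    "\<And>x. x \<in> U \<Longrightarrow> \<exists>r>0. ball x r \<subseteq> U \<and> hoelder_on (ball x r) v"
proof -
  have "\<exists>r w. 0 < r \<and> ball x r \<subseteq> U \<and> (AE z in lborel. z \<in> ball x r \<longrightarrow> u z = w z) \<and> hoelder_on (ball x r) w" if x: "x \<in> U" for x
  proof -
    obtain r0 where r0: "0 < r0" "ball x r0 \<subseteq> U" using U x unfolding open_contains_ball by blast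
    define \<rho> where "\<rho> = min 1 (r0 / 2)"
    have \<rho>: "0 < \<rho>" "\<rho> \<le> 1" "2 * \<rho> \<le> r0" using r0 by (auto simp: \<rho>_def)
    have "weak_on (ball x (2 * \<rho>)) u g"
      using \<rho> r0(2) by (intro weak_on_mono[OF weak]) (auto simp: subset_eq)
    then obtain w where w: "AE z in lborel. z \<in> ball x \<rho> \<longrightarrow> u z = w z" "hoelder_on (ball x (\<rho> / 4)) w"
      by (rule interior_representative[OF \<rho>(1,2) u B g B'])
    have "AE z in lborel. z \<in> ball x (\<rho> / 4) \<longrightarrow> u z = w z" using w(1) by eventually_elim (use \<rho> in auto)
    then show ?thesis using w(2) \<rho> r0 by (intro exI[of _ "\<rho> / 4"] exI[of _ w]) (auto simp: subset_eq)
  qed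
  then have "\<forall>x. \<exists>r w. x \<in> U \<longrightarrow> 0 < r \<and> ball x r \<subseteq> U \<and> (AE z in lborel. z \<in> ball x r \<longrightarrow> u z = w z) \<and> hoelder_on (ball x r) w"
    by blast
  then obtain R W where "\<forall>x. x \<in> U \<longrightarrow> 0 < R x \<and> ball x (R x) \<subseteq> U \<and> (AE z in lborel. z \<in> ball x (R x) \<longrightarrow> u z = W x z) \<and> hoelder_on (ball x (R x)) (W x)"
    unfolding choice_iff by (elim exE)
  then have RW: "\<And>x. x \<in> U \<Longrightarrow> 0 < R x" "\<And>x. x \<in> U \<Longrightarrow> ball x (R x) \<subseteq> U"
    "\<And>x. x \<in> U \<Longrightarrow> AE z in lborel. z \<in> ball x (R x) \<longrightarrow> u z = W x z" "\<And>x. x \<in> U \<Longrightarrow> hoelder_on (ball x (R x)) (W x)"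
    by blast+
  \<comment> \<open>Every point uses its own local representative. Two of them agree on the
    intersection of their balls, being continuous there and equal to u almost everywhere.\<close>
  define v where "v x = W x x" for x
  have veq: "v z = W x z" if x: "x \<in> U" and z: "z \<in> ball x (R x)" for x z
    unfolding v_def
  proof (rule continuous_AE_eq_on_open[of "ball x (R x) \<inter> ball z (R z)" "W z" "W x" z])
    have zU: "z \<in> U" using RW(2)[OF x] z by auto
    show "open (ball x (R x) \<inter> ball z (R z))" by auto
    show "continuous_on (ball x (R x) \<inter> ball z (R z)) (W z)" "continuous_on (ball x (R x) \<inter> ball z (R z)) (W x)"
      using hoelder_on_continuous[OF RW(4)[OF zU]] hoelder_on_continuous[OF RW(4)[OF x]] by (auto intro: continuous_on_subset)
    show "AE y in lborel. y \<in> ball x (R x) \<inter> ball z (R z) \<longrightarrow> W z y = W x y"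
      using RW(3)[OF zU] RW(3)[OF x] by eventually_elim auto
    show "z \<in> ball x (R x) \<inter> ball z (R z)" using z RW(1)[OF zU] by simp
  qed
  have hol: "hoelder_on (ball x (R x)) v" if "x \<in> U" for x
    by (rule hoelder_on_cong[OF RW(4)[OF that]]) (rule veq[OF that, symmetric])
  \<comment> \<open>Each ball comes with an exceptional null set; the Lindelof property reduces them
    to countably many.\<close>
  obtain F where F: "F \<subseteq> (\<lambda>x. ball x (R x)) ` U" "countable F" "\<Union>F = (\<Union>x\<in>U. ball x (R x))"
    using Lindelof[of "(\<lambda>x. ball x (R x)) ` U"] by auto
  have cov: "(\<Union>x\<in>U. ball x (R x)) = U" using RW(1,2) by (auto simp: subset_eq)
  have "AE y in lborel. \<forall>S\<in>F. y \<in> S \<longrightarrow> v y = u y"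
    unfolding AE_ball_countable[OF F(2)]
  proof
    fix S assume "S \<in> F"
    then obtain x where x: "x \<in> U" "S = ball x (R x)" using F(1) by auto
    show "AE y in lborel. y \<in> S \<longrightarrow> v y = u y" using RW(3)[OF x(1)] by eventually_elim (simp add: x veq)
  qed
  then have "AE y in lborel. y \<in> \<Union>F \<longrightarrow> v y = u y" by eventually_elim blast
  then have "AE y in lborel. y \<in> U \<longrightarrow> v y = u y" unfolding F(3) cov .
  moreover have "continuous_on U v"
  proof (rule continuous_at_imp_continuous_on, rule ballI)
    fix x assume x: "x \<in> U"
    show "isCont v x"
      using hoelder_on_continuous[OF hol[OF x]] RW(1)[OF x] by (auto simp: continuous_on_eq_continuous_at)
  qed
  moreover have "\<exists>r>0. ball x r \<subseteq> U \<and> hoelder_on (ball x r) v" if "x \<in> U" for x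
    using RW(1,2)[OF that] hol[OF that] by blast
  ultimately show ?thesis by (rule that)
qed

text \<open>Since \<gamma> > 2s, the bound on second differences gives one integrable majorant for
  all z near x0, so \<open>Lop v\<close> converges and is continuous there. The weak equation
  identifies it with g almost everywhere, and continuity removes the null set.\<close>

lemma pointwise_equation:
  assumes v: "continuous_on UNIV v" and B: "\<And>x. \<bar>v x\<bar> \<le> B"
    and g: "continuous_on UNIV g" and weak: "weak_on U v g" and r: "0 < r" "ball x0 r \<subseteq> U"
    and \<gamma>: "2 * s < \<gamma>" and sd: "\<And>z h. z \<in> ball x0 r \<Longrightarrow> norm h \<le> r \<Longrightarrow> \<bar>sd v h z\<bar> \<le> C * norm h powr \<gamma>"
  shows "L1 (\<lambda>h. sd v h x0 * ker h)" and "Lop v x0 = g x0"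
proof -
  have [measurable]: "borel_fun v" "borel_fun g"
    using v g by (auto intro: borel_measurable_continuous_onI)
  have B0: "0 \<le> B" using B[of 0] by simp
  have g0: "0 < \<gamma>" using \<gamma> s_pos by linarith
  \<comment> \<open>The terms serve |h| \<le> r, |h| \<ge> 1, and the gap r < |h| < 1, where 4 B
    \<le> (4 B / r^\<gamma>) |h|^\<gamma>.\<close>
  define D where "D = \<bar>C\<bar> + 4 * B + 4 * B / r powr \<gamma>"
  have D0: "0 \<le> D" using B0 by (simp add: D_def)
  let ?m = "\<lambda>h::'a. min 1 (norm h powr \<gamma>)"
  have le: "\<bar>sd v h z\<bar> \<le> D * ?m h" if z: "z \<in> ball x0 r" for z h
  proof -
    have 4: "\<bar>sd v h z\<bar> \<le> 4 * B" by (rule abs_sd_le[OF B])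
    show ?thesis
    proof (cases "1 \<le> norm h powr \<gamma>")
      case True
      have "4 * B \<le> D" using B0 by (simp add: D_def)
      then show ?thesis using 4 True by (simp add: min_absorb1)
    next
      case False
      have "\<bar>sd v h z\<bar> \<le> (\<bar>C\<bar> + 4 * B / r powr \<gamma>) * norm h powr \<gamma>"
      proof (cases "norm h \<le> r")
        case True
        have "C * norm h powr \<gamma> \<le> (\<bar>C\<bar> + 4 * B / r powr \<gamma>) * norm h powr \<gamma>"
          using B0 by (intro mult_right_mono) (auto intro: add_increasing2)
        then show ?thesis using sd[OF z True] by linarith
      next
        case h: False
        have "r powr \<gamma> \<le> norm h powr \<gamma>" using h r g0 by (intro powr_mono2) auto
        then have "4 * B \<le> 4 * B / r powr \<gamma> * norm h powr \<gamma>"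
          using r B0 by (simp add: field_simps mult_left_mono)
        also have "\<dots> \<le> (\<bar>C\<bar> + 4 * B / r powr \<gamma>) * norm h powr \<gamma>" by (intro mult_right_mono) auto
        finally show ?thesis using 4 by linarith
      qed
      also have "\<dots> \<le> D * norm h powr \<gamma>" using B0 by (intro mult_right_mono) (auto simp: D_def)
      finally show ?thesis using False by (simp add: min_absorb2)
    qed
  qed
  have ik: "L1 (\<lambda>h. D * (ker h * ?m h))" by (intro integrable_mult_right integrable_ker_min \<gamma>)
  have le2: "\<bar>sd v h z * ker h\<bar> \<le> D * (ker h * ?m h)" if "z \<in> ball x0 r" for z h
    using mult_right_mono[OF le[OF that, of h] ker_nonneg[of h]] by (simp add: abs_mult mult_ac)
  have i: "L1 (\<lambda>h. sd v h z * ker h)" if "z \<in> ball x0 r" for z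
    by (rule integrable_dominated[OF ik _ le2[OF that]]) measurable
  show "L1 (\<lambda>h. sd v h x0 * ker h)" using r by (intro i) simp
  have cL: "continuous_on (ball x0 r) (Lop v)"
    unfolding continuous_on_sequentially
  proof (intro allI ballI impI, elim conjE)
    fix x a assume x: "\<forall>n. x n \<in> ball x0 r" "x \<longlonglongrightarrow> a" and a: "a \<in> ball x0 r"
    have "(\<lambda>n. LBINT h. sd v h (x n) * ker h) \<longlonglongrightarrow> (LBINT h. sd v h a * ker h)"
    proof (rule integral_dominated_convergence[OF _ _ ik])
      have cv: "(\<lambda>n. v (y n)) \<longlonglongrightarrow> v b" if "y \<longlonglongrightarrow> b" for y b
        using continuous_on_tendsto_compose[OF v that] by simp
      show "AE h in lborel. (\<lambda>n. sd v h (x n) * ker h) \<longlonglongrightarrow> sd v h a * ker h"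
        unfolding sd_def by (intro AE_I2 tendsto_intros cv x)
      show "AE h in lborel. norm (sd v h (x n) * ker h) \<le> D * (ker h * ?m h)" for n
        unfolding real_norm_def using x(1) by (intro AE_I2 le2) blast
    qed measurable
    then have "(\<lambda>n. Lop v (x n)) \<longlonglongrightarrow> Lop v a" unfolding Lop_def by (rule tendsto_minus)
    then show "(Lop v \<circ> x) \<longlonglongrightarrow> Lop v a" by (simp add: o_def)
  qed
  define K where "K = (LBINT h. D * (ker h * ?m h))"
  have Lb: "\<bar>Lop v z\<bar> \<le> K" if "z \<in> ball x0 r" for z
  proof -
    show ?thesis unfolding Lop_def abs_minus_cancel K_def by (intro integral_abs_bound_integral i that ik le2)
  qed
  obtain Bg where Bg: "\<And>z. z \<in> cball x0 r \<Longrightarrow> \<bar>g z\<bar> \<le> Bg"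
  proof -
    have "bounded (g ` cball x0 r)" by (intro compact_imp_bounded compact_continuous_image continuous_on_subset[OF g]) auto
    then show ?thesis unfolding bounded_iff using that by (metis imageI real_norm_def)
  qed
  have "AE z in lborel. z \<in> ball x0 r \<longrightarrow> Lop v z - g z = 0"
  proof (rule fundamental_lemma_CoV)
    show "L1 (\<lambda>z. (Lop v z - g z) * indicat_real (ball x0 r) z)"
    proof (rule integrable_dominated[OF integrable_cball_const[of "K + Bg" x0 r]])
      show "\<bar>(Lop v z - g z) * indicat_real (ball x0 r) z\<bar> \<le> (K + Bg) * indicat_real (ball x0 r) z" for z
        using Lb[of z] Bg[of z] by (auto simp: indicator_def)
    qed measurable
    fix \<psi> :: "'a \<Rightarrow> real" assume \<psi>: "\<psi> \<in> C0_infinity" and supp: "\<And>x. x \<notin> ball x0 r \<Longrightarrow> \<psi> x = 0"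
    note [measurable] = C0_infinity_measurable[OF \<psi>]
    have i\<psi>: "L1 \<psi>" by (rule C0_infinity_integrable[OF \<psi>])
    have w: "form_integrable v \<psi>" "form v \<psi> = (LBINT x. g x * \<psi> x)"
      using weak \<psi> supp r(2) unfolding weak_on_def by blast+
    have vv: "L1 (\<lambda>x. v (x + h) * \<psi> x)" for h
      using conv_integrable[OF i\<psi>, of "\<lambda>y. v (h - y)" B 0] B by (simp add: mult.commute add.commute)
    have pair: "integrable lborel2 (\<lambda>(h, x). \<psi> x * (sd v h x * ker h))"
    proof (rule integrable_dominated_pair)
      show "integrable lborel2 (\<lambda>(h, x). (D * (ker h * ?m h)) * \<bar>\<psi> x\<bar>)"
        by (intro integrable_pair_times ik integrable_abs i\<psi>)
      show "\<bar>\<psi> x * (sd v h x * ker h)\<bar> \<le> (D * (ker h * ?m h)) * \<bar>\<psi> x\<bar>" for h x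
      proof (cases "x \<in> ball x0 r")
        case True
        from mult_right_mono[OF le2[OF this, of h] abs_ge_zero[of "\<psi> x"]] show ?thesis by (simp add: abs_mult mult_ac)
      qed (simp add: supp)
    qed measurable
    have f: "form v \<psi> = (LBINT x. \<psi> x * Lop v x)" "L1 (\<lambda>x. \<psi> x * Lop v x)"
      by (rule form_by_parts[OF _ _ w(1) vv pair]; measurable)+
    have ig: "L1 (\<lambda>x. g x * \<psi> x)"
    proof (rule integrable_dominated[of _ "\<lambda>x. Bg * \<bar>\<psi> x\<bar>"])
      show "\<bar>g x * \<psi> x\<bar> \<le> Bg * \<bar>\<psi> x\<bar>" for x
        using Bg[of x] supp[of x] by (cases "x \<in> ball x0 r") (auto simp: abs_mult intro!: mult_right_mono)
    qed (use i\<psi> in auto)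
    show "(LBINT z. (Lop v z - g z) * \<psi> z) = 0"
      using f w(2) ig by (simp add: left_diff_distrib right_diff_distrib mult.commute)
  qed measurable
  then have "AE z in lborel. z \<in> ball x0 r \<longrightarrow> Lop v z = g z" by eventually_elim auto
  from continuous_AE_eq_on_open[OF open_ball cL continuous_on_subset[OF g] this] r
  show "Lop v x0 = g x0" by simp
qed

text \<open>A continuous v coincides with its representative w on a whole ball, so the
  second-difference estimate for w holds for v itself.\<close>

lemma interior_equation:
  assumes U: "open U" and v: "continuous_on UNIV v" and B: "\<And>x. \<bar>v x\<bar> \<le> B"
    and g: "continuous_on UNIV g" and B': "\<And>x. \<bar>g x\<bar> \<le> B'" and weak: "weak_on U v g"
    and hol: "\<And>x. x \<in> U \<Longrightarrow> \<exists>r>0. hoelder_on (ball x r) g" and x: "x \<in> U"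
  shows "L1 (\<lambda>h. sd v h x * ker h)" and "Lop v x = g x"
proof -
  have [measurable]: "borel_fun v" "borel_fun g"
    using v g by (auto intro: borel_measurable_continuous_onI)
  obtain r0 where r0: "0 < r0" "ball x r0 \<subseteq> U" using U x unfolding open_contains_ball by blast
  obtain r1 where r1: "0 < r1" "hoelder_on (ball x r1) g" using hol[OF x] by blast
  define \<rho> where "\<rho> = min 1 (min (r0 / 2) (r1 / 3))"
  have \<rho>: "0 < \<rho>" "\<rho> \<le> 1" "2 * \<rho> \<le> r0" "3 * \<rho> \<le> r1" using r0 r1 by (auto simp: \<rho>_def min_def)
  have "weak_on (ball x (2 * \<rho>)) v g"
    using \<rho> r0(2) by (intro weak_on_mono[OF weak]) (auto simp: subset_eq)
  then obtain w where w: "AE z in lborel. z \<in> ball x \<rho> \<longrightarrow> v z = w z" "hoelder_on (ball x (\<rho> / 4)) w"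
    "hoelder_on (ball x (3 * \<rho>)) g \<Longrightarrow>
       \<exists>\<gamma> C. 2 * s < \<gamma> \<and> (\<forall>z h. z \<in> ball x (\<rho> / 8) \<longrightarrow> norm h \<le> \<rho> / 8 \<longrightarrow> \<bar>sd w h z\<bar> \<le> C * norm h powr \<gamma>)"
    by (rule interior_representative[OF \<rho>(1,2) _ B _ B', rotated 2]) measurable
  have "hoelder_on (ball x (3 * \<rho>)) g" using \<rho>(4) by (intro hoelder_on_subset[OF r1(2)]) (auto simp: subset_eq)
  then obtain \<gamma> C where \<gamma>: "2 * s < \<gamma>" "\<And>z h. z \<in> ball x (\<rho> / 8) \<Longrightarrow> norm h \<le> \<rho> / 8 \<Longrightarrow> \<bar>sd w h z\<bar> \<le> C * norm h powr \<gamma>"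
    using w(3) by blast
  have vw: "v z = w z" if "z \<in> ball x (\<rho> / 4)" for z
  proof (rule continuous_AE_eq_on_open[OF open_ball continuous_on_subset[OF v] hoelder_on_continuous[OF w(2)] _ that])
    show "AE z in lborel. z \<in> ball x (\<rho> / 4) \<longrightarrow> v z = w z" using w(1) by eventually_elim (use \<rho> in auto)
  qed simp
  \<comment> \<open>With both |z - x| and |h| at most \<rho>/8, the points z + h and z - h stay in
    the ball of radius \<rho>/4 on which v = w.\<close>
  have sdv: "\<bar>sd v h z\<bar> \<le> C * norm h powr \<gamma>" if z: "z \<in> ball x (\<rho> / 8)" and h: "norm h \<le> \<rho> / 8" for z h
  proof -
    have z1: "norm (z - x) < \<rho> / 8" using z by (simp add: dist_norm norm_minus_commute)
    have "norm (z + h - x) < \<rho> / 4" "norm (z - h - x) < \<rho> / 4" "norm (z - x) < \<rho> / 4"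
      using norm_triangle_ineq[of "z - x" h] norm_triangle_ineq4[of "z - x" h] z1 h \<rho> by (simp_all add: algebra_simps)
    then have "v (z + h) = w (z + h)" "v (z - h) = w (z - h)" "v z = w z"
      by (auto intro!: vw simp: dist_norm norm_minus_commute)
    then show ?thesis using \<gamma>(2)[OF z h] by (simp add: sd_def)
  qed
  have r: "0 < \<rho> / 8" "ball x (\<rho> / 8) \<subseteq> U" using \<rho> r0(2) by (auto simp: subset_eq)
  show "L1 (\<lambda>h. sd v h x * ker h)" "Lop v x = g x"
    by (rule pointwise_equation[OF v B g weak r \<gamma>(1) sdv]; assumption)+
qed

end

section \<open>Boundedness of weak solutions\<close>

lemma sigma_finite_lebesgue: "sigma_finite_measure (lebesgue :: 'a::euclidean_space measure)"
proof
  obtain A :: "'a set set" where "countable A" "A \<subseteq> sets lborel" "\<Union>A = space lborel" "\<forall>a\<in>A. emeasure lborel a \<noteq> \<infinity>"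
    using lborel.sigma_finite_countable by blast
  then show "\<exists>A::'a set set. countable A \<and> A \<subseteq> sets lebesgue \<and> \<Union>A = space lebesgue \<and> (\<forall>a\<in>A. emeasure lebesgue a \<noteq> \<infinity>)"
    by (intro exI[of _ A]) (auto simp: subset_eq)
qed

lemma measurable_lebesgue_pair:
  "(\<lambda>z. z) \<in> measurable (lebesgue \<Otimes>\<^sub>M lebesgue) ((lborel :: 'a::euclidean_space measure) \<Otimes>\<^sub>M (lborel :: 'a measure))"
proof (rule measurable_pair)
  have id: "(\<lambda>x. x) \<in> measurable lebesgue (lborel :: 'a measure)" by (simp add: measurable_completion)
  show "fst \<circ> (\<lambda>z. z) \<in> measurable (lebesgue \<Otimes>\<^sub>M lebesgue) (lborel :: 'a measure)"
    using measurable_compose[OF measurable_fst id] by (simp add: o_def)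
  show "snd \<circ> (\<lambda>z. z) \<in> measurable (lebesgue \<Otimes>\<^sub>M lebesgue) (lborel :: 'a measure)"
    using measurable_compose[OF measurable_snd id] by (simp add: o_def)
qed

text \<open>The product of the two completions carries a larger sigma-algebra than the Borel
  product, but both measures agree on Borel rectangles. Pushing forward along the identity therefore
  transports integrals of Borel functions.\<close>

lemma distr_lebesgue_pair:
  "distr (lebesgue \<Otimes>\<^sub>M lebesgue) lborel2 (\<lambda>z. z) = (lborel :: 'a::euclidean_space measure) \<Otimes>\<^sub>M (lborel :: 'a measure)"
proof (rule sym, rule pair_measure_eqI)
  fix A B :: "'a set" assume A: "A \<in> sets lborel" and B: "B \<in> sets lborel"
  interpret sigma_finite_measure "lebesgue :: 'a measure" by (rule sigma_finite_lebesgue)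
  have "emeasure (distr (lebesgue \<Otimes>\<^sub>M lebesgue) lborel2 (\<lambda>z. z)) (A \<times> B) = emeasure (lebesgue \<Otimes>\<^sub>M lebesgue) (A \<times> B)"
    using A B by (subst emeasure_distr[OF measurable_lebesgue_pair]) (auto simp: space_pair_measure)
  also have "\<dots> = emeasure lebesgue A * emeasure lebesgue B"
    using A B by (intro emeasure_pair_measure_Times) auto
  finally show "emeasure lborel A * emeasure lborel B =
    emeasure (distr (lebesgue \<Otimes>\<^sub>M lebesgue) lborel2 (\<lambda>z. z)) (A \<times> B)"
    using A B by (simp add: emeasure_completion)
qed (auto intro: lborel.sigma_finite_measure_axioms)

lemma AE_pair_lebesgue:
  assumes "AE x in lebesgue. P (x::'a::euclidean_space)"
  shows "AE z in lebesgue \<Otimes>\<^sub>M lebesgue. P (fst z) \<and> P (snd z)"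
proof -
  have "AE x in lborel. P x" using assms by (simp add: AE_completion_iff)
  from AE_pair_lborel[OF this]
  have "AE z in distr (lebesgue \<Otimes>\<^sub>M lebesgue) lborel2 (\<lambda>z. z). P (fst z) \<and> P (snd z)"
    by (subst distr_lebesgue_pair)
  from AE_distrD[OF measurable_lebesgue_pair this] show ?thesis .
qed

lemma borel_representative:
  fixes f :: "'a::euclidean_space \<Rightarrow> real"
  assumes "f \<in> borel_measurable lebesgue"
  obtains g where "borel_fun g" "AE x in lebesgue. f x = g x"
  using completion_ex_borel_measurable_real[OF assms] by (auto simp: AE_completion_iff)

lemma borel_imp_lebesgue_measurable:
  fixes f :: "'a::euclidean_space \<Rightarrow> real"
  assumes "borel_fun f" shows "f \<in> borel_measurable lebesgue"
  using assms by (intro measurable_completion) simp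

lemma power2_sum_le: "((a::real) + b)\<^sup>2 \<le> 2 * a\<^sup>2 + 2 * b\<^sup>2"
  using zero_le_power2[of "a - b"] by (simp add: power2_eq_square algebra_simps)

lemma powr_add_le:
  fixes a b r :: real
  assumes "0 \<le> r" shows "\<bar>a + b\<bar> powr r \<le> 2 powr r * (\<bar>a\<bar> powr r + \<bar>b\<bar> powr r)"
proof -
  have "\<bar>a + b\<bar> powr r \<le> (2 * max \<bar>a\<bar> \<bar>b\<bar>) powr r" using assms by (intro powr_mono2) auto
  also have "\<dots> = 2 powr r * max \<bar>a\<bar> \<bar>b\<bar> powr r" by (simp add: powr_mult)
  also have "\<dots> \<le> 2 powr r * (\<bar>a\<bar> powr r + \<bar>b\<bar> powr r)" by (intro mult_left_mono) (auto simp: max_def)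
  finally show ?thesis .
qed

section \<open>Finiteness of the energy\<close>

context fractional_order
begin

lemma energy_integrand_eq: "energy_integrand s u v = (\<lambda>(x, y). energy_density u v x (y::'a))"
  unfolding energy_integrand_def energy_density_def ker_def powr_minus_divide by (auto simp del: minus_add_distrib)

lemma measurable_energy_integrand [measurable]:
  assumes u: "u \<in> borel_measurable lebesgue" and v: "v \<in> borel_measurable (lebesgue :: 'a measure)"
  shows "energy_integrand s u v \<in> borel_measurable (lebesgue \<Otimes>\<^sub>M lebesgue)"
proof -
  have "(\<lambda>z. ker (fst z - snd z)) \<in> borel_measurable (lborel \<Otimes>\<^sub>M (lborel :: 'a measure))" by measurable
  from measurable_compose[OF measurable_lebesgue_pair this]
  have k: "(\<lambda>z. ker (fst z - snd z)) \<in> borel_measurable (lebesgue \<Otimes>\<^sub>M (lebesgue :: 'a measure))" .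
  note [measurable] = k measurable_compose[OF measurable_fst u] measurable_compose[OF measurable_snd u]
    measurable_compose[OF measurable_fst v] measurable_compose[OF measurable_snd v]
  have "(\<lambda>z. (u (fst z) - u (snd z)) * (v (fst z) - v (snd z)) * ker (fst z - snd z)) \<in> borel_measurable (lebesgue \<Otimes>\<^sub>M (lebesgue :: 'a measure))"
    by measurable
  then show ?thesis by (simp add: energy_integrand_eq energy_density_def split_beta')
qed

lemma energy_form_eq_form:
  assumes u: "u \<in> borel_measurable lebesgue" and v: "v \<in> borel_measurable (lebesgue :: 'a measure)"
    and [measurable]: "borel_fun u'" "borel_fun v'"
    and uu: "AE x in lebesgue. u x = u' x" and vv: "AE x in lebesgue. v x = v' x"
  shows "integrable (lebesgue \<Otimes>\<^sub>M lebesgue) (energy_integrand s u v) \<longleftrightarrow> form_integrable u' v'"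
    and "energy_form s u v = c_Ns DIM('a) s / 2 * form u' v'"
proof -
  have m: "(\<lambda>(x, y). energy_density u' v' x y) \<in> borel_measurable lborel2" by measurable
  have m': "energy_integrand s u' v' \<in> borel_measurable (lebesgue \<Otimes>\<^sub>M lebesgue)"
    by (intro measurable_energy_integrand borel_imp_lebesgue_measurable) auto
  have ae: "AE z in lebesgue \<Otimes>\<^sub>M lebesgue. energy_integrand s u v z = energy_integrand s u' v' z"
    using AE_pair_lebesgue[OF uu] AE_pair_lebesgue[OF vv] by eventually_elim (simp add: energy_integrand_def split_beta')
  have "integrable (lebesgue \<Otimes>\<^sub>M lebesgue) (energy_integrand s u v) \<longleftrightarrow> integrable (lebesgue \<Otimes>\<^sub>M lebesgue) (energy_integrand s u' v')"
    by (rule integrable_cong_AE[OF measurable_energy_integrand[OF u v] m' ae])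
  also have "\<dots> \<longleftrightarrow> form_integrable u' v'"
    using integrable_distr_eq[OF measurable_lebesgue_pair m] unfolding distr_lebesgue_pair form_integrable_def energy_integrand_eq by simp
  finally show "integrable (lebesgue \<Otimes>\<^sub>M lebesgue) (energy_integrand s u v) \<longleftrightarrow> form_integrable u' v'" .
  have "(LINT z|(lebesgue \<Otimes>\<^sub>M lebesgue). energy_integrand s u v z) = (LINT z|(lebesgue \<Otimes>\<^sub>M lebesgue). energy_integrand s u' v' z)"
    by (rule integral_cong_AE[OF measurable_energy_integrand[OF u v] m' ae])
  also have "\<dots> = form u' v'"
    using integral_distr[OF measurable_lebesgue_pair m] unfolding distr_lebesgue_pair form_def energy_integrand_eq by simp
  finally show "energy_form s u v = c_Ns DIM('a) s / 2 * form u' v'" by (simp add: energy_form_def)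
qed

lemma c_Ns_pos: "0 < c_Ns DIM('a) s"
  using s_pos s_less_1 unfolding c_Ns_def by (intro divide_pos_pos mult_pos_pos Gamma_real_pos) auto

lemma energy_density_nonneg: "0 \<le> energy_density u u x y"
  unfolding energy_density_def by (rule mult_nonneg_nonneg[OF zero_le_square ker_nonneg])

lemma form_integrable_mono:
  assumes [measurable]: "borel_fun v" "borel_fun w" "f \<in> borel_measurable (borel \<Otimes>\<^sub>M borel)"
    and f: "integrable lborel2 f" and le: "\<And>x y. \<bar>energy_density v w x y\<bar> \<le> f (x, y)"
  shows "form_integrable v w"
  unfolding form_integrable_def
  by (rule Bochner_Integration.integrable_bound[OF f]) (auto intro!: AE_I2 order_trans[OF le abs_ge_self])

text \<open>From |a b| \<le> a^2 + b^2, applied to the two differences under the kernel.\<close>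

lemma form_integrable_mixed:
  assumes [measurable]: "borel_fun v" "borel_fun w"
    and v: "form_integrable v v" and w: "form_integrable w w"
  shows "form_integrable v w"
proof (rule form_integrable_mono)
  show "integrable lborel2 (\<lambda>z. (case z of (x, y) \<Rightarrow> energy_density v v x y) + (case z of (x, y) \<Rightarrow> energy_density w w x y))"
    using v w unfolding form_integrable_def by (rule integrable_plus)
  fix x y
  have "\<bar>a * b\<bar> \<le> a * a + b * b" for a b :: real
    using sum_squares_bound[of "\<bar>a\<bar>" "\<bar>b\<bar>"] abs_ge_zero[of "a * b"]
    unfolding abs_mult power2_eq_square abs_mult_self_eq by linarith
  from mult_right_mono[OF this ker_nonneg]
  show "\<bar>energy_density v w x y\<bar> \<le> (case (x, y) of (x, y) \<Rightarrow> energy_density v v x y) + (case (x, y) of (x, y) \<Rightarrow> energy_density w w x y)"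
    by (simp add: energy_density_def abs_mult distrib_right)
qed measurable

lemma form_integrable_contraction:
  assumes [measurable]: "borel_fun v" "borel_fun w"
    and v: "form_integrable v v" and w: "\<And>x y. \<bar>w x - w y\<bar> \<le> \<bar>v x - v y\<bar>"
  shows "form_integrable w w"
proof (rule form_integrable_mono)
  show "integrable lborel2 (\<lambda>(x, y). energy_density v v x y)" using v by (simp add: form_integrable_def)
  fix x y
  have "\<bar>w x - w y\<bar> * \<bar>w x - w y\<bar> * ker (x - y) \<le> \<bar>v x - v y\<bar> * \<bar>v x - v y\<bar> * ker (x - y)"
    by (intro mult_right_mono mult_mono w) auto
  then show "\<bar>energy_density w w x y\<bar> \<le> (case (x, y) of (x, y) \<Rightarrow> energy_density v v x y)"
    by (simp add: energy_density_def abs_mult)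
qed measurable

lemma form_integrable_sum:
  assumes [measurable]: "borel_fun v" "borel_fun w"
    and v: "form_integrable v v" and w: "form_integrable w w"
  shows "form_integrable (\<lambda>x. v x + w x) (\<lambda>x. v x + w x)"
proof (rule form_integrable_mono)
  show "integrable lborel2 (\<lambda>z. 2 * (case z of (x, y) \<Rightarrow> energy_density v v x y) + 2 * (case z of (x, y) \<Rightarrow> energy_density w w x y))"
    using v w unfolding form_integrable_def by (intro integrable_plus integrable_mult_right)
  fix x y
  have "(v x + w x - (v y + w y))\<^sup>2 \<le> 2 * (v x - v y)\<^sup>2 + 2 * (w x - w y)\<^sup>2"
    using power2_sum_le[of "v x - v y" "w x - w y"] by (simp add: algebra_simps)
  from mult_right_mono[OF this ker_nonneg[of "x - y"]]
  have "energy_density (\<lambda>x. v x + w x) (\<lambda>x. v x + w x) x y \<le> 2 * energy_density v v x y + 2 * energy_density w w x y"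
    by (simp add: energy_density_def power2_eq_square algebra_simps)
  then show "\<bar>energy_density (\<lambda>x. v x + w x) (\<lambda>x. v x + w x) x y\<bar> \<le> 2 * (case (x, y) of (x, y) \<Rightarrow> energy_density v v x y) + 2 * (case (x, y) of (x, y) \<Rightarrow> energy_density w w x y)"
    using energy_density_nonneg[of "\<lambda>x. v x + w x"] by simp
qed measurable

lemma form_integrable_C0_infinity:
  assumes \<phi>: "\<phi> \<in> C0_infinity" shows "form_integrable \<phi> \<phi>"
proof -
  note [measurable] = C0_infinity_measurable[OF \<phi>]
  obtain R where R: "0 < R" "\<And>x. R < norm x \<Longrightarrow> \<phi> x = 0" using C0_infinity_support[OF \<phi>] by blast
  obtain C where C: "0 < C" "\<And>x. \<bar>\<phi> x\<bar> \<le> C" "\<And>x h. \<bar>\<phi> (x + h) - \<phi> x\<bar> \<le> C * norm h"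
    using C0_infinity_bounds[OF \<phi>] by metis
  \<comment> \<open>The integrand vanishes unless x or y lies in the support. It is thus at most the
    sum of two products: an indicator in one variable times ker(h) min(1, |h|^2) in the difference
    h, each with finite double integral.\<close>
  let ?I = "\<lambda>x::'a. 4 * C\<^sup>2 * indicat_real (cball 0 R) x"
  let ?m = "\<lambda>h::'a. ker h * min 1 ((norm h)\<^sup>2)"
  have I: "L1 ?I"
    by (intro integrable_mult_right integrable_real_indicator) (auto simp: emeasure_lborel_cball_finite[unfolded infinity_ennreal_def])
  have 1: "integrable lborel2 (\<lambda>(x, y). ?I x * ?m (y - x))"
  proof (rule integrable_pairI)
    have "(\<integral>\<^sup>+y. ennreal \<bar>?I x * ?m (y - x)\<bar> \<partial>lborel) = ennreal \<bar>?I x\<bar> * (\<integral>\<^sup>+h. ennreal \<bar>?m h\<bar> \<partial>lborel)" for x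
      using nn_integral_lborel_shift[of "\<lambda>h. ennreal \<bar>?m h\<bar>" "- x"]
      by (simp add: abs_mult[of "?I x"] ennreal_mult nn_integral_cmult)
    moreover have "(\<integral>\<^sup>+x. ennreal \<bar>?I x\<bar> * (\<integral>\<^sup>+h. ennreal \<bar>?m h\<bar> \<partial>lborel) \<partial>lborel) < \<infinity>"
      using I integrable_ker_min2 unfolding integrable_iff_bounded
      by (simp add: nn_integral_multc ennreal_mult_less_top)
    ultimately show "(\<integral>\<^sup>+x. (\<integral>\<^sup>+y. ennreal \<bar>?I x * ?m (y - x)\<bar> \<partial>lborel) \<partial>lborel) < \<infinity>" by simp
  qed measurable
  have 2: "integrable lborel2 (\<lambda>(x, y). ?I y * ?m (x - y))"
    using lborel_pair.integrable_product_swap[OF 1] by (simp add: split_beta')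
  show ?thesis
  proof (rule form_integrable_mono)
    show "integrable lborel2 (\<lambda>z. (case z of (x, y) \<Rightarrow> ?I x * ?m (y - x)) + (case z of (x, y) \<Rightarrow> ?I y * ?m (x - y)))"
      by (rule integrable_plus[OF 1 2])
    fix x y
    have le: "(\<phi> x - \<phi> y)\<^sup>2 \<le> 4 * C\<^sup>2 * min 1 ((norm (x - y))\<^sup>2)"
    proof -
      have "\<bar>\<phi> x - \<phi> y\<bar> \<le> 2 * C" using C(2)[of x] C(2)[of y] by linarith
      then have a: "(\<phi> x - \<phi> y)\<^sup>2 \<le> (2 * C)\<^sup>2" using power_mono[of "\<bar>\<phi> x - \<phi> y\<bar>" "2 * C" 2] by simp
      have "\<bar>\<phi> x - \<phi> y\<bar> \<le> 2 * C * norm (x - y)" using C(3)[of y "x - y"] C(1) by (simp add: mult_right_mono order_trans[of _ "C * norm (x - y)"])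
      then have b: "(\<phi> x - \<phi> y)\<^sup>2 \<le> (2 * C * norm (x - y))\<^sup>2" using power_mono[of "\<bar>\<phi> x - \<phi> y\<bar>" _ 2] by simp
      show ?thesis using a b by (simp add: min_def power_mult_distrib)
    qed
    show "\<bar>energy_density \<phi> \<phi> x y\<bar> \<le> (case (x, y) of (x, y) \<Rightarrow> ?I x * ?m (y - x)) + (case (x, y) of (x, y) \<Rightarrow> ?I y * ?m (x - y))"
    proof (cases "x \<in> cball 0 R \<or> y \<in> cball 0 R")
      case True
      have "energy_density \<phi> \<phi> x y \<le> 4 * C\<^sup>2 * ?m (x - y)"
        using mult_right_mono[OF le ker_nonneg[of "x - y"]] by (simp add: energy_density_def power2_eq_square mult_ac)
      also have "\<dots> \<le> ?I x * ?m (x - y) + ?I y * ?m (x - y)"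
        using True by (auto simp: indicator_def)
      finally show ?thesis
        using energy_density_nonneg[of \<phi> x y] by (simp add: ker_commute[of y x] norm_minus_commute[of y x])
    next
      case False
      then have "\<phi> x = 0" "\<phi> y = 0" by (auto intro!: R(2))
      then show ?thesis by (simp add: energy_density_def)
    qed
  qed measurable
qed


text \<open>The lower bound on p is equivalent to p + 1 \<le> (p - 1) N / (2s), and the bound on q
  then gives q > p. That p > 1 follows because the critical exponent exceeds 2.\<close>

lemma exponents:
  assumes "p \<ge> two_star DIM('a) s - 1" "q > (p - 1) * (real DIM('a) / (2 * s)) - 1"
  shows "1 < p" and "p < q"
proof -
  let ?N = "real DIM('a)"
  have D: "0 < ?N - 2 * s" using dim_gt by simp
  have "2 * ?N / (?N - 2 * s) \<le> p + 1" using assms(1) by (simp add: two_star_def)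
  then have le: "2 * ?N \<le> (p + 1) * (?N - 2 * s)" using D by (simp add: pos_divide_le_eq)
  show "1 < p"
  proof (rule ccontr)
    assume "\<not> 1 < p"
    then have "(p + 1) * (?N - 2 * s) \<le> 2 * (?N - 2 * s)" using D by (intro mult_right_mono) auto
    then show False using le s_pos by simp
  qed
  have "(p + 1) * (2 * s) \<le> (p - 1) * ?N" using le by (simp add: algebra_simps)
  then have "p + 1 \<le> (p - 1) * (?N / (2 * s))" using s_pos by (simp add: pos_le_divide_eq)
  then show "p < q" using assms(2) by linarith
qed

lemma energy_integrand_square:
  "energy_integrand s w w z = (w (fst z) - w (snd z :: 'a))\<^sup>2 * ker (fst z - snd z)"
  by (simp add: energy_integrand_eq energy_density_def split_beta' power2_eq_square)

lemma energy_form_nonneg: "0 \<le> energy_form s w (w :: 'a \<Rightarrow> real)"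
  unfolding energy_form_def using c_Ns_pos by (intro mult_nonneg_nonneg lint_nonneg) (auto simp: energy_integrand_square)

lemma finite_energy_C0_infinity: "\<phi> \<in> C0_infinity \<Longrightarrow> finite_energy s (\<phi> :: 'a \<Rightarrow> real)"
  unfolding finite_energy_def
  using energy_form_eq_form(1)[of \<phi> \<phi> \<phi> \<phi>] form_integrable_C0_infinity[of \<phi>] C0_infinity_measurable[of \<phi>]
  by (simp add: borel_imp_lebesgue_measurable)

lemma finite_energy_contraction:
  assumes u: "u \<in> borel_measurable lebesgue" and v: "v \<in> borel_measurable (lebesgue :: 'a measure)"
    and fe: "finite_energy s u" and le: "\<And>x y. \<bar>v x - v y\<bar> \<le> \<bar>u x - u y\<bar>"
  shows "finite_energy s v"
  unfolding finite_energy_def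
proof (rule Bochner_Integration.integrable_bound[OF fe[unfolded finite_energy_def] measurable_energy_integrand[OF v v]])
  have "(v x - v y)\<^sup>2 \<le> (u x - u y)\<^sup>2" for x y using le[of x y] by (simp add: abs_le_square_iff)
  then show "AE z in lebesgue \<Otimes>\<^sub>M lebesgue. norm (energy_integrand s v v z) \<le> norm (energy_integrand s u u z)"
    by (intro AE_I2) (simp add: energy_integrand_square mult_right_mono)
qed

lemma finite_energy_diff:
  assumes u: "u \<in> borel_measurable lebesgue" and v: "v \<in> borel_measurable (lebesgue :: 'a measure)"
    and fe: "finite_energy s u" "finite_energy s v"
  shows "finite_energy s (\<lambda>x. u x - v x)"
  unfolding finite_energy_def
proof (rule Bochner_Integration.integrable_bound)
  show "integrable (lebesgue \<Otimes>\<^sub>M lebesgue) (\<lambda>z. 2 * energy_integrand s u u z + 2 * energy_integrand s v v z)"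
    using fe unfolding finite_energy_def by (intro integrable_plus integrable_mult_right)
  show "energy_integrand s (\<lambda>x. u x - v x) (\<lambda>x. u x - v x) \<in> borel_measurable (lebesgue \<Otimes>\<^sub>M lebesgue)"
    using u v by (intro measurable_energy_integrand borel_measurable_diff)
  have "(u x - v x - (u y - v y))\<^sup>2 * k \<le> 2 * ((u x - u y)\<^sup>2 * k) + 2 * ((v x - v y)\<^sup>2 * k)" if "0 \<le> k" for x y k
    using mult_right_mono[OF power2_sum_le[of "u x - u y" "- (v x - v y)"] that] by (simp add: algebra_simps power2_commute[of "v y" "v x"])
  then show "AE z in lebesgue \<Otimes>\<^sub>M lebesgue. norm (energy_integrand s (\<lambda>x. u x - v x) (\<lambda>x. u x - v x) z)
      \<le> norm (2 * energy_integrand s u u z + 2 * energy_integrand s v v z)"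
    by (intro AE_I2) (simp add: energy_integrand_square)
qed

text \<open>Since G is monotone, the energy of u against G(u) is nonnegative, while t^p - t^q is
  negative wherever G is positive. The integral of (u^q - u^p) G(u) is therefore at most 0, although
  its integrand is nonnegative and positive where u > 1.\<close>

lemma truncation_test:
  assumes u: "u \<in> borel_measurable lebesgue" and pq: "p < q"
    and G: "\<And>t. t \<le> 1 \<Longrightarrow> G t = 0" "\<And>t. 1 < t \<Longrightarrow> 0 < G t" "\<And>x y::real. x \<le> y \<Longrightarrow> G x \<le> G y"
    and w: "weak_identity s p q u (\<lambda>x. G (u x))"
  shows "AE x in (lebesgue :: 'a measure). u x \<le> 1"
proof -
  let ?F = "\<lambda>x. u x powr q * G (u x) - u x powr p * G (u x)"
  have i: "integrable lebesgue (\<lambda>x. u x powr p * G (u x))" "integrable lebesgue (\<lambda>x. u x powr q * G (u x))"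
    and eq: "energy_form s u (\<lambda>x. G (u x)) = (LINT x|lebesgue. u x powr p * G (u x)) - (LINT x|lebesgue. u x powr q * G (u x))"
    using w unfolding weak_identity_def by auto
  have "0 \<le> (a - b) * (G a - G b)" for a b
    using G(3)[of a b] G(3)[of b a] by (cases "a \<le> b") (auto intro: mult_nonneg_nonneg mult_nonpos_nonpos)
  then have "0 \<le> energy_form s u (\<lambda>x. G (u x))"
    unfolding energy_form_def using c_Ns_pos
    by (intro mult_nonneg_nonneg lint_nonneg) (auto simp: energy_integrand_def split_beta')
  then have le: "(LINT x|lebesgue. ?F x) \<le> 0" using i eq by simp
  have pos: "0 < ?F x" if "1 < u x" for x
    using that pq G(2)[OF that] powr_less_mono[of p q "u x"] by simp
  have nn: "0 \<le> ?F x" for x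
    using pos[of x] G(1)[of "u x"] by (cases "1 < u x") auto
  have iF: "integrable lebesgue ?F" using i by simp
  have "(LINT x|lebesgue. ?F x) = 0" using le lint_nonneg[of lebesgue ?F] nn by (intro antisym) auto
  then have "AE x in lebesgue. ?F x = 0"
    using integral_nonneg_eq_0_iff_AE[OF iF] nn by blast
  then show ?thesis by eventually_elim (use pos in \<open>force simp: not_less[symmetric]\<close>)
qed

lemma C0_infinity_powr_integrable:
  assumes \<phi>: "\<phi> \<in> C0_infinity" and r: "0 < r"
  shows "L1 (\<lambda>x::'a. \<bar>\<phi> x\<bar> powr r)"
proof -
  note [measurable] = C0_infinity_measurable[OF \<phi>]
  obtain R where R: "0 < R" "\<And>x. R < norm x \<Longrightarrow> \<phi> x = 0" using C0_infinity_support[OF \<phi>] by blast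
  obtain C where C: "0 < C" "\<And>x. \<bar>\<phi> x\<bar> \<le> C" using C0_infinity_bounded[OF \<phi>] by blast
  show ?thesis
  proof (rule integrable_dominated[OF integrable_cball_const[of "C powr r" 0 "R + 1"]])
    show "\<bar>\<bar>\<phi> x\<bar> powr r\<bar> \<le> C powr r * indicat_real (ball 0 (R + 1)) x" for x
      using C R(2)[of x] r by (auto simp: indicator_def intro!: powr_mono2)
  qed measurable
qed

lemma Lp_on_dominated:
  assumes u: "u \<in> Lp_on UNIV r" and v: "v \<in> borel_measurable (lebesgue :: 'a measure)"
    and le: "\<And>x. \<bar>v x\<bar> \<le> \<bar>u x\<bar>" and r: "0 \<le> r"
  shows "v \<in> Lp_on UNIV r"
proof -
  have "integrable lebesgue (\<lambda>x. \<bar>v x\<bar> powr r)"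
  proof (rule integrable_dominated)
    show "integrable lebesgue (\<lambda>x. \<bar>u x\<bar> powr r)" using u by (simp add: Lp_on_def set_integrable_def)
    show "(\<lambda>x. \<bar>v x\<bar> powr r) \<in> borel_measurable lebesgue" using v by measurable
    show "\<bar>\<bar>v x\<bar> powr r\<bar> \<le> \<bar>u x\<bar> powr r" for x
      using le r by (auto intro!: powr_mono2)
  qed
  then show ?thesis using v by (simp add: Lp_on_def set_integrable_def)
qed

lemma Lp_on_diff:
  assumes u: "u \<in> Lp_on UNIV r" and v: "v \<in> Lp_on UNIV r" and r: "0 \<le> r"
  shows "(\<lambda>x. u x - v x :: real) \<in> Lp_on (UNIV :: 'a set) r"
proof -
  have m [measurable]: "u \<in> borel_measurable lebesgue" "v \<in> borel_measurable lebesgue" using u v by (auto simp: Lp_on_def)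
  have "integrable lebesgue (\<lambda>x. \<bar>u x - v x\<bar> powr r)"
  proof (rule integrable_dominated)
    show "integrable lebesgue (\<lambda>x. 2 powr r * (\<bar>u x\<bar> powr r + \<bar>v x\<bar> powr r))"
      using u v by (intro integrable_mult_right integrable_plus) (simp_all add: Lp_on_def set_integrable_def)
    show "\<bar>\<bar>u x - v x\<bar> powr r\<bar> \<le> 2 powr r * (\<bar>u x\<bar> powr r + \<bar>v x\<bar> powr r)" for x
      using powr_add_le[OF r, of "u x" "- v x" for x] by simp
  qed measurable
  then show ?thesis using m by (simp add: Lp_on_def set_integrable_def)
qed

lemma C0_infinity_Lp_on: "\<phi> \<in> C0_infinity \<Longrightarrow> 0 < r \<Longrightarrow> \<phi> \<in> Lp_on (UNIV :: 'a set) r"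
  using C0_infinity_powr_integrable[of \<phi> r] C0_infinity_measurable[of \<phi>]
  by (simp add: Lp_on_def set_integrable_def borel_imp_lebesgue_measurable integrable_completion)

lemma two_star_pos: "0 < two_star DIM('a) s"
  using dim_gt by (simp add: two_star_def)

lemma C0_infinity_Hdot: "\<phi> \<in> C0_infinity \<Longrightarrow> \<phi> \<in> (Hdot s :: ('a \<Rightarrow> real) set)"
  using two_star_pos
  by (auto simp: Hdot_def C0_infinity_Lp_on finite_energy_C0_infinity Hdot_norm_def energy_form_def energy_integrand_def
      Lp_norm_def split_beta' intro!: exI[of _ "\<lambda>_. \<phi>"])

text \<open>Composing G with the approximating test functions gives the candidates. The Lipschitz
  bound settles the Lebesgue norm at once, but the energy of G(u) - G(\<phi>) is not dominated by
  that of u - \<phi>; pointwise convergence has to be brought in.\<close>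

lemma Hdot_truncation:
  assumes u: "u \<in> (Hdot s :: ('a \<Rightarrow> real) set)" and G: "C_infinity G" "G 0 = 0" "\<And>x y. \<bar>G x - G y\<bar> \<le> \<bar>x - y\<bar>"
  shows "(\<lambda>x. G (u x)) \<in> Hdot s"
proof -
  let ?r = "two_star DIM('a) s" and ?M = "(lebesgue :: 'a measure) \<Otimes>\<^sub>M (lebesgue :: 'a measure)"
  note r = two_star_pos
  have uL: "u \<in> Lp_on UNIV ?r" and fe: "finite_energy s u" using u by (auto simp: Hdot_def)
  obtain \<phi> where \<phi>: "\<And>n. \<phi> n \<in> C0_infinity"
    and lim: "(\<lambda>n. Hdot_norm s (\<lambda>x. u x - \<phi> n x) + Lp_norm ?r (\<lambda>x. u x - \<phi> n x)) \<longlonglongrightarrow> 0"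
    using u by (auto simp: Hdot_def)
  have um: "u \<in> borel_measurable lebesgue" using uL by (simp add: Lp_on_def)
  have \<phi>m: "\<phi> n \<in> borel_measurable lebesgue" for n by (intro borel_imp_lebesgue_measurable C0_infinity_measurable \<phi>)
  have Gm [measurable]: "borel_fun G" by (rule C_infinity_measurable[OF G(1)])
  define v where "v x = G (u x)" for x
  have vm: "v \<in> borel_measurable lebesgue" unfolding v_def using measurable_compose[OF um Gm] .
  have G0: "\<bar>G t\<bar> \<le> \<bar>t\<bar>" for t using G(3)[of t 0] G(2) by simp
  have vL: "v \<in> Lp_on UNIV ?r" using G0 r by (intro Lp_on_dominated[OF uL vm]) (auto simp: v_def)
  have vfe: "finite_energy s v" using G(3) by (intro finite_energy_contraction[OF um vm fe]) (auto simp: v_def)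
  define d where "d n x = u x - \<phi> n x" for n x
  have dm: "d n \<in> borel_measurable lebesgue" for n unfolding d_def using um \<phi>m by (intro borel_measurable_diff)
  have dL: "d n \<in> Lp_on UNIV ?r" for n
    unfolding d_def using r by (intro Lp_on_diff uL C0_infinity_Lp_on \<phi>) auto
  have dfe: "finite_energy s (d n)" for n
    unfolding d_def by (intro finite_energy_diff um \<phi>m fe finite_energy_C0_infinity \<phi>)
  have Hn: "0 \<le> Hdot_norm s w" for w :: "'a \<Rightarrow> real" unfolding Hdot_norm_def by (intro real_sqrt_ge_zero energy_form_nonneg)
  have Ln: "0 \<le> Lp_norm ?r w" for w :: "'a \<Rightarrow> real" by (simp add: Lp_norm_def)
  define E where "E n = (LINT z|?M. energy_integrand s (d n) (d n) z)" for n
  define J where "J n = (LINT x|lebesgue. \<bar>d n x\<bar> powr ?r)" for n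
  have J0: "0 \<le> J n" for n unfolding J_def by (rule lint_nonneg) simp
  have "(\<lambda>n. Hdot_norm s (d n)) \<longlonglongrightarrow> 0"
    by (rule tendsto_sandwich[OF _ _ tendsto_const lim]) (auto simp: d_def[abs_def] Hn Ln)
  then have "(\<lambda>n. 2 / c_Ns DIM('a) s * (Hdot_norm s (d n))\<^sup>2) \<longlonglongrightarrow> 2 / c_Ns DIM('a) s * 0\<^sup>2"
    by (intro tendsto_intros)
  moreover have "2 / c_Ns DIM('a) s * (Hdot_norm s (d n))\<^sup>2 = E n" for n
    unfolding Hdot_norm_def real_sqrt_pow2[OF energy_form_nonneg] using c_Ns_pos by (simp add: E_def energy_form_def)
  ultimately have E: "E \<longlonglongrightarrow> 0" by simp
  have "(\<lambda>n. Lp_norm ?r (d n)) \<longlonglongrightarrow> 0"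
    by (rule tendsto_sandwich[OF _ _ tendsto_const lim]) (auto simp: d_def[abs_def] Hn Ln)
  then have "(\<lambda>n. Lp_norm ?r (d n) powr ?r) \<longlonglongrightarrow> 0 powr ?r"
    using r Ln by (intro tendsto_powr') auto
  moreover have "Lp_norm ?r (d n) powr ?r = J n" for n
    using r J0[of n] by (simp add: Lp_norm_def J_def[symmetric] powr_powr)
  ultimately have J: "J \<longlonglongrightarrow> 0" using r by simp
  have iJ: "integrable lebesgue (\<lambda>x. \<bar>d n x\<bar> powr ?r)" for n using dL[of n] by (simp add: Lp_on_def set_integrable_def)
  \<comment> \<open>Norm convergence gives pointwise convergence along a subsequence, and
    \<open>Hdot\<close> asks only for some approximating sequence.\<close>
  obtain k :: "nat \<Rightarrow> nat" where k: "strict_mono k" and k0: "AE x in lebesgue. (\<lambda>n. \<bar>d (k n) x\<bar> powr ?r) \<longlonglongrightarrow> 0"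
    using tendsto_L1_AE_subseq[of lebesgue "\<lambda>n x. \<bar>d n x\<bar> powr ?r"] iJ J unfolding J_def[abs_def] by auto
  from k0 have conv: "AE x in lebesgue. (\<lambda>n. \<phi> (k n) x) \<longlonglongrightarrow> u x"
  proof eventually_elim
    case (elim x)
    then have "(\<lambda>n. (\<bar>d (k n) x\<bar> powr ?r) powr (1 / ?r)) \<longlonglongrightarrow> 0 powr (1 / ?r)" using r by (intro tendsto_powr') auto
    then have "(\<lambda>n. d (k n) x) \<longlonglongrightarrow> 0" using r by (simp add: powr_powr tendsto_rabs_zero_iff)
    then have "(\<lambda>n. u x - d (k n) x) \<longlonglongrightarrow> u x - 0" by (intro tendsto_diff tendsto_const)
    then show ?case by (simp add: d_def)
  qed
  define \<psi> where "\<psi> n x = G (\<phi> (k n) x)" for n x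
  have \<psi>: "\<psi> n \<in> C0_infinity" for n
  proof -
    obtain R where R: "0 < R" "\<And>x. R < norm x \<Longrightarrow> \<phi> (k n) x = 0" using C0_infinity_support[OF \<phi>] by blast
    show ?thesis unfolding \<psi>_def
      using R(2) G(2) by (intro C0_infinityI[of _ R] C_infinity_compose[OF G(1) C0_infinity_imp_C_infinity[OF \<phi>]]) simp
  qed
  have \<psi>m: "\<psi> n \<in> borel_measurable lebesgue" for n by (intro borel_imp_lebesgue_measurable C0_infinity_measurable \<psi>)
  define e where "e n x = v x - \<psi> n x" for n x
  have em: "e n \<in> borel_measurable lebesgue" for n unfolding e_def using vm \<psi>m by (intro borel_measurable_diff)
  have efe: "finite_energy s (e n)" for n
    unfolding e_def by (intro finite_energy_diff vm \<psi>m vfe finite_energy_C0_infinity \<psi>)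
  have ed: "\<bar>e n x\<bar> \<le> \<bar>d (k n) x\<bar>" for n x unfolding e_def d_def v_def \<psi>_def by (rule G(3))
  have Lp: "(\<lambda>n. Lp_norm ?r (e n)) \<longlonglongrightarrow> 0"
  proof -
    have "(LINT x|lebesgue. \<bar>e n x\<bar> powr ?r) \<le> J (k n)" for n
      unfolding J_def
    proof (rule integral_mono[OF _ iJ])
      have "e n \<in> Lp_on UNIV ?r" using r by (intro Lp_on_dominated[OF dL em ed]) auto
      then show "integrable lebesgue (\<lambda>x. \<bar>e n x\<bar> powr ?r)" by (simp add: Lp_on_def set_integrable_def)
    qed (use ed r in \<open>auto intro!: powr_mono2\<close>)
    then have "(\<lambda>n. LINT x|lebesgue. \<bar>e n x\<bar> powr ?r) \<longlonglongrightarrow> 0"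
      by (intro tendsto_sandwich[OF _ _ tendsto_const LIMSEQ_subseq_LIMSEQ[OF J k]]) (auto intro!: always_eventually lint_nonneg)
    then have "(\<lambda>n. (LINT x|lebesgue. \<bar>e n x\<bar> powr ?r) powr (1 / ?r)) \<longlonglongrightarrow> 0 powr (1 / ?r)"
      using r by (intro tendsto_powr') (auto intro!: always_eventually lint_nonneg)
    then show ?thesis by (simp add: Lp_norm_def)
  qed
  \<comment> \<open>generalised dominated convergence: the energy density of \<open>e n\<close> is at most twice that of \<open>d (k n)\<close>,
    which tends to 0 in the mean, plus a fixed integrable function\<close>
  let ?a = "\<lambda>n. energy_integrand s (e n) (e n)" and ?b = "\<lambda>n. energy_integrand s (d (k n)) (d (k n))"
  define f where "f n z = max 0 (?a n z - 2 * ?b n z)" for n z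
  have am: "?a n \<in> borel_measurable ?M" and bm: "?b n \<in> borel_measurable ?M" for n
    using em dm by (auto intro: measurable_energy_integrand)
  have a0: "0 \<le> ?a n z" and b0: "0 \<le> ?b n z" for n z by (simp_all add: energy_integrand_square)
  \<comment> \<open>From |e x - e y| \<le> |d x - d y| + 2 |u x - u y| and (a + 2 b)^2 \<le> 2 a^2 +
    8 b^2.\<close>
  have ab: "?a n z \<le> 2 * ?b n z + 8 * energy_integrand s u u z" for n z
  proof -
    obtain x y where z: "z = (x, y)" by (cases z)
    have "\<bar>e n x - e n y\<bar> \<le> \<bar>v x - v y\<bar> + \<bar>\<psi> n x - \<psi> n y\<bar>" by (simp add: e_def)
    also have "\<dots> \<le> \<bar>u x - u y\<bar> + \<bar>\<phi> (k n) x - \<phi> (k n) y\<bar>" unfolding v_def \<psi>_def by (intro add_mono G(3))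
    also have "\<dots> \<le> \<bar>\<bar>d (k n) x - d (k n) y\<bar> + 2 * \<bar>u x - u y\<bar>\<bar>" by (simp add: d_def)
    finally have "(e n x - e n y)\<^sup>2 \<le> (\<bar>d (k n) x - d (k n) y\<bar> + 2 * \<bar>u x - u y\<bar>)\<^sup>2" by (simp only: abs_le_square_iff)
    also have "\<dots> \<le> 2 * (d (k n) x - d (k n) y)\<^sup>2 + 8 * (u x - u y)\<^sup>2"
      using power2_sum_le[of "\<bar>d (k n) x - d (k n) y\<bar>" "2 * \<bar>u x - u y\<bar>"] by (simp add: power_mult_distrib)
    finally show ?thesis
      using mult_right_mono[OF _ ker_nonneg[of "x - y"]] by (fastforce simp: z energy_integrand_square algebra_simps)
  qed
  have iu: "integrable ?M (\<lambda>z. 8 * energy_integrand s u u z)" using fe unfolding finite_energy_def by (rule integrable_mult_right)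
  have fl: "(\<lambda>n. LINT z|?M. f n z) \<longlonglongrightarrow> (LINT z|?M. 0)"
  proof (rule integral_dominated_convergence[OF _ _ iu])
    show "f n \<in> borel_measurable ?M" for n unfolding f_def[abs_def] using am bm by measurable
    show "AE z in ?M. norm (f n z) \<le> 8 * energy_integrand s u u z" for n
    proof (rule AE_I2)
      fix z
      have "0 \<le> 8 * energy_integrand s u u z" by (simp add: energy_integrand_square)
      then show "norm (f n z) \<le> 8 * energy_integrand s u u z" using ab[of n z] unfolding f_def by simp
    qed
    show "AE z in ?M. (\<lambda>n. f n z) \<longlonglongrightarrow> 0"
      using AE_pair_lebesgue[OF conv]
    proof eventually_elim
      case (elim z)
      have "(\<lambda>n. e n x) \<longlonglongrightarrow> 0" if "(\<lambda>n. \<phi> (k n) x) \<longlonglongrightarrow> u x" for x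
        using tendsto_diff[OF tendsto_const continuous_on_tendsto_compose[OF C_infinity_continuous[OF G(1), of UNIV] that], of "v x"]
        by (simp add: e_def v_def \<psi>_def)
      then have "(\<lambda>n. (e n (fst z) - e n (snd z))\<^sup>2 * ker (fst z - snd z)) \<longlonglongrightarrow> (0 - 0)\<^sup>2 * ker (fst z - snd z)"
        using elim by (intro tendsto_intros) auto
      then have az: "(\<lambda>n. ?a n z) \<longlonglongrightarrow> 0" by (simp add: energy_integrand_square)
      show ?case
        by (rule tendsto_sandwich[OF _ _ tendsto_const az])
          (auto simp: f_def a0 b0 intro: always_eventually)
    qed
  qed simp
  have "(\<lambda>n. LINT z|?M. ?a n z) \<longlonglongrightarrow> 0"
  proof (rule tendsto_sandwich[OF _ _ tendsto_const])
    show "\<forall>\<^sub>F n in sequentially. 0 \<le> (LINT z|?M. ?a n z)" by (intro always_eventually allI lint_nonneg a0)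
    have "(\<lambda>n. (LINT z|?M. f n z) + 2 * E (k n)) \<longlonglongrightarrow> 0 + 2 * 0"
      using fl LIMSEQ_subseq_LIMSEQ[OF E k] by (intro tendsto_intros) (simp_all add: o_def)
    then show "(\<lambda>n. (LINT z|?M. f n z) + 2 * E (k n)) \<longlonglongrightarrow> 0" by simp
    have "(LINT z|?M. ?a n z) \<le> (LINT z|?M. f n z) + 2 * E (k n)" for n
    proof -
      have i: "integrable ?M (?a n)" "integrable ?M (?b n)" using efe dfe by (simp_all add: finite_energy_def)
      have "integrable ?M (f n)"
        unfolding f_def by (intro integrable_max integrable_zero integrable_minus integrable_mult_right i)
      moreover have "(LINT z|?M. ?a n z) \<le> (LINT z|?M. f n z + 2 * ?b n z)"
        using calculation i by (intro integral_mono integrable_plus integrable_mult_right) (auto simp: f_def)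
      ultimately show ?thesis using i by (simp add: E_def)
    qed
    then show "\<forall>\<^sub>F n in sequentially. (LINT z|?M. ?a n z) \<le> (LINT z|?M. f n z) + 2 * E (k n)" by simp
  qed
  then have "(\<lambda>n. sqrt (c_Ns DIM('a) s / 2 * (LINT z|?M. ?a n z))) \<longlonglongrightarrow> sqrt (c_Ns DIM('a) s / 2 * 0)" by (intro tendsto_intros)
  then have "(\<lambda>n. Hdot_norm s (e n)) \<longlonglongrightarrow> 0" by (simp add: Hdot_norm_def energy_form_def)
  from tendsto_add[OF this Lp] have "(\<lambda>n. Hdot_norm s (\<lambda>x. v x - \<psi> n x) + Lp_norm ?r (\<lambda>x. v x - \<psi> n x)) \<longlonglongrightarrow> 0"
    by (simp add: e_def[abs_def])
  then have "v \<in> Hdot s" using vL vfe \<psi> by (auto simp: Hdot_def)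
  then show ?thesis by (simp add: v_def[abs_def])
qed

text \<open>The nonlinearity divided by c_Ns / 2, the factor by which \<open>energy_form\<close> and
  \<open>frac_laplacian\<close> differ from \<open>form\<close> and \<open>Lop\<close>.\<close>

definition source :: "real \<Rightarrow> real \<Rightarrow> real \<Rightarrow> real" where
  "source p q t = 2 / c_Ns DIM('a) s * (t powr p - t powr q)"

lemma borel_measurable_source [measurable]: "borel_fun (source p q)"
  unfolding source_def[abs_def] by measurable

section \<open>Reduction to Borel functions with values in the unit interval\<close>

lemma weak_identity_form:
  assumes w: "weak_identity s p q u \<phi>" and u: "u \<in> borel_measurable (lebesgue :: 'a measure)"
    and v [measurable]: "borel_fun v" "borel_fun \<phi>" and uv: "AE x in lebesgue. u x = v x"
  shows "form v \<phi> = (LBINT x. source p q (v x) * \<phi> x)"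
proof -
  have m: "(\<lambda>x. u x powr r * \<phi> x) \<in> borel_measurable lebesgue" "(\<lambda>x. v x powr r * \<phi> x) \<in> borel_measurable lebesgue" for r
    using u borel_imp_lebesgue_measurable[OF v(1)] borel_imp_lebesgue_measurable[OF v(2)] by measurable
  have ae: "AE x in lebesgue. u x powr r * \<phi> x = v x powr r * \<phi> x" for r using uv by eventually_elim simp
  have I: "L1 (\<lambda>x. v x powr r * \<phi> x)" "(LINT x|lebesgue. u x powr r * \<phi> x) = (LBINT x. v x powr r * \<phi> x)"
    if "integrable lebesgue (\<lambda>x. u x powr r * \<phi> x)" for r
    using that integrable_cong_AE[OF m ae, of r] integral_cong_AE[OF m ae, of r] by (simp_all add: integrable_completion integral_completion)
  have "c_Ns DIM('a) s / 2 * form v \<phi> = (LBINT x. v x powr p * \<phi> x) - (LBINT x. v x powr q * \<phi> x)"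
    using w energy_form_eq_form(2)[OF u borel_imp_lebesgue_measurable[OF v(2)] v uv] I unfolding weak_identity_def by simp
  also have "\<dots> = (LBINT x. (v x powr p - v x powr q) * \<phi> x)"
    using w I unfolding weak_identity_def by (simp add: left_diff_distrib)
  finally have "form v \<phi> = 2 / c_Ns DIM('a) s * (LBINT x. (v x powr p - v x powr q) * \<phi> x)"
    using c_Ns_pos by (simp add: field_simps)
  then show ?thesis unfolding source_def mult.assoc integral_mult_right_zero .
qed

text \<open>Clamping turns the almost-everywhere bounds into bounds at every point, so that the
  source is bounded everywhere.\<close>

lemma clamped_representative:
  fixes u :: "'a \<Rightarrow> real"
  assumes u: "u \<in> borel_measurable lebesgue" and b: "AE x in lebesgue. 0 \<le> u x" "AE x in lebesgue. u x \<le> 1"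
  obtains v where "borel_fun v" "AE x in lebesgue. u x = v x" "\<And>x. 0 \<le> v x" "\<And>x. v x \<le> 1"
proof -
  obtain w where w [measurable]: "borel_fun w" and uw: "AE x in lebesgue. u x = w x"
    by (rule borel_representative[OF u])
  show ?thesis
  proof (rule that[of "\<lambda>x. max 0 (min 1 (w x))"])
    show "AE x in lebesgue. u x = max 0 (min 1 (w x))" using uw b by eventually_elim auto
  qed auto
qed

lemma weak_solution_space_reduction:
  assumes w: "weak_solution_space s p q u" and pq: "p < q"
  obtains v :: "'a \<Rightarrow> real" where "borel_fun v" "AE x in lebesgue. u x = v x" "\<And>x. 0 \<le> v x" "\<And>x. v x \<le> 1"
    "weak_on UNIV v (\<lambda>x. source p q (v x))"
proof -
  have uH: "u \<in> Hdot s" and nn: "AE x in lebesgue. 0 \<le> u x" and id: "\<And>\<phi>. \<phi> \<in> Hdot s \<Longrightarrow> weak_identity s p q u \<phi>"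
    using w unfolding weak_solution_space_def by auto
  have um: "u \<in> borel_measurable lebesgue" and fe: "finite_energy s u" using uH by (auto simp: Hdot_def Lp_on_def)
  obtain G where G: "C_infinity G" "\<And>t. t \<le> 1 \<Longrightarrow> G t = 0" "\<And>t. 1 < t \<Longrightarrow> 0 < G t"
    "\<And>x y::real. x \<le> y \<Longrightarrow> G x \<le> G y" "\<And>x y. \<bar>G x - G y\<bar> \<le> \<bar>x - y\<bar>"
    by (rule ex_smooth_truncation) (rule that; assumption)
  have "(\<lambda>x. G (u x)) \<in> Hdot s" by (rule Hdot_truncation[OF uH G(1) _ G(5)]) (simp add: G(2))
  from truncation_test[OF um pq G(2,3,4) id[OF this]] have le: "AE x in lebesgue. u x \<le> 1" .
  obtain v where v: "borel_fun v" "AE x in lebesgue. u x = v x" "\<And>x. 0 \<le> v x" "\<And>x. v x \<le> 1"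
    by (rule clamped_representative[OF um nn le]) (rule that; assumption)
  have vv: "form_integrable v v" using energy_form_eq_form(1)[OF um um v(1,1,2,2)] fe by (simp add: finite_energy_def)
  have "weak_on UNIV v (\<lambda>x. source p q (v x))"
    unfolding weak_on_def
    using form_integrable_mixed[OF v(1) C0_infinity_measurable vv form_integrable_C0_infinity]
      weak_identity_form[OF id[OF C0_infinity_Hdot] um v(1) C0_infinity_measurable v(2)] by blast
  then show ?thesis using v that by blast
qed

text \<open>Two forms of the weak equation are produced: \<open>weak_on\<close> for interior
  regularity, and one with nonsmooth test functions, because the boundary argument tests with a
  positive part. Unlike in \<open>Hdot\<close>, membership of the truncated solution in
  \<open>X0\<close> is immediate: that space is given by conditions, not as a completion.\<close>

lemma weak_solution_domain_reduction:
  assumes w: "weak_solution_domain s p q \<Omega> u" and pq: "p < q" and \<Omega>: "open \<Omega>"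
  obtains v :: "'a \<Rightarrow> real" where "borel_fun v" "AE x in lebesgue. u x = v x" "\<And>x. 0 \<le> v x" "\<And>x. v x \<le> 1"
    "\<And>x. x \<notin> \<Omega> \<Longrightarrow> v x = 0" "form_integrable v v"
    "\<forall>\<phi>. \<phi> \<in> borel_measurable borel \<longrightarrow> L1 (\<lambda>x. (\<phi> x)\<^sup>2) \<longrightarrow> form_integrable \<phi> \<phi> \<longrightarrow>
      (\<forall>x. x \<notin> \<Omega> \<longrightarrow> \<phi> x = 0) \<longrightarrow> form v \<phi> = (LBINT x. source p q (v x) * \<phi> x)"
    "weak_on \<Omega> v (\<lambda>x. source p q (v x))"
proof -
  have uX: "u \<in> X0 s \<Omega>" and nn: "AE x in lebesgue. 0 \<le> u x" and id: "\<And>\<phi>. \<phi> \<in> X0 s \<Omega> \<Longrightarrow> weak_identity s p q u \<phi>"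
    using w unfolding weak_solution_domain_def by auto
  have uL: "u \<in> Lp_on UNIV 2" and um: "u \<in> borel_measurable lebesgue" and fe: "finite_energy s u"
    and off: "AE x in lebesgue. x \<notin> \<Omega> \<longrightarrow> u x = 0"
    using uX by (auto simp: X0_def Hs_def Lp_on_def)
  obtain G where G: "C_infinity G" "\<And>t. t \<le> 1 \<Longrightarrow> G t = 0" "\<And>t. 1 < t \<Longrightarrow> 0 < G t"
    "\<And>x y::real. x \<le> y \<Longrightarrow> G x \<le> G y" "\<And>x y. \<bar>G x - G y\<bar> \<le> \<bar>x - y\<bar>"
    by (rule ex_smooth_truncation) (rule that; assumption)
  have Gum: "(\<lambda>x. G (u x)) \<in> borel_measurable lebesgue" using measurable_compose[OF um C_infinity_measurable[OF G(1)]] .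
  have G0: "G 0 = 0" "\<bar>G t\<bar> \<le> \<bar>t\<bar>" for t using G(5)[of t 0] G(2)[of 0] by auto
  have "(\<lambda>x. G (u x)) \<in> X0 s \<Omega>"
    unfolding X0_def Hs_def mem_Collect_eq
  proof (intro conjI)
    show "(\<lambda>x. G (u x)) \<in> Lp_on UNIV 2" by (rule Lp_on_dominated[OF uL Gum G0(2)]) simp
    show "finite_energy s (\<lambda>x. G (u x))" by (rule finite_energy_contraction[OF um Gum fe G(5)])
    show "AE x in lebesgue. x \<notin> \<Omega> \<longrightarrow> G (u x) = 0" using off by eventually_elim (simp add: G0)
  qed
  from truncation_test[OF um pq G(2,3,4) id[OF this]] have le: "AE x in lebesgue. u x \<le> 1" .
  obtain v' where v': "borel_fun v'" "AE x in lebesgue. u x = v' x" "\<And>x. 0 \<le> v' x" "\<And>x. v' x \<le> 1"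
    by (rule clamped_representative[OF um nn le]) (rule that; assumption)
  \<comment> \<open>Makes v vanish at every point off \<Omega>, not only almost everywhere.\<close>
  define v where "v x = v' x * indicat_real \<Omega> x" for x
  have [measurable]: "\<Omega> \<in> sets borel" using \<Omega> by (rule borel_open)
  have v1: "borel_fun v" unfolding v_def[abs_def] using v'(1) by measurable
  have v2: "AE x in lebesgue. u x = v x" using v'(2) off by eventually_elim (auto simp: v_def indicator_def)
  have vv: "form_integrable v v" using energy_form_eq_form(1)[OF um um v1 v1 v2 v2] fe by (simp add: finite_energy_def)
  have test: "form v \<phi> = (LBINT x. source p q (v x) * \<phi> x)"
    if \<phi>: "borel_fun \<phi>" "L1 (\<lambda>x. (\<phi> x)\<^sup>2)" "form_integrable \<phi> \<phi>" "\<And>x. x \<notin> \<Omega> \<Longrightarrow> \<phi> x = 0" for \<phi>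
  proof -
    have m: "\<phi> \<in> borel_measurable lebesgue" by (rule borel_imp_lebesgue_measurable[OF \<phi>(1)])
    have "\<phi> \<in> X0 s \<Omega>"
      unfolding X0_def Hs_def mem_Collect_eq
    proof (intro conjI)
      show "\<phi> \<in> Lp_on UNIV 2" using m \<phi>(1,2) by (simp add: Lp_on_def set_integrable_def integrable_completion)
      show "finite_energy s \<phi>" unfolding finite_energy_def using energy_form_eq_form(1)[OF m m \<phi>(1) \<phi>(1)] \<phi>(3) by simp
    qed (simp add: \<phi>(4))
    from weak_identity_form[OF id[OF this] um v1 \<phi>(1) v2] show ?thesis .
  qed
  have "weak_on \<Omega> v (\<lambda>x. source p q (v x))"
    unfolding weak_on_def
  proof (intro ballI impI conjI)
    fix \<phi> :: "'a \<Rightarrow> real" assume \<phi>: "\<phi> \<in> C0_infinity" and off: "\<forall>x. x \<notin> \<Omega> \<longrightarrow> \<phi> x = 0"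
    note m = C0_infinity_measurable[OF \<phi>] and f = form_integrable_C0_infinity[OF \<phi>]
    show "form_integrable v \<phi>" by (rule form_integrable_mixed[OF v1 m vv f])
    show "form v \<phi> = (LBINT x. source p q (v x) * \<phi> x)"
      using C0_infinity_powr_integrable[OF \<phi>, of 2] off by (intro test m f) auto
  qed
  then show ?thesis
    using v' test by (intro that[of v] v1 v2 vv) (auto simp: v_def indicator_def)
qed

end

section \<open>Continuity at the boundary\<close>

text \<open>A scale-invariant form: at each small scale r a ball of radius c r, rather than one
  fixed ball touching the boundary. The centre lies r/2 below x0 in the direction of the graph, and
  the Lipschitz bound on the graph function keeps the ball underneath.\<close>

lemma exterior_ball_condition:
  fixes \<Omega> :: "'a::euclidean_space set"
  assumes "smooth_boundary \<Omega>" and \<Omega>: "open \<Omega>" and x0: "x0 \<in> frontier \<Omega>"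
  obtains c r1 where "0 < c" "0 < r1" "\<And>r. 0 < r \<Longrightarrow> r < r1 \<Longrightarrow> \<exists>z. ball z (c * r) \<subseteq> ball x0 r - \<Omega>"
proof -
  obtain r0 b \<sigma> g where r0: "0 < r0" and b: "b \<in> Basis" and \<sigma>: "\<sigma> \<in> {-1, 1::real}" and g: "C_infinity g"
    and inv: "\<forall>y t. g (y + t *\<^sub>R b) = g y" and graph: "\<Omega> \<inter> ball x0 r0 = {y \<in> ball x0 r0. \<sigma> * (y \<bullet> b) > g y}"
    using bspec[OF assms(1)[unfolded smooth_boundary_def] x0] by (elim bexE exE conjE) (rule that; assumption)
  have "x0 \<notin> \<Omega>" using x0 \<Omega> by (simp add: frontier_def interior_open)
  then have "x0 \<notin> {y \<in> ball x0 r0. \<sigma> * (y \<bullet> b) > g y}" using graph by blast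
  then have x0g: "\<sigma> * (x0 \<bullet> b) \<le> g x0" using r0 by simp
  obtain L where L: "0 < L" "\<And>x h. norm x + norm h \<le> norm x0 + r0 \<Longrightarrow> \<bar>g (x + h) - g x\<bar> \<le> L * norm h"
    by (rule C_infinity_local_bounds[OF g]) (rule that; assumption)
  \<comment> \<open>A displacement of length below c r changes height and graph together by at most
    (1 + L) c r = r/2, which is the depth of the centre.\<close>
  define c where "c = 1 / (2 * (1 + L))"
  have c: "0 < c" "c \<le> 1 / 2" "c * (1 + L) = 1 / 2" using L(1) by (auto simp: c_def field_simps)
  have "ball (x0 - (\<sigma> * (r / 2)) *\<^sub>R b) (c * r) \<subseteq> ball x0 r - \<Omega>" if r: "0 < r" "r < r0" for r
  proof
    fix y assume y: "y \<in> ball (x0 - (\<sigma> * (r / 2)) *\<^sub>R b) (c * r)"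
    define e where "e = y - (x0 - (\<sigma> * (r / 2)) *\<^sub>R b)"
    have e: "norm e < c * r" using y by (simp add: e_def dist_norm norm_minus_commute)
    have ye: "y = x0 + e + (- (\<sigma> * (r / 2))) *\<^sub>R b" by (simp add: e_def)
    have cr: "c * r \<le> r / 2" using mult_right_mono[OF c(2), of r] r by simp
    have \<sigma>1: "\<bar>\<sigma>\<bar> = 1" "\<sigma> * \<sigma> = 1" using \<sigma> by auto
    have "norm (y - x0) \<le> norm e + norm ((- (\<sigma> * (r / 2))) *\<^sub>R b)"
      unfolding ye using norm_triangle_ineq[of e "(- (\<sigma> * (r / 2))) *\<^sub>R b"] by (simp only: add.assoc add_diff_cancel_left')
    also have "norm ((- (\<sigma> * (r / 2))) *\<^sub>R b) = r / 2" using b r \<sigma>1 by (simp add: abs_mult)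
    also have "norm e + r / 2 < r" using e cr by linarith
    finally have yr: "norm (y - x0) < r" .
    have "\<bar>e \<bullet> b\<bar> \<le> norm e" by (rule Basis_le_norm[OF b])
    then have eb: "\<sigma> * (e \<bullet> b) \<le> norm e" using \<sigma> by auto
    have "\<sigma> * (y \<bullet> b) = \<sigma> * (x0 \<bullet> b) + \<sigma> * (e \<bullet> b) - r / 2"
      using \<sigma>1(2) b by (simp add: ye inner_add_left inner_Basis algebra_simps)
    moreover have "g y = g (x0 + e)" unfolding ye using inv by blast
    moreover have "\<bar>g (x0 + e) - g x0\<bar> \<le> L * norm e" using e cr r by (intro L(2)) linarith
    moreover have "norm e + L * norm e \<le> r / 2"
    proof -
      have "norm e * (1 + L) \<le> c * r * (1 + L)" using e L(1) by (intro mult_right_mono) auto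
      also have "\<dots> = r * (c * (1 + L))" by (simp only: mult_ac)
      finally show ?thesis unfolding c(3) by (simp add: algebra_simps)
    qed
    ultimately have "\<sigma> * (y \<bullet> b) \<le> g y" using x0g eb by linarith
    moreover have "y \<in> ball x0 r0" using yr r by (simp add: dist_norm norm_minus_commute)
    moreover have "\<sigma> * (y \<bullet> b) > g y" if "y \<in> \<Omega> \<inter> ball x0 r0" using that unfolding graph by simp
    ultimately have "y \<notin> \<Omega>" by auto
    then show "y \<in> ball x0 r - \<Omega>" using yr by (simp add: dist_norm norm_minus_commute)
  qed
  then show ?thesis using c(1) r0 by (intro that[of c r0]) blast+
qed

lemma AE_le_imp_le_on_open:
  fixes f :: "'a::euclidean_space \<Rightarrow> real"
  assumes U: "open U" and f: "continuous_on U f" and le: "AE x in lborel. x \<in> U \<longrightarrow> f x \<le> c" and x: "x \<in> U"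
  shows "f x \<le> c"
proof -
  have "max c (f x) = c"
  proof (rule continuous_AE_eq_on_open[of U "\<lambda>x. max c (f x)" "\<lambda>_. c" x])
    show "AE x in lborel. x \<in> U \<longrightarrow> max c (f x) = c" using le by eventually_elim auto
  qed (use U f x in \<open>auto intro!: continuous_intros\<close>)
  then show ?thesis by simp
qed

section \<open>Barriers and decrease of the upper limit\<close>

context fractional_order
begin

text \<open>The kernel is homogeneous of degree -(N + 2s), and the Jacobian gives back r^N.\<close>

lemma Lop_rescale:
  assumes f [measurable]: "borel_fun f" and M: "\<And>x h. \<bar>sd f h x\<bar> \<le> M * min 1 ((norm h)\<^sup>2)" and r: "0 < r"
  shows "Lop (\<lambda>x. f ((1 / r) *\<^sub>R (x - x0))) x = r powr (- (2 * s)) * Lop f ((1 / r) *\<^sub>R (x - x0))"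
proof -
  let ?y = "(1 / r) *\<^sub>R (x - x0)" and ?d = "real DIM('a) + 2 * s"
  have k: "ker h = (1 / r) powr ?d * ker ((1 / r) *\<^sub>R h)" for h
    using r by (simp add: ker_def powr_mult powr_divide powr_minus field_simps powr_add[symmetric])
  have "sd (\<lambda>x. f ((1 / r) *\<^sub>R (x - x0))) h x = sd f ((1 / r) *\<^sub>R h) ?y" for h
    by (simp add: sd_def algebra_simps)
  then have "Lop (\<lambda>x. f ((1 / r) *\<^sub>R (x - x0))) x =
      - (LBINT h. (1 / r) powr ?d * (sd f ((1 / r) *\<^sub>R h) ?y * ker ((1 / r) *\<^sub>R h)))"
    unfolding Lop_def by (subst k) (simp add: mult_ac)
  also have "\<dots> = - ((1 / r) powr ?d * ((LBINT h. sd f h ?y * ker h) / \<bar>1 / r\<bar> ^ DIM('a)))"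
    using lborel_scale(2)[OF _ Lop_integrable[OF f M], of "1 / r" ?y] r by simp
  also have "\<dots> = (1 / r) powr (2 * s) * Lop f ?y"
    using r by (simp add: Lop_def powr_add powr_realpow)
  finally show ?thesis using r by (simp add: powr_minus_divide powr_divide)
qed

text \<open>All bumps are translates and dilates of one fixed bump, so a single constant serves
  every centre and radius.\<close>

lemma scaled_bump:
  obtains \<beta> :: "real \<Rightarrow> 'a \<Rightarrow> 'a \<Rightarrow> real" and C where "0 < C" "\<And>r x0. 0 < r \<Longrightarrow> \<beta> r x0 \<in> C0_infinity"
    "\<And>r x0 x. 0 \<le> \<beta> r x0 x" "\<And>r x0 x. \<beta> r x0 x \<le> 1" "\<And>r x0 x. 0 < r \<Longrightarrow> x \<in> ball x0 (r / 2) \<Longrightarrow> \<beta> r x0 x = 1"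
    "\<And>r x0 x. 0 < r \<Longrightarrow> x \<notin> ball x0 r \<Longrightarrow> \<beta> r x0 x = 0"
    "\<And>r x0 x. 0 < r \<Longrightarrow> \<bar>Lop (\<beta> r x0) x\<bar> \<le> C * r powr (- (2 * s))"
proof -
  define b where "b x = 1 - smooth_step (2 * (norm x)\<^sup>2 - 1)" for x :: 'a
  have b1: "b x = 1" if "norm x \<le> 1 / 2" for x
    using that power_mono[OF that, of 2] by (simp add: b_def smooth_step_0 power_divide)
  have b0: "b x = 0" if "1 \<le> norm x" for x
    using that power_mono[OF that, of 2] by (simp add: b_def smooth_step_1)
  have bC: "C_infinity b"
    unfolding b_def
    by (intro C_infinity_diff C_infinity_const C_infinity_compose[OF C_infinity_smooth_step] C_infinity_mult C_infinity_norm_square)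
  have bC0: "b \<in> C0_infinity" by (rule C0_infinityI[OF bC, of 1]) (simp add: b0)
  have bm: "borel_fun b" by (rule C0_infinity_measurable[OF bC0])
  obtain C where C: "0 < C" "\<And>x. \<bar>b x\<bar> \<le> C" "\<And>x h. \<bar>b (x + h) - b x\<bar> \<le> C * norm h" "\<And>x h. \<bar>sd b h x\<bar> \<le> C * min 1 ((norm h)\<^sup>2)"
    by (rule C0_infinity_bounds[OF bC0]) (rule that; assumption)
  define \<beta> where "\<beta> r x0 x = b ((1 / r) *\<^sub>R (x - x0))" for r x0 x
  have \<beta>0: "\<beta> r x0 x = 0" if "0 < r" "x \<notin> ball x0 r" for r x0 x
    unfolding \<beta>_def using that by (intro b0) (simp add: dist_norm norm_minus_commute)
  show ?thesis
  proof (rule that)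
    show "0 < C * (ker_mass + 1)" using C(1) ker_mass_nonneg by (intro mult_pos_pos) auto
    show "\<beta> r x0 \<in> C0_infinity" if r: "0 < r" for r x0
    proof (rule C0_infinityI)
      have "C_infinity (\<lambda>x. b ((1 / r) *\<^sub>R x))" by (rule C_infinity_scale[OF bC])
      from C_infinity_shift[OF this, of "- x0"] show "C_infinity (\<beta> r x0)" by (simp add: \<beta>_def[abs_def])
      show "\<beta> r x0 x = 0" if "norm x0 + r < norm x" for x
        using that r norm_triangle_ineq2[of x x0] by (intro \<beta>0) (auto simp: dist_norm norm_minus_commute)
    qed
    show "0 \<le> \<beta> r x0 x" "\<beta> r x0 x \<le> 1" for r x0 x
      by (simp_all add: \<beta>_def b_def smooth_step_nonneg smooth_step_le_1)
    show "\<beta> r x0 x = 1" if "0 < r" "x \<in> ball x0 (r / 2)" for r x0 x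
      unfolding \<beta>_def using that by (intro b1) (simp add: dist_norm norm_minus_commute pos_divide_le_eq)
    show "\<bar>Lop (\<beta> r x0) x\<bar> \<le> C * (ker_mass + 1) * r powr (- (2 * s))" if r: "0 < r" for r x0 x
    proof -
      have "\<bar>Lop (\<beta> r x0) x\<bar> = r powr (- (2 * s)) * \<bar>Lop b ((1 / r) *\<^sub>R (x - x0))\<bar>"
        unfolding \<beta>_def Lop_rescale[OF bm C(4) r] by (simp add: abs_mult)
      also have "\<dots> \<le> r powr (- (2 * s)) * (C * ker_mass)" by (intro mult_left_mono Lop_bound bm C) simp
      also have "\<dots> \<le> r powr (- (2 * s)) * (C * (ker_mass + 1))" using C(1) by (intro mult_left_mono) auto
      finally show ?thesis by (simp add: mult_ac)
    qed
  qed (rule \<beta>0)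
qed

text \<open>Comparison with a barrier: \<open>w\<close> is \<open>v\<close> minus the barrier, its positive part \<open>\<phi>\<close> lives near
  \<open>x0\<close>, and the nonlocal interaction of \<open>\<phi>\<close> with the exterior ball, where \<open>w \<le> - M / 2\<close>,
  beats every other term by scaling in \<open>r\<close>.\<close>

lemma boundary_decrease:
  assumes v [measurable]: "borel_fun v" and v0: "\<And>x. 0 \<le> v x" and v1: "\<And>x. v x \<le> 1"
    and off: "\<And>x. x \<notin> \<Omega> \<Longrightarrow> v x = 0" and vv: "form_integrable v v" and \<Omega>: "bounded \<Omega>"
    and g [measurable]: "borel_fun g" and B: "\<And>x. \<bar>g x\<bar> \<le> B"
    and test: "\<And>\<phi>. \<phi> \<in> borel_measurable borel \<Longrightarrow> L1 (\<lambda>x. (\<phi> x)\<^sup>2) \<Longrightarrow> form_integrable \<phi> \<phi> \<Longrightarrow>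
      (\<And>x. x \<notin> \<Omega> \<Longrightarrow> \<phi> x = 0) \<Longrightarrow> form v \<phi> = (LBINT x. g x * \<phi> x)"
    and c: "0 < c" and r1: "0 < r1" and ext: "\<And>r. 0 < r \<Longrightarrow> r < r1 \<Longrightarrow> \<exists>z. ball z (c * r) \<subseteq> ball x0 r - \<Omega>"
    and M: "0 < M" and near: "\<And>\<eta>. 0 < \<eta> \<Longrightarrow> \<exists>R>0. AE x in lborel. x \<in> ball x0 R \<longrightarrow> v x \<le> M + \<eta>"
  shows "\<exists>m r. 0 \<le> m \<and> m < M \<and> 0 < r \<and> (AE x in lborel. x \<in> ball x0 r \<longrightarrow> v x \<le> m)"
proof -
  obtain \<beta> :: "real \<Rightarrow> 'a \<Rightarrow> 'a \<Rightarrow> real" and C where C: "0 < C" and \<beta>: "\<And>r x0. 0 < r \<Longrightarrow> \<beta> r x0 \<in> C0_infinity"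
    "\<And>r x0 x. 0 \<le> \<beta> r x0 x" "\<And>r x0 x. \<beta> r x0 x \<le> 1" "\<And>r x0 x. 0 < r \<Longrightarrow> x \<in> ball x0 (r / 2) \<Longrightarrow> \<beta> r x0 x = 1"
    "\<And>r x0 x. 0 < r \<Longrightarrow> x \<notin> ball x0 r \<Longrightarrow> \<beta> r x0 x = 0"
    "\<And>r x0 x. 0 < r \<Longrightarrow> \<bar>Lop (\<beta> r x0) x\<bar> \<le> C * r powr (- (2 * s))"
    by (rule scaled_bump) (rule that; assumption)
  let ?d = "real DIM('a) + 2 * s"
  \<comment> \<open>Strength of the interaction: kernel at least (2r)^(-N-2s), target ball of radius
    c r, and a drop of M/2. Together these give M \<delta> r^(-2s) times the integral of
    \<phi>.\<close>
  define \<delta> where "\<delta> = 2 powr (- ?d) * unit_ball_vol (real DIM('a)) * c ^ DIM('a) / 2"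
  have \<delta>: "0 < \<delta>" using c unit_ball_vol_pos[of "real DIM('a)"] by (simp add: \<delta>_def)
  \<comment> \<open>Height of the bump at scale r. The bound M/2 keeps w \<le> -M/2 off \<Omega>;
    the second bound lets the bump use at most half of the interaction M \<delta>.\<close>
  define \<kappa> where "\<kappa> = min (M / 2) (M * \<delta> / (2 * C))"
  have \<kappa>: "0 < \<kappa>" "\<kappa> \<le> M / 2" "\<kappa> * C \<le> M * \<delta> / 2"
  proof -
    have "\<kappa> \<le> M * \<delta> / (2 * C)" by (simp add: \<kappa>_def)
    then show "\<kappa> * C \<le> M * \<delta> / 2" using C by (simp add: field_simps)
  qed (use M \<delta> C in \<open>auto simp: \<kappa>_def\<close>)
  obtain R where R: "0 < R" and nearR: "AE x in lborel. x \<in> ball x0 R \<longrightarrow> v x \<le> M + \<kappa> / 2" using near[of "\<kappa> / 2"] \<kappa>(1) by auto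
  \<comment> \<open>The terms that do not scale with r: the right-hand side and the bump of fixed
    radius R. For small r the other half of the interaction exceeds them.\<close>
  define CR where "CR = B + C * R powr (- (2 * s))"
  have "((\<lambda>r::real. r powr (2 * s)) \<longlongrightarrow> 0 powr (2 * s)) (at_right 0)"
    using s_pos by (intro tendsto_powr' tendsto_const tendsto_ident_at) (auto simp: eventually_at_filter)
  then have "eventually (\<lambda>r. r powr (2 * s) < M * \<delta> / 2 / (\<bar>CR\<bar> + 1)) (at_right 0)"
    using M \<delta> by (intro order_tendstoD(2)) auto
  then have "eventually (\<lambda>r. r powr (2 * s) < M * \<delta> / 2 / (\<bar>CR\<bar> + 1) \<and> r < min (R / 2) r1 \<and> 0 < r) (at_right 0)"
    using R r1 by (intro eventually_conj eventually_at_right_less order_tendstoD(2)[OF tendsto_ident_at]) auto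
  from eventually_happens'[OF trivial_limit_at_right_real this]
  obtain r where r: "0 < r" "r < R / 2" "r < r1" and rC': "r powr (2 * s) < M * \<delta> / 2 / (\<bar>CR\<bar> + 1)"
    unfolding min_less_iff_conj by blast
  have rC: "CR < M * \<delta> / 2 * r powr (- (2 * s))"
  proof -
    have "\<bar>CR\<bar> + 1 < M * \<delta> / 2 / r powr (2 * s)" using rC' r(1) by (simp add: field_simps)
    then show ?thesis using r(1) by (simp add: powr_minus_divide)
  qed
  obtain z where z: "ball z (c * r) \<subseteq> ball x0 r - \<Omega>" using ext[OF r(1,3)] by blast
  \<comment> \<open>The bump of radius R and height 1 makes w negative outside that radius, as v
    \<le> 1 there; within it v \<le> M + \<kappa>/2 makes w \<le> 0 off the ball of radius r. On the
    ball of radius r/2 both bumps are 1 and w = v - M + \<kappa>/2, so \<phi> = 0 there means v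
    \<le> M - \<kappa>/2.\<close>
  define \<zeta> where "\<zeta> x = \<kappa> * \<beta> r x0 x + \<beta> R x0 x" for x
  define w where "w x = v x + \<zeta> x - (M + \<kappa> / 2 + 1)" for x
  define \<phi> where "\<phi> x = max 0 (w x)" for x
  have \<zeta>: "\<zeta> \<in> C0_infinity"
  proof (rule C0_infinityI)
    show "C_infinity \<zeta>" unfolding \<zeta>_def
      using \<beta>(1) r R by (intro C_infinity_add C_infinity_mult C_infinity_const C0_infinity_imp_C_infinity) auto
    show "\<zeta> x = 0" if "norm x0 + R < norm x" for x
    proof -
      have "x \<notin> ball x0 r" "x \<notin> ball x0 R"
        using that r R norm_triangle_ineq2[of x x0] by (simp_all add: dist_norm norm_minus_commute)
      then show ?thesis using \<beta>(5)[OF r(1)] \<beta>(5)[OF R] by (simp add: \<zeta>_def)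
    qed
  qed
  note [measurable] = C0_infinity_measurable[OF \<zeta>]
  have \<zeta>1: "\<zeta> x \<le> 1 + \<kappa>" for x
    using mult_left_mono[OF \<beta>(3)[of r x0 x] less_imp_le[OF \<kappa>(1)]] \<beta>(3)[of R x0 x] unfolding \<zeta>_def by linarith
  have w_off: "w x \<le> - M / 2" if "x \<notin> \<Omega>" for x using \<zeta>1[of x] \<kappa> off[OF that] by (simp add: w_def)
  have \<phi>_off: "\<phi> x = 0" if "x \<notin> \<Omega>" for x using w_off[OF that] M by (simp add: \<phi>_def)
  have [measurable]: "borel_fun w" "borel_fun \<phi>" unfolding w_def[abs_def] \<phi>_def[abs_def] by measurable
  have \<phi>0: "0 \<le> \<phi> x" for x by (simp add: \<phi>_def)
  have \<phi>1: "\<phi> x \<le> 1" for x using \<zeta>1[of x] \<kappa> v1[of x] M by (simp add: \<phi>_def w_def)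
  obtain K where K: "\<Omega> \<subseteq> ball 0 K" using bounded_subset_ballD[OF \<Omega>] by blast
  have dom: "L1 f" if [measurable]: "borel_fun f" and le: "\<And>x. \<bar>f x\<bar> \<le> D * \<phi> x" for f and D :: real
  proof (rule integrable_dominated[OF integrable_cball_const[of "\<bar>D\<bar>" 0 K]])
    show "\<bar>f x\<bar> \<le> \<bar>D\<bar> * indicat_real (ball 0 K) x" for x
    proof (cases "x \<in> \<Omega>")
      case True
      have "D * \<phi> x \<le> \<bar>D\<bar> * 1" using \<phi>0[of x] \<phi>1[of x] by (intro mult_mono) auto
      then show ?thesis using True K le[of x] by auto
    qed (use le[of x] \<phi>_off[of x] in \<open>auto simp: indicator_def\<close>)
  qed measurable
  have i\<phi>: "L1 \<phi>" using \<phi>0 by (intro dom[of _ 1]) auto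
  have i\<phi>2: "L1 (\<lambda>x. (\<phi> x)\<^sup>2)"
    using \<phi>0 \<phi>1 by (intro dom[of _ 1]) (auto simp: power2_eq_square intro!: mult_left_le)
  have \<zeta>\<zeta>: "form_integrable \<zeta> \<zeta>" by (rule form_integrable_C0_infinity[OF \<zeta>])
  have \<phi>\<phi>: "form_integrable \<phi> \<phi>"
  proof (rule form_integrable_contraction[OF _ _ form_integrable_sum[OF _ _ vv \<zeta>\<zeta>]])
    show "\<bar>\<phi> x - \<phi> y\<bar> \<le> \<bar>v x + \<zeta> x - (v y + \<zeta> y)\<bar>" for x y
    proof -
      have "w x - w y = v x + \<zeta> x - (v y + \<zeta> y)" by (simp add: w_def)
      moreover have "\<bar>\<phi> x - \<phi> y\<bar> \<le> \<bar>w x - w y\<bar>" unfolding \<phi>_def by linarith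
      ultimately show ?thesis by simp
    qed
  qed measurable
  have v\<phi>: "form_integrable v \<phi>" by (rule form_integrable_mixed[OF _ _ vv \<phi>\<phi>]) measurable
  have \<zeta>\<phi>: "form_integrable \<zeta> \<phi>" by (rule form_integrable_mixed[OF _ _ \<zeta>\<zeta> \<phi>\<phi>]) measurable
  have ed: "energy_density w \<phi> x y = energy_density v \<phi> x y + energy_density \<zeta> \<phi> x y" for x y
    by (simp add: energy_density_def w_def algebra_simps)
  have w\<phi>: "form_integrable w \<phi>" and "form w \<phi> = form v \<phi> + form \<zeta> \<phi>"
    using integrable_plus[OF v\<phi>[unfolded form_integrable_def] \<zeta>\<phi>[unfolded form_integrable_def]]
      integral_plus[OF v\<phi>[unfolded form_integrable_def] \<zeta>\<phi>[unfolded form_integrable_def]]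
    by (simp_all add: form_integrable_def form_def ed split_beta')
  moreover have "form v \<phi> = (LBINT x. g x * \<phi> x)" by (rule test[OF _ i\<phi>2 \<phi>\<phi> \<phi>_off]) measurable
  moreover have "form \<zeta> \<phi> = (LBINT x. \<phi> x * Lop \<zeta> x)" and i\<zeta>: "L1 (\<lambda>x. \<phi> x * Lop \<zeta> x)"
    using form_C0_infinity[OF \<zeta>, of \<phi> 1] \<phi>0 \<phi>1 \<zeta>\<phi> by (auto simp: form_commute[of \<zeta>] form_integrable_commute[of \<zeta>])
  ultimately have "form w \<phi> = (LBINT x. g x * \<phi> x) + (LBINT x. \<phi> x * Lop \<zeta> x)" by simp
  also have "\<dots> = (LBINT x. g x * \<phi> x + \<phi> x * Lop \<zeta> x)"
  proof (rule integral_plus[symmetric, OF _ i\<zeta>])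
    show "L1 (\<lambda>x. g x * \<phi> x)"
      using B \<phi>0 by (intro dom[of _ B]) (auto simp: abs_mult intro!: mult_right_mono)
  qed
  also have "\<dots> \<le> (LBINT x. (CR + \<kappa> * C * r powr (- (2 * s))) * \<phi> x)"
  proof (rule integral_mono)
    have Lb: "\<bar>Lop \<zeta> x\<bar> \<le> \<kappa> * (C * r powr (- (2 * s))) + C * R powr (- (2 * s))" for x
    proof -
      have sdi: "L1 (\<lambda>h. sd (\<beta> t x0) h x * ker h)" if t: "0 < t" for t
      proof -
        obtain D where "\<And>x h. \<bar>sd (\<beta> t x0) h x\<bar> \<le> D * min 1 ((norm h)\<^sup>2)"
          using C0_infinity_bounds[OF \<beta>(1)[OF t]] by metis
        then show ?thesis by (rule Lop_integrable[OF C0_infinity_measurable[OF \<beta>(1)[OF t]]])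
      qed
      have "Lop \<zeta> x = - (LBINT h. \<kappa> * (sd (\<beta> r x0) h x * ker h) + sd (\<beta> R x0) h x * ker h)"
        unfolding Lop_def by (simp add: sd_def \<zeta>_def algebra_simps)
      also have "\<dots> = \<kappa> * Lop (\<beta> r x0) x + Lop (\<beta> R x0) x"
        using sdi[OF r(1)] sdi[OF R] by (simp add: Lop_def)
      finally have "\<bar>Lop \<zeta> x\<bar> \<le> \<kappa> * \<bar>Lop (\<beta> r x0) x\<bar> + \<bar>Lop (\<beta> R x0) x\<bar>"
        using \<kappa>(1) abs_triangle_ineq[of "\<kappa> * Lop (\<beta> r x0) x" "Lop (\<beta> R x0) x"] by (simp add: abs_mult)
      also have "\<dots> \<le> \<kappa> * (C * r powr (- (2 * s))) + C * R powr (- (2 * s))"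
        using \<kappa>(1) r R by (intro add_mono mult_left_mono \<beta>(6)) auto
      finally show ?thesis .
    qed
    fix x
    have "g x + Lop \<zeta> x \<le> CR + \<kappa> * C * r powr (- (2 * s))"
      using B[of x] Lb[of x] by (simp add: CR_def mult_ac)
    from mult_right_mono[OF this \<phi>0[of x]]
    show "g x * \<phi> x + \<phi> x * Lop \<zeta> x \<le> (CR + \<kappa> * C * r powr (- (2 * s))) * \<phi> x" by (simp add: algebra_simps)
    have "L1 (\<lambda>x. g x * \<phi> x)"
      using B \<phi>0 by (intro dom[of _ B]) (auto simp: abs_mult intro!: mult_right_mono)
    then show "L1 (\<lambda>x. g x * \<phi> x + \<phi> x * Lop \<zeta> x)" using i\<zeta> by (rule integrable_plus)
    show "L1 (\<lambda>x. (CR + \<kappa> * C * r powr (- (2 * s))) * \<phi> x)" using i\<phi> by (rule integrable_mult_right)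
  qed
  also have "\<dots> = (CR + \<kappa> * C * r powr (- (2 * s))) * (LBINT x. \<phi> x)" by simp
  finally have upper: "form w \<phi> \<le> (CR + \<kappa> * C * r powr (- (2 * s))) * (LBINT x. \<phi> x)" .
  have \<phi>_supp: "AE x in lborel. x \<notin> ball x0 r \<longrightarrow> \<phi> x = 0"
    using nearR
  proof eventually_elim
    case (elim x)
    show ?case
    proof
      assume x: "x \<notin> ball x0 r"
      have "v x + \<beta> R x0 x \<le> M + \<kappa> / 2 + 1"
        using elim v1[of x] \<beta>(3)[of R x0 x] \<beta>(5)[OF R, of x x0] M \<kappa>(1) by (cases "x \<in> ball x0 R") auto
      then show "\<phi> x = 0" using \<beta>(5)[OF r(1) x] by (simp add: \<phi>_def w_def \<zeta>_def)
    qed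
  qed
  let ?A = "indicat_real (ball z (c * r))" and ?k = "M / 2 * (2 * r) powr (- ?d)"
  have iA: "L1 ?A" using integrable_cball_const[of 1 z "c * r"] by simp
  have ip: "integrable lborel2 (\<lambda>(x, y). \<phi> x * ?A y)" by (rule integrable_pair_times[OF i\<phi> iA])
  have "?k * ((LBINT x. \<phi> x) * (unit_ball_vol (real DIM('a)) * (c * r) ^ DIM('a))) = ?k * (LBINT x. (LBINT y. \<phi> x * ?A y))"
    using c r by (simp add: content_ball)
  also have "\<dots> = ?k * (LINT p|lborel2. (case p of (x, y) \<Rightarrow> \<phi> x * ?A y))"
    using lborel_pair.integral_fst'[OF ip] by simp
  also have "\<dots> = (LINT p|lborel2. ?k * (case p of (x, y) \<Rightarrow> \<phi> x * ?A y))" by (simp only: integral_mult_right_zero)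
  also have "\<dots> \<le> form w \<phi>"
    unfolding form_def
  proof (rule integral_mono_AE[OF integrable_mult_right[OF ip] w\<phi>[unfolded form_integrable_def]])
    show "AE p in lborel2. ?k * (case p of (x, y) \<Rightarrow> \<phi> x * ?A y) \<le> (case p of (x, y) \<Rightarrow> energy_density w \<phi> x y)"
      using AE_pair_lborel[OF \<phi>_supp]
    proof eventually_elim
      case (elim p)
      obtain x y where p: "p = (x, y)" by (cases p)
      \<comment> \<open>Taking the positive part preserves order. Hence the energy density is
        nonnegative, and pairs other than (x, y) with y in the exterior ball may be dropped.\<close>
      have mono: "0 \<le> (w x - w y) * (\<phi> x - \<phi> y)" by (auto simp: \<phi>_def max_def zero_le_mult_iff)
      show ?case
      proof (cases "\<phi> x = 0 \<or> y \<notin> ball z (c * r)")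
        case True
        then have "(case p of (x, y) \<Rightarrow> \<phi> x * ?A y) = 0" by (auto simp: p)
        then show ?thesis using mult_nonneg_nonneg[OF mono ker_nonneg[of "x - y"]] by (simp only: p energy_density_def prod.case mult_zero_right)
      next
        case False
        then have y: "y \<in> ball z (c * r)" and \<phi>x: "0 < \<phi> x" using \<phi>0[of x] by auto
        have xb: "x \<in> ball x0 r" "y \<in> ball x0 r" "y \<notin> \<Omega>" "x \<in> \<Omega>"
          using elim \<phi>x y z \<phi>_off[of x] by (auto simp: p)
        have wx: "w x = \<phi> x" using \<phi>x by (simp add: \<phi>_def max_def split: if_splits)
        have "norm (x - y) \<le> 2 * r"
          using xb(1,2) norm_triangle_ineq4[of "x - x0" "y - x0"] by (simp add: dist_norm norm_minus_commute)
        moreover have "0 < norm (x - y)" using xb by auto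
        ultimately have k: "(2 * r) powr (- ?d) \<le> ker (x - y)"
          unfolding ker_def using s_pos by (intro powr_mono2') auto
        have "M / 2 * \<phi> x \<le> (w x - w y) * \<phi> x" using w_off[OF xb(3)] \<phi>x wx by (intro mult_right_mono) auto
        from mult_mono[OF this k] have "M / 2 * \<phi> x * (2 * r) powr (- ?d) \<le> (w x - w y) * \<phi> x * ker (x - y)"
          using M \<phi>x mono \<phi>_off[OF xb(3)] by simp
        then show ?thesis using y \<phi>_off[OF xb(3)] by (simp add: p energy_density_def mult_ac)
      qed
    qed
  qed
  finally have lower: "M * \<delta> * r powr (- (2 * s)) * (LBINT x. \<phi> x) \<le> form w \<phi>"
  proof -
    have "(2 * r) powr (- ?d) * (c * r) ^ DIM('a) = 2 powr (- ?d) * c ^ DIM('a) * (r powr (- ?d) * r powr real DIM('a))"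
      using r c by (simp add: powr_mult power_mult_distrib powr_realpow)
    also have "r powr (- ?d) * r powr real DIM('a) = r powr (- (2 * s))" by (simp add: powr_add[symmetric])
    finally have eq: "?k * ((LBINT x. \<phi> x) * (unit_ball_vol (real DIM('a)) * (c * r) ^ DIM('a))) = M * \<delta> * r powr (- (2 * s)) * (LBINT x. \<phi> x)"
      by (simp add: \<delta>_def field_simps)
    then show "?k * ((LBINT x. \<phi> x) * (unit_ball_vol (real DIM('a)) * (c * r) ^ DIM('a))) \<le> form w \<phi> \<Longrightarrow> ?thesis" by (simp only: eq)
  qed
  have I0: "0 \<le> (LBINT x. \<phi> x)" using \<phi>0 by (rule lint_nonneg)
  \<comment> \<open>Both bounds on the form are multiples of this integral, and the choices of
    \<kappa> and r make the lower coefficient strictly larger than the upper one.\<close>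
  have "(LBINT x. \<phi> x) = 0"
  proof (rule ccontr)
    assume "(LBINT x. \<phi> x) \<noteq> 0"
    then have I: "0 < (LBINT x. \<phi> x)" using I0 by simp
    have "M * \<delta> * r powr (- (2 * s)) \<le> CR + \<kappa> * C * r powr (- (2 * s))"
      using order_trans[OF lower upper] I by simp
    also have "\<kappa> * C * r powr (- (2 * s)) \<le> M * \<delta> / 2 * r powr (- (2 * s))" using \<kappa>(3) by (intro mult_right_mono) auto
    finally show False using rC by simp
  qed
  then have "AE x in lborel. \<phi> x = 0" using integral_nonneg_eq_0_iff_AE[OF i\<phi>] \<phi>0 by simp
  then have "AE x in lborel. x \<in> ball x0 (r / 2) \<longrightarrow> v x \<le> M - \<kappa> / 2"
  proof eventually_elim
    case (elim x)
    show ?case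
    proof
      assume x: "x \<in> ball x0 (r / 2)"
      then have "\<beta> r x0 x = 1" "\<beta> R x0 x = 1" using r R by (auto intro!: \<beta>(4))
      then show "v x \<le> M - \<kappa> / 2" using elim by (simp add: \<phi>_def w_def \<zeta>_def max_def split: if_splits)
    qed
  qed
  then show ?thesis using \<kappa> M r by (intro exI[of _ "M - \<kappa> / 2"] exI[of _ "r / 2"]) auto
qed

end

lemma powr_lipschitz_unit_interval:
  fixes a b p :: real
  assumes p: "1 < p" and a: "0 \<le> a" "a \<le> 1" and b: "0 \<le> b" "b \<le> 1"
  shows "\<bar>a powr p - b powr p\<bar> \<le> p * \<bar>a - b\<bar>"
proof -
  have *: "\<bar>b powr p - a powr p\<bar> \<le> p * (b - a)" if ab: "0 \<le> a" "a < b" "b \<le> 1" for a b :: real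
  proof -
    have der: "((\<lambda>t. t powr p) has_real_derivative p * t powr (p - 1)) (at t)" if "a < t" for t
      using that ab p by (auto intro!: derivative_eq_intros)
    have "continuous_on {a..b} (\<lambda>t. t powr p)" using ab p by (intro continuous_on_powr' continuous_intros) auto
    from MVT[OF ab(2) this] der obtain l t where t: "a < t" "t < b" "((\<lambda>t. t powr p) has_real_derivative l) (at t)"
      "b powr p - a powr p = (b - a) * l"
      by (auto simp: real_differentiable_def)
    have l: "l = p * t powr (p - 1)" by (rule DERIV_unique[OF t(3) der[OF t(1)]])
    have "t powr (p - 1) \<le> 1 powr (p - 1)" using t ab p by (intro powr_mono2) auto
    then have "l \<le> p" "0 \<le> l" using p by (auto simp: l)
    then show ?thesis using mult_left_mono[of l p "b - a"] ab by (simp add: t(4) abs_mult mult.commute)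
  qed
  show ?thesis
    using *[of a b] *[of b a] a b by (cases a b rule: linorder_cases) (auto simp: abs_minus_commute)
qed

context fractional_order
begin

text \<open>\<open>Inf S\<close> is the essential upper limit of v at x0. If it were positive,
  \<open>boundary_decrease\<close> would produce a smaller element of S.\<close>

lemma boundary_vanishing:
  assumes v [measurable]: "borel_fun v" and v0: "\<And>x. 0 \<le> v x" and v1: "\<And>x. v x \<le> 1"
    and off: "\<And>x. x \<notin> \<Omega> \<Longrightarrow> v x = 0" and vv: "form_integrable v v"
    and \<Omega>: "bounded \<Omega>" "open \<Omega>" "smooth_boundary \<Omega>"
    and g [measurable]: "borel_fun g" and B: "\<And>x. \<bar>g x\<bar> \<le> B"
    and test: "\<And>\<phi>. \<phi> \<in> borel_measurable borel \<Longrightarrow> L1 (\<lambda>x. (\<phi> x)\<^sup>2) \<Longrightarrow> form_integrable \<phi> \<phi> \<Longrightarrow>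
      (\<And>x. x \<notin> \<Omega> \<Longrightarrow> \<phi> x = 0) \<Longrightarrow> form v \<phi> = (LBINT x. g x * \<phi> x)"
    and x0: "x0 \<in> frontier \<Omega>" and \<epsilon>: "0 < \<epsilon>"
  shows "\<exists>r>0. AE x in lborel. x \<in> ball x0 r \<longrightarrow> v x \<le> \<epsilon>"
proof -
  obtain c r1 where ext: "0 < c" "0 < r1" "\<And>r. 0 < r \<Longrightarrow> r < r1 \<Longrightarrow> \<exists>z. ball z (c * r) \<subseteq> ball x0 r - \<Omega>"
    by (rule exterior_ball_condition[OF \<Omega>(3,2) x0]) (rule that; assumption)
  define S where "S = {m. 0 \<le> m \<and> (\<exists>r>0. AE x in lborel. x \<in> ball x0 r \<longrightarrow> v x \<le> m)}"
  have S1: "1 \<in> S" using v1 by (auto simp: S_def intro!: exI[of _ "1::real"])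
  have bdd: "bdd_below S" by (rule bdd_belowI[of _ 0]) (simp add: S_def)
  have Sup: "\<exists>r>0. AE x in lborel. x \<in> ball x0 r \<longrightarrow> v x \<le> m'" if m: "Inf S < m'" for m'
  proof -
    have "S \<noteq> {}" using S1 by blast
    from cInf_lessD[OF this m] obtain m where mS: "m \<in> S" "m < m'" by blast
    then obtain r where mr: "m < m'" "0 < r" "AE x in lborel. x \<in> ball x0 r \<longrightarrow> v x \<le> m"
      unfolding S_def by blast
    have "AE x in lborel. x \<in> ball x0 r \<longrightarrow> v x \<le> m'" using mr(3) by eventually_elim (use mr(1) in auto)
    then show ?thesis using mr(2) by blast
  qed
  have "Inf S \<le> 0"
  proof (rule ccontr)
    assume "\<not> Inf S \<le> 0"
    then have M: "0 < Inf S" by simp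
    have "\<exists>m r. 0 \<le> m \<and> m < Inf S \<and> 0 < r \<and> (AE x in lborel. x \<in> ball x0 r \<longrightarrow> v x \<le> m)"
      by (rule boundary_decrease[OF v v0 v1 off vv \<Omega>(1) g B test ext M]; (assumption | rule Sup)?) simp
    then obtain m where "m \<in> S" "m < Inf S" by (auto simp: S_def)
    then show False using cInf_lower[OF _ bdd, of m] by simp
  qed
  then show ?thesis using Sup \<epsilon> by simp
qed

section \<open>From weak to classical solutions\<close>

lemma source_bound:
  assumes "0 \<le> t" "t \<le> 1" "0 < p" "0 < q" shows "\<bar>source p q t\<bar> \<le> 2 / c_Ns DIM('a) s"
proof -
  have "\<bar>t powr p - t powr q\<bar> \<le> 1" using powr_le1[of p t] powr_le1[of q t] assms by (simp add: abs_le_iff add_increasing2 diff_le_eq)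
  then have "2 / c_Ns DIM('a) s * \<bar>t powr p - t powr q\<bar> \<le> 2 / c_Ns DIM('a) s * 1"
    using c_Ns_pos by (intro mult_left_mono) auto
  moreover have "\<bar>source p q t\<bar> = 2 / c_Ns DIM('a) s * \<bar>t powr p - t powr q\<bar>"
    unfolding source_def abs_mult using c_Ns_pos by simp
  ultimately show ?thesis by linarith
qed

lemma source_hoelder:
  assumes pq: "1 < p" "1 < q" and f: "\<And>x. 0 \<le> f x" "\<And>x. f x \<le> 1" and h: "hoelder_on S f"
  shows "hoelder_on S (\<lambda>x. source p q (f x))"
proof -
  obtain C where C: "\<And>x y. x \<in> S \<Longrightarrow> y \<in> S \<Longrightarrow> \<bar>f x - f y\<bar> \<le> C * norm (x - y) powr hoelder_exponent"
    using h unfolding hoelder_on_def by blast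
  let ?K = "2 / c_Ns DIM('a) s * (p + q)"
  have K: "0 \<le> ?K" using c_Ns_pos pq by simp
  have "\<bar>source p q (f x) - source p q (f y)\<bar> \<le> ?K * C * norm (x - y) powr hoelder_exponent" if "x \<in> S" "y \<in> S" for x y
  proof -
    have "\<bar>(f x powr p - f x powr q) - (f y powr p - f y powr q)\<bar> \<le> p * \<bar>f x - f y\<bar> + q * \<bar>f x - f y\<bar>"
      using powr_lipschitz_unit_interval[OF pq(1) f f, of x y] powr_lipschitz_unit_interval[OF pq(2) f f, of x y] by linarith
    then have "2 / c_Ns DIM('a) s * \<bar>(f x powr p - f x powr q) - (f y powr p - f y powr q)\<bar> \<le> 2 / c_Ns DIM('a) s * ((p + q) * \<bar>f x - f y\<bar>)"
      using c_Ns_pos by (intro mult_left_mono) (auto simp: distrib_right)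
    then have "\<bar>source p q (f x) - source p q (f y)\<bar> \<le> ?K * \<bar>f x - f y\<bar>"
      using c_Ns_pos unfolding source_def right_diff_distrib[symmetric] abs_mult mult.assoc[of _ "p + q"] by simp
    also have "\<dots> \<le> ?K * (C * norm (x - y) powr hoelder_exponent)" by (intro mult_left_mono C that K)
    finally show ?thesis by (simp add: mult.assoc)
  qed
  then show ?thesis unfolding hoelder_on_def by blast
qed

text \<open>On [0, 1] both powers are Lipschitz, so local Hoelder continuity passes from v to the
  source and \<open>interior_equation\<close> applies. Restoring the factor c_Ns / 2 recovers the
  original nonlinearity.\<close>

lemma classical_solutionI:
  assumes U: "open U" and pq: "1 < p" "1 < q" and v: "continuous_on UNIV v" and v0: "\<And>x. 0 \<le> v x" and v1: "\<And>x. v x \<le> 1"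
    and weak: "weak_on U v (\<lambda>x. source p q (v x))" and hol: "\<And>x. x \<in> U \<Longrightarrow> \<exists>r>0. hoelder_on (ball x r) v"
  shows "classical_solution s U (\<lambda>t. t powr p - t powr q) v"
  unfolding classical_solution_def
proof (intro conjI v ballI)
  fix x assume x: "x \<in> U"
  note [measurable] = borel_measurable_continuous_onI[OF v]
  have vB: "\<bar>v x\<bar> \<le> 1" for x using v0[of x] v1[of x] by simp
  have gc: "continuous_on UNIV (\<lambda>x. source p q (v x))"
    unfolding source_def using v v0 pq by (intro continuous_intros continuous_on_powr') auto
  have gB: "\<bar>source p q (v x)\<bar> \<le> 2 / c_Ns DIM('a) s" for x using pq by (intro source_bound v0 v1) auto
  have gh: "\<exists>r>0. hoelder_on (ball x r) (\<lambda>x. source p q (v x))" if x: "x \<in> U" for x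
  proof -
    obtain r where "0 < r" "hoelder_on (ball x r) v" using hol[OF x] by auto
    then show ?thesis using source_hoelder[OF pq v0 v1, of "ball x r"] by (intro exI[of _ r]) simp
  qed
  have sdq: "second_difference_quotient s v x = (\<lambda>h. sd v h x * ker h)"
    unfolding second_difference_quotient_def[abs_def] sd_def ker_def powr_minus_divide by (simp add: algebra_simps diff_divide_distrib add_divide_distrib)
  note eq = interior_equation[OF U v vB gc gB weak gh x]
  have m: "(\<lambda>h. sd v h x * ker h) \<in> borel_measurable lborel" by measurable
  show "integrable lebesgue (second_difference_quotient s v x)"
    unfolding sdq integrable_completion[OF m] by (rule eq(1))
  have "frac_laplacian s v x = c_Ns DIM('a) s / 2 * Lop v x"
    unfolding frac_laplacian_def sdq integral_completion[OF m] Lop_def by simp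
  then show "frac_laplacian s v x = v x powr p - v x powr q"
    using c_Ns_pos by (simp add: eq(2) source_def)
qed

lemma unit_bounds_of_AE:
  assumes U: "open U" and f: "continuous_on U f" and fv: "AE x in lborel. x \<in> U \<longrightarrow> f x = v x"
    and v: "\<And>x. 0 \<le> v x" "\<And>x. v x \<le> 1" and x: "x \<in> U"
  shows "0 \<le> f x" "f x \<le> (1::real)"
proof -
  have "AE x in lborel. x \<in> U \<longrightarrow> f x \<le> 1" using fv by eventually_elim (use v in auto)
  then show "f x \<le> 1" using AE_le_imp_le_on_open[OF U f _ x] by blast
  have "AE x in lborel. x \<in> U \<longrightarrow> - f x \<le> 0" using fv by eventually_elim (use v in auto)
  from AE_le_imp_le_on_open[OF U continuous_on_minus[OF f] this x] show "0 \<le> f x" by simp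
qed

text \<open>The bootstrap: a bounded source yields a locally Hoelder representative f; the weak
  equation is rewritten for f, so that its source is now Hoelder continuous as well.\<close>

lemma weak_solution_space_classical:
  assumes w: "weak_solution_space s p q u" and pq: "1 < p" "p < q"
  shows "\<exists>v. (AE x in lebesgue. v x = u x) \<and> classical_solution s (UNIV :: 'a set) (\<lambda>t. t powr p - t powr q) v"
proof -
  obtain v :: "'a \<Rightarrow> real" where v: "borel_fun v" "AE x in lebesgue. u x = v x" "\<And>x. 0 \<le> v x" "\<And>x. v x \<le> 1"
    "weak_on UNIV v (\<lambda>x. source p q (v x))"
    by (rule weak_solution_space_reduction[OF w pq(2)]) (rule that; assumption)
  have vB: "\<bar>v x\<bar> \<le> 1" for x using v(3,4)[of x] by simp
  have gB: "\<bar>source p q (v x)\<bar> \<le> 2 / c_Ns DIM('a) s" for x using pq by (intro source_bound v) auto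
  have gm: "borel_fun (\<lambda>x. source p q (v x))" using v(1) by measurable
  obtain f where f: "AE x in lborel. x \<in> UNIV \<longrightarrow> f x = v x" "continuous_on UNIV f"
    "\<And>x. x \<in> UNIV \<Longrightarrow> \<exists>r>0. ball x r \<subseteq> UNIV \<and> hoelder_on (ball x r) f"
    by (rule interior_continuity[OF open_UNIV v(1) vB gm gB v(5)]) (rule that; assumption)
  have f01: "0 \<le> f x" "f x \<le> 1" for x using unit_bounds_of_AE[OF open_UNIV f(2,1) v(3,4)] by auto
  note [measurable] = borel_measurable_continuous_onI[OF f(2)]
  have vf: "AE x in lborel. v x = f x" using f(1) by eventually_elim simp
  have "AE x in lborel. x \<in> UNIV \<longrightarrow> source p q (v x) = source p q (f x)" using vf by eventually_elim simp
  from weak_on_cong[OF v(1) _ gm _ vf this v(5)] have "weak_on UNIV f (\<lambda>x. source p q (f x))" by simp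
  from classical_solutionI[OF open_UNIV pq(1) _ f(2) f01 this] f(3) pq
  have "classical_solution s UNIV (\<lambda>t. t powr p - t powr q) f" by auto
  moreover have "AE x in lebesgue. f x = u x" using AE_completion[OF vf] v(2) by eventually_elim simp
  ultimately show ?thesis by blast
qed

text \<open>In the interior as in the whole space. The continuous interior representative is
  extended by 0, and only boundary points need the extra argument for continuity.\<close>

lemma weak_solution_domain_classical:
  assumes w: "weak_solution_domain s p q \<Omega> u" and pq: "1 < p" "p < q" and dom: "smooth_bounded_domain \<Omega>"
  shows "\<exists>v. (AE x in lebesgue. v x = u x) \<and> classical_solution s (\<Omega> :: 'a set) (\<lambda>t. t powr p - t powr q) v \<and>
    (\<forall>x. x \<notin> \<Omega> \<longrightarrow> v x = 0)"
proof -
  have \<Omega>: "open \<Omega>" "bounded \<Omega>" "smooth_boundary \<Omega>" using dom by (auto simp: smooth_bounded_domain_def)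
  obtain v :: "'a \<Rightarrow> real" where v: "borel_fun v" "AE x in lebesgue. u x = v x" "\<And>x. 0 \<le> v x" "\<And>x. v x \<le> 1"
    "\<And>x. x \<notin> \<Omega> \<Longrightarrow> v x = 0" "form_integrable v v" "weak_on \<Omega> v (\<lambda>x. source p q (v x))"
    and test: "\<forall>\<phi>. \<phi> \<in> borel_measurable borel \<longrightarrow> L1 (\<lambda>x. (\<phi> x)\<^sup>2) \<longrightarrow> form_integrable \<phi> \<phi> \<longrightarrow>
      (\<forall>x. x \<notin> \<Omega> \<longrightarrow> \<phi> x = 0) \<longrightarrow> form v \<phi> = (LBINT x. source p q (v x) * \<phi> x)"
    by (rule weak_solution_domain_reduction[OF w pq(2) \<Omega>(1)]) (rule that; assumption)
  have vB: "\<bar>v x\<bar> \<le> 1" for x using v(3,4)[of x] by simp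
  have gB: "\<bar>source p q (v x)\<bar> \<le> 2 / c_Ns DIM('a) s" for x using pq by (intro source_bound v) auto
  have gm: "borel_fun (\<lambda>x. source p q (v x))" using v(1) by measurable
  obtain f0 where f0: "AE x in lborel. x \<in> \<Omega> \<longrightarrow> f0 x = v x" "continuous_on \<Omega> f0"
    "\<And>x. x \<in> \<Omega> \<Longrightarrow> \<exists>r>0. ball x r \<subseteq> \<Omega> \<and> hoelder_on (ball x r) f0"
    by (rule interior_continuity[OF \<Omega>(1) v(1) vB gm gB v(7)]) (rule that; assumption)
  define f where "f x = (if x \<in> \<Omega> then f0 x else 0)" for x
  have f01: "0 \<le> f x" "f x \<le> 1" for x using unit_bounds_of_AE[OF \<Omega>(1) f0(2,1) v(3,4)] by (auto simp: f_def)
  have vf: "AE x in lborel. v x = f x" using f0(1) by eventually_elim (auto simp: f_def v(5))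
  \<comment> \<open>The almost-everywhere bound becomes pointwise in \<Omega> by continuity of f0,
    and off \<Omega> the function is 0.\<close>
  have small: "\<exists>r>0. \<forall>y\<in>ball x r. f y \<le> \<epsilon>" if x: "x \<in> frontier \<Omega>" and \<epsilon>: "0 < \<epsilon>" for x \<epsilon>
  proof -
    have "\<exists>r>0. AE y in lborel. y \<in> ball x r \<longrightarrow> v y \<le> \<epsilon>"
      by (rule boundary_vanishing[OF v(1,3,4,5,6) \<Omega>(2,1,3) gm gB _ x \<epsilon>]) (simp_all add: test)
    then obtain r where r: "0 < r" "AE y in lborel. y \<in> ball x r \<longrightarrow> v y \<le> \<epsilon>" by blast
    have "AE y in lborel. y \<in> \<Omega> \<inter> ball x r \<longrightarrow> f0 y \<le> \<epsilon>" using f0(1) r(2) by eventually_elim auto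
    from AE_le_imp_le_on_open[OF open_Int[OF \<Omega>(1) open_ball] continuous_on_subset[OF f0(2) Int_lower1] this]
    have "f y \<le> \<epsilon>" if "y \<in> ball x r" for y using that \<epsilon> by (auto simp: f_def)
    then show ?thesis using r(1) by blast
  qed
  have fc: "continuous_on UNIV f"
  proof (rule continuous_at_imp_continuous_on, rule ballI)
    fix x
    consider "x \<in> \<Omega>" | "x \<in> frontier \<Omega>" | "x \<in> - closure \<Omega>"
      using \<Omega>(1) by (auto simp: frontier_def interior_open)
    then show "isCont f x"
    proof cases
      case 1
      then have "isCont f0 x" using f0(2) \<Omega>(1) continuous_on_eq_continuous_at by blast
      moreover have "\<forall>\<^sub>F y in nhds x. f y = f0 y"
        using eventually_nhds_in_open[OF \<Omega>(1) 1] by eventually_elim (simp add: f_def)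
      ultimately show ?thesis using isCont_cong by blast
    next
      case 2
      then have "x \<notin> \<Omega>" using \<Omega>(1) by (simp add: frontier_def interior_open)
      then have fx: "f x = 0" by (simp add: f_def)
      show ?thesis
        unfolding continuous_at_eps_delta
      proof (intro allI impI)
        fix \<epsilon> :: real assume "0 < \<epsilon>"
        then obtain r where r: "0 < r" "\<And>y. y \<in> ball x r \<Longrightarrow> f y \<le> \<epsilon> / 2" using small[OF 2, of "\<epsilon> / 2"] by auto
        have "dist (f y) (f x) < \<epsilon>" if "dist y x < r" for y
          using r(2)[of y] that f01(1)[of y] \<open>0 < \<epsilon>\<close> by (simp add: fx dist_commute)
        then show "\<exists>d>0. \<forall>x'. dist x' x < d \<longrightarrow> dist (f x') (f x) < \<epsilon>" using r(1) by blast
      qed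
    next
      case 3
      have "\<forall>\<^sub>F y in nhds x. f y = 0"
        using eventually_nhds_in_open[OF _ 3] by (rule eventually_mono) (use closure_subset[of \<Omega>] in \<open>auto simp: f_def\<close>)
      then show ?thesis using isCont_cong[of f "\<lambda>_. 0" x] by simp
    qed
  qed
  note [measurable] = borel_measurable_continuous_onI[OF fc]
  have "AE x in lborel. x \<in> \<Omega> \<longrightarrow> source p q (v x) = source p q (f x)" using vf by eventually_elim simp
  from weak_on_cong[OF v(1) _ gm _ vf this v(7)] have wf: "weak_on \<Omega> f (\<lambda>x. source p q (f x))" by simp
  have hf: "\<exists>r>0. hoelder_on (ball x r) f" if x: "x \<in> \<Omega>" for x
  proof -
    obtain r where r: "0 < r" "ball x r \<subseteq> \<Omega>" "hoelder_on (ball x r) f0" using f0(3)[OF x] by blast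
    have "hoelder_on (ball x r) f" by (rule hoelder_on_cong[OF r(3)]) (use r(2) in \<open>auto simp: f_def\<close>)
    then show ?thesis using r(1) by blast
  qed
  have "classical_solution s \<Omega> (\<lambda>t. t powr p - t powr q) f"
    using pq by (intro classical_solutionI[OF \<Omega>(1) pq(1) _ fc f01 wf hf]) auto
  moreover have "AE x in lebesgue. f x = u x" using AE_completion[OF vf] v(2) by eventually_elim simp
  moreover have "\<forall>x. x \<notin> \<Omega> \<longrightarrow> f x = 0" by (simp add: f_def)
  ultimately show ?thesis by blast
qed

end

theorem proposition3p1:
  fixes s p q :: real and \<Omega> :: "'a::euclidean_space set" and u :: "'a \<Rightarrow> real"
  assumes "0 < s" and "s < 1" and "real DIM('a) > 2 * s"
    and "p \<ge> two_star DIM('a) s - 1"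
    and "q > (p - 1) * (real DIM('a) / (2 * s)) - 1"
    and "smooth_bounded_domain \<Omega>"
  shows "p < q \<and>
    (weak_solution_space s p q u \<longrightarrow>
      (\<exists>v. (AE x in lebesgue. v x = u x) \<and>
           classical_solution s UNIV (\<lambda>t. t powr p - t powr q) v)) \<and>
    (weak_solution_domain s p q \<Omega> u \<longrightarrow>
      (\<exists>v. (AE x in lebesgue. v x = u x) \<and>
           classical_solution s \<Omega> (\<lambda>t. t powr p - t powr q) v \<and>
           (\<forall>x. x \<notin> \<Omega> \<longrightarrow> v x = 0)))"
proof -
  interpret fractional_order s "TYPE('a)" by unfold_locales (use assms(1-3) in auto)
  have "1 < p" "p < q" using exponents[OF assms(4,5)] by auto
  then show ?thesis using weak_solution_space_classical weak_solution_domain_classical assms(6) by blast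
qed

end
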